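(* Let $\alpha$ be a partition of $n$, let $\Lambda=(\boldsymbol\lambda\mid\boldsymbol\mu)\in\mathcal L_n(\alpha)$ and let $\mathsf s,\mathsf t\in\mathrm{Std}(\Lambda)$. Then $$(m_{\mathsf t}\,n_{\mathsf t'\mathsf s'},\,m_{\mathsf s})_\Lambda\neq0,\quad\text{or equivalently}\quad (m_{\mathsf t},\,m_{\mathsf s}\,n_{\mathsf s'\mathsf t'})_\Lambda\neq0 .$$ In particular $m_{\mathsf t}n_{\mathsf t'\mathsf s'}\ne0$ and $m_{\mathsf s}n_{\mathsf s'\mathsf t'}\neq0$. (Here the ground ring is $S=\mathbb Z[q,q^{-1}]$ or a field $\mathcal K$ containing a nonzero element $q$.)
   Context: **The algebra.** $\mathfrak S_n$ acts on the right on $\mathbf n=\{1,\dots,n\}$, $s_i=(i,i+1)$, $\ell$ is the length function. The $bt$-algebra $\mathcal E_n(q)$ is the associative unital $S$-algebra generated by $g_1,\dots,g_{n-1},e_1,\dots,e_{n-1}$ with relations: $g_ig_j=g_jg_i$ for $|i-j|>1$; $g_ie_i=e_ig_i$; $g_ig_jg_i=g_jg_ig_j$ for $|i-j|=1$; $e_ig_jg_i=g_jg_ie_j$ for $|i-j|=1$; $e_ie_jg_j=e_ig_je_i=g_je_ie_j$ for $|i-j|=1$; $e_ie_j=e_je_i$ for all $i,j$; $g_ie_j=e_jg_i$ for $|i-j|>1$; $e_i^2=e_i$; $g_i^2=1+(q-q^{-1})e_ig_i$. For a reduced expression $w=s_{i_1}\cdots s_{i_k}$ put $g_w=g_{i_1}\cdots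 g_{i_k}$. The linear anti-automorphism $*$ fixes all $g_i$ and $e_i$. **Idempotents.** $\mathcal{SP}_n$ is the set of set partitions of $\mathbf n$, with $A\subseteq B$ if every block of $B$ is a union of blocks of $A$; $\mu$ is its Möbius function. $E_{i,i+1}=e_i$, $E_{ij}=g_iE_{i+1,j}g_i^{-1}$ for $j>i+1$; $E_A=\prod E_{ij}$ over pairs $i<j$ in a common block of $A$; $\mathbb E_A=\sum_{B:A\subseteq B}\mu(A,B)E_B$. These are orthogonal idempotents with $\mathbb E_Ag_w=g_w\mathbb E_{Aw}$. $A$ is of type $\alpha$ if its block sizes in decreasing order form $\alpha$; $\mathbb E_\alpha=\sum_{A\text{ of type }\alpha}\mathbb E_A$ is a central idempotent and $\mathcal E_n^\alpha(q)=\mathbb E_\alpha\mathcal E_n(q)$. Over $\mathcal K$ one uses $\mathcal E_n^\alpha(q)\otimes_S\mathcal K$. **Multitableaux.** An $r$-multipartition of $n$ is an $r$-tuple of partitions of total size $n$. A $\boldsymbol\lambda$-multitableau is a bijective filling of the nodes of the Young diagrams of the components of $\boldsymbol\lambda$ by $\mathbf n$; it is row standard (standard) if in each component entries increase along rows (along rows and down columns). $\mathfrak S_n$ acts on the right on entries. $\mathfrak t^{\boldsymbol\lambda}$ is filled with $1,\dots,n$ in order along the rows of the first component, then the second, etc.; $\mathfrak t=\mathfrak t^{\boldsymbol\lambda}d(\mathfrak t)$ defines $d(\mathfrak t)$; $\mathfrak S_{\boldsymbol\lambda}$ is the row stabilizer of $\mathfrak t^{\boldsymbol\lambda}$. $\mathfrak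 t$ is of the initial kind if each $j$ lies in the same component of $\mathfrak t$ as of $\mathfrak t^{\boldsymbol\lambda}$. $A_{\boldsymbol\lambda}$ is the set partition whose blocks $I_1,I_2,\dots$ are the (nonempty) entry sets of the components of $\mathfrak t^{\boldsymbol\lambda}$; $\boldsymbol\lambda$ is of type $\alpha$ if $A_{\boldsymbol\lambda}$ is. Put $\mathbb E_{\boldsymbol\lambda}=\mathbb E_{A_{\boldsymbol\lambda}}$. **The set $\mathcal L_n(\alpha)$.** Let $r=\ell(\alpha)$. Fix a total order $<$ on partitions that extends dominance and satisfies $\lambda<\tau$ whenever $|\lambda|<|\tau|$. $\mathcal L_n(\alpha)$ is the set of pairs $\Lambda=(\boldsymbol\lambda\mid\boldsymbol\mu)$ where $\boldsymbol\lambda=(\lambda^{(1)},\dots,\lambda^{(r)})$ is an $r$-multipartition of $n$ of type $\alpha$ with nonempty components and $\lambda^{(1)}\le\cdots\le\lambda^{(r)}$, and, if the distinct components $\lambda^{(i_1)}<\cdots<\lambda^{(i_s)}$ have multiplicities $m_1,\dots,m_s$, $\boldsymbol\mu=(\mu^{(1)},\dots,\mu^{(s)})$ with $\mu^{(j)}$ a partition of $m_j$ (so $\boldsymbol\mu$ is an $s$-multipartition of $r$). **$\Lambda$-tableaux.** A row standard (standard) $\Lambda$-tableau is a pair $\mathsf t=(\mathfrak t\mid\mathfrak v)$ with $\mathfrak t$ a row standard (standard) $\boldsymbol\lambda$-multitableau, increasing in the sense that whenever $\lambda^{(i)}=\lambda^{(j)}$ and $i<j$ the minimal entry of $\mathfrak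 t^{(i)}$ is smaller than that of $\mathfrak t^{(j)}$, and $\mathfrak v$ a row standard (standard) $\boldsymbol\mu$-multitableau (entries $1,\dots,r$) of the initial kind. The sets of these are $\mathrm{RStd}(\Lambda)$ and $\mathrm{Std}(\Lambda)$. **Elements $m_{\mathsf t}$, $n_{\mathsf s\mathsf t}$.** Let $\mathfrak S^m_\Lambda=\mathfrak S_{m_1}\times\cdots\times\mathfrak S_{m_s}\le\mathfrak S_r$ (permutations of the indices of equal components). For $w\in\mathfrak S^m_\Lambda$ let $B_w\in\mathfrak S_n$ send the $k$-th smallest element of $I_j$ to the $k$-th smallest element of $I_{jw}$, and put $\mathbb B_w=\mathbb E_{\boldsymbol\lambda}g_{B_w}$. Let $x_{\boldsymbol\lambda}=\sum_{w\in\mathfrak S_{\boldsymbol\lambda}}q^{\ell(w)}g_w$, $y_{\boldsymbol\lambda}=\sum_{w\in\mathfrak S_{\boldsymbol\lambda}}(-q)^{-\ell(w)}g_w$, $b_{\boldsymbol\mu}=\sum_{w\in\mathfrak S_{\boldsymbol\mu}}\mathbb B_w$, $c_{\boldsymbol\mu}=\sum_{w\in\mathfrak S_{\boldsymbol\mu}}(-1)^{\ell(w)}\mathbb B_w$. For row standard $\Lambda$-tableaux $\mathsf s=(\mathfrak s\mid\mathfrak u)$, $\mathsf t=(\mathfrak t\mid\mathfrak v)$, $$m_{\mathsf t}=\mathbb E_{\boldsymbol\lambda}x_{\boldsymbol\lambda}b_{\boldsymbol\mu}\mathbb B_{d(\mathfrak v)}g_{d(\mathfrak t)},\qquad n_{\mathsf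 s\mathsf t}=g_{d(\mathfrak s)}^*\,\mathbb E_{\boldsymbol\lambda}\,y_{\boldsymbol\lambda}\,\mathbb B_{d(\mathfrak u)}^*\,c_{\boldsymbol\mu}\,\mathbb B_{d(\mathfrak v)}\,g_{d(\mathfrak t)}.$$ **Conjugation.** $\Lambda'=(\boldsymbol\lambda'\mid\boldsymbol\mu')$ is obtained by transposing every component of $\boldsymbol\lambda$ and $\boldsymbol\mu$ (keeping the order of the components), and $\mathsf t'=(\mathfrak t'\mid\mathfrak v')$ by transposing every component of $\mathfrak t$ and $\mathfrak v$. The element $n_{\mathsf t'\mathsf s'}$ is defined by the formula above for $\Lambda'$ (for which $A_{\boldsymbol\lambda'}=A_{\boldsymbol\lambda}$ and the multiplicities are the same; the formula is used whether or not the componentwise transpose $\boldsymbol\lambda'$ is increasing for the chosen total order). **Bilinear form.** $M(\Lambda)=\mathbb E_{\boldsymbol\lambda}x_{\boldsymbol\lambda}b_{\boldsymbol\mu}\mathcal E_n^\alpha(q)$ is a right ideal with basis $\{m_{\mathsf t}\mid\mathsf t\in\mathrm{RStd}(\Lambda)\}$, and $(\cdot,\cdot)_\Lambda$ is the bilinear form on $M(\Lambda)$ with $(m_{\mathsf s},m_{\mathsf t})_\Lambda=1$ if $\mathsf s=\mathsf t$ and $0$ otherwise. *)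

theory Defs
  imports
    "HOL-Library.Poly_Mapping"
    "HOL-Library.Multiset"
    "HOL-Library.Disjoint_Sets"
    "HOL-Combinatorics.Permutations"
    "HOL-Algebra.QuotRing"
begin

section \<open>Ground rings\<close>

text \<open>The ring of integral Laurent polynomials is the group ring of the additive group of
  integers: a Laurent polynomial is the finitely supported map sending an exponent to its
  coefficient, with the convolution product.\<close>

type_synonym laurent = "int \<Rightarrow>\<^sub>0 int"

definition laurent_q :: laurent where
  "laurent_q = Poly_Mapping.single 1 1"

text \<open>Only used for units: it is the Laurent monomial of exponent -1 for \<^const>\<open>laurent_q\<close>,
  and \<^term>\<open>inverse q\<close> for a nonzero \<open>q\<close> in a field.\<close>

definition unit_inv :: "'a::comm_ring_1 \<Rightarrow> 'a" where
  "unit_inv q = (THE r. q * r = 1)"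

lemma unit_inv_eqI:
  assumes "q * r = (1 :: 'a::comm_ring_1)"
  shows "unit_inv q = r"
  unfolding unit_inv_def
proof (rule the_equality)
  fix r' assume "q * r' = 1"
  then show "r' = r"
    using assms by (metis mult.left_commute mult.right_neutral)
qed (use assms in auto)

lemma unit_inv_laurent_q: "unit_inv laurent_q = Poly_Mapping.single (-1) 1"
  by (rule unit_inv_eqI) (simp add: laurent_q_def mult_single)

lemma unit_inv_field: "q \<noteq> 0 \<Longrightarrow> unit_inv q = inverse (q :: 'a::field)"
  by (rule unit_inv_eqI) simp


section \<open>The symmetric group\<close>

text \<open>Permutations act on the right: the image of \<open>j\<close> under \<open>w\<close> is the value \<open>w j\<close>, so the
  product \<open>u v\<close> of the right action is the function \<open>v \<circ> u\<close>. In particular, in a word the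
  leftmost simple transposition is applied first.\<close>

definition perm_of_word :: "nat list \<Rightarrow> nat \<Rightarrow> nat" where
  "perm_of_word is = fold (\<lambda>i w. Transposition.transpose i (i + 1) \<circ> w) is id"

definition perm_words :: "nat \<Rightarrow> (nat \<Rightarrow> nat) \<Rightarrow> nat list set" where
  "perm_words n w = {is. set is \<subseteq> {1..<n} \<and> perm_of_word is = w}"

definition perm_length :: "nat \<Rightarrow> (nat \<Rightarrow> nat) \<Rightarrow> nat" where
  "perm_length n w = (LEAST k. \<exists>is\<in>perm_words n w. length is = k)"

definition reduced_words :: "nat \<Rightarrow> (nat \<Rightarrow> nat) \<Rightarrow> nat list set" where
  "reduced_words n w = {is \<in> perm_words n w. length is = perm_length n w}"


section \<open>The free algebra\<close>

datatype generator = Gen_g nat | Gen_e nat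

text \<open>Words in the generators, wrapped in a type of their own so that concatenation can be the
  addition that \<^typ>\<open>'a \<Rightarrow>\<^sub>0 'b\<close> uses for its convolution product. Finitely supported
  functions on words then form the free unital algebra on all the generators.\<close>

datatype word = Word (letters: "generator list")

instantiation word :: monoid_add
begin

definition zero_word :: word where
  "zero_word = Word []"

definition plus_word :: "word \<Rightarrow> word \<Rightarrow> word" where
  "plus_word u v = Word (letters u @ letters v)"

instance
  by standard (simp_all add: zero_word_def plus_word_def)

end

type_synonym 'a free_elem = "word \<Rightarrow>\<^sub>0 'a"

definition free_g :: "nat \<Rightarrow> 'a::comm_ring_1 free_elem" where
  "free_g i = Poly_Mapping.single (Word [Gen_g i]) 1"

definition free_e :: "nat \<Rightarrow> 'a::comm_ring_1 free_elem" where
  "free_e i = Poly_Mapping.single (Word [Gen_e i]) 1"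

definition free_scalar :: "'a \<Rightarrow> 'a::comm_ring_1 free_elem" where
  "free_scalar a = Poly_Mapping.single 0 a"

definition words_below :: "nat \<Rightarrow> word set" where
  "words_below n = {u. set (letters u) \<subseteq> Gen_g ` {1..<n} \<union> Gen_e ` {1..<n}}"

definition free_alg :: "nat \<Rightarrow> 'a::comm_ring_1 free_elem ring" where
  "free_alg n = \<lparr>carrier = {p. Poly_Mapping.keys p \<subseteq> words_below n},
     mult = (*), one = 1, zero = 0, add = (+)\<rparr>"

lemma ring_free_alg: "ring (free_alg n :: 'a::comm_ring_1 free_elem ring)"
proof (rule ringI)
  have w0: "0 \<in> words_below n"
    by (simp add: words_below_def zero_word_def)
  have wp: "u + v \<in> words_below n" if "u \<in> words_below n" "v \<in> words_below n" for u v
    using that by (simp add: words_below_def plus_word_def)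
  have ka: "Poly_Mapping.keys (p + q) \<subseteq> words_below n"
    if "Poly_Mapping.keys p \<subseteq> words_below n" "Poly_Mapping.keys q \<subseteq> words_below n"
    for p q :: "'a free_elem"
    using that Poly_Mapping.keys_add[of p q] by blast
  have km: "Poly_Mapping.keys (p * q) \<subseteq> words_below n"
    if "Poly_Mapping.keys p \<subseteq> words_below n" "Poly_Mapping.keys q \<subseteq> words_below n"
    for p q :: "'a free_elem"
    using that keys_mult[of p q] wp by blast
  have k1: "Poly_Mapping.keys (1 :: 'a free_elem) \<subseteq> words_below n"
    using w0 by simp
  show "abelian_group (free_alg n :: 'a free_elem ring)"
  proof (rule abelian_groupI)
    fix p :: "'a free_elem" assume "p \<in> carrier (free_alg n)"
    then have "- p \<in> carrier (free_alg n)"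
      by (simp add: free_alg_def)
    then show "\<exists>r\<in>carrier (free_alg n). r \<oplus>\<^bsub>free_alg n\<^esub> p = \<zero>\<^bsub>free_alg n\<^esub>"
      by (intro bexI[of _ "- p"]) (auto simp: free_alg_def)
  qed (use ka in \<open>auto simp: free_alg_def ac_simps\<close>)
  show "monoid (free_alg n :: 'a free_elem ring)"
    by (rule monoidI) (use km k1 in \<open>auto simp: free_alg_def ac_simps\<close>)
qed (auto simp: free_alg_def algebra_simps)


section \<open>The algebra of braids and ties\<close>

definition far :: "nat \<Rightarrow> nat \<Rightarrow> bool" where
  "far i j \<longleftrightarrow> i + 1 < j \<or> j + 1 < i"

definition adjacent :: "nat \<Rightarrow> nat \<Rightarrow> bool" where
  "adjacent i j \<longleftrightarrow> j = i + 1 \<or> i = j + 1"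

definition bt_relations :: "nat \<Rightarrow> 'a::comm_ring_1 \<Rightarrow> 'a free_elem set" where
  "bt_relations n q = (let g = free_g; e = free_e; N = {1..<n} in
     {g i * g j - g j * g i | i j. i \<in> N \<and> j \<in> N \<and> far i j}
   \<union> {g i * e i - e i * g i | i. i \<in> N}
   \<union> {g i * g j * g i - g j * g i * g j | i j. i \<in> N \<and> j \<in> N \<and> adjacent i j}
   \<union> {e i * g j * g i - g j * g i * e j | i j. i \<in> N \<and> j \<in> N \<and> adjacent i j}
   \<union> {e i * e j * g j - e i * g j * e i | i j. i \<in> N \<and> j \<in> N \<and> adjacent i j}
   \<union> {e i * g j * e i - g j * e i * e j | i j. i \<in> N \<and> j \<in> N \<and> adjacent i j}
   \<union> {e i * e j - e j * e i | i j. i \<in> N \<and> j \<in> N}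
   \<union> {g i * e j - e j * g i | i j. i \<in> N \<and> j \<in> N \<and> far i j}
   \<union> {e i * e i - e i | i. i \<in> N}
   \<union> {g i * g i - (1 + free_scalar (q - unit_inv q) * e i * g i) | i. i \<in> N})"

definition bt_ideal :: "nat \<Rightarrow> 'a::comm_ring_1 \<Rightarrow> 'a free_elem set" where
  "bt_ideal n q = Idl\<^bsub>free_alg n\<^esub> (bt_relations n q)"

definition bt :: "nat \<Rightarrow> 'a::comm_ring_1 \<Rightarrow> 'a free_elem set ring" where
  "bt n q = free_alg n Quot bt_ideal n q"

lemma bt_relations_carrier: "bt_relations n q \<subseteq> carrier (free_alg n)"
proof -
  interpret ring "free_alg n :: 'a free_elem ring" by (rule ring_free_alg)
  have g: "free_g i \<in> carrier (free_alg n :: 'a free_elem ring)" if "i \<in> {1..<n}" for i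
    using that by (simp add: free_alg_def free_g_def words_below_def)
  have e: "free_e i \<in> carrier (free_alg n :: 'a free_elem ring)" if "i \<in> {1..<n}" for i
    using that by (simp add: free_alg_def free_e_def words_below_def)
  have s: "free_scalar a \<in> carrier (free_alg n :: 'a free_elem ring)" for a
    by (auto simp: free_alg_def free_scalar_def words_below_def zero_word_def split: if_splits)
  have o: "1 \<in> carrier (free_alg n :: 'a free_elem ring)"
    using one_closed by (simp add: free_alg_def)
  have m: "x * y \<in> carrier (free_alg n)"
    if "x \<in> carrier (free_alg n)" "y \<in> carrier (free_alg n)" for x y :: "'a free_elem"
    using m_closed[OF that] by (simp add: free_alg_def)
  have p: "x + y \<in> carrier (free_alg n)"
    if "x \<in> carrier (free_alg n)" "y \<in> carrier (free_alg n)" for x y :: "'a free_elem"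
    using a_closed[OF that] by (simp add: free_alg_def)
  have d: "x - y \<in> carrier (free_alg n)"
    if "x \<in> carrier (free_alg n)" "y \<in> carrier (free_alg n)" for x y :: "'a free_elem"
    using that p[of x "- y"] by (simp add: free_alg_def)
  show ?thesis
    unfolding bt_relations_def Let_def
    by (auto intro!: d p m g e s o simp del: atLeastLessThan_iff)
qed

lemma ring_bt: "ring (bt n q)"
  unfolding bt_def bt_ideal_def
  by (intro ideal.quotient_is_ring ring.genideal_ideal ring_free_alg bt_relations_carrier)

definition bt_class :: "nat \<Rightarrow> 'a::comm_ring_1 \<Rightarrow> 'a free_elem \<Rightarrow> 'a free_elem set" where
  "bt_class n q p = bt_ideal n q +>\<^bsub>free_alg n\<^esub> p"

definition bt_smult ::
    "nat \<Rightarrow> 'a::comm_ring_1 \<Rightarrow> 'a \<Rightarrow> 'a free_elem set \<Rightarrow> 'a free_elem set" where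
  "bt_smult n q a x = bt_class n q (free_scalar a) \<otimes>\<^bsub>bt n q\<^esub> x"

definition bt_g :: "nat \<Rightarrow> 'a::comm_ring_1 \<Rightarrow> nat \<Rightarrow> 'a free_elem set" where
  "bt_g n q i = bt_class n q (free_g i)"

definition bt_e :: "nat \<Rightarrow> 'a::comm_ring_1 \<Rightarrow> nat \<Rightarrow> 'a free_elem set" where
  "bt_e n q i = bt_class n q (free_e i)"

definition bt_prod ::
    "nat \<Rightarrow> 'a::comm_ring_1 \<Rightarrow> 'a free_elem set list \<Rightarrow> 'a free_elem set" where
  "bt_prod n q xs = foldr (mult (bt n q)) xs \<one>\<^bsub>bt n q\<^esub>"

text \<open>The element \<open>g\<^sub>w\<close>; the choice of the reduced expression is immaterial.\<close>

definition bt_gw :: "nat \<Rightarrow> 'a::comm_ring_1 \<Rightarrow> (nat \<Rightarrow> nat) \<Rightarrow> 'a free_elem set" where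
  "bt_gw n q w = bt_prod n q (map (bt_g n q) (SOME is. is \<in> reduced_words n w))"

text \<open>The linear anti-automorphism \<open>*\<close>: reversing words, applied to all representatives of a
  class. The ideal of relations is stable under reversal.\<close>

definition rev_word :: "word \<Rightarrow> word" where
  "rev_word u = Word (rev (letters u))"

definition bt_star :: "'a::comm_ring_1 free_elem set \<Rightarrow> 'a free_elem set" where
  "bt_star x = Poly_Mapping.map_key rev_word ` x"


section \<open>Idempotents\<close>

definition set_partitions :: "nat \<Rightarrow> nat set set set" where
  "set_partitions n = {A. partition_on {1..n} A}"

text \<open>The Moebius function of the poset of set partitions ordered by \<^const>\<open>refines\<close>
  (the finest partition is the smallest).\<close>

function mobius :: "nat \<Rightarrow> nat set set \<Rightarrow> nat set set \<Rightarrow> int" where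
  "mobius n A B =
     (if \<not> refines {1..n} A B then 0
      else if A = B then 1
      else - (\<Sum>C \<in> {C. refines {1..n} A C \<and> refines {1..n} C B \<and> C \<noteq> B}. mobius n A C))"
  by auto
termination
proof (relation "Wellfounded.measure
    (\<lambda>(n, A, B). card {D. refines {1..n} A D \<and> refines {1..n} D B})")
  fix n :: nat and A B C :: "nat set set"
  assume "C \<in> {C. refines {1..n} A C \<and> refines {1..n} C B \<and> C \<noteq> B}"
  then have C: "refines {1..n} A C" "refines {1..n} C B" "C \<noteq> B"
    by auto
  have "finite {D. refines {1..n} A D \<and> refines {1..n} D B}"
    by (rule finite_subset[of _ "{D. partition_on {1..n} D}"])
      (auto simp: refines_def finitely_many_partition_on)
  moreover have "{D. refines {1..n} A D \<and> refines {1..n} D C}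
      \<subset> {D. refines {1..n} A D \<and> refines {1..n} D B}"
  proof (rule psubsetI)
    show "{D. refines {1..n} A D \<and> refines {1..n} D C}
        \<subseteq> {D. refines {1..n} A D \<and> refines {1..n} D B}"
      using C by (auto intro: refines_trans)
    have "refines {1..n} A B" "refines {1..n} B B"
      using C refines_trans refines_refl refines_def by metis+
    moreover have "\<not> refines {1..n} B C"
      using C refines_asym by blast
    ultimately show "{D. refines {1..n} A D \<and> refines {1..n} D C}
        \<noteq> {D. refines {1..n} A D \<and> refines {1..n} D B}"
      by blast
  qed
  ultimately show "((n, A, C), n, A, B) \<in> Wellfounded.measure
      (\<lambda>(n, A, B). card {D. refines {1..n} A D \<and> refines {1..n} D B})"
    by (simp add: psubset_card_mono)
qed simp

declare mobius.simps [simp del]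

text \<open>Meant for \<open>i < j\<close>.\<close>

function bt_E_pair :: "nat \<Rightarrow> 'a::comm_ring_1 \<Rightarrow> nat \<Rightarrow> nat \<Rightarrow> 'a free_elem set" where
  "bt_E_pair n q i j =
     (if j \<le> i + 1 then bt_e n q i
      else bt_g n q i \<otimes>\<^bsub>bt n q\<^esub> bt_E_pair n q (i + 1) j \<otimes>\<^bsub>bt n q\<^esub> (inv\<^bsub>bt n q\<^esub> (bt_g n q i)))"
  by auto
termination
  by (relation "Wellfounded.measure (\<lambda>(n, q, i, j). j - i)") auto

declare bt_E_pair.simps [simp del]

text \<open>The factors \<open>E\<^sub>i\<^sub>j\<close> commute, so the order of the pairs does not matter.\<close>

definition bt_E :: "nat \<Rightarrow> 'a::comm_ring_1 \<Rightarrow> nat set set \<Rightarrow> 'a free_elem set" where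
  "bt_E n q A = bt_prod n q
     [bt_E_pair n q i j. i \<leftarrow> [1..<n + 1], j \<leftarrow> [i + 1..<n + 1], \<exists>X\<in>A. i \<in> X \<and> j \<in> X]"

definition bt_EE :: "nat \<Rightarrow> 'a::comm_ring_1 \<Rightarrow> nat set set \<Rightarrow> 'a free_elem set" where
  "bt_EE n q A =
     (\<Oplus>\<^bsub>bt n q\<^esub>B\<in>{B. refines {1..n} A B}. bt_smult n q (of_int (mobius n A B)) (bt_E n q B))"

definition has_type :: "nat set set \<Rightarrow> nat list \<Rightarrow> bool" where
  "has_type A \<alpha> \<longleftrightarrow> rev (sorted_list_of_multiset (image_mset card (mset_set A))) = \<alpha>"

definition bt_EE_type :: "nat \<Rightarrow> 'a::comm_ring_1 \<Rightarrow> nat list \<Rightarrow> 'a free_elem set" where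
  "bt_EE_type n q \<alpha> = (\<Oplus>\<^bsub>bt n q\<^esub>A\<in>{A \<in> set_partitions n. has_type A \<alpha>}. bt_EE n q A)"

definition bt_summand :: "nat \<Rightarrow> 'a::comm_ring_1 \<Rightarrow> nat list \<Rightarrow> 'a free_elem set set" where
  "bt_summand n q \<alpha> = (\<lambda>h. bt_EE_type n q \<alpha> \<otimes>\<^bsub>bt n q\<^esub> h) ` carrier (bt n q)"


section \<open>Partitions and multitableaux\<close>

definition is_partition :: "nat list \<Rightarrow> bool" where
  "is_partition \<rho> \<longleftrightarrow> sorted_wrt (\<ge>) \<rho> \<and> 0 \<notin> set \<rho>"

definition dominated_by :: "nat list \<Rightarrow> nat list \<Rightarrow> bool" where
  "dominated_by \<rho> \<tau> \<longleftrightarrow> sum_list \<rho> = sum_list \<tau> \<and> (\<forall>k. sum_list (take k \<rho>) \<le> sum_list (take k \<tau>))"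

text \<open>The reflexive versions of the total orders on partitions that are allowed in the
  definition of the index set.\<close>

definition admissible_order :: "(nat list \<times> nat list) set \<Rightarrow> bool" where
  "admissible_order R \<longleftrightarrow>
     linear_order_on {\<rho>. is_partition \<rho>} R \<and>
     (\<forall>\<rho> \<tau>. is_partition \<rho> \<and> is_partition \<tau> \<and> dominated_by \<rho> \<tau> \<longrightarrow> (\<rho>, \<tau>) \<in> R) \<and>
     (\<forall>\<rho> \<tau>. is_partition \<rho> \<and> is_partition \<tau> \<and> sum_list \<rho> < sum_list \<tau> \<longrightarrow> (\<rho>, \<tau>) \<in> R)"

definition conj_partition :: "nat list \<Rightarrow> nat list" where
  "conj_partition \<rho> =
     map (\<lambda>j. length (filter (\<lambda>p. j < p) \<rho>)) [0..<(if \<rho> = [] then 0 else hd \<rho>)]"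

text \<open>Multipartitions are lists of partitions; a multitableau is the list of its components,
  each of which is the list of its rows. List positions count from 0, whereas the indices
  permuted by \<open>S\<^sub>r\<close> and the entries of tableaux count from 1.\<close>

type_synonym multipartition = "nat list list"
type_synonym multitableau = "nat list list list"

definition mp_size :: "multipartition \<Rightarrow> nat" where
  "mp_size \<Lambda> = sum_list (map sum_list \<Lambda>)"

definition is_multitableau :: "multipartition \<Rightarrow> multitableau \<Rightarrow> bool" where
  "is_multitableau \<Lambda> t \<longleftrightarrow>
     map (map length) t = \<Lambda> \<and> distinct (concat (concat t)) \<and>
     set (concat (concat t)) = {1..mp_size \<Lambda>}"

definition row_standard :: "multitableau \<Rightarrow> bool" where
  "row_standard t \<longleftrightarrow> (\<forall>c \<in> set t. \<forall>r \<in> set c. sorted_wrt (<) r)"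

definition col_standard :: "multitableau \<Rightarrow> bool" where
  "col_standard t \<longleftrightarrow>
     (\<forall>c \<in> set t. \<forall>i j. i + 1 < length c \<and> j < length (c ! (i + 1)) \<longrightarrow> c ! i ! j < c ! (i + 1) ! j)"

definition entries :: "nat list list \<Rightarrow> nat set" where
  "entries c = set (concat c)"

fun fill_rows :: "nat \<Rightarrow> nat list \<Rightarrow> nat list list" where
  "fill_rows k [] = []"
| "fill_rows k (p # ps) = [k..<k + p] # fill_rows (k + p) ps"

fun fill_components :: "nat \<Rightarrow> multipartition \<Rightarrow> multitableau" where
  "fill_components k [] = []"
| "fill_components k (\<rho> # \<Lambda>) = fill_rows k \<rho> # fill_components (k + sum_list \<rho>) \<Lambda>"

definition initial_tableau :: "multipartition \<Rightarrow> multitableau" where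
  "initial_tableau \<Lambda> = fill_components 1 \<Lambda>"

definition act :: "multitableau \<Rightarrow> (nat \<Rightarrow> nat) \<Rightarrow> multitableau" where
  "act t w = map (map (map w)) t"

definition tableau_perm :: "multipartition \<Rightarrow> multitableau \<Rightarrow> nat \<Rightarrow> nat" where
  "tableau_perm \<Lambda> t = (THE w. w permutes {1..mp_size \<Lambda>} \<and> t = act (initial_tableau \<Lambda>) w)"

definition row_stabilizer :: "multipartition \<Rightarrow> (nat \<Rightarrow> nat) set" where
  "row_stabilizer \<Lambda> = {w. w permutes {1..mp_size \<Lambda>} \<and>
     (\<forall>c \<in> set (initial_tableau \<Lambda>). \<forall>r \<in> set c. w ` set r = set r)}"

definition initial_kind :: "multipartition \<Rightarrow> multitableau \<Rightarrow> bool" where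
  "initial_kind \<Lambda> t \<longleftrightarrow> map entries t = map entries (initial_tableau \<Lambda>)"

definition block :: "multipartition \<Rightarrow> nat \<Rightarrow> nat set" where
  "block \<Lambda> j = entries (initial_tableau \<Lambda> ! (j - 1))"

definition block_partition :: "multipartition \<Rightarrow> nat set set" where
  "block_partition \<Lambda> = entries ` set (initial_tableau \<Lambda>) - {{}}"


section \<open>The index set and its tableaux\<close>

text \<open>An index is a pair of multipartitions \<open>(\<Lambda>, M)\<close>, the shape and the shape of the
  multiplicities. Equal components of \<open>\<Lambda>\<close> are contiguous; this does not refer to the total
  order, so it also makes sense after conjugation.\<close>

definition multiplicities :: "multipartition \<Rightarrow> nat list" where
  "multiplicities \<Lambda> = map (count_list \<Lambda>) (remdups_adj \<Lambda>)"

type_synonym index = "multipartition \<times> multipartition"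

definition index_set :: "(nat list \<times> nat list) set \<Rightarrow> nat \<Rightarrow> nat list \<Rightarrow> index set" where
  "index_set R n \<alpha> = {(\<Lambda>, M).
     length \<Lambda> = length \<alpha> \<and> mp_size \<Lambda> = n \<and>
     (\<forall>\<rho> \<in> set \<Lambda>. is_partition \<rho> \<and> \<rho> \<noteq> []) \<and>
     has_type (block_partition \<Lambda>) \<alpha> \<and>
     sorted_wrt (\<lambda>\<rho> \<tau>. (\<rho>, \<tau>) \<in> R) \<Lambda> \<and>
     (\<forall>\<mu> \<in> set M. is_partition \<mu>) \<and>
     map sum_list M = multiplicities \<Lambda>}"

definition increasing_tableau :: "multipartition \<Rightarrow> multitableau \<Rightarrow> bool" where
  "increasing_tableau \<Lambda> t \<longleftrightarrow>
     (\<forall>i j. i < j \<and> j < length \<Lambda> \<and> \<Lambda> ! i = \<Lambda> ! j \<longrightarrow> Min (entries (t ! i)) < Min (entries (t ! j)))"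

type_synonym index_tableau = "multitableau \<times> multitableau"

definition RStd :: "index \<Rightarrow> index_tableau set" where
  "RStd = (\<lambda>(\<Lambda>, M). {(t, v).
     is_multitableau \<Lambda> t \<and> row_standard t \<and> increasing_tableau \<Lambda> t \<and>
     is_multitableau M v \<and> row_standard v \<and> initial_kind M v})"

definition Std :: "index \<Rightarrow> index_tableau set" where
  "Std I = {(t, v) \<in> RStd I. col_standard t \<and> col_standard v}"

definition conj_index :: "index \<Rightarrow> index" where
  "conj_index = (\<lambda>(\<Lambda>, M). (map conj_partition \<Lambda>, map conj_partition M))"

definition conj_tableau :: "index_tableau \<Rightarrow> index_tableau" where
  "conj_tableau = (\<lambda>(t, v). (map List.transpose t, map List.transpose v))"


section \<open>The elements \<open>m\<close> and \<open>n\<close> and the bilinear form\<close>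

text \<open>The permutation \<open>B\<^sub>w\<close>, for \<open>w\<close> permuting the indices of equal components.\<close>

definition block_perm :: "multipartition \<Rightarrow> (nat \<Rightarrow> nat) \<Rightarrow> nat \<Rightarrow> nat" where
  "block_perm \<Lambda> w = (THE b. b permutes {1..mp_size \<Lambda>} \<and>
     (\<forall>j \<in> {1..length \<Lambda>}. \<forall>k < card (block \<Lambda> j).
        b (sorted_list_of_set (block \<Lambda> j) ! k) = sorted_list_of_set (block \<Lambda> (w j)) ! k))"

definition bt_EEm :: "nat \<Rightarrow> 'a::comm_ring_1 \<Rightarrow> multipartition \<Rightarrow> 'a free_elem set" where
  "bt_EEm n q \<Lambda> = bt_EE n q (block_partition \<Lambda>)"

definition bt_BB ::
    "nat \<Rightarrow> 'a::comm_ring_1 \<Rightarrow> multipartition \<Rightarrow> (nat \<Rightarrow> nat) \<Rightarrow> 'a free_elem set" where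
  "bt_BB n q \<Lambda> w = bt_EEm n q \<Lambda> \<otimes>\<^bsub>bt n q\<^esub> bt_gw n q (block_perm \<Lambda> w)"

definition bt_x :: "nat \<Rightarrow> 'a::comm_ring_1 \<Rightarrow> multipartition \<Rightarrow> 'a free_elem set" where
  "bt_x n q \<Lambda> =
     (\<Oplus>\<^bsub>bt n q\<^esub>w\<in>row_stabilizer \<Lambda>. bt_smult n q (q ^ perm_length n w) (bt_gw n q w))"

definition bt_y :: "nat \<Rightarrow> 'a::comm_ring_1 \<Rightarrow> multipartition \<Rightarrow> 'a free_elem set" where
  "bt_y n q \<Lambda> =
     (\<Oplus>\<^bsub>bt n q\<^esub>w\<in>row_stabilizer \<Lambda>. bt_smult n q (unit_inv (- q) ^ perm_length n w) (bt_gw n q w))"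

definition bt_b :: "nat \<Rightarrow> 'a::comm_ring_1 \<Rightarrow> index \<Rightarrow> 'a free_elem set" where
  "bt_b n q = (\<lambda>(\<Lambda>, M). \<Oplus>\<^bsub>bt n q\<^esub>w\<in>row_stabilizer M. bt_BB n q \<Lambda> w)"

definition bt_c :: "nat \<Rightarrow> 'a::comm_ring_1 \<Rightarrow> index \<Rightarrow> 'a free_elem set" where
  "bt_c n q = (\<lambda>(\<Lambda>, M).
     \<Oplus>\<^bsub>bt n q\<^esub>w\<in>row_stabilizer M. bt_smult n q ((- 1) ^ perm_length (mp_size M) w) (bt_BB n q \<Lambda> w))"

definition bt_m ::
    "nat \<Rightarrow> 'a::comm_ring_1 \<Rightarrow> index \<Rightarrow> index_tableau \<Rightarrow> 'a free_elem set" where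
  "bt_m n q = (\<lambda>(\<Lambda>, M) (t, v). bt_prod n q
     [bt_EEm n q \<Lambda>, bt_x n q \<Lambda>, bt_b n q (\<Lambda>, M),
      bt_BB n q \<Lambda> (tableau_perm M v), bt_gw n q (tableau_perm \<Lambda> t)])"

definition bt_n ::
    "nat \<Rightarrow> 'a::comm_ring_1 \<Rightarrow> index \<Rightarrow> index_tableau \<Rightarrow> index_tableau \<Rightarrow> 'a free_elem set" where
  "bt_n n q = (\<lambda>(\<Lambda>, M) (s, u) (t, v). bt_prod n q
     [bt_star (bt_gw n q (tableau_perm \<Lambda> s)), bt_EEm n q \<Lambda>, bt_y n q \<Lambda>,
      bt_star (bt_BB n q \<Lambda> (tableau_perm M u)), bt_c n q (\<Lambda>, M),
      bt_BB n q \<Lambda> (tableau_perm M v), bt_gw n q (tableau_perm \<Lambda> t)])"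

definition perm_module ::
    "nat \<Rightarrow> 'a::comm_ring_1 \<Rightarrow> nat list \<Rightarrow> index \<Rightarrow> 'a free_elem set set" where
  "perm_module n q \<alpha> I =
     (\<lambda>h. bt_prod n q [bt_EEm n q (fst I), bt_x n q (fst I), bt_b n q I, h]) ` bt_summand n q \<alpha>"

definition bilinear_on ::
    "nat \<Rightarrow> 'a::comm_ring_1 \<Rightarrow> 'a free_elem set set \<Rightarrow>
     ('a free_elem set \<Rightarrow> 'a free_elem set \<Rightarrow> 'a) \<Rightarrow> bool" where
  "bilinear_on n q V f \<longleftrightarrow>
     (\<forall>x\<in>V. \<forall>y\<in>V. \<forall>z\<in>V. f (x \<oplus>\<^bsub>bt n q\<^esub> y) z = f x z + f y z \<and> f z (x \<oplus>\<^bsub>bt n q\<^esub> y) = f z x + f z y) \<and>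
     (\<forall>a. \<forall>x\<in>V. \<forall>y\<in>V. f (bt_smult n q a x) y = a * f x y \<and> f x (bt_smult n q a y) = a * f x y)"

text \<open>The bilinear form for which the elements \<open>m\<close> of the row standard tableaux, a basis of the
  module, are orthonormal. It is determined uniquely on the module, and only its values there
  are of interest.\<close>

definition bt_form ::
    "nat \<Rightarrow> 'a::comm_ring_1 \<Rightarrow> nat list \<Rightarrow> index \<Rightarrow> 'a free_elem set \<Rightarrow> 'a free_elem set \<Rightarrow> 'a" where
  "bt_form n q \<alpha> I = (SOME f. bilinear_on n q (perm_module n q \<alpha> I) f \<and>
     (\<forall>s \<in> RStd I. \<forall>t \<in> RStd I. f (bt_m n q I s) (bt_m n q I t) = (if s = t then 1 else 0)))"

end

theory Submission
  imports Defs
begin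

text \<open>The algebra acts from the right on functions on words: \<open>g\<^sub>i\<close> acts as in the regular representation
  of the Hecke algebra on neighbouring letters of the same colour and exchanges letters of different
  colours. When the colours are the blocks of \<open>A\<close>, an element of the right ideal generated by the
  idempotent of \<open>A\<close> is determined by its effect on the vector of the identity, so all computations
  take place on vectors. The permutations that occur in \<open>m\<^sub>t\<close> and, because the tableaux are standard,
  in \<open>n\<^sub>t\<^sub>'\<^sub>s\<^sub>'\<close> only ever add inversions within a colour. Hence the quadratic relation never produces a
  correction term, and the product is a sum of basis vectors indexed by row and column permutations.
  The coordinate of a vector at \<open>m\<^sub>s\<close> is its coefficient at the word of \<open>s\<close>. Row and column stabilizers
  meet trivially, first for the permutations of equal components and then inside the components, so
  exactly one summand contributes, and the coordinate is \<open>1\<close>.\<close>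

text \<open>The algebra is given by generators and relations and no basis of it is at hand, so
  equalities cannot be read off from coefficients. What replaces a basis is a comparison:
  multiplying the elements E_A g_w by generators produces exactly the structure constants of the
  action on words coloured by the blocks of \<open>A\<close>. The point is that a tie between
  different blocks must be annihilated by the idempotent, which is Weisner's theorem for the Moebius
  function of set partitions. The form is a choice among functions with prescribed properties, so a
  witness has to be exhibited, and any choice has to be shown to agree with the coordinates. The
  last two factors of the product are never applied to the sum obtained from the other ones. The
  action is symmetric for the pairing of vectors, so they are moved to the basis vector of the
  second tableau, where standardness again excludes collisions. Transposed components need not be
  increasing for the chosen order; the arguments rest on the contiguity of equal components
  instead.\<close>

unbundle no m_inv_syntax

section \<open>Inversions and reduced words\<close>

definition adj_swap :: "nat \<Rightarrow> nat \<Rightarrow> nat" where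
  "adj_swap i = Transposition.transpose i (i + 1)"

lemma adj_swap_simps [simp]:
  "adj_swap i i = Suc i" "adj_swap i (Suc i) = i" "k \<noteq> i \<Longrightarrow> k \<noteq> Suc i \<Longrightarrow> adj_swap i k = k"
  by (simp_all add: adj_swap_def)

lemma adj_swap_eq: "adj_swap i k = (if k = i then Suc i else if k = Suc i then i else k)"
  by (simp add: adj_swap_def Transposition.transpose_def)

lemma adj_swap_invol [simp]: "adj_swap i (adj_swap i k) = k" "adj_swap i \<circ> adj_swap i = id"
  by (auto simp: adj_swap_eq fun_eq_iff)

lemma inj_adj_swap [simp]: "inj (adj_swap i)"
  by (metis adj_swap_invol(1) injI)

lemma inv_adj_swap [simp]: "inv (adj_swap i) = adj_swap i"
  by (simp add: inv_unique_comp)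

lemma permutes_adj_swap: "i \<in> {1..<n} \<Longrightarrow> adj_swap i permutes {1..n}"
  unfolding adj_swap_def by (rule permutes_swap_id) auto

lemma perm_of_word_Nil [simp]: "perm_of_word [] = id"
  by (simp add: perm_of_word_def)

lemma perm_of_word_append: "perm_of_word (u @ v) = perm_of_word v \<circ> perm_of_word u"
proof -
  have "fold (\<lambda>i w. Transposition.transpose i (i + 1) \<circ> w) v w = perm_of_word v \<circ> w"
    for v and w :: "nat \<Rightarrow> nat"
    unfolding perm_of_word_def
  proof (induction v arbitrary: w)
    case (Cons i v)
    show ?case
      using Cons[of "Transposition.transpose i (i + 1) \<circ> w"] Cons[of "Transposition.transpose i (i + 1)"]
      by (simp add: comp_assoc)
  qed simp
  from this[of v "perm_of_word u"] show ?thesis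
    by (simp add: perm_of_word_def)
qed

lemma perm_of_word_single [simp]: "perm_of_word [i] = adj_swap i"
  by (simp add: perm_of_word_def adj_swap_def)

lemma perm_of_word_Cons: "perm_of_word (i # is) = perm_of_word is \<circ> adj_swap i"
  using perm_of_word_append[of "[i]" "is"] by simp

lemma permutes_perm_of_word: "set is \<subseteq> {1..<n} \<Longrightarrow> perm_of_word is permutes {1..n}"
proof (induction "is")
  case (Cons i "is")
  then show ?case
    unfolding perm_of_word_Cons by (intro permutes_compose permutes_adj_swap) auto
qed (simp add: permutes_id)

definition inversions :: "nat \<Rightarrow> (nat \<Rightarrow> nat) \<Rightarrow> (nat \<times> nat) set" where
  "inversions n w = {(i, j). 1 \<le> i \<and> i < j \<and> j \<le> n \<and> w j < w i}"

definition inv_count :: "nat \<Rightarrow> (nat \<Rightarrow> nat) \<Rightarrow> nat" where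
  "inv_count n w = card (inversions n w)"

lemma finite_inversions [simp]: "finite (inversions n w)"
  by (rule finite_subset[of _ "{1..n} \<times> {1..n}"]) (auto simp: inversions_def)

text \<open>No position lies strictly between \<open>i\<close> and \<open>i + 1\<close>, so
  exchanging the two keeps the order of every pair of positions other than
  \<open>(i, i + 1)\<close>. That pair is the one new inversion.\<close>

lemma inv_count_adj_swap:
  assumes "i \<in> {1..<n}" "w i < w (Suc i)"
  shows "inv_count n (w \<circ> adj_swap i) = Suc (inv_count n w)"
proof -
  let ?f = "\<lambda>(a, b). (adj_swap i a, adj_swap i b)"
  have "inversions n (w \<circ> adj_swap i) = insert (i, Suc i) (?f ` inversions n w)" (is "?L = ?R")
  proof (rule Set.set_eqI)
    fix p :: "nat \<times> nat"
    obtain a b where p: "p = (a, b)" by fastforce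
    have "(a, b) \<in> ?f ` inversions n w \<longleftrightarrow> (adj_swap i a, adj_swap i b) \<in> inversions n w"
    proof
      assume "(adj_swap i a, adj_swap i b) \<in> inversions n w"
      then show "(a, b) \<in> ?f ` inversions n w"
        by (rule rev_image_eqI) simp
    qed auto
    moreover have "(a, b) \<in> ?L \<longleftrightarrow> (a, b) = (i, Suc i) \<or> (adj_swap i a, adj_swap i b) \<in> inversions n w"
      using assms
      by (cases "a = i"; cases "a = Suc i"; cases "b = i"; cases "b = Suc i") (auto simp: inversions_def)
    ultimately show "p \<in> ?L \<longleftrightarrow> p \<in> ?R"
      using p by auto
  qed
  moreover have "(i, Suc i) \<notin> ?f ` inversions n w"
    by (auto simp: inversions_def adj_swap_eq split: if_splits)
  moreover have "inj_on ?f (inversions n w)"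
    by (rule inj_onI) (auto simp: inj_eq)
  ultimately show ?thesis
    by (simp add: inv_count_def card_image)
qed

lemma inv_count_adj_swap_down:
  assumes "i \<in> {1..<n}" "w (Suc i) < w i"
  shows "Suc (inv_count n (w \<circ> adj_swap i)) = inv_count n w"
  using inv_count_adj_swap[of i n "w \<circ> adj_swap i"] assms by (simp add: comp_assoc)

text \<open>The inversion of \<open>w\<close> at positions \<open>(i, j)\<close> becomes the
  inversion of \<open>inv w\<close> at positions \<open>(w j, w i)\<close>.\<close>

lemma inv_count_inv:
  assumes "w permutes {1..n}"
  shows "inv_count n (inv w) = inv_count n w"
proof -
  have "bij_betw (\<lambda>(i, j). (w j, w i)) (inversions n w) (inversions n (inv w))"
  proof (rule bij_betw_byWitness[where f' = "\<lambda>(i, j). (inv w j, inv w i)"])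
    have m: "w i \<in> {1..n}" "inv w i \<in> {1..n}" if "i \<in> {1..n}" for i
      using assms that permutes_in_image permutes_inv by metis+
    show "(\<lambda>(i, j). (w j, w i)) ` inversions n w \<subseteq> inversions n (inv w)"
      using m permutes_inverses[OF assms] by (force simp: inversions_def)
    show "(\<lambda>(i, j). (inv w j, inv w i)) ` inversions n (inv w) \<subseteq> inversions n w"
      using m permutes_inverses[OF assms] by (force simp: inversions_def)
  qed (use permutes_inverses[OF assms] in auto)
  then show ?thesis
    by (simp add: inv_count_def bij_betw_same_card)
qed

lemma inv_count_id [simp]: "inv_count n id = 0"
  by (auto simp: inv_count_def inversions_def card_eq_0_iff)

text \<open>Strong induction: smaller elements are fixed, so \<open>w a\<close> cannot be smaller
  than \<open>a\<close>; if it were larger, the preimage of \<open>a\<close> would lie beyond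
  \<open>a\<close>, against monotonicity. An arbitrary finite set is allowed because the lemma is
  applied to single rows and to single runs of equal components.\<close>

lemma strict_mono_permutes_id:
  fixes w :: "nat \<Rightarrow> nat"
  assumes "bij_betw w S S" "finite S" "\<And>i j. i \<in> S \<Longrightarrow> j \<in> S \<Longrightarrow> i < j \<Longrightarrow> w i < w j" "a \<in> S"
  shows "w a = a"
  using assms(4)
proof (induction a rule: less_induct)
  case (less a)
  have "\<not> w a < a"
    using less assms(1,3) bij_betwE[OF assms(1)] by (metis less_irrefl)
  moreover have "\<not> a < w a"
  proof
    assume a: "a < w a"
    obtain b where b: "b \<in> S" "w b = a"
      using less(2) assms(1) by (metis bij_betw_def imageE)
    then show False
      using less a assms(3)[of a b] by (metis less_asym linorder_neqE_nat)
  qed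
  ultimately show ?case by simp
qed

lemma ex_descent:
  assumes "w permutes {1..n}" "w \<noteq> id"
  shows "\<exists>i\<in>{1..<n}. w (Suc i) < w i"
proof (rule ccontr)
  assume "\<not> ?thesis"
  then have le: "w i < w (Suc i)" if "i \<in> {1..<n}" for i
    using that permutes_inj[OF assms(1)] by (metis inj_eq linorder_neqE_nat n_not_Suc_n)
  have "w i < w j" if "i \<in> {1..n}" "j \<in> {1..n}" "i < j" for i j
    using that(3,1,2)
  proof (induction j)
    case (Suc j)
    then show ?case
      using le[of j] by (cases "i = j") (auto intro: less_trans)
  qed simp
  then have "w a = a" for a
    using strict_mono_permutes_id[of w "{1..n}" a] permutes_imp_bij[OF assms(1)] permutes_not_in[OF assms(1)]
    by blast
  then show False
    using assms(2) by auto
qed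

text \<open>Bubble sort: every descent removed lowers the number of inversions by one, until none is
  left and the permutation is the identity.\<close>

lemma ex_word_inv_count:
  "w permutes {1..n} \<Longrightarrow> \<exists>is\<in>perm_words n w. length is = inv_count n w"
proof (induction "inv_count n w" arbitrary: w rule: less_induct)
  case less
  show ?case
  proof (cases "w = id")
    case False
    then obtain i where i: "i \<in> {1..<n}" "w (Suc i) < w i"
      using ex_descent less by blast
    have "w \<circ> adj_swap i permutes {1..n}"
      using i less permutes_compose permutes_adj_swap by metis
    then obtain "is" where "is \<in> perm_words n (w \<circ> adj_swap i)" "length is = inv_count n (w \<circ> adj_swap i)"
      using less(1)[of "w \<circ> adj_swap i"] inv_count_adj_swap_down[of i n w] i by force
    then show ?thesis
      using inv_count_adj_swap_down[of i n w] i
      by (intro bexI[of _ "i # is"]) (auto simp: perm_words_def perm_of_word_Cons comp_assoc)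
  qed (auto simp: perm_words_def intro: bexI[of _ "[]"])
qed

lemma inv_count_le_length: "set is \<subseteq> {1..<n} \<Longrightarrow> inv_count n (perm_of_word is) \<le> length is"
proof (induction "is")
  case (Cons i "is")
  have "perm_of_word is i \<noteq> perm_of_word is (Suc i)"
    using Cons permutes_inj[OF permutes_perm_of_word[of "is" n]] by (auto simp: inj_eq)
  then have "inv_count n (perm_of_word is \<circ> adj_swap i) \<le> Suc (inv_count n (perm_of_word is))"
    using inv_count_adj_swap[of i n "perm_of_word is"] inv_count_adj_swap_down[of i n "perm_of_word is"] Cons(2)
    by (cases "perm_of_word is i < perm_of_word is (Suc i)") (auto simp: not_less)
  moreover have "inv_count n (perm_of_word is) \<le> length is"
    using Cons by simp
  ultimately show ?case
    unfolding perm_of_word_Cons by (simp only: list.size)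
qed simp

lemma perm_length_eq: "w permutes {1..n} \<Longrightarrow> perm_length n w = inv_count n w"
  unfolding perm_length_def
  by (rule Least_equality) (use ex_word_inv_count inv_count_le_length in \<open>auto simp: perm_words_def\<close>)

lemma reduced_words_iff:
  "w permutes {1..n} \<Longrightarrow>
    is \<in> reduced_words n w \<longleftrightarrow> set is \<subseteq> {1..<n} \<and> perm_of_word is = w \<and> length is = inv_count n w"
  by (auto simp: reduced_words_def perm_words_def perm_length_eq)

lemma ex_reduced_word: "w permutes {1..n} \<Longrightarrow> \<exists>is. is \<in> reduced_words n w"
  using ex_word_inv_count[of w n] by (auto simp: reduced_words_iff perm_words_def)

lemma permutes_comp_adj_swap:
  "w permutes {1..n} \<Longrightarrow> i \<in> {1..<n} \<Longrightarrow> w \<circ> adj_swap i permutes {1..n}"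
  "w permutes {1..n} \<Longrightarrow> i \<in> {1..<n} \<Longrightarrow> adj_swap i \<circ> w permutes {1..n}"
  by (rule permutes_compose permutes_adj_swap; assumption?)+

text \<open>The leftmost letter is applied first, so deleting it composes \<open>w\<close> with a
  swap on the side of positions. The length drops by one exactly if that swap removes an inversion,
  so the possible first letters of reduced words are the descents.\<close>

lemma reduced_word_Cons_iff:
  assumes "w permutes {1..n}"
  shows "i # is \<in> reduced_words n w \<longleftrightarrow>
    i \<in> {1..<n} \<and> w (Suc i) < w i \<and> is \<in> reduced_words n (w \<circ> adj_swap i)" (is "?L \<longleftrightarrow> ?R")
proof
  assume L: ?L
  then have i: "i \<in> {1..<n}" and "is": "set is \<subseteq> {1..<n}" and w: "w = perm_of_word is \<circ> adj_swap i"
    and len: "Suc (length is) = inv_count n w"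
    using assms by (auto simp: reduced_words_iff perm_of_word_Cons)
  have w': "w \<circ> adj_swap i = perm_of_word is"
    using w by (simp add: comp_assoc)
  then have "inv_count n (w \<circ> adj_swap i) \<le> length is"
    using inv_count_le_length[OF "is"] by simp
  then have "\<not> w i < w (Suc i)"
    using inv_count_adj_swap[OF i, of w] len by auto
  then have "w (Suc i) < w i"
    using permutes_inj[OF assms] by (metis inj_eq linorder_neqE_nat n_not_Suc_n)
  then show ?R
    using inv_count_adj_swap_down[OF i, of w] len i "is" w' permutes_comp_adj_swap(1)[OF assms i]
    by (auto simp: reduced_words_iff)
next
  assume ?R
  then show ?L
    using inv_count_adj_swap_down[of i n w] permutes_comp_adj_swap(1)[OF assms, of i] assms
    by (auto simp: reduced_words_iff perm_of_word_Cons comp_assoc)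
qed

text \<open>A letter appended at the end acts on values, so the relevant ascent is one of the
  inverse permutation.\<close>

lemma reduced_word_snoc:
  assumes "w permutes {1..n}" "is \<in> reduced_words n w" "i \<in> {1..<n}" "inv w i < inv w (Suc i)"
  shows "is @ [i] \<in> reduced_words n (adj_swap i \<circ> w)"
proof -
  have "inv (adj_swap i \<circ> w) = inv w \<circ> adj_swap i"
    using o_inv_distrib[OF permutes_bij[OF permutes_adj_swap[OF assms(3)]] permutes_bij[OF assms(1)]]
    by (simp only: inv_adj_swap)
  then have "inv_count n (adj_swap i \<circ> w) = Suc (inv_count n w)"
    using inv_count_adj_swap[OF assms(3,4)] assms(1)
      inv_count_inv[OF assms(1)] inv_count_inv[OF permutes_comp_adj_swap(2)[OF assms(1,3)]] by simp
  then show ?thesis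
    using assms permutes_comp_adj_swap(2)[OF assms(1,3)]
    by (auto simp: reduced_words_iff perm_of_word_append)
qed

lemma perm_of_word_rev: "set is \<subseteq> {1..<n} \<Longrightarrow> perm_of_word (rev is) = inv (perm_of_word is)"
proof (induction "is")
  case (Cons i "is")
  have "bij (perm_of_word is)"
    using Cons permutes_bij permutes_perm_of_word by (meson set_subset_Cons subset_trans)
  moreover have "bij (adj_swap i)"
    using Cons permutes_bij permutes_adj_swap by (metis insert_subset list.simps(15))
  moreover have "perm_of_word (rev is) = inv (perm_of_word is)"
    using Cons by simp
  ultimately show ?case
    by (simp only: rev.simps perm_of_word_append perm_of_word_Cons o_inv_distrib inv_adj_swap perm_of_word_single
      perm_of_word_Nil id_o)
qed simp

text \<open>Needed for the anti-automorphism \<open>*\<close>, which reverses the word of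
  g_w.\<close>

lemma reduced_word_rev:
  assumes "w permutes {1..n}" "is \<in> reduced_words n w"
  shows "rev is \<in> reduced_words n (inv w)"
  using assms perm_of_word_rev[of "is" n]
  by (auto simp: reduced_words_iff permutes_inv inv_count_inv)

text \<open>Matsumoto's theorem: if two reduced words of the same permutation start with different
  letters, both letters are descents, so there is a third and a fourth reduced word, starting
  with the two sides of the braid relation.\<close>

theorem matsumoto:
  fixes g :: "nat \<Rightarrow> 'm::monoid_mult"
  assumes far: "\<And>i j. i \<in> {1..<n} \<Longrightarrow> j \<in> {1..<n} \<Longrightarrow> far i j \<Longrightarrow> g i * g j = g j * g i"
    and braid: "\<And>i j. i \<in> {1..<n} \<Longrightarrow> j \<in> {1..<n} \<Longrightarrow> adjacent i j \<Longrightarrow>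
      g i * g j * g i = g j * g i * g j"
    and w: "w permutes {1..n}" "is \<in> reduced_words n w" "js \<in> reduced_words n w"
  shows "prod_list (map g is) = prod_list (map g js)"
  using w
proof (induction "length is" arbitrary: w "is" js rule: less_induct)
  case less
  have len: "length is = length js"
    using less by (simp add: reduced_words_iff)
  show ?case
  proof (cases "is")
    case Nil
    then show ?thesis using len by simp
  next
    case (Cons i is')
    then obtain j js' where js: "js = j # js'"
      using len by (cases js) auto
    have i: "i \<in> {1..<n}" "w (Suc i) < w i" and is': "is' \<in> reduced_words n (w \<circ> adj_swap i)"
      using less Cons by (auto simp: reduced_word_Cons_iff)
    have j: "j \<in> {1..<n}" "w (Suc j) < w j" and js': "js' \<in> reduced_words n (w \<circ> adj_swap j)"
      using less js by (auto simp: reduced_word_Cons_iff)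
    note wi = permutes_comp_adj_swap(1)[OF less(2) i(1)]
    note wj = permutes_comp_adj_swap(1)[OF less(2) j(1)]
    have IHi: "prod_list (map g is') = prod_list (map g ks)" if "ks \<in> reduced_words n (w \<circ> adj_swap i)" for ks
      using less(1)[OF _ wi is' that] Cons by simp
    have IHj: "prod_list (map g js') = prod_list (map g ks)" if "ks \<in> reduced_words n (w \<circ> adj_swap j)" for ks
      using less(1)[OF _ wj js' that] len js by simp
    consider "i = j" | "far i j" | "adjacent i j"
      by (auto simp: far_def adjacent_def) linarith
    then show ?thesis
    proof cases
      case 1
      then show ?thesis
        using IHi js' Cons js by simp
    next
      case 2
      have wij: "w \<circ> adj_swap i \<circ> adj_swap j permutes {1..n}"
        by (rule permutes_comp_adj_swap(1)[OF wi j(1)])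
      obtain ks where ks: "ks \<in> reduced_words n (w \<circ> adj_swap i \<circ> adj_swap j)"
        using ex_reduced_word[OF wij] by blast
      have eq: "w \<circ> adj_swap i \<circ> adj_swap j = w \<circ> adj_swap j \<circ> adj_swap i"
        using 2 by (auto simp: fun_eq_iff adj_swap_eq far_def)
      have "j # ks \<in> reduced_words n (w \<circ> adj_swap i)"
        using 2 j ks by (subst reduced_word_Cons_iff[OF wi]) (auto simp: adj_swap_eq far_def)
      moreover have "i # ks \<in> reduced_words n (w \<circ> adj_swap j)"
        using 2 i ks eq by (subst reduced_word_Cons_iff[OF wj]) (auto simp: adj_swap_eq far_def)
      ultimately have "prod_list (map g is) = g i * g j * prod_list (map g ks)"
        "prod_list (map g js) = g j * g i * prod_list (map g ks)"
        using IHi IHj Cons js by (auto simp: mult.assoc)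
      then show ?thesis
        using far[OF i(1) j(1) 2] by simp
    next
      case 3
      let ?wij = "w \<circ> adj_swap i \<circ> adj_swap j" and ?wji = "w \<circ> adj_swap j \<circ> adj_swap i"
      have wij: "?wij permutes {1..n}" and wji: "?wji permutes {1..n}"
        using permutes_comp_adj_swap(1) wi wj i(1) j(1) by metis+
      have wiji: "?wij \<circ> adj_swap i permutes {1..n}"
        by (rule permutes_comp_adj_swap(1)[OF wij i(1)])
      obtain ks where ks: "ks \<in> reduced_words n (?wij \<circ> adj_swap i)"
        using ex_reduced_word[OF wiji] by blast
      have eq: "?wij \<circ> adj_swap i = ?wji \<circ> adj_swap j"
        using 3 by (auto simp: fun_eq_iff adj_swap_eq adjacent_def)
      have lt: "w j < w i" if "j = Suc i" using that i(2) by simp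
      have lt': "w i < w j" if "i = Suc j" using that j(2) by simp
      have "j # i # ks \<in> reduced_words n (w \<circ> adj_swap i)"
        using 3 i j ks
        by (subst reduced_word_Cons_iff[OF wi], subst reduced_word_Cons_iff[OF wij])
          (auto simp: adj_swap_eq adjacent_def)
      moreover have "i # j # ks \<in> reduced_words n (w \<circ> adj_swap j)"
        using 3 i j ks unfolding eq
        by (subst reduced_word_Cons_iff[OF wj], subst reduced_word_Cons_iff[OF wji])
          (auto simp: adj_swap_eq adjacent_def)
      ultimately have "prod_list (map g is) = g i * g j * g i * prod_list (map g ks)"
        "prod_list (map g js) = g j * g i * g j * prod_list (map g ks)"
        using IHi IHj Cons js by (auto simp: mult.assoc)
      then show ?thesis
        using braid[OF i(1) j(1) 3] by simp
    qed
  qed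
qed

section \<open>The partition lattice\<close>

text \<open>The equivalence relation of a partition. Refinement becomes implication between
  relations, so that arguments about blocks can be carried out pointwise.\<close>

definition same_block :: "nat set set \<Rightarrow> nat \<Rightarrow> nat \<Rightarrow> bool" where
  "same_block A i j \<longleftrightarrow> (\<exists>X\<in>A. i \<in> X \<and> j \<in> X)"

lemma same_block_sym: "same_block A i j \<Longrightarrow> same_block A j i"
  by (auto simp: same_block_def)

lemma same_block_refl: "partition_on S A \<Longrightarrow> i \<in> S \<Longrightarrow> same_block A i i"
  by (auto simp: same_block_def partition_on_def)

lemma same_block_trans:
  "partition_on S A \<Longrightarrow> same_block A i j \<Longrightarrow> same_block A j k \<Longrightarrow> same_block A i k"
  unfolding same_block_def partition_on_def disjoint_def by (metis disjoint_iff)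

lemma refines_iff_same_block:
  assumes "partition_on S A" "partition_on S B"
  shows "refines S A B \<longleftrightarrow> (\<forall>i j. same_block A i j \<longrightarrow> same_block B i j)"
proof
  assume "refines S A B"
  then have "\<exists>Y\<in>B. X \<subseteq> Y" if "X \<in> A" for X
    using that by (auto simp: refines_def)
  then show "\<forall>i j. same_block A i j \<longrightarrow> same_block B i j"
    unfolding same_block_def by (meson subsetD)
next
  assume R: "\<forall>i j. same_block A i j \<longrightarrow> same_block B i j"
  show "refines S A B"
    unfolding refines_def
  proof (intro conjI ballI assms)
    fix X assume X: "X \<in> A"
    then obtain i where i: "i \<in> X"
      using assms(1) by (metis ex_in_conv partition_onD3)
    then have "same_block A i i"
      using X by (auto simp: same_block_def)
    then obtain Y where Y: "Y \<in> B" "i \<in> Y"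
      using R by (auto simp: same_block_def)
    have "j \<in> Y" if "j \<in> X" for j
    proof -
      have "same_block B i j"
        using R X i that by (auto simp: same_block_def)
      then show ?thesis
        using Y assms(2) unfolding same_block_def partition_on_def disjoint_def by blast
    qed
    then show "\<exists>Y\<in>B. X \<subseteq> Y"
      using Y by blast
  qed
qed

lemma finite_refines [simp]: "finite {B. refines {1..n::nat} A B}"
  by (rule finite_subset[of _ "{D. partition_on {1..n} D}"])
    (auto simp: refines_def finitely_many_partition_on)

lemma mobius_sum:
  assumes "refines {1..n} A C"
  shows "(\<Sum>B | refines {1..n} A B \<and> refines {1..n} B C. mobius n A B) = (if A = C then 1 else 0)"
proof (cases "A = C")
  case True
  then have "{B. refines {1..n} A B \<and> refines {1..n} B C} = {A}"
    using assms refines_asym by blast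
  then show ?thesis
    using assms True by (simp add: mobius.simps)
next
  case False
  let ?X = "{B. refines {1..n} A B \<and> refines {1..n} B C}"
  have "finite ?X"
    by (rule finite_subset[OF _ finite_refines[of n A]]) auto
  moreover have "C \<in> ?X"
    using assms refines_refl refines_def by blast
  ultimately have "sum (mobius n A) ?X = mobius n A C + sum (mobius n A) (?X - {C})"
    by (rule sum.remove)
  moreover have "?X - {C} = {B. refines {1..n} A B \<and> refines {1..n} B C \<and> B \<noteq> C}"
    by blast
  ultimately show ?thesis
    using assms False by (simp add: mobius.simps[of n A C])
qed

section \<open>Merging two blocks, and Weisner's theorem\<close>

definition block_of :: "nat set set \<Rightarrow> nat \<Rightarrow> nat set" where
  "block_of A i = {k. same_block A i k}"

text \<open>If \<open>i\<close> and \<open>j\<close> already share a block, the two removed blocks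
  coincide and the result is \<open>A\<close> again, so the later formulas cover this case as
  well.\<close>

definition merge :: "nat set set \<Rightarrow> nat \<Rightarrow> nat \<Rightarrow> nat set set" where
  "merge A i j = insert (block_of A i \<union> block_of A j) (A - {block_of A i, block_of A j})"

lemma block_of_eq:
  "partition_on S A \<Longrightarrow> X \<in> A \<Longrightarrow> i \<in> X \<Longrightarrow> block_of A i = X"
  unfolding block_of_def same_block_def partition_on_def disjoint_def by blast

lemma block_of_in: "partition_on S A \<Longrightarrow> i \<in> S \<Longrightarrow> block_of A i \<in> A \<and> i \<in> block_of A i"
  using block_of_eq[of S A] unfolding partition_on_def by (metis UnionE)

lemma partition_on_merge:
  assumes "partition_on S A" "i \<in> S" "j \<in> S"
  shows "partition_on S (merge A i j)"
proof (rule partition_onI)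
  note b = block_of_in[OF assms(1)]
  have "\<Union>(merge A i j) = \<Union>A"
  proof
    show "\<Union>(merge A i j) \<subseteq> \<Union>A"
      using b[OF assms(2)] b[OF assms(3)] unfolding merge_def by auto
    show "\<Union>A \<subseteq> \<Union>(merge A i j)"
      unfolding merge_def by auto
  qed
  then show "\<Union>(merge A i j) = S"
    using partition_onD1[OF assms(1)] by simp
  show "{} \<notin> merge A i j"
    using b[OF assms(2)] assms(1) unfolding merge_def partition_on_def by auto
  fix X Y assume "X \<in> merge A i j" "Y \<in> merge A i j" "X \<noteq> Y"
  then show "disjnt X Y"
    using b[OF assms(2)] b[OF assms(3)] partition_onD2[OF assms(1)]
    unfolding merge_def disjoint_def disjnt_def by auto
qed

lemma same_block_merge:
  assumes "partition_on S A" "i \<in> S" "j \<in> S"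
  shows "same_block (merge A i j) k l \<longleftrightarrow> same_block A k l \<or>
    (same_block A i k \<or> same_block A j k) \<and> (same_block A i l \<or> same_block A j l)" (is "?L \<longleftrightarrow> ?R")
proof -
  have L: "?L \<longleftrightarrow> (\<exists>X \<in> insert (block_of A i \<union> block_of A j) (A - {block_of A i, block_of A j}). k \<in> X \<and> l \<in> X)"
    by (simp only: merge_def same_block_def)
  have mem: "m \<in> block_of A i \<union> block_of A j \<longleftrightarrow> same_block A i m \<or> same_block A j m" for m
    by (simp add: block_of_def)
  show ?thesis
  proof
    assume ?L
    then show ?R
      unfolding L using mem by (auto simp: same_block_def[of A k l])
  next
    assume ?R
    then show ?L
    proof
      assume "same_block A k l"
      then obtain X where X: "X \<in> A" "k \<in> X" "l \<in> X"
        by (auto simp: same_block_def)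
      then show ?L
        unfolding L by (cases "X = block_of A i"; cases "X = block_of A j") auto
    next
      assume "(same_block A i k \<or> same_block A j k) \<and> (same_block A i l \<or> same_block A j l)"
      then show ?L
        unfolding L using mem by blast
    qed
  qed
qed

lemma refines_merge: "partition_on S A \<Longrightarrow> i \<in> S \<Longrightarrow> j \<in> S \<Longrightarrow> refines S A (merge A i j)"
  by (simp add: refines_iff_same_block partition_on_merge same_block_merge)

lemma merge_refines:
  assumes "refines S A D" "i \<in> S" "j \<in> S" "same_block D i j"
  shows "refines S (merge A i j) D"
proof -
  have A: "partition_on S A" and D: "partition_on S D"
    using assms(1) by (auto simp: refines_def)
  have AD: "same_block A k l \<Longrightarrow> same_block D k l" for k l
    using assms(1) refines_iff_same_block[OF A D] by blast
  show ?thesis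
    unfolding refines_iff_same_block[OF partition_on_merge[OF A assms(2,3)] D] same_block_merge[OF A assms(2,3)]
    using AD assms(4) by (metis D same_block_sym same_block_trans)
qed

text \<open>Weisner's theorem for the join with the partition whose only nontrivial block is \<open>{i, j}\<close>:
  the sum over all \<open>B\<close> whose merge refines \<open>D\<close> is a sum over an interval.\<close>

lemma weisner:
  assumes A: "partition_on {1..n} A" and ij: "i \<in> {1..n}" "j \<in> {1..n}" "\<not> same_block A i j"
  shows "(\<Sum>B | refines {1..n} A B \<and> merge B i j = D. mobius n A B) = 0"
proof (induction "card {C. refines {1..n} A C \<and> refines {1..n} C D}" arbitrary: D rule: less_induct)
  case less
  let ?S = "\<lambda>D. \<Sum>B | refines {1..n} A B \<and> merge B i j = D. mobius n A B"
  let ?I = "\<lambda>D. {C. refines {1..n} A C \<and> refines {1..n} C D}"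
  have fin: "finite (?I D)" for D
    by (rule finite_subset[OF _ finite_refines[of n A]]) auto
  show ?case
  proof (cases "refines {1..n} A D \<and> same_block D i j")
    case False
    have "{B. refines {1..n} A B \<and> merge B i j = D} = {}"
    proof (rule ccontr)
      assume "\<not> ?thesis"
      then obtain B where B: "refines {1..n} A B" "merge B i j = D"
        by blast
      then have pB: "partition_on {1..n} B"
        by (simp add: refines_def)
      have "refines {1..n} A D"
        using B refines_merge[OF pB ij(1,2)] refines_trans by blast
      moreover have "same_block D i j"
        using same_block_merge[OF pB ij(1,2), of i j] B(2) same_block_refl[OF pB] ij by blast
      ultimately show False
        using False by blast
    qed
    then show ?thesis
      by (metis sum.empty)
  next
    case True
    then have D: "refines {1..n} A D" "same_block D i j" and "A \<noteq> D" and pD: "partition_on {1..n} D"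
      using ij by (auto simp: refines_def)
    have m: "merge B i j \<in> ?I D" if "B \<in> ?I D" for B
    proof -
      have B: "refines {1..n} A B" "refines {1..n} B D" and "partition_on {1..n} B"
        using that by (auto simp: refines_def)
      then have "refines {1..n} A (merge B i j)"
        using refines_merge[of "{1..n}" B i j] ij refines_trans by metis
      moreover have "refines {1..n} (merge B i j) D"
        using merge_refines[OF B(2) ij(1,2) D(2)] .
      ultimately show ?thesis
        by simp
    qed
    \<comment> \<open>\<open>D\<close> ties \<open>i\<close> and \<open>j\<close> while
      \<open>A\<close> does not, so the interval is nontrivial and its Moebius sum is zero. Grouped
      by the value of \<open>merge\<close>, it is the sum of the claimed expressions for all
      \<open>E\<close> in the interval; those for \<open>E\<close> other than \<open>D\<close>
      vanish by induction, hence so does the one for \<open>D\<close>.\<close>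
    have "0 = sum (mobius n A) (?I D)"
      using mobius_sum[OF D(1)] \<open>A \<noteq> D\<close> by simp
    also have "\<dots> = (\<Sum>E\<in>?I D. sum (mobius n A) {B \<in> ?I D. merge B i j = E})"
      by (rule sum.group[symmetric, OF fin fin]) (use m in blast)
    also have "\<dots> = (\<Sum>E\<in>?I D. ?S E)"
    proof (intro sum.cong refl)
      fix E assume E: "E \<in> ?I D"
      have "B \<in> ?I D" if "refines {1..n} A B" "merge B i j = E" for B
      proof -
        have "partition_on {1..n} B"
          using that(1) by (simp add: refines_def)
        then have "refines {1..n} B D"
          using refines_merge[of "{1..n}" B i j] ij that(2) E refines_trans by auto
        then show ?thesis
          using that(1) by simp
      qed
      then show "{B \<in> ?I D. merge B i j = E} = {B. refines {1..n} A B \<and> merge B i j = E}"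
        by blast
    qed
    also have "\<dots> = ?S D + (\<Sum>E\<in>?I D - {D}. ?S E)"
      using D(1) pD by (intro sum.remove fin) (auto intro: refines_refl)
    also have "(\<Sum>E\<in>?I D - {D}. ?S E) = 0"
    proof (rule sum.neutral, rule ballI)
      fix E assume E: "E \<in> ?I D - {D}"
      have "?I E \<subset> ?I D"
      proof
        show "?I E \<subseteq> ?I D"
          using E by (auto intro: refines_trans)
        have "D \<in> ?I D"
          using D(1) refines_refl[OF pD] by simp
        moreover have "D \<notin> ?I E"
          using E refines_asym[of "{1..n}" D E] by auto
        ultimately show "?I E \<noteq> ?I D"
          by blast
      qed
      then show "?S E = 0"
        by (intro less psubset_card_mono fin)
    qed
    finally show ?thesis
      by simp
  qed
qed

section \<open>Consequences of the defining relations\<close>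

lemma set_comprehension_elem:
  "x \<in> set [f i j. i \<leftarrow> xs, j \<leftarrow> ys i, P i j] \<longleftrightarrow> (\<exists>i\<in>set xs. \<exists>j\<in>set (ys i). P i j \<and> x = f i j)"
  by auto

text \<open>The relations over a type instead of a carrier set, so that computations carry no
  membership conditions. Here \<open>z\<close> takes the place of q minus its inverse, and
  \<open>sc\<close> embeds the scalars centrally. The classes \<open>ring\<close> and
  \<open>monoid_mult\<close> together describe a ring with unit in which 0 and 1 may coincide, so
  that nontriviality of the algebra is not presupposed.\<close>

locale bt_system =
  fixes n :: nat and sc :: "'a::comm_ring_1 \<Rightarrow> 'r::{ring,monoid_mult}" and z :: 'a and g e :: "nat \<Rightarrow> 'r"
  assumes sc_add: "sc (a + b) = sc a + sc b"
    and sc_mult: "sc (a * b) = sc a * sc b"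
    and sc_1 [simp]: "sc 1 = 1"
    and sc_central: "sc a * x = x * sc a"
    and gg_far: "i \<in> {1..<n} \<Longrightarrow> j \<in> {1..<n} \<Longrightarrow> far i j \<Longrightarrow> g i * g j = g j * g i"
    and ge: "i \<in> {1..<n} \<Longrightarrow> g i * e i = e i * g i"
    and braid: "i \<in> {1..<n} \<Longrightarrow> j \<in> {1..<n} \<Longrightarrow> adjacent i j \<Longrightarrow> g i * g j * g i = g j * g i * g j"
    and egg: "i \<in> {1..<n} \<Longrightarrow> j \<in> {1..<n} \<Longrightarrow> adjacent i j \<Longrightarrow> e i * g j * g i = g j * g i * e j"
    and eeg: "i \<in> {1..<n} \<Longrightarrow> j \<in> {1..<n} \<Longrightarrow> adjacent i j \<Longrightarrow> e i * e j * g j = e i * g j * e i"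
    and ege: "i \<in> {1..<n} \<Longrightarrow> j \<in> {1..<n} \<Longrightarrow> adjacent i j \<Longrightarrow> e i * g j * e i = g j * e i * e j"
    and ee: "i \<in> {1..<n} \<Longrightarrow> j \<in> {1..<n} \<Longrightarrow> e i * e j = e j * e i"
    and ge_far: "i \<in> {1..<n} \<Longrightarrow> j \<in> {1..<n} \<Longrightarrow> far i j \<Longrightarrow> g i * e j = e j * g i"
    and e_idem: "i \<in> {1..<n} \<Longrightarrow> e i * e i = e i"
    and gsq: "i \<in> {1..<n} \<Longrightarrow> g i * g i = 1 + sc z * e i * g i"
begin

section \<open>Inverses of the generators and conjugation by them\<close>

definition ginv :: "nat \<Rightarrow> 'r" where
  "ginv i = g i - sc z * e i"

text \<open>Since \<open>e i\<close> commutes with \<open>g i\<close>, the quadratic relation reads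
  \<open>g i * (g i - sc z * e i) = 1\<close>.\<close>

lemma g_ginv: "i \<in> {1..<n} \<Longrightarrow> g i * ginv i = 1" "i \<in> {1..<n} \<Longrightarrow> ginv i * g i = 1"
proof -
  assume i: "i \<in> {1..<n}"
  have "g i * (sc z * e i) = sc z * e i * g i"
    using ge[OF i] sc_central[of z "g i"] by (metis mult.assoc)
  then show "g i * ginv i = 1" "ginv i * g i = 1"
    using gsq[OF i] by (simp_all add: ginv_def algebra_simps)
qed

lemma g_ginv_assoc:
  "i \<in> {1..<n} \<Longrightarrow> g i * (ginv i * x) = x" "i \<in> {1..<n} \<Longrightarrow> ginv i * (g i * x) = x"
  by (simp_all add: g_ginv mult.assoc[symmetric])

abbreviation comm :: "'r \<Rightarrow> 'r \<Rightarrow> bool" where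
  "comm x y \<equiv> x * y = y * x"

lemma comm_mult: "comm x y \<Longrightarrow> comm x w \<Longrightarrow> comm x (y * w)"
  by (metis mult.assoc)

lemma comm_mult_left: "comm x y \<Longrightarrow> comm w y \<Longrightarrow> comm (x * w) y"
  by (metis mult.assoc)

lemma comm_left: "comm x y \<Longrightarrow> x * (y * w) = y * (x * w)"
  by (metis mult.assoc)

lemma intertwine_mult: "p * (a :: 'r) = x * p \<Longrightarrow> p * b = y * p \<Longrightarrow> x * y * p = p * (a * b)"
proof -
  assume a: "p * a = x * p" and b: "p * b = y * p"
  have "x * y * p = x * p * b"
    by (simp only: mult.assoc b)
  then show ?thesis
    by (simp only: mult.assoc a[symmetric])
qed

lemma comm_ginv: "comm x (g i) \<Longrightarrow> comm x (e i) \<Longrightarrow> comm x (ginv i)"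
  using sc_central[of z x] by (simp add: ginv_def algebra_simps) (metis mult.assoc)

text \<open>By the quadratic relation the square of \<open>g i\<close> differs from 1 by a multiple
  of \<open>e i * g i\<close>. Commuting with the square is what makes conjugation by
  \<open>g i\<close> and by its inverse agree.\<close>

lemma comm_gsq: "i \<in> {1..<n} \<Longrightarrow> comm (e i * g i) x \<Longrightarrow> g i * g i * x = x * (g i * g i)"
  using sc_central[of z x] by (simp add: gsq algebra_simps) (metis mult.assoc)

text \<open>\<open>EP i d\<close> is E_ij for \<open>j = i + d + 1\<close>; counting by the gap
  \<open>d\<close> makes the recursion structural. The recursion moves the left end only, and the
  lemmas that follow establish the same behaviour at the right end.\<close>

fun EP :: "nat \<Rightarrow> nat \<Rightarrow> 'r" where
  "EP i 0 = e i"
| "EP i (Suc d) = g i * EP (Suc i) d * ginv i"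

lemma EP_far:
  assumes "1 \<le> i" "i + d < n" "k \<in> {1..<n}" "k + 1 < i \<or> i + d + 1 < k"
  shows "comm (g k) (EP i d) \<and> comm (e k) (EP i d)"
  using assms
proof (induction d arbitrary: i)
  case 0
  then show ?case
    using ge_far[of k i] ee[of k i] by (auto simp: far_def)
next
  case (Suc d)
  have "comm (g k) (EP (Suc i) d) \<and> comm (e k) (EP (Suc i) d)"
    using Suc.prems by (intro Suc.IH) auto
  moreover have "comm (g k) (g i)" "comm (g k) (e i)" "comm (e k) (g i)" "comm (e k) (e i)"
    using Suc.prems gg_far[of k i] ge_far[of k i] ge_far[of i k] ee[of k i] by (auto simp: far_def)
  ultimately show ?case
    by (auto intro!: comm_mult comm_ginv)
qed

text \<open>The two mixed relations for \<open>(b, a)\<close> together say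
  \<open>e b * e a * g a = g a * e b * e a\<close>; what remains is to commute \<open>e a\<close>
  with \<open>e b\<close> and with \<open>g a\<close>.\<close>

lemma e_g_comm_adjacent:
  assumes "a \<in> {1..<n}" "b \<in> {1..<n}" "adjacent a b"
  shows "comm (e a * g a) (e b)"
proof -
  have "adjacent b a"
    using assms(3) by (auto simp: adjacent_def)
  then have "e b * e a * g a = g a * e b * e a"
    using eeg ege assms by metis
  then show ?thesis
    using ge[OF assms(1)] ee[OF assms(1,2)] by (metis mult.assoc)
qed

text \<open>The direction of the conjugation is immaterial because the square of a generator
  commutes with the neighbouring tie. The roles of \<open>a\<close> and \<open>b\<close> are
  exchanged by the relation \<open>egg\<close>, multiplied by inverses on both sides.\<close>

lemma conj_e_adjacent:
  assumes ab: "a \<in> {1..<n}" "b \<in> {1..<n}" "adjacent a b"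
  shows "ginv a * e b * g a = g a * e b * ginv a" (is ?A)
    and "ginv b * e a * g b = g a * e b * ginv a" (is ?B)
    and "g b * e a = g a * e b * ginv a * g b" (is ?C)
proof -
  have aux: "ginv a * e b * g a = g a * e b * ginv a"
    if ab: "a \<in> {1..<n}" "b \<in> {1..<n}" "adjacent a b" for a b
  proof -
    have "ginv a * (g a * g a * e b) * ginv a = ginv a * (e b * (g a * g a)) * ginv a"
      using comm_gsq[OF ab(1) e_g_comm_adjacent[OF ab]] by simp
    then show ?thesis
      by (simp add: mult.assoc g_ginv[OF ab(1)] g_ginv_assoc[OF ab(1)])
  qed
  have aux2: "ginv b * e a * g b = g a * e b * ginv a"
    if ab: "a \<in> {1..<n}" "b \<in> {1..<n}" "adjacent a b" for a b
  proof -
    have "ginv b * (e a * g b * g a) * ginv a = ginv b * (g b * g a * e b) * ginv a"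
      using egg[OF ab] by simp
    then show ?thesis
      by (simp add: mult.assoc g_ginv[OF ab(1)] g_ginv_assoc[OF ab(2)])
  qed
  have ba: "adjacent b a"
    using ab(3) by (auto simp: adjacent_def)
  show ?A ?B by (rule aux[OF ab] aux2[OF ab])+
  have "g a * e b * ginv a = g b * e a * ginv b"
    using aux[OF ab] aux2[OF ab(2,1) ba] by simp
  then show ?C
    by (simp add: mult.assoc g_ginv[OF ab(2)])
qed

text \<open>The generator at the right end commutes with the factors \<open>g i\<close> and
  \<open>ginv i\<close> that the recursion wraps around, so the claim descends to the case of two
  neighbouring ties.\<close>

lemma EP_extend_right:
  assumes "1 \<le> i" "i + d + 1 < n"
  shows "g (i + d + 1) * EP i d = EP i (Suc d) * g (i + d + 1)"
  using assms
proof (induction d arbitrary: i)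
  case 0
  then show ?case
    using conj_e_adjacent(3)[of i "Suc i"] by (simp add: adjacent_def)
next
  case (Suc d)
  let ?k = "i + Suc d + 1"
  have IH: "g ?k * EP (Suc i) d = EP (Suc i) (Suc d) * g ?k"
    using Suc.prems Suc.IH[of "Suc i"] by simp
  have c: "comm (g ?k) (g i)" "comm (g ?k) (ginv i)"
    using Suc.prems gg_far[of ?k i] ge_far[of ?k i] by (auto simp: far_def intro!: comm_ginv)
  have "g ?k * (g i * EP (Suc i) d * ginv i) = g ?k * g i * EP (Suc i) d * ginv i"
    by (simp only: mult.assoc)
  also have "\<dots> = g i * (g ?k * EP (Suc i) d) * ginv i"
    unfolding c(1) by (simp only: mult.assoc)
  also have "\<dots> = g i * EP (Suc i) (Suc d) * ginv i * g ?k"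
    unfolding IH by (simp only: mult.assoc c(2))
  finally show ?case
    by simp
qed

text \<open>The right end is moved outwards by generators far from \<open>i\<close>, which reduces
  the claim to the neighbouring tie. It allows the square of \<open>g i\<close> to pass through
  \<open>EP (Suc i) d\<close> when the left end is moved back.\<close>

lemma e_g_comm_EP:
  assumes "1 \<le> i" "i + d + 1 < n"
  shows "comm (e i * g i) (EP (Suc i) d)"
  using assms
proof (induction d)
  case 0
  then show ?case
    using e_g_comm_adjacent[of i "Suc i"] by (simp add: adjacent_def)
next
  case (Suc d)
  let ?k = "i + Suc d + 1"
  have "EP (Suc i) (Suc d) = g ?k * EP (Suc i) d * ginv ?k"
    using EP_extend_right[of "Suc i" d] Suc.prems g_ginv[of ?k] by (simp add: mult.assoc del: EP.simps)
  moreover have "comm (e i * g i) (g ?k)" "comm (e i * g i) (ginv ?k)"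
    using Suc.prems gg_far[of i ?k] ge_far[of i ?k] ge_far[of ?k i] ee[of i ?k]
    by (auto simp: far_def intro!: comm_ginv comm_mult_left)
  ultimately show ?case
    using Suc by (auto intro!: comm_mult)
qed

lemma EP_shrink_left:
  assumes "1 \<le> i" "i + d + 1 < n"
  shows "g i * EP i (Suc d) = EP (Suc i) d * g i"
proof -
  have i: "i \<in> {1..<n}"
    using assms by auto
  have "g i * EP i (Suc d) = g i * g i * EP (Suc i) d * ginv i"
    by (simp add: mult.assoc)
  also have "\<dots> = EP (Suc i) d * g i"
    unfolding comm_gsq[OF i e_g_comm_EP[OF assms]] by (simp add: mult.assoc g_ginv[OF i])
  finally show ?thesis .
qed

lemma EP_shrink_right:
  assumes "1 \<le> i" "i + d + 1 < n"
  shows "g (i + d + 1) * EP i (Suc d) = EP i d * g (i + d + 1)"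
  using assms
proof (induction d arbitrary: i)
  case 0
  then have "Suc i \<in> {1..<n}" "i \<in> {1..<n}" by auto
  then show ?case
    using conj_e_adjacent(2)[of i "Suc i"] 0 g_ginv_assoc[of "Suc i"]
    by (simp add: adjacent_def mult.assoc) (metis mult.assoc)
next
  case (Suc d)
  let ?k = "i + Suc d + 1"
  have IH: "g ?k * EP (Suc i) (Suc d) = EP (Suc i) d * g ?k"
    using Suc.prems Suc.IH[of "Suc i"] by simp
  have c: "comm (g ?k) (g i)" "comm (g ?k) (ginv i)"
    using Suc.prems gg_far[of ?k i] ge_far[of ?k i] by (auto simp: far_def intro!: comm_ginv)
  have "g ?k * (g i * EP (Suc i) (Suc d) * ginv i) = g ?k * g i * EP (Suc i) (Suc d) * ginv i"
    by (simp only: mult.assoc)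
  also have "\<dots> = g i * (g ?k * EP (Suc i) (Suc d)) * ginv i"
    unfolding c(1) by (simp only: mult.assoc)
  also have "\<dots> = g i * EP (Suc i) d * ginv i * g ?k"
    unfolding IH by (simp only: mult.assoc c(2))
  finally show ?case
    by simp
qed

lemma EP_inner:
  assumes "1 \<le> i" "i + d < n" "i < k" "k < i + d"
  shows "comm (g k) (EP i d)"
  using assms
proof (induction d arbitrary: i)
  case (Suc d)
  show ?case
  proof (cases "k = Suc i")
    case False
    then have "comm (g k) (EP (Suc i) d)"
      using Suc by auto
    moreover have "comm (g k) (g i)" "comm (g k) (ginv i)"
      using False Suc.prems gg_far[of k i] ge_far[of k i] by (auto simp: far_def intro!: comm_ginv)
    ultimately show ?thesis
      by (auto intro!: comm_mult)
  next
    case True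
    \<comment> \<open>Two layers of the recursion are opened. The braid relation turns
      \<open>g k\<close> into \<open>g i\<close> on its way through them; \<open>g i\<close>
      commutes with the core, which begins at \<open>k + 1\<close>, and a second use of the braid
      relation, for inverses, brings \<open>g k\<close> out on the right.\<close>
    with Suc.prems obtain d' where d: "d = Suc d'"
      by (cases d) auto
    have ik: "i \<in> {1..<n}" "k \<in> {1..<n}" "adjacent i k"
      using Suc.prems True by (auto simp: adjacent_def)
    have c: "comm (g i) (EP (Suc k) d')"
      using EP_far[of "Suc k" d' i] Suc.prems True d by auto
    have b: "g i * g k * g i = g k * g i * g k"
      by (rule braid[OF ik])
    have "ginv k * ginv i * g k = ginv k * ginv i * (g k * g i * g k) * ginv k * ginv i"
      by (simp add: mult.assoc g_ginv[OF ik(1)] g_ginv_assoc[OF ik(2)])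
    also have "\<dots> = g i * ginv k * ginv i"
      unfolding b[symmetric] by (simp add: mult.assoc g_ginv_assoc[OF ik(1)] g_ginv_assoc[OF ik(2)])
    finally have b': "ginv k * ginv i * g k = g i * ginv k * ginv i" .
    have "g k * EP i (Suc d) = (g k * g i * g k) * EP (Suc k) d' * ginv k * ginv i"
      using d True by (simp add: mult.assoc)
    also have "\<dots> = g i * g k * (g i * EP (Suc k) d') * ginv k * ginv i"
      unfolding b[symmetric] by (simp add: mult.assoc)
    also have "\<dots> = g i * g k * EP (Suc k) d' * (g i * ginv k * ginv i)"
      unfolding c by (simp add: mult.assoc)
    also have "\<dots> = EP i (Suc d) * g k"
      unfolding b'[symmetric] using d True by (simp add: mult.assoc)
    finally show ?thesis .
  qed
qed simp

text \<open>Unordered indices, so that a permutation can be applied to both without recording which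
  one is smaller. For \<open>i = j\<close> the value is \<open>EP j 0\<close> and has no
  meaning.\<close>

definition ep :: "nat \<Rightarrow> nat \<Rightarrow> 'r" where
  "ep i j = (if i < j then EP i (j - i - 1) else EP j (i - j - 1))"

lemma ep_sym: "i \<noteq> j \<Longrightarrow> ep i j = ep j i"
  by (auto simp: ep_def)

text \<open>Eight positions of \<open>k\<close> relative to the pair: outside or strictly inside,
  where \<open>g k\<close> commutes; next to an end or at it, where that end moves by one step; and
  \<open>k = i = j - 1\<close>, where the swap fixes the pair.\<close>

lemma g_ep_less:
  assumes k: "k \<in> {1..<n}" and ij: "i \<in> {1..n}" "j \<in> {1..n}" "i < j"
  shows "g k * ep i j = ep (adj_swap k i) (adj_swap k j) * g k"
proof -
  obtain d where d: "j = i + d + 1"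
    using ij(3) less_iff_Suc_add by auto
  consider "k + 1 < i" | "k + 1 = i" | "k = i" "d = 0" | "k = i" "d \<noteq> 0" | "i < k" "k < i + d"
    | "i < k" "k = i + d" | "k = j" | "j < k"
    using d by linarith
  then show ?thesis
  proof cases
    case 2
    then show ?thesis
      using g_ginv[OF k] d by (auto simp: ep_def adj_swap_eq mult.assoc)
  next
    case 3
    then show ?thesis
      using ge[OF k] d by (auto simp: ep_def adj_swap_eq)
  next
    case 4
    then obtain d' where "d = Suc d'"
      by (cases d) auto
    then show ?thesis
      using EP_shrink_left[of i d'] ij d 4 by (auto simp: ep_def adj_swap_eq simp del: EP.simps)
  next
    case 6
    then obtain d' where "d = Suc d'"
      by (cases d) auto
    then show ?thesis
      using EP_shrink_right[of i d'] ij d 6 by (auto simp: ep_def adj_swap_eq simp del: EP.simps)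
  next
    case 7
    then show ?thesis
      using EP_extend_right[of i d] ij d k by (auto simp: ep_def adj_swap_eq simp del: EP.simps)
  qed (use EP_far[of i d k] EP_inner[of i d k] ij d k in \<open>auto simp: ep_def adj_swap_eq simp del: EP.simps\<close>)
qed

lemma g_ep:
  assumes k: "k \<in> {1..<n}" and ij: "i \<in> {1..n}" "j \<in> {1..n}" "i \<noteq> j"
  shows "g k * ep i j = ep (adj_swap k i) (adj_swap k j) * g k"
proof (cases "i < j")
  case False
  moreover have "adj_swap k i \<noteq> adj_swap k j"
    using ij(3) inj_adj_swap by (metis injD)
  ultimately show ?thesis
    using g_ep_less[OF k ij(2,1)] ij(3) ep_sym by (metis linorder_neqE_nat)
qed (use g_ep_less assms in auto)

text \<open>Conjugation by any word, reduced or not, permutes the indices. As words are invertible,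
  identities among the \<open>ep i j\<close> need to be checked for one choice of indices
  only.\<close>

lemma word_ep:
  assumes "set is \<subseteq> {1..<n}" "i \<in> {1..n}" "j \<in> {1..n}" "i \<noteq> j"
  shows "prod_list (map g is) * ep (perm_of_word is i) (perm_of_word is j) = ep i j * prod_list (map g is)"
  using assms
proof (induction "is" arbitrary: i j)
  case (Cons k "is")
  have k: "k \<in> {1..<n}" "set is \<subseteq> {1..<n}"
    using Cons.prems by auto
  have s: "adj_swap k i \<in> {1..n}" "adj_swap k j \<in> {1..n}" "adj_swap k i \<noteq> adj_swap k j"
    using Cons.prems permutes_in_image[OF permutes_adj_swap[OF k(1)]] by (auto simp: inj_eq)
  have "prod_list (map g is) * ep (perm_of_word is (adj_swap k i)) (perm_of_word is (adj_swap k j))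
      = ep (adj_swap k i) (adj_swap k j) * prod_list (map g is)"
    by (rule Cons.IH[OF k(2) s])
  then show ?case
    using g_ep[OF k(1) s] by (simp add: perm_of_word_Cons) (metis mult.assoc)
qed simp

section \<open>Identities among the elements \<open>ep i j\<close>, by conjugation to the indices 1
  to 4\<close>

lemma word_unit:
  assumes "set is \<subseteq> {1..<n}"
  shows "\<exists>y. prod_list (map g is) * y = 1 \<and> y * prod_list (map g is) = 1"
  using assms
proof (induction "is")
  case (Cons k "is")
  then obtain y where y: "prod_list (map g is) * y = 1" "y * prod_list (map g is) = 1"
    by auto
  have k: "k \<in> {1..<n}"
    using Cons by auto
  have "g k * prod_list (map g is) * (y * ginv k) = 1" "y * ginv k * (g k * prod_list (map g is)) = 1"
    using y g_ginv[OF k] by (metis mult.assoc mult.right_neutral)+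
  then show ?case
    by auto
qed auto

text \<open>The entries are placed one after the other: a transposition of values brings the next
  one to its number and leaves the earlier ones in place.\<close>

lemma ex_word_list:
  assumes "distinct xs" "set xs \<subseteq> {1..n}"
  shows "\<exists>is. set is \<subseteq> {1..<n} \<and> (\<forall>m<length xs. perm_of_word is (xs ! m) = m + 1)"
proof -
  have "\<exists>u. u permutes {1..n} \<and> (\<forall>m<length xs. u (xs ! m) = m + 1)"
    using assms
  proof (induction xs rule: rev_induct)
    case Nil
    then show ?case
      by (intro exI[of _ id]) (simp add: permutes_id[unfolded id_def])
  next
    case (snoc x xs)
    then obtain u where u: "u permutes {1..n}" "\<forall>m<length xs. u (xs ! m) = m + 1"
      by auto
    let ?L = "length xs + 1"
    have "card (set (xs @ [x])) \<le> card {1..n}"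
      by (rule card_mono) (use snoc.prems in auto)
    then have L: "?L \<in> {1..n}"
      using snoc.prems by (simp add: distinct_card)
    have ux: "u x \<in> {1..n}"
      using snoc.prems permutes_in_image[OF u(1)] by auto
    have "Transposition.transpose (u x) ?L \<circ> u permutes {1..n}"
      by (intro permutes_compose u permutes_swap_id ux L)
    moreover have "(Transposition.transpose (u x) ?L \<circ> u) ((xs @ [x]) ! m) = m + 1"
      if "m < length (xs @ [x])" for m
    proof (cases "m = length xs")
      case False
      then have m: "m < length xs"
        using that by auto
      then have "u (xs ! m) \<noteq> u x"
        using snoc.prems permutes_inj[OF u(1)] by (auto simp: inj_eq)
      then show ?thesis
        using m u(2) by (auto simp: nth_append Transposition.transpose_def)
    qed auto
    ultimately show ?case
      by blast
  qed
  then obtain u where u: "u permutes {1..n}" "\<forall>m<length xs. u (xs ! m) = m + 1"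
    by blast
  then show ?thesis
    using ex_word_inv_count[OF u(1)] by (auto simp: perm_words_def)
qed

lemma ep_eq_e: "ep i (Suc i) = e i"
  by (simp add: ep_def)

lemma word_cancel:
  assumes "set is \<subseteq> {1..<n}" "x * prod_list (map g is) = y * prod_list (map g is)"
  shows "x = y"
  using word_unit[OF assms(1)] assms(2) by (metis mult.assoc mult.right_neutral)

lemma ep_idem:
  assumes "i \<in> {1..n}" "j \<in> {1..n}" "i \<noteq> j"
  shows "ep i j * ep i j = ep i j"
proof -
  obtain "is" where "is": "set is \<subseteq> {1..<n}" "\<forall>m<2. perm_of_word is ([i, j] ! m) = m + 1"
    using ex_word_list[of "[i, j]"] assms by (auto simp: numeral_2_eq_2)
  have p: "perm_of_word is i = 1" "perm_of_word is j = 2"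
    using "is"(2)[rule_format, of 0] "is"(2)[rule_format, of 1] by auto
  have n: "1 \<in> {1..<n}"
    using assms by auto
  note w = word_ep[OF "is"(1) assms, unfolded p]
  have "ep i j * ep i j * prod_list (map g is) = prod_list (map g is) * (ep 1 2 * ep 1 2)"
    by (rule intertwine_mult[OF w w])
  also have "ep 1 2 * ep 1 2 = ep 1 2"
    using e_idem[OF n] ep_eq_e[of 1] by (simp add: numeral_2_eq_2)
  also note w
  finally show ?thesis
    by (rule word_cancel[OF "is"(1)])
qed

text \<open>Ties are transitive: tying \<open>i, j\<close> and \<open>j, k\<close> is the same as
  tying \<open>i, j\<close> and \<open>i, k\<close>. For the indices 1, 2, 3 this follows from the
  relations between \<open>g 1\<close>, \<open>e 1\<close> and \<open>e 2\<close>.\<close>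

lemma ep_three:
  assumes "i \<in> {1..n}" "j \<in> {1..n}" "k \<in> {1..n}" "i \<noteq> j" "j \<noteq> k" "i \<noteq> k"
  shows "ep i j * ep j k = ep j k * ep i j \<and> ep i j * ep j k = ep i j * ep i k"
proof -
  obtain "is" where "is": "set is \<subseteq> {1..<n}" "\<forall>m<3. perm_of_word is ([i, j, k] ! m) = m + 1"
    using ex_word_list[of "[i, j, k]"] assms by (auto simp: numeral_3_eq_3)
  have p: "perm_of_word is i = 1" "perm_of_word is j = 2" "perm_of_word is k = 3"
    using "is"(2)[rule_format, of 0] "is"(2)[rule_format, of 1] "is"(2)[rule_format, of 2] by auto
  have "card {i, j, k} \<le> card {1..n}"
    by (rule card_mono) (use assms in auto)
  then have "3 \<le> n"
    using assms by simp
  then have n: "1 \<in> {1..<n}" "2 \<in> {1..<n}" "adjacent 1 2" "adjacent 2 1"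
    by (auto simp: adjacent_def)
  note w = word_ep[OF "is"(1), unfolded p]
  note w12 = w[OF assms(1,2,4), unfolded p] and w23 = w[OF assms(2,3,5), unfolded p]
    and w13 = w[OF assms(1,3,6), unfolded p]
  let ?P = "prod_list (map g is)"
  have e12: "ep 1 2 = e 1" and e23: "ep 2 3 = e 2"
    using ep_eq_e[of 1] ep_eq_e[of 2] by (simp_all add: numeral_2_eq_2 numeral_3_eq_3)
  have e13: "ep 1 3 = g 1 * e 2 * ginv 1"
    by (simp add: ep_def numeral_2_eq_2)
  have "e 1 * (g 1 * e 2 * ginv 1) = e 1 * g 1 * e 2 * ginv 1"
    by (simp only: mult.assoc)
  also have "\<dots> = g 1 * (e 1 * e 2) * ginv 1"
    unfolding ge[OF n(1), symmetric] by (simp only: mult.assoc)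
  also have "\<dots> = g 1 * e 2 * e 1 * ginv 1"
    unfolding ee[OF n(1,2)] by (simp only: mult.assoc)
  also have "g 1 * e 2 * e 1 = e 2 * e 1 * g 1"
    using eeg[OF n(2,1,4)] ege[OF n(2,1,4)] by simp
  also have "e 2 * e 1 * g 1 * ginv 1 = e 1 * e 2"
    using g_ginv[OF n(1)] ee[OF n(1,2)] by (simp add: mult.assoc)
  finally have t: "ep 1 2 * ep 2 3 = ep 1 2 * ep 1 3"
    unfolding e12 e23 e13 by simp
  have c: "ep 1 2 * ep 2 3 = ep 2 3 * ep 1 2"
    unfolding e12 e23 by (rule ee[OF n(1,2)])
  have "ep i j * ep j k * ?P = ?P * (ep 1 2 * ep 2 3)" "ep j k * ep i j * ?P = ?P * (ep 2 3 * ep 1 2)"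
    "ep i j * ep i k * ?P = ?P * (ep 1 2 * ep 1 3)"
    by (rule intertwine_mult[OF w12 w23] intertwine_mult[OF w23 w12] intertwine_mult[OF w12 w13])+
  then show ?thesis
    using word_cancel[OF "is"(1)] c t by metis
qed

lemma ep_four:
  assumes "i \<in> {1..n}" "j \<in> {1..n}" "k \<in> {1..n}" "l \<in> {1..n}" "distinct [i, j, k, l]"
  shows "ep i j * ep k l = ep k l * ep i j"
proof -
  obtain "is" where "is": "set is \<subseteq> {1..<n}" "\<forall>m<4. perm_of_word is ([i, j, k, l] ! m) = m + 1"
    using ex_word_list[of "[i, j, k, l]"] assms by (auto simp: numeral_eq_Suc)
  have p: "perm_of_word is i = 1" "perm_of_word is j = 2" "perm_of_word is k = 3" "perm_of_word is l = 4"
    using "is"(2)[rule_format, of 0] "is"(2)[rule_format, of 1] "is"(2)[rule_format, of 2]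
      "is"(2)[rule_format, of 3] by (auto simp: numeral_eq_Suc)
  have "card {i, j, k, l} \<le> card {1..n}"
    by (rule card_mono) (use assms in auto)
  then have "4 \<le> n"
    using assms by simp
  then have n: "1 \<in> {1..<n}" "3 \<in> {1..<n}"
    by auto
  have w: "prod_list (map g is) * ep 1 2 = ep i j * prod_list (map g is)"
    "prod_list (map g is) * ep 3 4 = ep k l * prod_list (map g is)"
    using word_ep[OF "is"(1), of i j] word_ep[OF "is"(1), of k l] assms p by auto
  have c: "ep 1 2 * ep 3 4 = ep 3 4 * ep 1 2"
    using ee[OF n] ep_eq_e[of 1] ep_eq_e[of 3] by (simp add: numeral_eq_Suc)
  have "ep i j * ep k l * prod_list (map g is) = prod_list (map g is) * (ep 1 2 * ep 3 4)"
    "ep k l * ep i j * prod_list (map g is) = prod_list (map g is) * (ep 3 4 * ep 1 2)"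
    by (rule intertwine_mult[OF w] intertwine_mult[OF w(2,1)])+
  then show ?thesis
    using word_cancel[OF "is"(1)] c by metis
qed

lemma ep_comm:
  assumes "i \<in> {1..n}" "j \<in> {1..n}" "k \<in> {1..n}" "l \<in> {1..n}" "i \<noteq> j" "k \<noteq> l"
  shows "ep i j * ep k l = ep k l * ep i j"
proof -
  consider "distinct [i, j, k, l]" | "{i, j} = {k, l}" | "i = k" "j \<noteq> l" | "i = l" "j \<noteq> k"
    | "j = k" "i \<noteq> l" | "j = l" "i \<noteq> k"
    using assms(5,6) by auto
  then show ?thesis
  proof cases
    case 2
    then show ?thesis
      using ep_sym assms by (metis doubleton_eq_iff)
  next
    case 3
    then show ?thesis
      using ep_three[of j i l] assms ep_sym[of i j] by auto
  next
    case 4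
    then show ?thesis
      using ep_three[of j i k] assms ep_sym[of i j] ep_sym[of k l] by auto
  next
    case 5
    then show ?thesis
      using ep_three[of i j l] assms by auto
  next
    case 6
    then show ?thesis
      using ep_three[of i j k] assms ep_sym[of k l] by auto
  qed (use ep_four assms in blast)
qed

section \<open>The elements E_A and their Moebius inversion\<close>

definition EB :: "nat set set \<Rightarrow> 'r" where
  "EB A = prod_list [ep i j. i \<leftarrow> [1..<n + 1], j \<leftarrow> [i + 1..<n + 1], \<exists>X\<in>A. i \<in> X \<and> j \<in> X]"

lemma EB_list_elem:
  "x \<in> set [ep i j. i \<leftarrow> [1..<n + 1], j \<leftarrow> [i + 1..<n + 1], \<exists>X\<in>A. i \<in> X \<and> j \<in> X] \<longleftrightarrow>
    (\<exists>i j. i \<in> {1..n} \<and> j \<in> {1..n} \<and> i < j \<and> same_block A i j \<and> x = ep i j)"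
  (is "?L \<longleftrightarrow> ?R")
proof
  assume ?L
  then obtain i j where "i \<in> {1..<n + 1}" "j \<in> {i + 1..<n + 1}" "same_block A i j" "x = ep i j"
    unfolding set_comprehension_elem set_upt same_block_def by blast
  then show ?R
    by (intro exI[of _ i] exI[of _ j]) auto
next
  assume ?R
  then obtain i j where "i \<in> {1..n}" "j \<in> {1..n}" "i < j" "same_block A i j" "x = ep i j"
    by blast
  then show ?L
    unfolding set_comprehension_elem set_upt same_block_def
    by (intro bexI[of _ i] bexI[of _ j]) auto
qed

lemma absorb_prod_list: "(\<And>x. x \<in> set xs \<Longrightarrow> y * x = y) \<Longrightarrow> y * prod_list xs = y"
  by (induction xs) (auto simp: mult.assoc[symmetric])

lemma prod_list_absorb:
  assumes "x \<in> set xs" "\<And>x y. x \<in> set xs \<Longrightarrow> y \<in> set xs \<Longrightarrow> comm x y" "x * x = x"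
  shows "prod_list xs * x = prod_list xs"
  using assms
proof (induction xs)
  case (Cons y ys)
  show ?case
  proof (cases "x \<in> set ys")
    case True
    then show ?thesis
      using Cons by (auto simp: mult.assoc)
  next
    case False
    then have "x = y"
      using Cons.prems by auto
    moreover have "comm y (prod_list ws)" if "set ws \<subseteq> set ys" for ws
      using that Cons.prems(2)[of y] by (induction ws) (auto intro!: comm_mult)
    ultimately show ?thesis
      using Cons.prems(3) by (simp add: mult.assoc)
  qed
qed simp

lemma EB_absorb:
  assumes "i \<in> {1..n}" "j \<in> {1..n}" "i \<noteq> j" "same_block A i j"
  shows "EB A * ep i j = EB A"
proof -
  have *: "EB A * ep i j = EB A" if "i \<in> {1..n}" "j \<in> {1..n}" "i < j" "same_block A i j" for i j
    unfolding EB_def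
  proof (rule prod_list_absorb)
    show "ep i j * ep i j = ep i j"
      using that by (intro ep_idem) auto
  qed (use that ep_comm in \<open>auto simp only: EB_list_elem\<close>)
  show ?thesis
    using *[of i j] *[of j i] assms ep_sym[of i j] same_block_sym by (metis linorder_neqE_nat)
qed

lemma absorb_EB:
  assumes "\<And>i j. i \<in> {1..n} \<Longrightarrow> j \<in> {1..n} \<Longrightarrow> i \<noteq> j \<Longrightarrow> same_block A i j \<Longrightarrow> y * ep i j = y"
  shows "y * EB A = y"
  unfolding EB_def by (rule absorb_prod_list) (use assms in \<open>auto simp only: EB_list_elem\<close>)

lemma comm_EB:
  assumes "\<And>i j. i \<in> {1..n} \<Longrightarrow> j \<in> {1..n} \<Longrightarrow> i \<noteq> j \<Longrightarrow> comm y (ep i j)"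
  shows "comm y (EB A)"
proof -
  have "comm y (prod_list xs)" if "\<And>x. x \<in> set xs \<Longrightarrow> comm y x" for xs
    using that by (induction xs) (auto intro!: comm_mult)
  then show ?thesis
    unfolding EB_def by this (use assms in \<open>auto simp only: EB_list_elem\<close>)
qed

text \<open>Each side absorbs the other. The pairs absorbed by \<open>EB A * ep i j\<close> form an
  equivalence relation, by transitivity of ties, and so include all pairs tied by the merge;
  conversely \<open>EB (merge A i j)\<close> absorbs both factors on the left. The two elements
  commute, hence they are equal.\<close>

lemma EB_merge:
  assumes A: "partition_on {1..n} A" and ij: "i \<in> {1..n}" "j \<in> {1..n}" "i \<noteq> j"
  shows "EB A * ep i j = EB (merge A i j)"
proof -
  let ?y = "EB A * ep i j"
  have ep_EB: "comm (ep k l) (EB B)" if "k \<in> {1..n}" "l \<in> {1..n}" "k \<noteq> l" for k l B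
    using that ep_comm by (intro comm_EB) auto
  have y: "?y * ep k l = ?y" if "k \<in> {1..n}" "l \<in> {1..n}" "k \<noteq> l" "same_block A k l" for k l
  proof -
    have "?y * ep k l = EB A * ep k l * ep i j"
      using ep_comm[OF ij(1,2) that(1,2) ij(3) that(3)] by (simp only: mult.assoc)
    then show ?thesis
      using EB_absorb[OF that] by simp
  qed
  have yij: "?y * ep i j = ?y"
    using ep_idem[OF ij] by (simp add: mult.assoc)
  have tr: "?y * ep k m = ?y" if "?y * ep k l = ?y" "?y * ep l m = ?y" "k \<in> {1..n}" "l \<in> {1..n}" "m \<in> {1..n}"
    "k \<noteq> l" "l \<noteq> m" "k \<noteq> m" for k l m
  proof -
    have eq: "ep k l * ep l m = ep k l * ep k m"
      using ep_three that by blast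
    have "?y * ep k m = ?y * (ep k l * ep k m)"
      using that(1) by (simp only: mult.assoc[symmetric])
    also have "\<dots> = ?y"
      unfolding eq[symmetric] using that(1,2) by (simp only: mult.assoc[symmetric])
    finally show ?thesis .
  qed
  \<comment> \<open>The case \<open>k = l\<close> is included by hand to make the relation
    reflexive, since \<open>ep k k\<close> has no meaning.\<close>
  define T where "T k l \<longleftrightarrow> k = l \<or> ?y * ep k l = ?y" for k l
  have T_sym: "T k l \<Longrightarrow> T l k" for k l
    unfolding T_def using ep_sym by metis
  have T_trans: "T k m" if "T k l" "T l m" "k \<in> {1..n}" "l \<in> {1..n}" "m \<in> {1..n}" for k l m
    using that tr unfolding T_def by metis
  have T_A: "T k l" if "same_block A k l" "k \<in> {1..n}" "l \<in> {1..n}" for k l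
    using y that unfolding T_def by blast
  have Tij: "T i j"
    using yij by (simp add: T_def)
  have "?y * ep k l = ?y" if kl: "k \<in> {1..n}" "l \<in> {1..n}" "k \<noteq> l" "same_block (merge A i j) k l" for k l
  proof -
    have "T k l"
      using kl(4) unfolding same_block_merge[OF A ij(1,2)]
    proof
      assume kl': "(same_block A i k \<or> same_block A j k) \<and> (same_block A i l \<or> same_block A j l)"
      have Ti: "T i m" if "same_block A i m \<or> same_block A j m" "m \<in> {1..n}" for m
        using that T_A T_trans[OF Tij] ij by metis
      show ?thesis
        using T_trans[OF T_sym[OF Ti] Ti] kl' kl(1,2) ij by blast
    qed (rule T_A[OF _ kl(1,2)])
    then show ?thesis
      using kl by (simp add: T_def)
  qed
  then have 1: "?y * EB (merge A i j) = ?y"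
    by (rule absorb_EB)
  have "EB (merge A i j) * ep k l = EB (merge A i j)" if "k \<in> {1..n}" "l \<in> {1..n}" "k \<noteq> l" "same_block A k l" for k l
    using that same_block_merge[OF A ij(1,2)] by (intro EB_absorb) auto
  then have "EB (merge A i j) * EB A = EB (merge A i j)"
    by (rule absorb_EB)
  moreover have "EB (merge A i j) * ep i j = EB (merge A i j)"
    using same_block_merge[OF A ij(1,2)] same_block_refl[OF A] ij by (intro EB_absorb) auto
  ultimately have 2: "EB (merge A i j) * ?y = EB (merge A i j)"
    by (simp add: mult.assoc[symmetric])
  have "comm (ep i j) (EB B)" for B
    by (rule ep_EB[OF ij])
  moreover have "comm (EB A) (EB B)" for B
    using ep_EB by (intro comm_EB) (rule sym)
  ultimately have "comm ?y (EB (merge A i j))"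
    by (intro comm_mult_left)
  then show ?thesis
    using 1 2 by simp
qed

definition EE :: "nat set set \<Rightarrow> 'r" where
  "EE A = (\<Sum>B | refines {1..n} A B. sc (of_int (mobius n A B)) * EB B)"

lemma sc_0 [simp]: "sc 0 = 0"
  using sc_add[of 0 0] by simp

lemma sc_sum: "sc (sum f S) = (\<Sum>x\<in>S. sc (f x))"
  by (induction S rule: infinite_finite_induct) (auto simp: sc_add)

text \<open>If \<open>i\<close> and \<open>j\<close> are tied by \<open>A\<close>, every summand
  absorbs the factor. Otherwise the factor turns E_B into the element of the merged partition;
  collected by that partition, the coefficients are the sums that vanish by Weisner's
  theorem.\<close>

lemma EE_ep:
  assumes A: "partition_on {1..n} A" and ij: "i \<in> {1..n}" "j \<in> {1..n}" "i \<noteq> j"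
  shows "EE A * ep i j = (if same_block A i j then EE A else 0)"
proof (cases "same_block A i j")
  case True
  have "EB B * ep i j = EB B" if B: "refines {1..n} A B" for B
    using B A True ij refines_iff_same_block[of "{1..n}" A B] by (intro EB_absorb) (auto simp: refines_def)
  then show ?thesis
    using True by (simp add: EE_def sum_distrib_right mult.assoc)
next
  case False
  let ?R = "{B. refines {1..n} A B}"
  let ?M = "(\<lambda>B. merge B i j) ` ?R"
  have "EE A * ep i j = (\<Sum>B\<in>?R. sc (of_int (mobius n A B)) * EB (merge B i j))"
    unfolding EE_def sum_distrib_right
    by (intro sum.cong refl) (auto simp: mult.assoc refines_def EB_merge[OF _ ij])
  also have "\<dots> = (\<Sum>D\<in>?M. \<Sum>B\<in>{B \<in> ?R. merge B i j = D}. sc (of_int (mobius n A B)) * EB (merge B i j))"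
    by (rule sum.group[symmetric, OF finite_refines finite_imageI[OF finite_refines] order_refl])
  also have "\<dots> = (\<Sum>D\<in>?M. sc (of_int (\<Sum>B | refines {1..n} A B \<and> merge B i j = D. mobius n A B)) * EB D)"
    by (intro sum.cong refl) (auto simp: sc_sum of_int_sum sum_distrib_right intro!: sum.cong)
  also have "\<dots> = 0"
    using weisner[OF A ij(1,2) False] by simp
  finally show ?thesis
    using False by simp
qed

end

section \<open>The action on coloured words\<close>

text \<open>A word \<open>x\<close> has the letter \<open>x i\<close> at position \<open>i\<close>; a permutation \<open>w\<close> is represented by
  the word \<open>inv w\<close>, so that right multiplication acts on positions. The generator \<open>g i\<close> acts as in the
  regular representation of the Hecke algebra on adjacent letters of the same colour, and it simply
  exchanges letters of different colours; \<open>e i\<close> projects to the words whose letters at \<open>i\<close>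
  and \<open>i + 1\<close> have the same colour.\<close>

fun act_letter :: "(nat \<Rightarrow> nat) \<Rightarrow> 'a::comm_ring_1 \<Rightarrow> generator \<Rightarrow> ((nat \<Rightarrow> nat) \<Rightarrow> 'a) \<Rightarrow> (nat \<Rightarrow> nat) \<Rightarrow> 'a" where
  "act_letter col z (Gen_g i) v x = v (x \<circ> adj_swap i) +
     (if col (x i) = col (x (Suc i)) \<and> x (Suc i) < x i then z * v x else 0)"
| "act_letter col z (Gen_e i) v x = (if col (x i) = col (x (Suc i)) then v x else 0)"

definition act_word :: "(nat \<Rightarrow> nat) \<Rightarrow> 'a::comm_ring_1 \<Rightarrow> generator list \<Rightarrow> ((nat \<Rightarrow> nat) \<Rightarrow> 'a) \<Rightarrow> (nat \<Rightarrow> nat) \<Rightarrow> 'a" where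
  "act_word col z u v = fold (act_letter col z) u v"

text \<open>Words with repeated letters are masked out: the braid relations are only needed, and only hold,
  on injective words.\<close>

definition act_free :: "(nat \<Rightarrow> nat) \<Rightarrow> 'a::comm_ring_1 \<Rightarrow> 'a free_elem \<Rightarrow> ((nat \<Rightarrow> nat) \<Rightarrow> 'a) \<Rightarrow> (nat \<Rightarrow> nat) \<Rightarrow> 'a" where
  "act_free col z p v x = (if inj x then \<Sum>u\<in>Poly_Mapping.keys p. Poly_Mapping.lookup p u * act_word col z (letters u) v x else 0)"

lemma act_word_Nil [simp]: "act_word col z [] v = v"
  and act_word_Cons: "act_word col z (l # u) v = act_word col z u (act_letter col z l v)"
  and act_word_append: "act_word col z (u @ u') v = act_word col z u' (act_word col z u v)"
  by (simp_all add: act_word_def)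

lemma act_letter_sum:
  "act_letter col z l (\<lambda>x. \<Sum>k\<in>K. c k * v k x) = (\<lambda>x. \<Sum>k\<in>K. c k * act_letter col z l (v k) x)"
  by (cases l) (auto simp: fun_eq_iff sum.distrib[symmetric] distrib_left sum_distrib_left algebra_simps)

lemma act_word_sum:
  "act_word col z u (\<lambda>x. \<Sum>k\<in>K. c k * v k x) = (\<lambda>x. \<Sum>k\<in>K. c k * act_word col z u (v k) x)"
  by (induction u arbitrary: v) (simp_all add: act_word_Cons act_letter_sum)

text \<open>A letter reads its argument only at \<open>x\<close> and at \<open>x\<close> with two
  positions exchanged, and the latter is injective if the former is. Values at words with repeated
  letters therefore never reach the others.\<close>

lemma act_letter_cong:
  "(\<And>x. inj x \<Longrightarrow> v x = v' x) \<Longrightarrow> inj x \<Longrightarrow> act_letter col z l v x = act_letter col z l v' x"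
  by (cases l) (auto simp: inj_compose)

lemma act_word_cong:
  "(\<And>x. inj x \<Longrightarrow> v x = v' x) \<Longrightarrow> inj x \<Longrightarrow> act_word col z u v x = act_word col z u v' x"
proof (induction u arbitrary: v v' x)
  case (Cons l u)
  show ?case
    unfolding act_word_Cons by (rule Cons.IH[OF act_letter_cong[OF Cons.prems(1)] Cons.prems(2)])
qed simp

section \<open>Extension of the action to the free algebra\<close>

lemma act_free_superset:
  assumes "finite K" "Poly_Mapping.keys p \<subseteq> K" "inj x"
  shows "act_free col z p v x = (\<Sum>u\<in>K. Poly_Mapping.lookup p u * act_word col z (letters u) v x)"
  using assms by (auto simp: act_free_def in_keys_iff intro!: sum.mono_neutral_left)

lemma act_free_single: "inj x \<Longrightarrow> act_free col z (Poly_Mapping.single u a) v x = a * act_word col z (letters u) v x"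
  by (subst act_free_superset[of "{u}"]) auto

lemma act_free_add: "act_free col z (p + p') v x = act_free col z p v x + act_free col z p' v x"
proof (cases "inj x")
  case True
  have "Poly_Mapping.keys (p + p') \<subseteq> Poly_Mapping.keys p \<union> Poly_Mapping.keys p'"
    by (rule Poly_Mapping.keys_add)
  then show ?thesis
    using True
    by (simp add: act_free_superset[of "Poly_Mapping.keys p \<union> Poly_Mapping.keys p'"]
        lookup_add distrib_right sum.distrib)
qed (simp add: act_free_def)

lemma act_free_zero [simp]: "act_free col z 0 v x = 0"
  by (simp add: act_free_def)

lemma act_free_diff: "act_free col z (p - p') v x = act_free col z p v x - act_free col z p' v x"
  using act_free_add[of col z "p - p'" p' v x] by simp

lemma act_free_sum_left: "act_free col z (sum f K) v x = (\<Sum>k\<in>K. act_free col z (f k) v x)"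
  by (induction K rule: infinite_finite_induct) (auto simp: act_free_add)

lemma act_free_sum:
  "act_free col z p (\<lambda>x. \<Sum>k\<in>K. c k * v k x) = (\<lambda>x. \<Sum>k\<in>K. c k * act_free col z p (v k) x)"
proof
  fix x
  show "act_free col z p (\<lambda>x. \<Sum>k\<in>K. c k * v k x) x = (\<Sum>k\<in>K. c k * act_free col z p (v k) x)"
    unfolding act_free_def act_word_sum
    by (simp add: sum_distrib_left mult.left_commute sum.swap[of _ K])
qed

lemma act_free_cong:
  "(\<And>x. inj x \<Longrightarrow> v x = v' x) \<Longrightarrow> act_free col z p v = act_free col z p v'"
  unfolding act_free_def fun_eq_iff using act_word_cong[of v v'] by auto

lemma sum_singles_lookup:
  "(\<Sum>u\<in>Poly_Mapping.keys p. Poly_Mapping.single u (Poly_Mapping.lookup p u)) = p"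
proof (rule poly_mapping_eqI)
  fix k
  show "Poly_Mapping.lookup (\<Sum>u\<in>Poly_Mapping.keys p. Poly_Mapping.single u (Poly_Mapping.lookup p u)) k = Poly_Mapping.lookup p k"
    by (cases "k \<in> Poly_Mapping.keys p")
      (auto simp: lookup_sum lookup_single when_def in_keys_iff sum.delta)
qed

text \<open>The action is from the right, so the left factor acts first. Both factors are expanded
  into monomials, for which the claim is concatenation of words; the mask of the inner action is
  invisible because only injective words are read.\<close>

lemma act_free_mult: "act_free col z (p * p') v = act_free col z p' (act_free col z p v)"
proof
  fix x
  show "act_free col z (p * p') v x = act_free col z p' (act_free col z p v) x"
  proof (cases "inj x")
    case True
    have single: "act_free col z (Poly_Mapping.single u a * Poly_Mapping.single u' a') v x
        = a' * (a * act_word col z (letters u') (act_word col z (letters u) v) x)" for u u' a a'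
      using True by (simp add: mult_single act_free_single plus_word_def act_word_append mult.commute mult.left_commute)
    have "p * p' = (\<Sum>u\<in>Poly_Mapping.keys p. Poly_Mapping.single u (Poly_Mapping.lookup p u)) *
        (\<Sum>u'\<in>Poly_Mapping.keys p'. Poly_Mapping.single u' (Poly_Mapping.lookup p' u'))"
      by (simp only: sum_singles_lookup)
    also have "\<dots> = (\<Sum>u'\<in>Poly_Mapping.keys p'. \<Sum>u\<in>Poly_Mapping.keys p.
        Poly_Mapping.single u (Poly_Mapping.lookup p u) * Poly_Mapping.single u' (Poly_Mapping.lookup p' u'))"
      by (simp add: sum_distrib_left sum_distrib_right)
    finally have "act_free col z (p * p') v x = (\<Sum>u'\<in>Poly_Mapping.keys p'. \<Sum>u\<in>Poly_Mapping.keys p.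
        Poly_Mapping.lookup p' u' * (Poly_Mapping.lookup p u * act_word col z (letters u') (act_word col z (letters u) v) x))"
      by (simp only: act_free_sum_left single)
    also have "\<dots> = (\<Sum>u'\<in>Poly_Mapping.keys p'. Poly_Mapping.lookup p' u' * act_word col z (letters u')
        (\<lambda>x. \<Sum>u\<in>Poly_Mapping.keys p. Poly_Mapping.lookup p u * act_word col z (letters u) v x) x)"
      by (simp add: act_word_sum sum_distrib_left)
    also have "\<dots> = (\<Sum>u'\<in>Poly_Mapping.keys p'. Poly_Mapping.lookup p' u' * act_word col z (letters u')
        (act_free col z p v) x)"
    proof (intro sum.cong refl)
      fix u'
      have "act_word col z (letters u') (\<lambda>x. \<Sum>u\<in>Poly_Mapping.keys p. Poly_Mapping.lookup p u * act_word col z (letters u) v x) x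
          = act_word col z (letters u') (act_free col z p v) x"
        by (rule act_word_cong[OF _ True]) (simp add: act_free_def)
      then show "Poly_Mapping.lookup p' u' * act_word col z (letters u') (\<lambda>x. \<Sum>u\<in>Poly_Mapping.keys p. Poly_Mapping.lookup p u * act_word col z (letters u) v x) x
          = Poly_Mapping.lookup p' u' * act_word col z (letters u') (act_free col z p v) x"
        by simp
    qed
    also have "\<dots> = act_free col z p' (act_free col z p v) x"
      using True by (simp add: act_free_def[of _ _ p'])
    finally show ?thesis .
  qed (simp add: act_free_def)
qed

lemma act_free_one: "act_free col z 1 v x = (if inj x then v x else 0)"
  using act_free_single[of x col z 0 1 v] by (auto simp: act_free_def zero_word_def lookup_one)

lemma act_free_g: "inj x \<Longrightarrow> act_free col z (free_g i) v x = act_letter col z (Gen_g i) v x"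
  and act_free_e: "inj x \<Longrightarrow> act_free col z (free_e i) v x = act_letter col z (Gen_e i) v x"
  and act_free_scalar: "inj x \<Longrightarrow> act_free col z (free_scalar a) v x = a * v x"
  by (simp_all add: free_g_def free_e_def free_scalar_def act_free_single act_word_Cons zero_word_def)

lemma inj_comp_adj_swap: "inj x \<Longrightarrow> inj (x \<circ> adj_swap i)"
  by (simp add: inj_compose)

lemma swap_far: "far i j \<Longrightarrow> x \<circ> adj_swap i \<circ> adj_swap j = x \<circ> adj_swap j \<circ> adj_swap i"
  by (auto simp: fun_eq_iff adj_swap_eq far_def)

lemma swap_braid: "x \<circ> adj_swap i \<circ> adj_swap (Suc i) \<circ> adj_swap i
    = x \<circ> adj_swap (Suc i) \<circ> adj_swap i \<circ> adj_swap (Suc i)"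
  by (auto simp: fun_eq_iff adj_swap_eq)

lemma swap_twice: "x \<circ> adj_swap i \<circ> adj_swap i = x"
  by (simp add: comp_assoc)

text \<open>At an injective word, both sides of a relation move only the letters at the few
  positions it names. Each relation is thus a finite check over the colours of these letters and
  their order, where distinctness leaves strict comparisons only.\<close>

lemma act_free_relation:
  assumes "r \<in> bt_relations n q"
  shows "act_free col (q - unit_inv q) r v x = 0"
proof (cases "inj x")
  case inj: True
  let ?z = "q - unit_inv q"
  let ?A = "\<lambda>p. act_free col ?z p v x"
  let ?l = "act_letter col ?z"
  note injs = inj inj_comp_adj_swap inj_compose
  have neq: "x i \<noteq> x j" if "i \<noteq> j" for i j
    using inj that by (auto simp: inj_eq)
  have one: "act_free col ?z (free_g i) v = (\<lambda>x. if inj x then ?l (Gen_g i) v x else 0)"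
    "act_free col ?z (free_e i) v = (\<lambda>x. if inj x then ?l (Gen_e i) v x else 0)"
    "act_free col ?z (free_scalar a) v = (\<lambda>x. if inj x then a * v x else 0)" for i a v
    by (auto simp: fun_eq_iff act_free_g act_free_e act_free_scalar simp del: act_letter.simps) (auto simp: act_free_def)
  note exp = act_free_mult act_free_diff act_free_add act_free_one one inj inj_comp_adj_swap
  consider
    (gg) i j where "r = free_g i * free_g j - free_g j * free_g i" "far i j"
  | (ge) i where "r = free_g i * free_e i - free_e i * free_g i"
  | (b) i j where "r = free_g i * free_g j * free_g i - free_g j * free_g i * free_g j" "adjacent i j"
  | (egg) i j where "r = free_e i * free_g j * free_g i - free_g j * free_g i * free_e j" "adjacent i j"
  | (eeg) i j where "r = free_e i * free_e j * free_g j - free_e i * free_g j * free_e i" "adjacent i j"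
  | (ege) i j where "r = free_e i * free_g j * free_e i - free_g j * free_e i * free_e j" "adjacent i j"
  | (ee) i j where "r = free_e i * free_e j - free_e j * free_e i"
  | (gef) i j where "r = free_g i * free_e j - free_e j * free_g i" "far i j"
  | (eei) i where "r = free_e i * free_e i - free_e i"
  | (gsq) i where "r = free_g i * free_g i - (1 + free_scalar ?z * free_e i * free_g i)"
    using assms unfolding bt_relations_def Let_def by blast
  then show ?thesis
  proof cases
    case gg
    have s: "adj_swap i j = j" "adj_swap i (Suc j) = Suc j" "adj_swap j i = i" "adj_swap j (Suc i) = Suc i"
      using gg(2) by (auto simp: far_def adj_swap_eq)
    show ?thesis
      unfolding gg(1) by (simp add: exp s swap_far[OF gg(2), of x] del: adj_swap_simps) (simp add: algebra_simps)
  next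
    case ge
    then show ?thesis
      by (auto simp: exp)
  next
    case b
    from b(2) consider "j = Suc i" | "i = Suc j"
      by (auto simp: adjacent_def)
    then show ?thesis
    proof cases
      case 1
      then show ?thesis
        unfolding b(1) using neq[of i "Suc i"] neq[of i "Suc (Suc i)"] neq[of "Suc i" "Suc (Suc i)"]
        by (cases "x i < x (Suc i)"; cases "x (Suc i) < x (Suc (Suc i))"; cases "x i < x (Suc (Suc i))";
            simp add: exp swap_braid swap_twice; simp add: algebra_simps)
    next
      case 2
      then show ?thesis
        unfolding b(1) using neq[of j "Suc j"] neq[of j "Suc (Suc j)"] neq[of "Suc j" "Suc (Suc j)"]
        by (cases "x j < x (Suc j)"; cases "x (Suc j) < x (Suc (Suc j))"; cases "x j < x (Suc (Suc j))";
            simp add: exp swap_braid swap_twice; simp add: algebra_simps)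
    qed
  next
    case egg
    from egg(2) consider "j = Suc i" | "i = Suc j"
      by (auto simp: adjacent_def)
    then show ?thesis
    proof cases
      case 1
      show ?thesis
        unfolding egg(1) 1
        by (cases "col (x i) = col (x (Suc i))"; cases "col (x (Suc i)) = col (x (Suc (Suc i)))";
            cases "col (x i) = col (x (Suc (Suc i)))"; simp add: exp; simp add: algebra_simps)
    next
      case 2
      show ?thesis
        unfolding egg(1) 2
        by (cases "col (x j) = col (x (Suc j))"; cases "col (x (Suc j)) = col (x (Suc (Suc j)))";
            cases "col (x j) = col (x (Suc (Suc j)))"; simp add: exp; simp add: algebra_simps)
    qed
  next
    case eeg
    from eeg(2) consider "j = Suc i" | "i = Suc j"
      by (auto simp: adjacent_def)
    then show ?thesis
    proof cases
      case 1
      show ?thesis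
        unfolding eeg(1) 1
        by (cases "col (x i) = col (x (Suc i))"; cases "col (x (Suc i)) = col (x (Suc (Suc i)))";
            cases "col (x i) = col (x (Suc (Suc i)))"; simp add: exp; simp add: algebra_simps)
    next
      case 2
      show ?thesis
        unfolding eeg(1) 2
        by (cases "col (x j) = col (x (Suc j))"; cases "col (x (Suc j)) = col (x (Suc (Suc j)))";
            cases "col (x j) = col (x (Suc (Suc j)))"; simp add: exp; simp add: algebra_simps)
    qed
  next
    case ege
    from ege(2) consider "j = Suc i" | "i = Suc j"
      by (auto simp: adjacent_def)
    then show ?thesis
    proof cases
      case 1
      show ?thesis
        unfolding ege(1) 1
        by (cases "col (x i) = col (x (Suc i))"; cases "col (x (Suc i)) = col (x (Suc (Suc i)))";
            cases "col (x i) = col (x (Suc (Suc i)))"; simp add: exp; simp add: algebra_simps)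
    next
      case 2
      show ?thesis
        unfolding ege(1) 2
        by (cases "col (x j) = col (x (Suc j))"; cases "col (x (Suc j)) = col (x (Suc (Suc j)))";
            cases "col (x j) = col (x (Suc (Suc j)))"; simp add: exp; simp add: algebra_simps)
    qed
  next
    case gef
    then show ?thesis
      by (auto simp: exp far_def)
  next
    case gsq
    show ?thesis
      unfolding gsq using neq[of i "Suc i"] by (auto simp: exp swap_twice) (auto simp: algebra_simps)
  qed (auto simp: exp)
qed (simp add: act_free_def)

section \<open>The right module generated by an idempotent\<close>

context bt_system
begin

definition GW :: "(nat \<Rightarrow> nat) \<Rightarrow> 'r" where
  "GW w = prod_list (map g (SOME is. is \<in> reduced_words n w))"

lemma GW_eq:
  assumes "w permutes {1..n}" "is \<in> reduced_words n w"
  shows "GW w = prod_list (map g is)"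
  unfolding GW_def
  by (rule matsumoto[where n = n and w = w]) (use gg_far braid assms someI_ex[OF ex_reduced_word[OF assms(1)]] in auto)

lemma GW_id: "GW id = 1"
  using GW_eq[of id "[]"] reduced_words_iff[of id n "[]"] by (simp add: permutes_id)

lemma GW_up:
  assumes "w permutes {1..n}" "i \<in> {1..<n}" "inv w i < inv w (Suc i)"
  shows "GW (adj_swap i \<circ> w) = GW w * g i"
proof -
  obtain "is" where "is": "is \<in> reduced_words n w"
    using ex_reduced_word[OF assms(1)] by blast
  show ?thesis
    using GW_eq[OF permutes_comp_adj_swap(2)[OF assms(1,2)] reduced_word_snoc[OF assms(1) "is" assms(2,3)]]
      GW_eq[OF assms(1) "is"] by simp
qed

text \<open>Moved to the left through \<open>GW w\<close>, the tie \<open>e i\<close> becomes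
  \<open>ep\<close> at the preimages of \<open>i\<close> and \<open>i + 1\<close>, which the
  idempotent absorbs or annihilates.\<close>

lemma EE_GW_e:
  assumes A: "partition_on {1..n} A" and w: "w permutes {1..n}" and i: "i \<in> {1..<n}"
  shows "EE A * GW w * e i = (if same_block A (inv w i) (inv w (Suc i)) then EE A * GW w else 0)"
proof -
  let ?a = "inv w i" and ?b = "inv w (Suc i)"
  obtain "is" where "is": "is \<in> reduced_words n w"
    using ex_reduced_word[OF w] by blast
  then have s: "set is \<subseteq> {1..<n}" "perm_of_word is = w"
    using reduced_words_iff[OF w] by auto
  have ab: "?a \<in> {1..n}" "?b \<in> {1..n}" "?a \<noteq> ?b" "w ?a = i" "w ?b = Suc i"
    using i permutes_in_image[OF permutes_inv[OF w]] permutes_inverses[OF w] permutes_inj[OF permutes_inv[OF w]]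
    by (auto simp: inj_eq)
  have "GW w * e i = ep ?a ?b * GW w"
    using word_ep[OF s(1) ab(1-3)] GW_eq[OF w "is"] s(2) ab(4,5) ep_eq_e[of i] by simp
  then have "EE A * GW w * e i = EE A * ep ?a ?b * GW w"
    by (simp only: mult.assoc)
  then show ?thesis
    using EE_ep[OF A ab(1-3)] by simp
qed

text \<open>These are the structure constants of \<open>act_letter\<close>: the word
  \<open>inv w\<close> has the letters \<open>inv w i\<close> and \<open>inv w (Suc i)\<close>, and
  blocks are colours. On a descent the quadratic relation yields a correction term, which the
  idempotent keeps only if both letters lie in one block.\<close>

lemma EE_GW_g:
  assumes A: "partition_on {1..n} A" and w: "w permutes {1..n}" and i: "i \<in> {1..<n}"
  shows "EE A * GW w * g i = EE A * GW (adj_swap i \<circ> w) +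
    (if same_block A (inv w i) (inv w (Suc i)) \<and> inv w (Suc i) < inv w i then sc z * (EE A * GW w) else 0)"
proof (cases "inv w i < inv w (Suc i)")
  case True
  then show ?thesis
    using GW_up[OF w i True] by (simp add: mult.assoc)
next
  case False
  \<comment> \<open>\<open>w\<close> extends the shorter \<open>w'\<close> by one letter, so
    \<open>GW w\<close> ends in \<open>g i\<close> and the square of \<open>g i\<close>
    appears.\<close>
  define w' where "w' = adj_swap i \<circ> w"
  have w': "w' permutes {1..n}"
    unfolding w'_def by (rule permutes_comp_adj_swap(2)[OF w i])
  have inv': "inv w' = inv w \<circ> adj_swap i"
    unfolding w'_def using o_inv_distrib[OF permutes_bij[OF permutes_adj_swap[OF i]] permutes_bij[OF w]]
    by (simp only: inv_adj_swap)
  have ne: "inv w i \<noteq> inv w (Suc i)"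
    using permutes_inj[OF permutes_inv[OF w]] by (auto simp: inj_eq)
  have "w = adj_swap i \<circ> w'"
    by (simp add: w'_def comp_assoc[symmetric])
  then have Gw: "GW w = GW w' * g i"
    using GW_up[OF w' i] inv' False ne by simp
  have "EE A * GW w * g i = EE A * GW w' * (g i * g i)"
    unfolding Gw by (simp only: mult.assoc)
  also have "\<dots> = EE A * GW w' + EE A * GW w' * (sc z * e i * g i)"
    unfolding gsq[OF i] by (simp add: distrib_left)
  also have "EE A * GW w' * (sc z * e i * g i) = sc z * (EE A * GW w' * e i * g i)"
    using sc_central[of z "EE A * GW w'"] by (simp add: mult.assoc[symmetric])
  also have "EE A * GW w' * e i * g i = (if same_block A (inv w i) (inv w (Suc i)) then EE A * GW w else 0)"
    unfolding EE_GW_e[OF A w' i] Gw using inv' same_block_sym by (auto simp: mult.assoc)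
  finally show ?thesis
    unfolding w'_def using False ne by (auto simp: comp_def)
qed

text \<open>Reads a vector as an element of the right ideal: the value at the word
  \<open>inv w\<close> becomes the coefficient of \<open>EE A * GW w\<close>. Independence of these
  elements is not claimed; the map only has to intertwine the two actions.\<close>

definition expand :: "nat set set \<Rightarrow> ((nat \<Rightarrow> nat) \<Rightarrow> 'a) \<Rightarrow> 'r" where
  "expand A v = (\<Sum>w | w permutes {1..n}. sc (v (inv w)) * (EE A * GW w))"

fun letter_val :: "generator \<Rightarrow> 'r" where
  "letter_val (Gen_g i) = g i"
| "letter_val (Gen_e i) = e i"

definition free_val :: "'a free_elem \<Rightarrow> 'r" where
  "free_val p = (\<Sum>u\<in>Poly_Mapping.keys p. sc (Poly_Mapping.lookup p u) * prod_list (map letter_val (letters u)))"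

lemma finite_perms: "finite {w. w permutes {1..n}}"
  by (simp add: finite_permutations)

text \<open>The structure constants on both sides agree after the sum has been reindexed by
  \<open>w \<mapsto> adj_swap i \<circ> w\<close>, which exchanges two neighbouring letters of the
  word \<open>inv w\<close>.\<close>

lemma expand_letter:
  assumes A: "partition_on {1..n} A"
    and col: "\<And>i j. i \<in> {1..n} \<Longrightarrow> j \<in> {1..n} \<Longrightarrow> same_block A i j \<longleftrightarrow> col i = col j"
    and l: "l \<in> Gen_g ` {1..<n} \<union> Gen_e ` {1..<n}"
  shows "expand A (act_letter col z l v) = expand A v * letter_val l"
proof -
  have same: "same_block A (inv w i) (inv w (Suc i)) \<longleftrightarrow> col (inv w i) = col (inv w (Suc i))"
    if "w permutes {1..n}" "i \<in> {1..<n}" for w i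
    using that permutes_in_image[OF permutes_inv[OF that(1)]] by (intro col) auto
  from l consider i where "l = Gen_g i" "i \<in> {1..<n}" | i where "l = Gen_e i" "i \<in> {1..<n}"
    by auto
  then show ?thesis
  proof cases
    case (2 i)
    have "expand A v * e i = (\<Sum>w | w permutes {1..n}. sc (v (inv w)) * (EE A * GW w * e i))"
      by (simp add: expand_def sum_distrib_right mult.assoc)
    also have "\<dots> = expand A (act_letter col z l v)"
      unfolding expand_def
    proof (intro sum.cong refl)
      fix w assume "w \<in> {w. w permutes {1..n}}"
      then have w: "w permutes {1..n}" by simp
      show "sc (v (inv w)) * (EE A * GW w * e i) = sc (act_letter col z l v (inv w)) * (EE A * GW w)"
        unfolding EE_GW_e[OF A w 2(2)] same[OF w 2(2)] 2(1) by simp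
    qed
    finally show ?thesis
      using 2 by simp
  next
    case (1 i)
    let ?P = "{w. w permutes {1..n}}"
    let ?d = "\<lambda>w. if col (inv w i) = col (inv w (Suc i)) \<and> inv w (Suc i) < inv w i then z * v (inv w) else 0"
    have "expand A v * g i = (\<Sum>w\<in>?P. sc (v (inv w)) * (EE A * GW w * g i))"
      by (simp add: expand_def sum_distrib_right mult.assoc)
    also have "\<dots> = (\<Sum>w\<in>?P. sc (v (inv w)) * (EE A * GW (adj_swap i \<circ> w)) + sc (?d w) * (EE A * GW w))"
    proof (intro sum.cong refl)
      fix w assume "w \<in> ?P"
      then have w: "w permutes {1..n}" by simp
      have "sc (v (inv w)) * (sc z * (EE A * GW w)) = sc (z * v (inv w)) * (EE A * GW w)"
        by (simp add: sc_mult[symmetric] mult.assoc[symmetric] mult.commute)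
      then show "sc (v (inv w)) * (EE A * GW w * g i) =
          sc (v (inv w)) * (EE A * GW (adj_swap i \<circ> w)) + sc (?d w) * (EE A * GW w)"
        unfolding EE_GW_g[OF A w 1(2)] same[OF w 1(2)] by (simp add: distrib_left)
    qed
    also have "\<dots> = (\<Sum>w\<in>?P. sc (v (inv w)) * (EE A * GW (adj_swap i \<circ> w))) + (\<Sum>w\<in>?P. sc (?d w) * (EE A * GW w))"
      by (rule sum.distrib)
    also have "(\<Sum>w\<in>?P. sc (v (inv w)) * (EE A * GW (adj_swap i \<circ> w))) =
        (\<Sum>w\<in>?P. sc (v (inv w \<circ> adj_swap i)) * (EE A * GW w))"
    proof (rule sum.reindex_bij_witness[where i = "\<lambda>w. adj_swap i \<circ> w" and j = "\<lambda>w. adj_swap i \<circ> w"])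
      fix w assume "w \<in> ?P"
      then have w: "w permutes {1..n}" by simp
      show "adj_swap i \<circ> w \<in> ?P"
        using permutes_comp_adj_swap(2)[OF w 1(2)] by simp
      show "adj_swap i \<circ> w \<in> ?P" by fact
      have "inv (adj_swap i \<circ> w) = inv w \<circ> adj_swap i"
        using o_inv_distrib[OF permutes_bij[OF permutes_adj_swap[OF 1(2)]] permutes_bij[OF w]] by (simp only: inv_adj_swap)
      then show "sc (v (inv (adj_swap i \<circ> w) \<circ> adj_swap i)) * (EE A * GW (adj_swap i \<circ> w)) =
          sc (v (inv w)) * (EE A * GW (adj_swap i \<circ> w))"
        by (simp add: comp_assoc)
    qed (simp_all add: comp_assoc[symmetric])
    also have "\<dots> + (\<Sum>w\<in>?P. sc (?d w) * (EE A * GW w)) = expand A (act_letter col z l v)"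
      unfolding expand_def sum.distrib[symmetric] using 1(1)
      by (intro sum.cong refl) (simp add: sc_add[symmetric] distrib_right[symmetric])
    finally show ?thesis
      using 1 by simp
  qed
qed

lemma expand_word:
  assumes A: "partition_on {1..n} A"
    and col: "\<And>i j. i \<in> {1..n} \<Longrightarrow> j \<in> {1..n} \<Longrightarrow> same_block A i j \<longleftrightarrow> col i = col j"
  shows "set u \<subseteq> Gen_g ` {1..<n} \<union> Gen_e ` {1..<n} \<Longrightarrow>
    expand A (act_word col z u v) = expand A v * prod_list (map letter_val u)"
proof (induction u arbitrary: v)
  case (Cons l u)
  have l: "l \<in> Gen_g ` {1..<n} \<union> Gen_e ` {1..<n}"
    using Cons.prems by simp
  show ?case
    using Cons.IH[of "act_letter col z l v"] Cons.prems expand_letter[OF A col l]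
    by (simp add: act_word_Cons mult.assoc)
qed simp

text \<open>The vector of the identity expands to \<open>EE A\<close> itself, and expansion
  intertwines the actions. An element of the right ideal is thereby recovered from its
  vector.\<close>

theorem EE_free_val:
  assumes A: "partition_on {1..n} A"
    and col: "\<And>i j. i \<in> {1..n} \<Longrightarrow> j \<in> {1..n} \<Longrightarrow> same_block A i j \<longleftrightarrow> col i = col j"
    and p: "p \<in> carrier (free_alg n)"
  shows "EE A * free_val p = expand A (act_free col z p (\<lambda>x. if x = id then 1 else 0))"
proof -
  let ?v = "\<lambda>x :: nat \<Rightarrow> nat. if x = id then 1 else 0 :: 'a"
  have "expand A ?v = (\<Sum>w | w permutes {1..n}. if w = id then EE A else 0)"
    unfolding expand_def
  proof (intro sum.cong refl)
    fix w assume "w \<in> {w. w permutes {1..n}}"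
    then have "inv w = id \<longleftrightarrow> w = id"
      using inv_inv_eq[OF permutes_bij] by (metis inv_id mem_Collect_eq)
    then show "sc (?v (inv w)) * (EE A * GW w) = (if w = id then EE A else 0)"
      by (auto simp: GW_id)
  qed
  then have 1: "expand A ?v = EE A"
    using finite_perms by (simp add: permutes_id)
  have "EE A * free_val p = (\<Sum>u\<in>Poly_Mapping.keys p. sc (Poly_Mapping.lookup p u) * (EE A * prod_list (map letter_val (letters u))))"
    unfolding free_val_def sum_distrib_left using sc_central[of _ "EE A"]
    by (simp add: mult.assoc[symmetric])
  also have "\<dots> = (\<Sum>u\<in>Poly_Mapping.keys p. sc (Poly_Mapping.lookup p u) * expand A (act_word col z (letters u) ?v))"
  proof (intro sum.cong refl)
    fix u assume "u \<in> Poly_Mapping.keys p"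
    then have u: "set (letters u) \<subseteq> Gen_g ` {1..<n} \<union> Gen_e ` {1..<n}"
      using p unfolding free_alg_def words_below_def by auto
    show "sc (Poly_Mapping.lookup p u) * (EE A * prod_list (map letter_val (letters u))) =
        sc (Poly_Mapping.lookup p u) * expand A (act_word col z (letters u) ?v)"
      using expand_word[OF A col u, where v = "?v"] 1 by simp
  qed
  also have "\<dots> = (\<Sum>w | w permutes {1..n}. sc (\<Sum>u\<in>Poly_Mapping.keys p. Poly_Mapping.lookup p u * act_word col z (letters u) ?v (inv w)) * (EE A * GW w))"
    unfolding expand_def sum_distrib_left sc_sum sum_distrib_right
    by (subst sum.swap) (simp add: sc_mult mult.assoc)
  also have "\<dots> = expand A (act_free col z p ?v)"
    unfolding expand_def act_free_def
    by (intro sum.cong refl) (simp add: permutes_inj[OF permutes_inv])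
  finally show ?thesis .
qed

end

section \<open>Classes of free elements\<close>

lemma free_alg_simps [simp]:
  "x \<otimes>\<^bsub>free_alg n\<^esub> y = x * y" "x \<oplus>\<^bsub>free_alg n\<^esub> y = x + y" "\<one>\<^bsub>free_alg n\<^esub> = 1" "\<zero>\<^bsub>free_alg n\<^esub> = 0"
  by (simp_all add: free_alg_def)

lemma ideal_bt: "ideal (bt_ideal n q) (free_alg n)"
  unfolding bt_ideal_def by (intro ring.genideal_ideal ring_free_alg bt_relations_carrier)

lemma free_carrier:
  "i \<in> {1..<n} \<Longrightarrow> free_g i \<in> carrier (free_alg n)"
  "i \<in> {1..<n} \<Longrightarrow> free_e i \<in> carrier (free_alg n)"
  "free_scalar a \<in> carrier (free_alg n)"
  by (auto simp: free_alg_def free_g_def free_e_def free_scalar_def words_below_def zero_word_def split: if_splits)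

lemma free_add_closed: "x \<in> carrier (free_alg n) \<Longrightarrow> y \<in> carrier (free_alg n) \<Longrightarrow> x + y \<in> carrier (free_alg n)"
  using ring.ring_simprules(1)[OF ring_free_alg, of x n y] by simp

lemma free_mult_closed: "x \<in> carrier (free_alg n) \<Longrightarrow> y \<in> carrier (free_alg n) \<Longrightarrow> x * y \<in> carrier (free_alg n)"
  using ring.ring_simprules(5)[OF ring_free_alg, of x n y] by simp

lemma free_uminus_closed: "x \<in> carrier (free_alg n) \<Longrightarrow> - x \<in> carrier (free_alg n)"
  by (simp add: free_alg_def)

lemma free_one_closed: "1 \<in> carrier (free_alg n)"
  using ring.ring_simprules(6)[OF ring_free_alg] by simp

lemmas free_closed = free_carrier free_add_closed free_mult_closed free_uminus_closed free_one_closed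

lemma bt_class_hom: "bt_class n q \<in> ring_hom (free_alg n) (bt n q)"
  using ideal.rcos_ring_hom[OF ideal_bt] unfolding bt_class_def[abs_def] bt_def .

lemma bt_class_closed: "p \<in> carrier (free_alg n) \<Longrightarrow> bt_class n q p \<in> carrier (bt n q)"
  by (rule ring_hom_closed[OF bt_class_hom])

lemma bt_class_mult: "p \<in> carrier (free_alg n) \<Longrightarrow> p' \<in> carrier (free_alg n) \<Longrightarrow>
  bt_class n q (p * p') = bt_class n q p \<otimes>\<^bsub>bt n q\<^esub> bt_class n q p'"
  using ring_hom_mult[OF bt_class_hom, of p n p'] by simp

lemma bt_class_add: "p \<in> carrier (free_alg n) \<Longrightarrow> p' \<in> carrier (free_alg n) \<Longrightarrow>
  bt_class n q (p + p') = bt_class n q p \<oplus>\<^bsub>bt n q\<^esub> bt_class n q p'"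
  using ring_hom_add[OF bt_class_hom, of p n p'] by simp

lemma bt_class_one: "bt_class n q 1 = \<one>\<^bsub>bt n q\<^esub>"
  using ring_hom_one[OF bt_class_hom] by simp

lemma bt_class_zero: "bt_class n q 0 = \<zero>\<^bsub>bt n q\<^esub>"
  using ring_hom_zero[OF bt_class_hom ring_free_alg ring_bt] by simp

lemma bt_class_iff: "x \<in> bt_class n q p \<longleftrightarrow> (\<exists>h\<in>bt_ideal n q. x = h + p)"
  by (auto simp: bt_class_def a_r_coset_def')

lemma bt_class_eqI:
  assumes "p \<in> carrier (free_alg n)" "p' \<in> carrier (free_alg n)" "p - p' \<in> bt_ideal n q"
  shows "bt_class n q p = bt_class n q p'"
proof -
  interpret I: ideal "bt_ideal n q" "free_alg n" by (rule ideal_bt)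
  have "bt_class n q (p - p') = bt_class n q 0"
    unfolding bt_class_def
    using abelian_subgroup.a_rcos_const[OF abelian_subgroupI3[OF I.is_additive_subgroup I.is_abelian_group]]
      assms(3) additive_subgroup.zero_closed[OF I.is_additive_subgroup] by (metis free_alg_simps(4))
  then show ?thesis
    using bt_class_add[of "p - p'" n p' q] bt_class_add[of 0 n p' q] assms
    by (simp add: free_closed ring.ring_simprules(2)[OF ring_free_alg, simplified])
qed

lemma bt_relation: "r \<in> bt_relations n q \<Longrightarrow> r \<in> bt_ideal n q"
  using ring.genideal_self[OF ring_free_alg bt_relations_carrier] unfolding bt_ideal_def by blast

lemma bt_carrierE:
  assumes "X \<in> carrier (bt n q)"
  obtains p where "p \<in> carrier (free_alg n)" "X = bt_class n q p"
  using assms unfolding bt_def FactRing_simps A_RCOSETS_def' bt_class_def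
  by (auto simp: FactRing_def A_RCOSETS_def')

lemma bt_class_self: "p \<in> bt_class n q p"
  unfolding bt_class_iff using additive_subgroup.zero_closed[OF ideal.axioms(1)[OF ideal_bt]]
  by (metis add_0 free_alg_simps(4))

section \<open>All the algebras at once\<close>

text \<open>The product of the algebras over all \<open>n\<close> and \<open>q\<close> is a type, in which the
  relations can be used without carrier conditions; evaluation at one pair \<open>(n, q)\<close> transports the
  results to \<^term>\<open>bt n q\<close>.\<close>

typedef (overloaded) 'a bt_product = "{f :: nat \<Rightarrow> 'a::comm_ring_1 \<Rightarrow> 'a free_elem set. \<forall>n q. f n q \<in> carrier (bt n q)}"
  by (rule exI[of _ "\<lambda>n q. \<zero>\<^bsub>bt n q\<^esub>"]) (auto intro: ring.ring_simprules(2)[OF ring_bt])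

definition component :: "nat \<Rightarrow> 'a \<Rightarrow> 'a::comm_ring_1 bt_product \<Rightarrow> 'a free_elem set" where
  "component n q f = Rep_bt_product f n q"

lemma component_closed: "component n q f \<in> carrier (bt n q)"
  using Rep_bt_product[of f] by (simp add: component_def)

lemma component_Abs: "(\<And>n q. f n q \<in> carrier (bt n q)) \<Longrightarrow> component n q (Abs_bt_product f) = f n q"
  by (simp add: component_def Abs_bt_product_inverse)

lemma bt_product_eqI: "(\<And>n q. component n q f = component n q h) \<Longrightarrow> f = h"
  unfolding component_def by (metis Rep_bt_product_inject ext)

instantiation bt_product :: (comm_ring_1) "{ring, monoid_mult}"
begin

definition zero_bt_product :: "'a bt_product" where
  "zero_bt_product = Abs_bt_product (\<lambda>n q. \<zero>\<^bsub>bt n q\<^esub>)"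

definition one_bt_product :: "'a bt_product" where
  "one_bt_product = Abs_bt_product (\<lambda>n q. \<one>\<^bsub>bt n q\<^esub>)"

definition plus_bt_product :: "'a bt_product \<Rightarrow> 'a bt_product \<Rightarrow> 'a bt_product" where
  "plus_bt_product f h = Abs_bt_product (\<lambda>n q. component n q f \<oplus>\<^bsub>bt n q\<^esub> component n q h)"

definition times_bt_product :: "'a bt_product \<Rightarrow> 'a bt_product \<Rightarrow> 'a bt_product" where
  "times_bt_product f h = Abs_bt_product (\<lambda>n q. component n q f \<otimes>\<^bsub>bt n q\<^esub> component n q h)"

definition uminus_bt_product :: "'a bt_product \<Rightarrow> 'a bt_product" where
  "uminus_bt_product f = Abs_bt_product (\<lambda>n q. \<ominus>\<^bsub>bt n q\<^esub> component n q f)"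

definition minus_bt_product :: "'a bt_product \<Rightarrow> 'a bt_product \<Rightarrow> 'a bt_product" where
  "minus_bt_product f h = Abs_bt_product (\<lambda>n q. component n q f \<oplus>\<^bsub>bt n q\<^esub> (\<ominus>\<^bsub>bt n q\<^esub> component n q h))"

lemma component_hom:
  "component n q (0 :: 'a bt_product) = \<zero>\<^bsub>bt n q\<^esub>"
  "component n q (1 :: 'a bt_product) = \<one>\<^bsub>bt n q\<^esub>"
  "component n q (f + h) = component n q f \<oplus>\<^bsub>bt n q\<^esub> component n q h"
  "component n q (f * h) = component n q f \<otimes>\<^bsub>bt n q\<^esub> component n q h"
  "component n q (- f) = \<ominus>\<^bsub>bt n q\<^esub> component n q f"
  "component n q (f - h) = component n q f \<oplus>\<^bsub>bt n q\<^esub> (\<ominus>\<^bsub>bt n q\<^esub> component n q h)"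
  unfolding zero_bt_product_def one_bt_product_def plus_bt_product_def times_bt_product_def
    uminus_bt_product_def minus_bt_product_def
  by (subst component_Abs; auto intro!: component_closed ring.ring_simprules[OF ring_bt])+

instance
proof
  fix a b c :: "'a bt_product"
  note r = ring.ring_simprules[OF ring_bt] monoid.r_one[OF ring.is_monoid[OF ring_bt]] component_closed component_hom
  show "a + b + c = a + (b + c)" "a + b = b + a" "0 + a = a" "- a + a = 0" "a - b = a + - b"
    "a * b * c = a * (b * c)" "(a + b) * c = a * c + b * c" "a * (b + c) = a * b + a * c"
    "1 * a = a" "a * 1 = a"
    by (rule bt_product_eqI; simp add: r)+
qed

end

lemma component_prod_list: "component n q (prod_list xs) = bt_prod n q (map (component n q) xs)"
  by (induction xs) (simp_all add: component_hom bt_prod_def)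

lemma component_sum:
  assumes "finite K"
  shows "component n q (sum f K) = (\<Oplus>\<^bsub>bt n q\<^esub>k\<in>K. component n q (f k))"
proof -
  interpret ring "bt n q" by (rule ring_bt)
  show ?thesis
    using assms by (induction K) (simp_all add: component_hom component_closed)
qed

definition prod_scalar :: "'a \<Rightarrow> 'a::comm_ring_1 bt_product" where
  "prod_scalar a = Abs_bt_product (\<lambda>n q. bt_class n q (free_scalar a))"

text \<open>In the other components the relations are solved by \<open>g = 1\<close> and \<open>e = 0\<close>.\<close>

definition prod_g :: "nat \<Rightarrow> 'a \<Rightarrow> nat \<Rightarrow> 'a::comm_ring_1 bt_product" where
  "prod_g n q i = Abs_bt_product (\<lambda>m r. if m = n \<and> r = q \<and> i \<in> {1..<n} then bt_g n q i else \<one>\<^bsub>bt m r\<^esub>)"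

definition prod_e :: "nat \<Rightarrow> 'a \<Rightarrow> nat \<Rightarrow> 'a::comm_ring_1 bt_product" where
  "prod_e n q i = Abs_bt_product (\<lambda>m r. if m = n \<and> r = q \<and> i \<in> {1..<n} then bt_e n q i else \<zero>\<^bsub>bt m r\<^esub>)"

lemma bt_g_closed: "i \<in> {1..<n} \<Longrightarrow> bt_g n q i \<in> carrier (bt n q)"
  and bt_e_closed: "i \<in> {1..<n} \<Longrightarrow> bt_e n q i \<in> carrier (bt n q)"
  unfolding bt_g_def bt_e_def by (simp_all add: bt_class_closed free_carrier)

lemma component_prod:
  "component m r (prod_scalar a) = bt_class m r (free_scalar a)"
  "component m r (prod_g n q i) = (if m = n \<and> r = q \<and> i \<in> {1..<n} then bt_g n q i else \<one>\<^bsub>bt m r\<^esub>)"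
  "component m r (prod_e n q i) = (if m = n \<and> r = q \<and> i \<in> {1..<n} then bt_e n q i else \<zero>\<^bsub>bt m r\<^esub>)"
  unfolding prod_scalar_def prod_g_def prod_e_def
  by (subst component_Abs; auto intro!: bt_class_closed free_carrier bt_g_closed bt_e_closed ring.ring_simprules[OF ring_bt])+

lemma free_scalar_central: "free_scalar a * p = p * free_scalar a"
proof -
  have "Poly_Mapping.single 0 a * (\<Sum>u\<in>Poly_Mapping.keys p. Poly_Mapping.single u (Poly_Mapping.lookup p u)) =
      (\<Sum>u\<in>Poly_Mapping.keys p. Poly_Mapping.single u (Poly_Mapping.lookup p u)) * Poly_Mapping.single 0 a"
    by (simp add: sum_distrib_left sum_distrib_right mult_single mult.commute)
  then show ?thesis
    by (simp add: sum_singles_lookup free_scalar_def)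
qed

lemma prod_scalar_central: "prod_scalar a * x = x * prod_scalar a"
proof (rule bt_product_eqI)
  fix m :: nat and r :: 'a
  obtain p where p: "p \<in> carrier (free_alg m)" "component m r x = bt_class m r p"
    by (rule bt_carrierE[OF component_closed])
  show "component m r (prod_scalar a * x) = component m r (x * prod_scalar a)"
    using p by (simp add: component_hom component_prod bt_class_mult[symmetric] free_carrier free_scalar_central)
qed

lemma bt_relationsI:
  assumes "i \<in> {1..<n}" "j \<in> {1..<n}"
  shows "far i j \<Longrightarrow> free_g i * free_g j - free_g j * free_g i \<in> bt_relations n q"
    and "free_g i * free_e i - free_e i * free_g i \<in> bt_relations n q"
    and "adjacent i j \<Longrightarrow> free_g i * free_g j * free_g i - free_g j * free_g i * free_g j \<in> bt_relations n q"
    and "adjacent i j \<Longrightarrow> free_e i * free_g j * free_g i - free_g j * free_g i * free_e j \<in> bt_relations n q"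
    and "adjacent i j \<Longrightarrow> free_e i * free_e j * free_g j - free_e i * free_g j * free_e i \<in> bt_relations n q"
    and "adjacent i j \<Longrightarrow> free_e i * free_g j * free_e i - free_g j * free_e i * free_e j \<in> bt_relations n q"
    and "free_e i * free_e j - free_e j * free_e i \<in> bt_relations n q"
    and "far i j \<Longrightarrow> free_g i * free_e j - free_e j * free_g i \<in> bt_relations n q"
    and "free_e i * free_e i - free_e i \<in> bt_relations n q"
    and "free_g i * free_g i - (1 + free_scalar (q - unit_inv q) * free_e i * free_g i) \<in> bt_relations n q"
  using assms unfolding bt_relations_def Let_def by blast+

lemma prod_relation:
  assumes "i \<in> {1..<n}" "j \<in> {1..<n}"
  shows "far i j \<Longrightarrow> prod_g n q i * prod_g n q j = prod_g n q j * prod_g n q i"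
    and "prod_g n q i * prod_e n q i = prod_e n q i * prod_g n q i"
    and "adjacent i j \<Longrightarrow> prod_g n q i * prod_g n q j * prod_g n q i = prod_g n q j * prod_g n q i * prod_g n q j"
    and "adjacent i j \<Longrightarrow> prod_e n q i * prod_g n q j * prod_g n q i = prod_g n q j * prod_g n q i * prod_e n q j"
    and "adjacent i j \<Longrightarrow> prod_e n q i * prod_e n q j * prod_g n q j = prod_e n q i * prod_g n q j * prod_e n q i"
    and "adjacent i j \<Longrightarrow> prod_e n q i * prod_g n q j * prod_e n q i = prod_g n q j * prod_e n q i * prod_e n q j"
    and "prod_e n q i * prod_e n q j = prod_e n q j * prod_e n q i"
    and "far i j \<Longrightarrow> prod_g n q i * prod_e n q j = prod_e n q j * prod_g n q i"
    and "prod_e n q i * prod_e n q i = prod_e n q i"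
    and "prod_g n q i * prod_g n q i = 1 + prod_scalar (q - unit_inv q) * prod_e n q i * prod_g n q i"
proof -
  \<comment> \<open>An identity in the product is checked in the component \<open>(n, q)\<close>,
    where it is a defining relation, and in the other components, where it only involves 0, 1 and
    scalars.\<close>
  have *: "f = h" if "component n q f = bt_class n q p" "component n q h = bt_class n q p'"
    "p \<in> carrier (free_alg n)" "p' \<in> carrier (free_alg n)" "p - p' \<in> bt_relations n q"
    "\<And>m r. \<not> (m = n \<and> r = q) \<Longrightarrow> component m r f = component m r h" for f h p p'
  proof (rule bt_product_eqI)
    fix m r
    show "component m r f = component m r h"
      using that bt_class_eqI[OF that(3,4) bt_relation[OF that(5)]] by metis
  qed
  have cs: "component n q (prod_g n q k) = bt_class n q (free_g k)" "component n q (prod_e n q k) = bt_class n q (free_e k)"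
    if "k \<in> {1..<n}" for k
    using that by (simp_all add: component_prod bt_g_def bt_e_def)
  have co: "component m r (prod_g n q k) = \<one>\<^bsub>bt m r\<^esub>" "component m r (prod_e n q k) = \<zero>\<^bsub>bt m r\<^esub>"
    if "\<not> (m = n \<and> r = q)" for k m r
    using that by (auto simp: component_prod)
  note simps = component_hom component_prod(1) cs[OF assms(1)] cs[OF assms(2)] co bt_class_mult bt_class_add bt_class_one
    free_carrier(1)[OF assms(1)] free_carrier(1)[OF assms(2)] free_carrier(2)[OF assms(1)] free_carrier(2)[OF assms(2)]
    free_carrier(3) free_mult_closed free_add_closed free_one_closed bt_class_closed ring.ring_simprules[OF ring_bt]
    monoid.r_one[OF ring.is_monoid[OF ring_bt]]
  show "far i j \<Longrightarrow> prod_g n q i * prod_g n q j = prod_g n q j * prod_g n q i"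
    by (rule *[of _ "free_g i * free_g j" _ "free_g j * free_g i"]; (rule bt_relationsI[OF assms]; assumption?)?; simp add: simps)
  show "prod_g n q i * prod_e n q i = prod_e n q i * prod_g n q i"
    by (rule *[of _ "free_g i * free_e i" _ "free_e i * free_g i"]; (rule bt_relationsI[OF assms]; assumption?)?; simp add: simps)
  show "adjacent i j \<Longrightarrow> prod_g n q i * prod_g n q j * prod_g n q i = prod_g n q j * prod_g n q i * prod_g n q j"
    by (rule *[of _ "free_g i * free_g j * free_g i" _ "free_g j * free_g i * free_g j"]; (rule bt_relationsI[OF assms]; assumption?)?; simp add: simps)
  show "adjacent i j \<Longrightarrow> prod_e n q i * prod_g n q j * prod_g n q i = prod_g n q j * prod_g n q i * prod_e n q j"
    by (rule *[of _ "free_e i * free_g j * free_g i" _ "free_g j * free_g i * free_e j"]; (rule bt_relationsI[OF assms]; assumption?)?; simp add: simps)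
  show "adjacent i j \<Longrightarrow> prod_e n q i * prod_e n q j * prod_g n q j = prod_e n q i * prod_g n q j * prod_e n q i"
    by (rule *[of _ "free_e i * free_e j * free_g j" _ "free_e i * free_g j * free_e i"]; (rule bt_relationsI[OF assms]; assumption?)?; simp add: simps)
  show "adjacent i j \<Longrightarrow> prod_e n q i * prod_g n q j * prod_e n q i = prod_g n q j * prod_e n q i * prod_e n q j"
    by (rule *[of _ "free_e i * free_g j * free_e i" _ "free_g j * free_e i * free_e j"]; (rule bt_relationsI[OF assms]; assumption?)?; simp add: simps)
  show "prod_e n q i * prod_e n q j = prod_e n q j * prod_e n q i"
    by (rule *[of _ "free_e i * free_e j" _ "free_e j * free_e i"]; (rule bt_relationsI[OF assms]; assumption?)?; simp add: simps)
  show "far i j \<Longrightarrow> prod_g n q i * prod_e n q j = prod_e n q j * prod_g n q i"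
    by (rule *[of _ "free_g i * free_e j" _ "free_e j * free_g i"]; (rule bt_relationsI[OF assms]; assumption?)?; simp add: simps)
  show "prod_e n q i * prod_e n q i = prod_e n q i"
    by (rule *[of _ "free_e i * free_e i" _ "free_e i"]; (rule bt_relationsI[OF assms]; assumption?)?; simp add: simps)
  show "prod_g n q i * prod_g n q i = 1 + prod_scalar (q - unit_inv q) * prod_e n q i * prod_g n q i"
    by (rule *[of _ "free_g i * free_g i" _ "1 + free_scalar (q - unit_inv q) * free_e i * free_g i"];
        (rule bt_relationsI[OF assms])?; simp add: simps)
qed

interpretation bt_sys: bt_system n prod_scalar "q - unit_inv q" "prod_g n q" "prod_e n q" for n q
proof
  fix a b :: 'a and x :: "'a bt_product"
  show "prod_scalar (a + b) = prod_scalar a + prod_scalar b"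
    by (rule bt_product_eqI) (simp add: component_prod component_hom bt_class_add[symmetric] free_carrier,
        simp add: free_scalar_def single_add)
  show "prod_scalar (a * b) = prod_scalar a * prod_scalar b"
    by (rule bt_product_eqI) (simp add: component_prod component_hom bt_class_mult[symmetric] free_carrier,
        simp add: free_scalar_def mult_single)
  show "prod_scalar 1 = (1 :: 'a bt_product)"
    by (rule bt_product_eqI) (simp add: component_prod component_hom free_scalar_def bt_class_one)
  show "prod_scalar a * x = x * prod_scalar a"
    by (rule prod_scalar_central)
qed (rule prod_relation; assumption)+

lemma component_word:
  fixes q :: "'a::comm_ring_1"
  assumes "set u \<subseteq> Gen_g ` {1..<n} \<union> Gen_e ` {1..<n}"
  shows "component n q (prod_list (map (bt_sys.letter_val n q) u)) = bt_class n q (Poly_Mapping.single (Word u) 1)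
    \<and> Poly_Mapping.single (Word u) (1 :: 'a::comm_ring_1) \<in> carrier (free_alg n)"
  using assms
proof (induction u)
  case Nil
  have "Poly_Mapping.single (Word []) (1 :: 'a) = 1"
    by (simp add: zero_word_def[symmetric])
  then show ?case
    by (simp add: component_hom bt_class_one free_one_closed)
next
  case (Cons l u)
  have "Poly_Mapping.single (Word (l # u)) (1 :: 'a) = Poly_Mapping.single (Word [l]) 1 * Poly_Mapping.single (Word u) 1"
    by (simp add: mult_single plus_word_def)
  moreover have "Poly_Mapping.single (Word [l]) (1 :: 'a) \<in> carrier (free_alg n)"
    "component n q (bt_sys.letter_val n q l) = bt_class n q (Poly_Mapping.single (Word [l]) 1)"
    using Cons.prems
    by (auto simp: free_alg_def words_below_def component_prod bt_g_def bt_e_def free_g_def free_e_def bt_sys.letter_val.simps)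
  ultimately show ?case
    using Cons by (simp add: component_hom bt_class_mult free_mult_closed)
qed

text \<open>Evaluation in the product followed by projection to \<open>(n, q)\<close> is the
  quotient map, which turns results about \<open>bt_system\<close> into results about
  classes.\<close>

lemma component_free_val:
  fixes q :: "'a::comm_ring_1"
  assumes "p \<in> carrier (free_alg n)"
  shows "component n q (bt_sys.free_val n q p) = bt_class n q p"
proof -
  let ?s = "\<lambda>u. free_scalar (Poly_Mapping.lookup p u) * Poly_Mapping.single (Word (letters u)) 1"
  have c: "Poly_Mapping.single (Word (letters u)) (1 :: 'a) \<in> carrier (free_alg n)"
    "component n q (prod_list (map (bt_sys.letter_val n q) (letters u))) = bt_class n q (Poly_Mapping.single (Word (letters u)) 1)"
    if "u \<in> Poly_Mapping.keys p" for u
    using that assms component_word[of "letters u" n q] by (auto simp: free_alg_def words_below_def)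
  have "component n q (\<Sum>u\<in>K. prod_scalar (Poly_Mapping.lookup p u) * prod_list (map (bt_sys.letter_val n q) (letters u)))
      = bt_class n q (\<Sum>u\<in>K. ?s u) \<and> (\<Sum>u\<in>K. ?s u) \<in> carrier (free_alg n)" if "finite K" "K \<subseteq> Poly_Mapping.keys p" for K
    using that
  proof (induction K)
    case empty
    show ?case
      using ring.ring_simprules(2)[OF ring_free_alg, of n] by (simp add: component_hom bt_class_zero)
  next
    case (insert u K)
    then show ?case
      using c[of u] by (simp add: component_hom component_prod bt_class_mult bt_class_add free_closed)
  qed
  from this[of "Poly_Mapping.keys p"]
  have "component n q (bt_sys.free_val n q p) = bt_class n q (\<Sum>u\<in>Poly_Mapping.keys p. ?s u)"
    by (simp add: bt_sys.free_val_def)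
  also have "(\<Sum>u\<in>Poly_Mapping.keys p. ?s u) = p"
    using sum_singles_lookup[of p] by (simp add: free_scalar_def mult_single)
  finally show ?thesis .
qed


section \<open>Inverses and idempotents of the algebra as components\<close>

lemma component_ginv:
  assumes "i \<in> {1..<n}"
  shows "m_inv (bt n q) (bt_g n q i) = component n q (bt_sys.ginv q n i)"
proof -
  have g: "component n q (prod_g n q i) = bt_g n q i"
    using assms by (simp add: component_prod)
  have "bt_g n q i \<otimes>\<^bsub>bt n q\<^esub> component n q (bt_sys.ginv q n i) = \<one>\<^bsub>bt n q\<^esub>"
    "component n q (bt_sys.ginv q n i) \<otimes>\<^bsub>bt n q\<^esub> bt_g n q i = \<one>\<^bsub>bt n q\<^esub>"
    unfolding g[symmetric] component_hom(2,4)[symmetric] using bt_sys.g_ginv[OF assms] by metis+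
  then show ?thesis
    by (intro monoid.inv_char[OF ring.is_monoid[OF ring_bt]] component_closed bt_g_closed assms)
qed

lemma component_EP:
  "1 \<le> i \<Longrightarrow> i + d < n \<Longrightarrow> bt_E_pair n q i (i + d + 1) = component n q (bt_sys.EP q n i d)"
proof (induction d arbitrary: i)
  case 0
  then show ?case
    by (subst bt_E_pair.simps) (simp add: component_prod bt_sys.EP.simps)
next
  case (Suc d)
  have i: "i \<in> {1..<n}"
    using Suc.prems by simp
  have "bt_E_pair n q (Suc i) (i + Suc d + 1) = component n q (bt_sys.EP q n (Suc i) d)"
    using Suc.IH[of "Suc i"] Suc.prems by simp
  then show ?case
    using i by (subst bt_E_pair.simps) (simp add: component_hom component_prod component_ginv[OF i] bt_sys.EP.simps)
qed

lemma component_EB: "bt_E n q A = component n q (bt_sys.EB n q A)"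
proof -
  have *: "bt_E_pair n q i j = component n q (bt_sys.ep q n i j)" if "i \<in> {1..<n + 1}" "j \<in> {i + 1..<n + 1}" for i j
    using component_EP[of i "j - i - 1" n q] that by (auto simp: bt_sys.ep_def)
  have "map (component n q) [bt_sys.ep q n i j. i \<leftarrow> xs, j \<leftarrow> ys i, P i j] =
      [component n q (bt_sys.ep q n i j). i \<leftarrow> xs, j \<leftarrow> ys i, P i j]" for xs ys P
    by (simp add: map_concat comp_def if_distrib cong: if_cong)
  then show ?thesis
    unfolding bt_E_def bt_sys.EB_def component_prod_list
    by (intro arg_cong[of _ _ "bt_prod n q"]) (auto simp: * simp del: upt_Suc intro!: arg_cong[of _ _ concat] map_cong)
qed

lemma component_EE: "bt_EE n q A = component n q (bt_sys.EE n q A)"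
  unfolding bt_EE_def bt_sys.EE_def bt_smult_def
  by (simp only: component_sum[OF finite_refines] component_hom component_prod component_EB)

lemma bt_EE_closed: "bt_EE n q A \<in> carrier (bt n q)"
  unfolding component_EE by (rule component_closed)

section \<open>The action of the algebra\<close>

text \<open>The representative is arbitrary; that the choice does not matter is
  \<open>bt_act_class\<close>.\<close>

definition bt_act :: "nat \<Rightarrow> 'a::comm_ring_1 \<Rightarrow> (nat \<Rightarrow> nat) \<Rightarrow> 'a free_elem set \<Rightarrow> ((nat \<Rightarrow> nat) \<Rightarrow> 'a) \<Rightarrow> (nat \<Rightarrow> nat) \<Rightarrow> 'a" where
  "bt_act n q col X v = act_free col (q - unit_inv q) (SOME p. p \<in> X) v"

text \<open>The elements that annihilate every vector form an ideal, and it contains the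
  relations.\<close>

lemma act_free_ideal:
  fixes q :: "'a::comm_ring_1"
  assumes "r \<in> bt_ideal n q"
  shows "act_free col (q - unit_inv q) r v x = 0"
proof -
  let ?K = "{p \<in> carrier (free_alg n). \<forall>v x. act_free col (q - unit_inv q) p v x = 0}"
  have 0: "act_free col (q - unit_inv q) p (\<lambda>x. 0) x = 0" for p x
    using act_free_sum[of col "q - unit_inv q" p "\<lambda>_. 0" "\<lambda>_ _. 0" "{}"] by (simp add: fun_eq_iff)
  have "ideal ?K (free_alg n)"
  proof (rule idealI[OF ring_free_alg])
    show "subgroup ?K (add_monoid (free_alg n))"
    proof
      fix x assume x: "x \<in> ?K"
      have "- x \<oplus>\<^bsub>free_alg n\<^esub> x = \<zero>\<^bsub>free_alg n\<^esub>" "- x \<in> carrier (free_alg n)"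
        using x by (auto simp: free_closed)
      then have "\<ominus>\<^bsub>free_alg n\<^esub> x = - x"
        using x abelian_group.minus_equality[OF ring.is_abelian_group[OF ring_free_alg]] by blast
      moreover have "act_free col (q - unit_inv q) (- x) v y = 0" for v y
        using x act_free_diff[of col "q - unit_inv q" 0 x v y] by simp
      ultimately show "m_inv (add_monoid (free_alg n)) x \<in> ?K"
        using x unfolding a_inv_def[symmetric] by (simp add: free_closed)
    qed (auto simp: act_free_add free_closed ring.ring_simprules(2)[OF ring_free_alg, simplified])
  next
    fix a p :: "'a free_elem" assume a: "a \<in> ?K" and p: "p \<in> carrier (free_alg n)"
    have "act_free col (q - unit_inv q) a v = (\<lambda>x. 0)" for v
      using a by (auto simp: fun_eq_iff)
    then show "p \<otimes>\<^bsub>free_alg n\<^esub> a \<in> ?K" "a \<otimes>\<^bsub>free_alg n\<^esub> p \<in> ?K"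
      using a p by (auto simp: act_free_mult free_closed 0)
  qed
  moreover have "bt_relations n q \<subseteq> ?K"
    using bt_relations_carrier act_free_relation by blast
  ultimately have "bt_ideal n q \<subseteq> ?K"
    unfolding bt_ideal_def by (rule ring.genideal_minimal[OF ring_free_alg])
  then show ?thesis
    using assms by blast
qed

lemma bt_act_class: "bt_act n q col (bt_class n q p) v = act_free col (q - unit_inv q) p v"
proof -
  have "(SOME p'. p' \<in> bt_class n q p) \<in> bt_class n q p"
    by (rule someI[of "\<lambda>p'. p' \<in> bt_class n q p", OF bt_class_self])
  then obtain h where "h \<in> bt_ideal n q" "(SOME p'. p' \<in> bt_class n q p) = h + p"
    unfolding bt_class_iff by blast
  then show ?thesis
    by (auto simp: bt_act_def fun_eq_iff act_free_add act_free_ideal)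
qed

lemma bt_act_mult:
  assumes "X \<in> carrier (bt n q)" "Y \<in> carrier (bt n q)"
  shows "bt_act n q col (X \<otimes>\<^bsub>bt n q\<^esub> Y) v = bt_act n q col Y (bt_act n q col X v)"
  using assms by (auto elim!: bt_carrierE simp: bt_class_mult[symmetric] bt_act_class act_free_mult)

lemma bt_act_add:
  assumes "X \<in> carrier (bt n q)" "Y \<in> carrier (bt n q)"
  shows "bt_act n q col (X \<oplus>\<^bsub>bt n q\<^esub> Y) v x = bt_act n q col X v x + bt_act n q col Y v x"
  using assms by (auto elim!: bt_carrierE simp: bt_class_add[symmetric] bt_act_class act_free_add)

lemma bt_act_one: "bt_act n q col \<one>\<^bsub>bt n q\<^esub> v x = (if inj x then v x else 0)"
  by (simp add: bt_class_one[symmetric] bt_act_class act_free_one)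

lemma bt_act_zero: "bt_act n q col \<zero>\<^bsub>bt n q\<^esub> v x = 0"
  by (simp add: bt_class_zero[symmetric] bt_act_class)

lemma bt_smult_closed: "X \<in> carrier (bt n q) \<Longrightarrow> bt_smult n q a X \<in> carrier (bt n q)"
  unfolding bt_smult_def by (intro ring.ring_simprules(5)[OF ring_bt] bt_class_closed free_carrier)

lemma bt_smult_mult:
  assumes "X \<in> carrier (bt n q)" "Y \<in> carrier (bt n q)"
  shows "X \<otimes>\<^bsub>bt n q\<^esub> bt_smult n q a Y = bt_smult n q a (X \<otimes>\<^bsub>bt n q\<^esub> Y)"
proof -
  obtain p p' where p: "p \<in> carrier (free_alg n)" "X = bt_class n q p" "p' \<in> carrier (free_alg n)" "Y = bt_class n q p'"
    using assms bt_carrierE by metis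
  have "p * (free_scalar a * p') = free_scalar a * (p * p')"
    by (metis free_scalar_central mult.assoc)
  then show ?thesis
    using p by (simp add: bt_smult_def bt_class_mult[symmetric] free_closed)
qed

lemma act_free_smult: "act_free col z p (\<lambda>x. a * v x) = (\<lambda>x. a * act_free col z p v x)"
  using act_free_sum[of col z p "\<lambda>_. a" "\<lambda>_. v" "{()}"] by simp

lemma bt_act_smult:
  assumes "X \<in> carrier (bt n q)"
  shows "bt_act n q col (bt_smult n q a X) v x = a * bt_act n q col X v x"
proof -
  obtain p where p: "p \<in> carrier (free_alg n)" "X = bt_class n q p"
    using assms by (rule bt_carrierE)
  have "act_free col (q - unit_inv q) (free_scalar a * p) v = act_free col (q - unit_inv q) p (\<lambda>x. a * v x)"
    unfolding act_free_mult by (rule act_free_cong) (simp add: act_free_scalar)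
  then show ?thesis
    using p by (simp add: bt_smult_def bt_class_mult[symmetric] free_closed bt_act_class act_free_smult)
qed

lemma bt_act_sum:
  "bt_act n q col X (\<lambda>x. \<Sum>k\<in>K. c k * v k x) = (\<lambda>x. \<Sum>k\<in>K. c k * bt_act n q col X (v k) x)"
  unfolding bt_act_def by (rule act_free_sum)

lemma bt_act_finsum:
  assumes "finite K" "\<And>k. k \<in> K \<Longrightarrow> f k \<in> carrier (bt n q)"
  shows "bt_act n q col (\<Oplus>\<^bsub>bt n q\<^esub>k\<in>K. f k) v x = (\<Sum>k\<in>K. bt_act n q col (f k) v x)"
proof -
  interpret ring "bt n q" by (rule ring_bt)
  show ?thesis
    using assms by (induction K) (auto simp: bt_act_zero bt_act_add Pi_def)
qed

lemma bt_act_not_inj: "\<not> inj x \<Longrightarrow> bt_act n q col X v x = 0"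
  by (simp add: bt_act_def act_free_def)

lemma bt_act_g:
  "inj x \<Longrightarrow> bt_act n q col (bt_g n q i) v x = act_letter col (q - unit_inv q) (Gen_g i) v x"
  and bt_act_e: "inj x \<Longrightarrow> bt_act n q col (bt_e n q i) v x = act_letter col (q - unit_inv q) (Gen_e i) v x"
  unfolding bt_g_def bt_e_def by (simp_all add: bt_act_class act_free_g act_free_e del: act_letter.simps)

text \<open>Both products are the expansion of the same vector. This is the way back from
  computations with vectors to equalities in the algebra.\<close>

theorem bt_EE_faithful:
  assumes A: "partition_on {1..n} A"
    and col: "\<And>i j. i \<in> {1..n} \<Longrightarrow> j \<in> {1..n} \<Longrightarrow> same_block A i j \<longleftrightarrow> col i = col j"
    and XY: "X \<in> carrier (bt n q)" "Y \<in> carrier (bt n q)"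
    and eq: "bt_act n q col X (\<lambda>x. if x = id then 1 else 0) = bt_act n q col Y (\<lambda>x. if x = id then 1 else 0)"
  shows "bt_EE n q A \<otimes>\<^bsub>bt n q\<^esub> X = bt_EE n q A \<otimes>\<^bsub>bt n q\<^esub> Y"
proof -
  have "bt_EE n q A \<otimes>\<^bsub>bt n q\<^esub> Z = component n q (bt_sys.expand n q A (bt_act n q col Z (\<lambda>x. if x = id then 1 else 0)))"
    if Z: "Z \<in> carrier (bt n q)" for Z
  proof -
    obtain p where p: "p \<in> carrier (free_alg n)" "Z = bt_class n q p"
      using Z by (rule bt_carrierE)
    have "bt_EE n q A \<otimes>\<^bsub>bt n q\<^esub> Z = component n q (bt_sys.EE n q A * bt_sys.free_val n q p)"
      using p by (simp add: component_hom component_EE component_free_val)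
    also have "\<dots> = component n q (bt_sys.expand n q A (act_free col (q - unit_inv q) p (\<lambda>x. if x = id then 1 else 0)))"
      using bt_sys.EE_free_val[OF A col p(1)] by simp
    finally show ?thesis
      unfolding p(2) bt_act_class .
  qed
  then show ?thesis
    using XY eq by simp
qed

section \<open>Idempotents acting as projections\<close>

lemma bt_prod_closed: "set Xs \<subseteq> carrier (bt n q) \<Longrightarrow> bt_prod n q Xs \<in> carrier (bt n q)"
  by (induction Xs) (auto simp: bt_prod_def intro: ring.ring_simprules[OF ring_bt])

lemma bt_prod_Nil: "bt_prod n q [] = \<one>\<^bsub>bt n q\<^esub>"
  and bt_prod_Cons: "bt_prod n q (X # Xs) = X \<otimes>\<^bsub>bt n q\<^esub> bt_prod n q Xs"
  by (simp_all add: bt_prod_def)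

lemma bt_mult_closed: "X \<in> carrier (bt n q) \<Longrightarrow> Y \<in> carrier (bt n q) \<Longrightarrow> X \<otimes>\<^bsub>bt n q\<^esub> Y \<in> carrier (bt n q)"
  by (rule ring.ring_simprules(5)[OF ring_bt])

lemma bt_mult_assoc: "X \<in> carrier (bt n q) \<Longrightarrow> Y \<in> carrier (bt n q) \<Longrightarrow> Z \<in> carrier (bt n q) \<Longrightarrow>
  X \<otimes>\<^bsub>bt n q\<^esub> Y \<otimes>\<^bsub>bt n q\<^esub> Z = X \<otimes>\<^bsub>bt n q\<^esub> (Y \<otimes>\<^bsub>bt n q\<^esub> Z)"
  by (rule ring.ring_simprules(11)[OF ring_bt])

lemma bt_E_pair_closed: "1 \<le> i \<Longrightarrow> i < j \<Longrightarrow> j \<le> n \<Longrightarrow> bt_E_pair n q i j \<in> carrier (bt n q)"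
  using component_EP[of i "j - i - 1" n q] component_closed[of n q] by simp

text \<open>Induction along the conjugation: acting with \<open>g i\<close> carries the projection
  for \<open>(i + 1, j)\<close> to the one for \<open>(i, j)\<close>, and the inverse then undoes
  \<open>g i\<close>.\<close>

lemma bt_act_E_pair:
  assumes "1 \<le> i" "i < j" "j \<le> n" "inj x"
  shows "bt_act n q col (bt_E_pair n q i j) v x = (if col (x i) = col (x j) then v x else 0)"
  using assms
proof (induction "j - i" arbitrary: i v x)
  case (Suc d)
  have i: "i \<in> {1..<n}"
    using Suc.prems by simp
  show ?case
  proof (cases "j \<le> i + 1")
    case True
    then have "j = Suc i"
      using Suc.prems by simp
    then show ?thesis
      using Suc.prems by (subst bt_E_pair.simps) (simp add: bt_act_e)
  next
    case False
    let ?g = "bt_g n q i" and ?E = "bt_E_pair n q (i + 1) j"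
    define h where "h = m_inv (bt n q) ?g"
    define d where "d v x = (if col (x i) = col (x j) then v x else 0)" for v :: "(nat \<Rightarrow> nat) \<Rightarrow> 'a" and x
    have h: "h \<in> carrier (bt n q)" "?g \<otimes>\<^bsub>bt n q\<^esub> h = \<one>\<^bsub>bt n q\<^esub>"
    proof -
      have hc: "h = component n q (bt_sys.ginv q n i)"
        unfolding h_def by (rule component_ginv[OF i])
      then show "h \<in> carrier (bt n q)"
        by (simp add: component_closed)
      have "component n q (prod_g n q i * bt_sys.ginv q n i) = \<one>\<^bsub>bt n q\<^esub>"
        using bt_sys.g_ginv(1)[OF i] by (metis component_hom(2))
      then show "?g \<otimes>\<^bsub>bt n q\<^esub> h = \<one>\<^bsub>bt n q\<^esub>"
        using i hc by (simp add: component_hom component_prod)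
    qed
    have E: "?E \<in> carrier (bt n q)"
      using Suc.prems False by (intro bt_E_pair_closed) auto
    \<comment> \<open>The correction term of \<open>g i\<close> occurs only if the letters at
      \<open>i\<close> and \<open>i + 1\<close> have the same colour, and then the two projections
      impose the same condition.\<close>
    have eq: "bt_act n q col ?E (bt_act n q col ?g v) = bt_act n q col ?g (d v)"
    proof
      fix y
      show "bt_act n q col ?E (bt_act n q col ?g v) y = bt_act n q col ?g (d v) y"
      proof (cases "inj y")
        case inj: True
        have "bt_act n q col ?E (bt_act n q col ?g v) y =
            (if col (y (i + 1)) = col (y j) then bt_act n q col ?g v y else 0)"
          using Suc.hyps(2) Suc.prems False inj by (intro Suc.hyps(1)) auto
        also have "\<dots> = bt_act n q col ?g (d v) y"
          using False by (auto simp: bt_act_g inj inj_comp_adj_swap d_def)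
        finally show ?thesis .
      qed (simp add: bt_act_not_inj)
    qed
    have "bt_act n q col (bt_E_pair n q i j) v x = bt_act n q col h (bt_act n q col ?E (bt_act n q col ?g v)) x"
      using False i h E by (subst bt_E_pair.simps) (simp add: h_def[symmetric] bt_act_mult bt_mult_closed bt_g_closed)
    also have "\<dots> = bt_act n q col (?g \<otimes>\<^bsub>bt n q\<^esub> h) (d v) x"
      unfolding eq by (simp add: bt_act_mult[OF bt_g_closed[OF i] h(1)])
    also have "\<dots> = d v x"
      using Suc.prems by (simp add: h bt_act_one)
    finally show ?thesis
      by (simp add: d_def)
  qed
qed simp

lemma bt_act_E:
  assumes "inj x"
  shows "bt_act n q col (bt_E n q A) v x =
    (if \<forall>i\<in>{1..n}. \<forall>j\<in>{1..n}. same_block A i j \<longrightarrow> col (x i) = col (x j) then v x else 0)"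
proof -
  define L where "L = [(i, j). i \<leftarrow> [1..<n + 1], j \<leftarrow> [i + 1..<n + 1], \<exists>X\<in>A. i \<in> X \<and> j \<in> X]"
  let ?f = "\<lambda>(i, j). bt_E_pair n q i j"
  have "map ?f [(i, j). i \<leftarrow> xs, j \<leftarrow> ys i, P i j] = [bt_E_pair n q i j. i \<leftarrow> xs, j \<leftarrow> ys i, P i j]" for xs ys P
    by (simp add: map_concat comp_def if_distrib cong: if_cong)
  then have E: "bt_E n q A = bt_prod n q (map ?f L)"
    unfolding bt_E_def L_def by simp
  have mem: "(i, j) \<in> set L \<longleftrightarrow> i \<in> {1..n} \<and> j \<in> {1..n} \<and> i < j \<and> same_block A i j" for i j
    unfolding L_def set_comprehension_elem set_upt same_block_def by auto
  have "bt_act n q col (bt_prod n q (map ?f K)) v x = (if \<forall>(i, j)\<in>set K. col (x i) = col (x j) then v x else 0)"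
    if "\<forall>(i, j)\<in>set K. 1 \<le> i \<and> i < j \<and> j \<le> n" for K
    using that
  proof (induction K arbitrary: v)
    case Nil
    then show ?case
      using assms by (simp add: bt_prod_Nil bt_act_one)
  next
    case (Cons p K)
    obtain i j where p: "p = (i, j)" by fastforce
    then have ij: "1 \<le> i" "i < j" "j \<le> n"
      using Cons.prems by auto
    have c: "set (map ?f K) \<subseteq> carrier (bt n q)"
      using Cons.prems by (auto intro!: bt_E_pair_closed)
    have "bt_act n q col (bt_prod n q (map ?f (p # K))) v x =
        (if \<forall>(i, j)\<in>set K. col (x i) = col (x j) then bt_act n q col (bt_E_pair n q i j) v x else 0)"
      using Cons p by (simp add: bt_prod_Cons bt_act_mult bt_E_pair_closed[OF ij] bt_prod_closed[OF c])
    then show ?case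
      using p by (auto simp: bt_act_E_pair[OF ij assms])
  qed
  moreover have "\<forall>(i, j)\<in>set L. 1 \<le> i \<and> i < j \<and> j \<le> n"
  proof (rule ballI)
    fix p assume "p \<in> set L"
    then show "case p of (i, j) \<Rightarrow> 1 \<le> i \<and> i < j \<and> j \<le> n"
      using mem[of "fst p" "snd p"] by (simp add: case_prod_unfold)
  qed
  ultimately have "bt_act n q col (bt_E n q A) v x = (if \<forall>(i, j)\<in>set L. col (x i) = col (x j) then v x else 0)"
    unfolding E by blast
  moreover have "(\<forall>(i, j)\<in>set L. col (x i) = col (x j)) \<longleftrightarrow>
      (\<forall>i\<in>{1..n}. \<forall>j\<in>{1..n}. same_block A i j \<longrightarrow> col (x i) = col (x j))" (is "?P \<longleftrightarrow> ?Q")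
  proof
    assume P: ?P
    have *: "col (x i) = col (x j)" if "i \<in> {1..n}" "j \<in> {1..n}" "same_block A i j" "i < j" for i j
      using P mem[of i j] that by blast
    show ?Q
      using * same_block_sym by (metis linorder_neqE_nat)
  qed (use mem in blast)
  ultimately show ?thesis
    by simp
qed

lemma bt_E_closed: "bt_E n q A \<in> carrier (bt n q)"
  unfolding component_EB by (rule component_closed)

text \<open>Let \<open>C\<close> be the partition of the positions by the colours of the letters of
  \<open>x\<close>. Then E_B keeps the value at \<open>x\<close> exactly if \<open>B\<close> refines
  \<open>C\<close>, and the Moebius sum from \<open>A\<close> to \<open>C\<close> leaves only the
  case \<open>A = C\<close>.\<close>

theorem bt_act_EE:
  assumes A: "partition_on {1..n} A" and x: "inj x"
  shows "bt_act n q col (bt_EE n q A) v x =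
    (if \<forall>i\<in>{1..n}. \<forall>j\<in>{1..n}. same_block A i j \<longleftrightarrow> col (x i) = col (x j) then v x else 0)"
proof -
  define C where "C = (\<lambda>i. {j \<in> {1..n}. col (x i) = col (x j)}) ` {1..n}"
  have C: "partition_on {1..n} C"
    by (rule partition_onI) (auto simp: C_def disjnt_def)
  have sC: "same_block C i j \<longleftrightarrow> i \<in> {1..n} \<and> j \<in> {1..n} \<and> col (x i) = col (x j)" for i j
    by (auto simp: same_block_def C_def)
  have range: "same_block B i j \<Longrightarrow> i \<in> {1..n} \<and> j \<in> {1..n}" if "partition_on {1..n} B" for B i j
    using that by (auto simp: same_block_def partition_on_def)
  have rC: "(\<forall>i\<in>{1..n}. \<forall>j\<in>{1..n}. same_block B i j \<longrightarrow> col (x i) = col (x j)) \<longleftrightarrow> refines {1..n} B C"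
    if "partition_on {1..n} B" for B
    using range[OF that] unfolding refines_iff_same_block[OF that C] sC by blast
  have AC: "A = C \<longleftrightarrow> (\<forall>i\<in>{1..n}. \<forall>j\<in>{1..n}. same_block A i j \<longleftrightarrow> col (x i) = col (x j))" (is "_ \<longleftrightarrow> ?R")
  proof
    assume ?R
    then have "refines {1..n} A C" "refines {1..n} C A"
      unfolding refines_iff_same_block[OF A C] refines_iff_same_block[OF C A] sC using range[OF A] by blast+
    then show "A = C"
      by (rule refines_asym)
  qed (use sC in blast)
  have "bt_act n q col (bt_EE n q A) v x = (\<Sum>B | refines {1..n} A B.
      of_int (mobius n A B) * (if refines {1..n} B C then v x else 0))"
    unfolding bt_EE_def
  proof (subst bt_act_finsum[OF finite_refines])
    show "(\<Sum>B | refines {1..n} A B. bt_act n q col (bt_smult n q (of_int (mobius n A B)) (bt_E n q B)) v x) =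
        (\<Sum>B | refines {1..n} A B. of_int (mobius n A B) * (if refines {1..n} B C then v x else 0))"
    proof (intro sum.cong refl)
      fix B assume "B \<in> {B. refines {1..n} A B}"
      then have "partition_on {1..n} B"
        by (simp add: refines_def)
      from rC[OF this] show "bt_act n q col (bt_smult n q (of_int (mobius n A B)) (bt_E n q B)) v x =
          of_int (mobius n A B) * (if refines {1..n} B C then v x else 0)"
        by (simp only: bt_act_smult[OF bt_E_closed] bt_act_E[OF x])
    qed
  qed (auto intro: bt_smult_closed bt_E_closed)
  also have "\<dots> = (\<Sum>B | refines {1..n} A B \<and> refines {1..n} B C. of_int (mobius n A B) * v x)"
    by (rule sum.mono_neutral_cong_right[OF finite_refines]) auto
  also have "\<dots> = of_int (\<Sum>B | refines {1..n} A B \<and> refines {1..n} B C. mobius n A B) * v x"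
    by (simp add: sum_distrib_right)
  also have "(\<Sum>B | refines {1..n} A B \<and> refines {1..n} B C. mobius n A B) = (if A = C then 1 else 0)"
  proof (cases "refines {1..n} A C")
    case False
    then have "{B. refines {1..n} A B \<and> refines {1..n} B C} = {}"
      using refines_trans by blast
    moreover have "A \<noteq> C"
      using False refines_refl[OF C] by auto
    ultimately show ?thesis
      by (metis sum.empty)
  qed (rule mobius_sum)
  finally show ?thesis
    unfolding AC by simp
qed

section \<open>The anti-automorphism\<close>

definition rev_free :: "'a::comm_ring_1 free_elem \<Rightarrow> 'a free_elem" where
  "rev_free = Poly_Mapping.map_key rev_word"

lemma rev_word_invol [simp]: "rev_word (rev_word u) = u"
  by (simp add: rev_word_def)

lemma inj_rev_word: "inj rev_word"
  by (metis injI rev_word_invol)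

lemma rev_free_single: "rev_free (Poly_Mapping.single u a) = Poly_Mapping.single (rev_word u) a"
  unfolding rev_free_def using map_key_single[OF inj_rev_word, of "rev_word u" a] by simp

lemma rev_free_add: "rev_free (p + p') = rev_free p + rev_free p'"
  unfolding rev_free_def by (rule map_key_plus[OF inj_rev_word])

lemma rev_free_zero [simp]: "rev_free 0 = 0"
  using rev_free_add[of 0 0] by simp

lemma rev_free_uminus: "rev_free (- p) = - rev_free p"
  using rev_free_add[of p "- p"] by (simp add: eq_neg_iff_add_eq_0 add.commute)

lemma rev_free_diff: "rev_free (p - p') = rev_free p - rev_free p'"
  using rev_free_add[of p "- p'"] by (simp add: rev_free_uminus)

lemma rev_free_sum: "rev_free (sum f K) = (\<Sum>k\<in>K. rev_free (f k))"
  by (induction K rule: infinite_finite_induct) (auto simp: rev_free_add)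

lemma rev_free_invol [simp]: "rev_free (rev_free p) = p"
  by (subst (1 3) sum_singles_lookup[symmetric]) (simp only: rev_free_sum rev_free_single rev_word_invol)

lemma rev_free_eq_sum:
  "rev_free p = (\<Sum>u\<in>Poly_Mapping.keys p. Poly_Mapping.single (rev_word u) (Poly_Mapping.lookup p u))"
  by (subst (1) sum_singles_lookup[symmetric]) (simp only: rev_free_sum rev_free_single)

lemma rev_word_add: "rev_word (u + u') = rev_word u' + rev_word u"
  by (simp add: rev_word_def plus_word_def)

lemma rev_free_mult: "rev_free (p * p') = rev_free p' * rev_free p"
proof -
  have "p * p' = (\<Sum>u\<in>Poly_Mapping.keys p. \<Sum>u'\<in>Poly_Mapping.keys p'.
      Poly_Mapping.single (u + u') (Poly_Mapping.lookup p u * Poly_Mapping.lookup p' u'))"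
    by (subst (1) sum_singles_lookup[of p, symmetric], subst (1) sum_singles_lookup[of p', symmetric])
      (simp add: sum_distrib_left sum_distrib_right mult_single sum.swap[of _ "Poly_Mapping.keys p'"])
  moreover have "rev_free p' * rev_free p = (\<Sum>u\<in>Poly_Mapping.keys p. \<Sum>u'\<in>Poly_Mapping.keys p'.
      Poly_Mapping.single (rev_word u' + rev_word u) (Poly_Mapping.lookup p' u' * Poly_Mapping.lookup p u))"
    unfolding rev_free_eq_sum by (simp add: sum_distrib_left sum_distrib_right mult_single)
  ultimately show ?thesis
    by (simp add: rev_free_sum rev_free_single rev_word_add mult.commute)
qed

lemma rev_free_scalar: "rev_free (free_scalar a) = free_scalar a"
  by (simp add: free_scalar_def rev_free_single zero_word_def rev_word_def)

lemma rev_free_gen: "rev_free (free_g i) = free_g i" "rev_free (free_e i) = free_e i"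
  "rev_free (free_scalar a) = free_scalar a" "rev_free 1 = 1"
  using rev_free_scalar[of a] rev_free_scalar[of 1]
  by (simp_all add: free_g_def free_e_def rev_free_single rev_word_def) (simp add: free_scalar_def)

lemma rev_free_closed: "p \<in> carrier (free_alg n) \<Longrightarrow> rev_free p \<in> carrier (free_alg n)"
proof -
  assume p: "p \<in> carrier (free_alg n)"
  have "Poly_Mapping.keys (rev_free p) \<subseteq> rev_word ` Poly_Mapping.keys p"
    unfolding rev_free_eq_sum by (rule order_trans[OF keys_sum]) (auto split: if_splits)
  moreover have "rev_word u \<in> words_below n" if "u \<in> words_below n" for u
    using that by (simp add: words_below_def rev_word_def)
  ultimately show ?thesis
    using p by (auto simp: free_alg_def)
qed

lemma bt_class_eqD: "bt_class n q p = bt_class n q p' \<Longrightarrow> p - p' \<in> bt_ideal n q"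
  using bt_class_self[of p n q] by (auto simp: bt_class_iff)

text \<open>Up to sign, exchange of the indices and commuting factors, reversal maps relations to
  relations; the two that describe \<open>e i * g j * e i\<close> are interchanged.\<close>

lemma rev_free_relation:
  assumes "r \<in> bt_relations n q"
  shows "rev_free r \<in> bt_ideal n q"
proof -
  have c: "bt_class n q (free_g i) = component n q (prod_g n q i)" "bt_class n q (free_e i) = component n q (prod_e n q i)"
    "bt_class n q (free_scalar a) = component n q (prod_scalar a)" if "i \<in> {1..<n}" for i a
    using that by (auto simp: component_prod bt_g_def bt_e_def)
  have d: "p - p' \<in> bt_ideal n q" if "bt_class n q p = component n q f" "bt_class n q p' = component n q f'" "f = f'" for p p' f f'
    using that by (intro bt_class_eqD) simp
  note simps = bt_class_mult bt_class_add bt_class_one c component_hom free_closed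
  note rev = rev_free_diff rev_free_mult rev_free_gen rev_free_add
  have sym: "adjacent j i" if "adjacent i j" for i j
    using that by (auto simp: adjacent_def)
  consider
    (gg) i j where "r = free_g i * free_g j - free_g j * free_g i" "i \<in> {1..<n}" "j \<in> {1..<n}" "far i j"
  | (ge) i where "r = free_g i * free_e i - free_e i * free_g i" "i \<in> {1..<n}"
  | (b) i j where "r = free_g i * free_g j * free_g i - free_g j * free_g i * free_g j" "i \<in> {1..<n}" "j \<in> {1..<n}" "adjacent i j"
  | (egg) i j where "r = free_e i * free_g j * free_g i - free_g j * free_g i * free_e j" "i \<in> {1..<n}" "j \<in> {1..<n}" "adjacent i j"
  | (eeg) i j where "r = free_e i * free_e j * free_g j - free_e i * free_g j * free_e i" "i \<in> {1..<n}" "j \<in> {1..<n}" "adjacent i j"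
  | (ege) i j where "r = free_e i * free_g j * free_e i - free_g j * free_e i * free_e j" "i \<in> {1..<n}" "j \<in> {1..<n}" "adjacent i j"
  | (ee) i j where "r = free_e i * free_e j - free_e j * free_e i" "i \<in> {1..<n}" "j \<in> {1..<n}"
  | (gef) i j where "r = free_g i * free_e j - free_e j * free_g i" "i \<in> {1..<n}" "j \<in> {1..<n}" "far i j"
  | (eei) i where "r = free_e i * free_e i - free_e i" "i \<in> {1..<n}"
  | (gsq) i where "r = free_g i * free_g i - (1 + free_scalar (q - unit_inv q) * free_e i * free_g i)" "i \<in> {1..<n}"
    using assms unfolding bt_relations_def Let_def by blast
  then show ?thesis
  proof cases
    case gg
    show ?thesis
      unfolding gg(1) rev
      by (rule d[OF _ _ prod_relation(1)[OF gg(2-4), symmetric]]) (use gg in \<open>simp_all add: simps\<close>)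
  next
    case ge
    show ?thesis
      unfolding ge(1) rev
      by (rule d[OF _ _ prod_relation(2)[OF ge(2,2), symmetric]]) (use ge in \<open>simp_all add: simps\<close>)
  next
    case b
    show ?thesis
      unfolding b(1) rev mult.assoc[symmetric]
      by (rule d[OF _ _ prod_relation(3)[OF b(2-4)]]) (use b in \<open>simp_all add: simps\<close>)
  next
    case egg
    show ?thesis
      unfolding egg(1) rev mult.assoc[symmetric]
      by (rule d[OF _ _ prod_relation(4)[OF egg(3,2) sym[OF egg(4)], symmetric]]) (use egg in \<open>simp_all add: simps\<close>)
  next
    case eeg
    show ?thesis
      unfolding eeg(1) rev mult.assoc[symmetric]
    proof (rule d[of _ "prod_g n q j * prod_e n q j * prod_e n q i" _ "prod_e n q i * prod_g n q j * prod_e n q i"])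
      show "prod_g n q j * prod_e n q j * prod_e n q i = prod_e n q i * prod_g n q j * prod_e n q i"
        unfolding prod_relation(6)[OF eeg(2-4)] by (simp only: mult.assoc prod_relation(7)[OF eeg(3,2)])
    qed (use eeg in \<open>simp_all add: simps\<close>)
  next
    case ege
    show ?thesis
      unfolding ege(1) rev mult.assoc[symmetric]
    proof (rule d[of _ "prod_e n q i * prod_g n q j * prod_e n q i" _ "prod_e n q j * prod_e n q i * prod_g n q j"])
      show "prod_e n q i * prod_g n q j * prod_e n q i = prod_e n q j * prod_e n q i * prod_g n q j"
        unfolding prod_relation(5)[OF ege(2-4), symmetric] by (simp only: prod_relation(7)[OF ege(2,3)])
    qed (use ege in \<open>simp_all add: simps\<close>)
  next
    case ee
    show ?thesis
      unfolding ee(1) rev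
      by (rule d[OF _ _ prod_relation(7)[OF ee(3,2)]]) (use ee in \<open>simp_all add: simps\<close>)
  next
    case gef
    show ?thesis
      unfolding gef(1) rev
      by (rule d[OF _ _ prod_relation(8)[OF gef(2-4), symmetric]]) (use gef in \<open>simp_all add: simps\<close>)
  next
    case eei
    show ?thesis
      unfolding eei(1) rev
      by (rule d[OF _ _ prod_relation(9)[OF eei(2,2)]]) (use eei in \<open>simp_all add: simps\<close>)
  next
    case gsq
    show ?thesis
      unfolding gsq(1) rev mult.assoc[symmetric]
    proof (rule d[of _ "prod_g n q i * prod_g n q i" _ "1 + prod_g n q i * prod_e n q i * prod_scalar (q - unit_inv q)"])
      show "prod_g n q i * prod_g n q i = 1 + prod_g n q i * prod_e n q i * prod_scalar (q - unit_inv q)"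
        unfolding prod_relation(10)[OF gsq(2,2)]
        by (simp only: mult.assoc prod_relation(2)[OF gsq(2,2), symmetric]
            prod_scalar_central[of _ "prod_g n q i * prod_e n q i"])
    qed (use gsq in \<open>simp_all add: simps\<close>)
  qed
qed

lemma free_uminus: "y \<in> carrier (free_alg n) \<Longrightarrow> \<ominus>\<^bsub>free_alg n\<^esub> y = - y"
  using abelian_group.minus_equality[OF ring.is_abelian_group[OF ring_free_alg]]
  by (metis ab_left_minus free_alg_simps(2,4) free_uminus_closed)

text \<open>The elements whose reversal lies in the ideal again form an ideal, as reversal exchanges
  left and right multiples, and all relations belong to it.\<close>

lemma rev_free_ideal:
  fixes q :: "'a::comm_ring_1"
  assumes "p \<in> bt_ideal n q"
  shows "rev_free p \<in> bt_ideal n q"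
proof -
  let ?K = "{p \<in> carrier (free_alg n). rev_free p \<in> bt_ideal n q}"
  interpret I: ideal "bt_ideal n q" "free_alg n" by (rule ideal_bt)
  have "ideal ?K (free_alg n)"
  proof (rule idealI[OF ring_free_alg])
    show "subgroup ?K (add_monoid (free_alg n))"
    proof
      fix x assume x: "x \<in> ?K"
      note um = free_uminus[where n = n]
      have "- rev_free x \<in> bt_ideal n q"
        using x um[OF rev_free_closed[of x n]] I.I_l_closed[of "rev_free x" "- 1"]
        by (simp add: free_closed)
      then show "m_inv (add_monoid (free_alg n)) x \<in> ?K"
        using x um[of x] unfolding a_inv_def[symmetric] by (simp add: free_closed rev_free_uminus)
    next
      fix x y assume "x \<in> ?K" "y \<in> ?K"
      then show "x \<otimes>\<^bsub>add_monoid (free_alg n)\<^esub> y \<in> ?K"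
        using additive_subgroup.a_closed[OF I.is_additive_subgroup, of "rev_free x" "rev_free y"]
        by (simp add: free_closed rev_free_add)
    next
      show "\<one>\<^bsub>add_monoid (free_alg n)\<^esub> \<in> ?K"
        using additive_subgroup.zero_closed[OF I.is_additive_subgroup] ring.ring_simprules(2)[OF ring_free_alg, of n] by simp
    qed auto
  next
    fix a p :: "'a free_elem" assume a: "a \<in> ?K" and p: "p \<in> carrier (free_alg n)"
    show "p \<otimes>\<^bsub>free_alg n\<^esub> a \<in> ?K" "a \<otimes>\<^bsub>free_alg n\<^esub> p \<in> ?K"
      using a p I.I_l_closed[of "rev_free a" "rev_free p"] I.I_r_closed[of "rev_free a" "rev_free p"]
      by (auto simp: rev_free_mult free_closed rev_free_closed)
  qed
  moreover have "bt_relations n q \<subseteq> ?K"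
    using bt_relations_carrier rev_free_relation by blast
  ultimately have "bt_ideal n q \<subseteq> ?K"
    by (subst bt_ideal_def) (rule ring.genideal_minimal[OF ring_free_alg])
  then show ?thesis
    using assms by blast
qed

text \<open>One inclusion holds for every element; for the reversed element, and with involutivity,
  it is the opposite inclusion.\<close>

lemma bt_star_class: "bt_star (bt_class n q p) = bt_class n q (rev_free p)"
proof -
  have "rev_free ` bt_class n q p \<subseteq> bt_class n q (rev_free p)" for p
    by (auto simp: bt_class_iff rev_free_add intro!: rev_free_ideal)
  from this[of p] this[of "rev_free p"] show ?thesis
    unfolding bt_star_def rev_free_def[symmetric] by (force simp: image_iff subset_iff)
qed

lemma bt_star_closed: "X \<in> carrier (bt n q) \<Longrightarrow> bt_star X \<in> carrier (bt n q)"
  by (auto elim!: bt_carrierE simp: bt_star_class intro!: bt_class_closed rev_free_closed)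

lemma bt_star_mult:
  assumes "X \<in> carrier (bt n q)" "Y \<in> carrier (bt n q)"
  shows "bt_star (X \<otimes>\<^bsub>bt n q\<^esub> Y) = bt_star Y \<otimes>\<^bsub>bt n q\<^esub> bt_star X"
  using assms
  by (auto elim!: bt_carrierE simp: bt_class_mult[symmetric] bt_star_class rev_free_mult rev_free_closed)

lemma bt_star_g: "bt_star (bt_g n q i) = bt_g n q i"
  unfolding bt_g_def by (simp add: bt_star_class rev_free_gen)

lemma bt_star_g_prod:
  assumes "set is \<subseteq> {1..<n}"
  shows "bt_star (bt_prod n q (map (bt_g n q) is)) = bt_prod n q (map (bt_g n q) (rev is))"
  using assms
proof (induction "is")
  case Nil
  then show ?case
    by (simp add: bt_prod_Nil bt_class_one[symmetric] bt_star_class rev_free_gen)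
next
  case (Cons i "is")
  have c: "bt_g n q j \<in> carrier (bt n q)" if "j \<in> set (i # is)" for j
    using that Cons.prems by (intro bt_g_closed) auto
  have app: "bt_prod n q (xs @ [x]) = bt_prod n q xs \<otimes>\<^bsub>bt n q\<^esub> x"
    if "set xs \<subseteq> carrier (bt n q)" "x \<in> carrier (bt n q)" for xs x
    using that by (induction xs)
      (auto simp: bt_prod_def bt_mult_assoc bt_prod_closed[unfolded bt_prod_def] ring.ring_simprules[OF ring_bt] monoid.r_one[OF ring.is_monoid[OF ring_bt]])
  have "bt_star (bt_prod n q (map (bt_g n q) (i # is))) = bt_prod n q (map (bt_g n q) (rev is)) \<otimes>\<^bsub>bt n q\<^esub> bt_g n q i"
    using Cons c by (simp add: bt_prod_Cons bt_star_mult bt_prod_closed image_subset_iff bt_star_g)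
  also have "\<dots> = bt_prod n q (map (bt_g n q) (rev (i # is)))"
    using c by (simp add: app image_subset_iff)
  finally show ?case .
qed

section \<open>Adjointness of the action\<close>

lemma act_letter_adjoint:
  assumes "l \<in> Gen_g ` {1..<n} \<union> Gen_e ` {1..<n}"
  shows "(\<Sum>x | x permutes {1..n}. act_letter col z l v x * v' x) = (\<Sum>x | x permutes {1..n}. v x * act_letter col z l v' x)"
proof -
  from assms consider i where "l = Gen_g i" "i \<in> {1..<n}" | i where "l = Gen_e i" "i \<in> {1..<n}"
    by auto
  then show ?thesis
  proof cases
    case (1 i)
    \<comment> \<open>The exchange of two letters moves to the other factor by reindexing with an
      involution. The correction term only rescales the value at each word, so it is symmetric
      too.\<close>
    have "(\<Sum>x | x permutes {1..n}. v (x \<circ> adj_swap i) * v' x) = (\<Sum>x | x permutes {1..n}. v x * v' (x \<circ> adj_swap i))"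
      by (rule sum.reindex_bij_witness[where i = "\<lambda>x. x \<circ> adj_swap i" and j = "\<lambda>x. x \<circ> adj_swap i"])
        (use permutes_comp_adj_swap(1)[OF _ 1(2)] in \<open>auto simp: comp_assoc\<close>)
    moreover have "(\<Sum>x | x permutes {1..n}. (if col (x i) = col (x (Suc i)) \<and> x (Suc i) < x i then z * v x else 0) * v' x) =
        (\<Sum>x | x permutes {1..n}. v x * (if col (x i) = col (x (Suc i)) \<and> x (Suc i) < x i then z * v' x else 0))"
      by (rule sum.cong) auto
    ultimately show ?thesis
      using 1 by (simp add: distrib_left distrib_right sum.distrib del: adj_swap_simps)
  qed (auto intro!: sum.cong)
qed

lemma act_word_adjoint:
  assumes "set u \<subseteq> Gen_g ` {1..<n} \<union> Gen_e ` {1..<n}"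
  shows "(\<Sum>x | x permutes {1..n}. act_word col z u v x * v' x) = (\<Sum>x | x permutes {1..n}. v x * act_word col z (rev u) v' x)"
  using assms
proof (induction u arbitrary: v v')
  case (Cons l u)
  then show ?case
    using act_letter_adjoint[of l n col z v "act_word col z (rev u) v'"] by (simp add: act_word_Cons act_word_append)
qed simp

text \<open>Generators are symmetric for the pairing of vectors by summation over permutations, so
  passing to the adjoint reverses products, as \<open>*\<close> does. Factors at the right end of a
  product can thus be moved onto the vector with which the result is paired.\<close>

theorem bt_act_adjoint:
  assumes "X \<in> carrier (bt n q)"
  shows "(\<Sum>x | x permutes {1..n}. bt_act n q col X v x * v' x) =
    (\<Sum>x | x permutes {1..n}. v x * bt_act n q col (bt_star X) v' x)"
proof -
  obtain p where p: "p \<in> carrier (free_alg n)" "X = bt_class n q p"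
    using assms by (rule bt_carrierE)
  let ?z = "q - unit_inv q" and ?P = "{x. x permutes {1..n}}"
  have inj: "inj x" if "x permutes {1..n}" for x
    using that by (rule permutes_inj)
  have "(\<Sum>x\<in>?P. bt_act n q col X v x * v' x) =
      (\<Sum>x\<in>?P. \<Sum>u\<in>Poly_Mapping.keys p. Poly_Mapping.lookup p u * (act_word col ?z (letters u) v x * v' x))"
    unfolding p(2) bt_act_class by (intro sum.cong refl) (simp add: act_free_def inj sum_distrib_right mult.assoc)
  also have "\<dots> = (\<Sum>u\<in>Poly_Mapping.keys p. Poly_Mapping.lookup p u * (\<Sum>x\<in>?P. act_word col ?z (letters u) v x * v' x))"
    by (subst sum.swap) (simp add: sum_distrib_left)
  also have "\<dots> = (\<Sum>u\<in>Poly_Mapping.keys p. Poly_Mapping.lookup p u * (\<Sum>x\<in>?P. v x * act_word col ?z (letters (rev_word u)) v' x))"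
  proof (intro sum.cong refl)
    fix u assume "u \<in> Poly_Mapping.keys p"
    then have "set (letters u) \<subseteq> Gen_g ` {1..<n} \<union> Gen_e ` {1..<n}"
      using p(1) unfolding free_alg_def words_below_def by auto
    then show "Poly_Mapping.lookup p u * (\<Sum>x\<in>?P. act_word col ?z (letters u) v x * v' x) =
        Poly_Mapping.lookup p u * (\<Sum>x\<in>?P. v x * act_word col ?z (letters (rev_word u)) v' x)"
      by (simp only: act_word_adjoint rev_word_def word.sel)
  qed
  also have "\<dots> = (\<Sum>x\<in>?P. \<Sum>u\<in>Poly_Mapping.keys p. v x * (Poly_Mapping.lookup p u * act_word col ?z (letters (rev_word u)) v' x))"
    by (subst sum.swap) (simp add: sum_distrib_left mult.left_commute)
  also have "\<dots> = (\<Sum>x\<in>?P. v x * bt_act n q col (bt_star X) v' x)"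
    unfolding p(2) bt_star_class bt_act_class
    by (intro sum.cong refl) (simp add: rev_free_eq_sum act_free_sum_left act_free_single inj sum_distrib_left)
  finally show ?thesis .
qed

section \<open>Permutations acting without collisions\<close>

definition basis_vec :: "(nat \<Rightarrow> nat) \<Rightarrow> (nat \<Rightarrow> nat) \<Rightarrow> 'a::comm_ring_1" where
  "basis_vec w x = (if x = inv w then 1 else 0)"

text \<open>If every inversion of \<open>w\<close> between letters of the same colour persists in \<open>u \<circ> w\<close>, then each step
  of a reduced word of \<open>u\<close> either meets letters of different colours or creates a new inversion,
  so the correction term of \<open>g i\<close> never appears.\<close>

definition collision_free :: "nat \<Rightarrow> (nat \<Rightarrow> nat) \<Rightarrow> (nat \<Rightarrow> nat) \<Rightarrow> (nat \<Rightarrow> nat) \<Rightarrow> bool" where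
  "collision_free n col w u \<longleftrightarrow>
    (\<forall>a\<in>{1..n}. \<forall>b\<in>{1..n}. a < b \<and> col a = col b \<and> w b < w a \<longrightarrow> u (w b) < u (w a))"

lemma bt_act_g_basis:
  assumes w: "w permutes {1..n}" and i: "i \<in> {1..<n}"
    and c: "col (inv w i) = col (inv w (Suc i)) \<Longrightarrow> inv w i < inv w (Suc i)"
  shows "bt_act n q col (bt_g n q i) (basis_vec w) = basis_vec (adj_swap i \<circ> w)"
proof
  fix x :: "nat \<Rightarrow> nat"
  have inv: "inv (adj_swap i \<circ> w) = inv w \<circ> adj_swap i"
    using o_inv_distrib[OF permutes_bij[OF permutes_adj_swap[OF i]] permutes_bij[OF w]] by (simp only: inv_adj_swap)
  have iw: "inj (inv w)"
    by (rule permutes_inj[OF permutes_inv[OF w]])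
  show "bt_act n q col (bt_g n q i) (basis_vec w) x = basis_vec (adj_swap i \<circ> w) x"
  proof (cases "inj x")
    case True
    have "x \<circ> adj_swap i = inv w \<longleftrightarrow> x = inv w \<circ> adj_swap i"
      by (metis swap_twice)
    moreover have "basis_vec w x = (0 :: 'a)" if "col (x i) = col (x (Suc i))" "x (Suc i) < x i"
      using that c by (auto simp: basis_vec_def)
    ultimately show ?thesis
      using True by (simp add: bt_act_g basis_vec_def inv)
  next
    case False
    then show ?thesis
      using inj_comp_adj_swap[OF iw, of i] by (auto simp: bt_act_not_inj basis_vec_def inv)
  qed
qed

lemma bt_act_g_prod_basis:
  assumes "w permutes {1..n}" "u permutes {1..n}" "is \<in> reduced_words n u" "collision_free n col w u"
  shows "bt_act n q col (bt_prod n q (map (bt_g n q) is)) (basis_vec w) = basis_vec (u \<circ> w)"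
  using assms
proof (induction "is" arbitrary: w u)
  case Nil
  then have "u = id"
    using reduced_words_iff[of u n "[]"] by auto
  moreover have "inj (inv w)"
    by (rule permutes_inj[OF permutes_inv[OF Nil(1)]])
  ultimately show ?case
    by (auto simp: bt_prod_Nil bt_act_one basis_vec_def fun_eq_iff[of "bt_act _ _ _ _ _"])
next
  case (Cons i "is")
  note w = Cons.prems(1) and u = Cons.prems(2)
  have i: "i \<in> {1..<n}" "u (Suc i) < u i" and "is": "is \<in> reduced_words n (u \<circ> adj_swap i)"
    using Cons.prems(3) by (auto simp: reduced_word_Cons_iff[OF u])
  have w': "adj_swap i \<circ> w permutes {1..n}" and u': "u \<circ> adj_swap i permutes {1..n}"
    using permutes_comp_adj_swap w u i by auto
  have cf: "u (w b) < u (w a)" if "a \<in> {1..n}" "b \<in> {1..n}" "a < b" "col a = col b" "w b < w a" for a b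
    using Cons.prems(4) that unfolding collision_free_def by blast
  have range: "inv w i \<in> {1..n}" "inv w (Suc i) \<in> {1..n}"
    using i permutes_in_image[OF permutes_inv[OF w]] by auto
  have "inv w i \<noteq> inv w (Suc i)"
    using permutes_inj[OF permutes_inv[OF w]] by (auto simp: inj_eq)
  \<comment> \<open>\<open>i\<close> is a descent of \<open>u\<close>. If letters of one colour at
    \<open>i\<close> and \<open>i + 1\<close> were inverted in \<open>w\<close>, they would not be
    inverted in \<open>u \<circ> w\<close>, against the hypothesis.\<close>
  then have c: "inv w i < inv w (Suc i)" if "col (inv w i) = col (inv w (Suc i))"
    using cf[OF range(2,1)] that i permutes_inverses[OF w] by fastforce
  \<comment> \<open>The step can only add the inversion between the letters at \<open>i\<close> and
    \<open>i + 1\<close>, and this one persists because \<open>i\<close> is a descent of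
    \<open>u\<close>.\<close>
  have "collision_free n col (adj_swap i \<circ> w) (u \<circ> adj_swap i)"
    unfolding collision_free_def
  proof (intro ballI impI, elim conjE)
    fix a b assume ab: "a \<in> {1..n}" "b \<in> {1..n}" "a < b" "col a = col b" "(adj_swap i \<circ> w) b < (adj_swap i \<circ> w) a"
    have "u (w b) < u (w a)"
    proof (cases "w b < w a")
      case False
      then have "w a = i" "w b = Suc i"
        using ab(5) by (auto simp: adj_swap_eq split: if_splits)
      then show ?thesis
        using i by simp
    qed (use cf ab in auto)
    then show "(u \<circ> adj_swap i) ((adj_swap i \<circ> w) b) < (u \<circ> adj_swap i) ((adj_swap i \<circ> w) a)"
      by simp
  qed
  then have "bt_act n q col (bt_prod n q (map (bt_g n q) is)) (basis_vec (adj_swap i \<circ> w)) =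
      basis_vec ((u \<circ> adj_swap i) \<circ> (adj_swap i \<circ> w))"
    by (rule Cons.IH[OF w' u' "is"])
  moreover have "(u \<circ> adj_swap i) \<circ> (adj_swap i \<circ> w) = u \<circ> w"
    by (simp add: fun_eq_iff)
  moreover have "bt_prod n q (map (bt_g n q) is) \<in> carrier (bt n q)"
    using "is" reduced_words_iff[OF u'] by (intro bt_prod_closed) (auto intro!: bt_g_closed)
  moreover have "bt_act n q col (bt_g n q i) (basis_vec w) = basis_vec (adj_swap i \<circ> w)"
    by (rule bt_act_g_basis[OF w i(1) c])
  ultimately show ?case
    by (simp only: list.map bt_prod_Cons bt_act_mult[OF bt_g_closed[OF i(1)]])
qed

lemma some_reduced_word:
  assumes "u permutes {1..n}"
  shows "(SOME is. is \<in> reduced_words n u) \<in> reduced_words n u"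
  using someI_ex[OF ex_reduced_word[OF assms]] .

lemma bt_gw_closed: "u permutes {1..n} \<Longrightarrow> bt_gw n q u \<in> carrier (bt n q)"
  using some_reduced_word[of u n] unfolding bt_gw_def
  by (intro bt_prod_closed) (auto simp: reduced_words_iff intro!: bt_g_closed)

lemma bt_act_gw:
  assumes "w permutes {1..n}" "u permutes {1..n}" "collision_free n col w u"
  shows "bt_act n q col (bt_gw n q u) (basis_vec w) = basis_vec (u \<circ> w)"
  unfolding bt_gw_def by (rule bt_act_g_prod_basis[OF assms(1,2) some_reduced_word[OF assms(2)] assms(3)])

lemma bt_act_star_gw:
  assumes "w permutes {1..n}" "u permutes {1..n}" "collision_free n col w (inv u)"
  shows "bt_act n q col (bt_star (bt_gw n q u)) (basis_vec w) = basis_vec (inv u \<circ> w)"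
proof -
  let ?is = "SOME is. is \<in> reduced_words n u"
  have "set ?is \<subseteq> {1..<n}"
    using some_reduced_word[OF assms(2)] by (auto simp: reduced_words_iff[OF assms(2)])
  then have "bt_star (bt_gw n q u) = bt_prod n q (map (bt_g n q) (rev ?is))"
    unfolding bt_gw_def by (rule bt_star_g_prod)
  then show ?thesis
    using bt_act_g_prod_basis[OF assms(1) permutes_inv[OF assms(2)] reduced_word_rev[OF assms(2) some_reduced_word[OF assms(2)]] assms(3)]
    by simp
qed

section \<open>Nodes and positions\<close>

definition nodes :: "multipartition \<Rightarrow> (nat \<times> nat \<times> nat) set" where
  "nodes L = {(c, i, j). c < length L \<and> i < length (L ! c) \<and> j < L ! c ! i}"

definition entry :: "multitableau \<Rightarrow> nat \<times> nat \<times> nat \<Rightarrow> nat" where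
  "entry t = (\<lambda>(c, i, j). t ! c ! i ! j)"

abbreviation pos :: "multipartition \<Rightarrow> nat \<times> nat \<times> nat \<Rightarrow> nat" where
  "pos L \<equiv> entry (initial_tableau L)"

lemma nodes_Sigma: "nodes L = (SIGMA c:{..<length L}. SIGMA i:{..<length (L ! c)}. {..<L ! c ! i})"
  by (auto simp: nodes_def)

lemma finite_nodes [simp]: "finite (nodes L)"
  unfolding nodes_Sigma by auto

lemma card_nodes: "card (nodes L) = mp_size L"
proof -
  have "card (nodes L) = (\<Sum>c<length L. \<Sum>i<length (L ! c). L ! c ! i)"
    unfolding nodes_Sigma by (subst card_SigmaI, auto)+
  then show ?thesis
    by (simp add: mp_size_def sum_list_sum_nth atLeast0LessThan)
qed

lemma entry_image:
  "entry t ` nodes (map (map length) t) = set (concat (concat t))"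
proof (intro equalityI subsetI)
  fix a assume "a \<in> entry t ` nodes (map (map length) t)"
  then obtain c i j where "a = t ! c ! i ! j" "c < length t" "i < length (t ! c)" "j < length (t ! c ! i)"
    by (auto simp: entry_def nodes_def)
  then show "a \<in> set (concat (concat t))"
    using nth_mem by (metis UN_I set_concat)
next
  fix a assume "a \<in> set (concat (concat t))"
  then obtain c i j where "c < length t" "i < length (t ! c)" "j < length (t ! c ! i)" "a = t ! c ! i ! j"
    by (auto simp: in_set_conv_nth)
  then show "a \<in> entry t ` nodes (map (map length) t)"
    by (auto simp: entry_def nodes_def intro!: image_eqI[of _ _ "(c, i, j)"])
qed

lemma length_concat_tableau:
  "map (map length) t = L \<Longrightarrow> length (concat (concat t)) = mp_size L"
  by (induction t arbitrary: L) (auto simp: mp_size_def length_concat)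

text \<open>Distinctness follows by counting: there are exactly as many entries as numbers to be
  hit.\<close>

lemma is_multitableau_iff:
  "is_multitableau L t \<longleftrightarrow> map (map length) t = L \<and> entry t ` nodes L = {1..mp_size L}"
proof -
  have "distinct (concat (concat t))" if "map (map length) t = L" "set (concat (concat t)) = {1..mp_size L}"
    using that length_concat_tableau[OF that(1)] by (intro card_distinct) simp
  then show ?thesis
    unfolding is_multitableau_def using entry_image[of t] by auto
qed

lemma bij_entry:
  assumes "is_multitableau L t"
  shows "bij_betw (entry t) (nodes L) {1..mp_size L}"
proof -
  have "entry t ` nodes L = {1..mp_size L}"
    using assms by (simp add: is_multitableau_iff)
  moreover from this have "inj_on (entry t) (nodes L)"
    by (intro eq_card_imp_inj_on) (simp_all add: card_nodes)
  ultimately show ?thesis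
    by (simp add: bij_betw_def)
qed

lemma fill_rows_props:
  "map length (fill_rows k \<rho>) = \<rho>"
  "i < length \<rho> \<Longrightarrow> fill_rows k \<rho> ! i = [k + sum_list (take i \<rho>)..<k + sum_list (take i \<rho>) + \<rho> ! i]"
  "concat (fill_rows k \<rho>) = [k..<k + sum_list \<rho>]"
proof (induction \<rho> arbitrary: k i)
  case (Cons p ps)
  {
    case 2
    then show ?case
      using Cons(2) by (cases i) (auto simp: add.assoc)
  next
    case 3
    show ?case
      using upt_add_eq_append[of k "k + p" "sum_list ps"] Cons(3) by (simp add: add.assoc)
  }
qed (simp_all add: add.assoc)

definition comp_start :: "multipartition \<Rightarrow> nat \<Rightarrow> nat" where
  "comp_start L c = 1 + sum_list (map sum_list (take c L))"

lemma initial_tableau_nth: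
  "c < length L \<Longrightarrow> initial_tableau L ! c = fill_rows (comp_start L c) (L ! c)"
proof -
  have "c < length L \<Longrightarrow> fill_components k L ! c = fill_rows (k + sum_list (map sum_list (take c L))) (L ! c)" for k
  proof (induction L arbitrary: k c)
    case (Cons \<rho> L)
    then show ?case
      by (cases c) (auto simp: add.assoc)
  qed simp
  then show "c < length L \<Longrightarrow> initial_tableau L ! c = fill_rows (comp_start L c) (L ! c)"
    by (simp add: initial_tableau_def comp_start_def)
qed

lemma shape_initial: "map (map length) (initial_tableau L) = L"
proof -
  have "map (map length) (fill_components k L) = L" for k
    by (induction L arbitrary: k) (simp_all add: fill_rows_props)
  then show ?thesis
    by (simp add: initial_tableau_def)
qed

lemma length_initial [simp]: "length (initial_tableau L) = length L"
  using shape_initial[of L] by (metis length_map)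

lemma concat_initial: "concat (concat (initial_tableau L)) = [1..<mp_size L + 1]"
proof -
  have "concat (concat (fill_components k L)) = [k..<k + mp_size L]" for k
  proof (induction L arbitrary: k)
    case (Cons \<rho> L)
    then show ?case
      using upt_add_eq_append[of k "k + sum_list \<rho>" "mp_size L"]
      by (simp add: fill_rows_props mp_size_def add.assoc)
  qed (simp add: mp_size_def)
  from this[of 1] show ?thesis
    by (simp add: initial_tableau_def add.commute)
qed

lemma is_multitableau_initial: "is_multitableau L (initial_tableau L)"
  unfolding is_multitableau_def shape_initial concat_initial by auto

lemmas bij_pos = bij_entry[OF is_multitableau_initial]

lemma pos_eq: "(c, i, j) \<in> nodes L \<Longrightarrow> pos L (c, i, j) = comp_start L c + sum_list (take i (L ! c)) + j"
  by (auto simp: nodes_def entry_def initial_tableau_nth fill_rows_props)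

lemma sum_list_take_mono: "i \<le> i' \<Longrightarrow> sum_list (take i xs) \<le> sum_list (take i' (xs :: nat list))"
  by (metis le_add1 le_add_diff_inverse sum_list_append take_add)

lemma sum_list_take_Suc: "i < length xs \<Longrightarrow> sum_list (take (Suc i) xs) = sum_list (take i xs) + (xs ! i :: nat)"
  by (simp add: take_Suc_conv_app_nth)

lemma pos_less_row: "(c, i, j) \<in> nodes L \<Longrightarrow> (c, i, j') \<in> nodes L \<Longrightarrow> j < j' \<Longrightarrow> pos L (c, i, j) < pos L (c, i, j')"
  by (simp add: pos_eq)

lemma pos_less_comp:
  assumes "(c, i, j) \<in> nodes L" "(c, i', j') \<in> nodes L" "i < i'"
  shows "pos L (c, i, j) < pos L (c, i', j')"
proof -
  have "sum_list (take i (L ! c)) + j < sum_list (take (Suc i) (L ! c))"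
    using assms by (auto simp: nodes_def sum_list_take_Suc)
  also have "\<dots> \<le> sum_list (take i' (L ! c))"
    using assms by (intro sum_list_take_mono) simp
  finally show ?thesis
    using assms by (simp add: pos_eq)
qed

lemma pos_less_iff:
  assumes "(c, i, j) \<in> nodes L" "(c, i', j') \<in> nodes L"
  shows "pos L (c, i, j) < pos L (c, i', j') \<longleftrightarrow> i < i' \<or> i = i' \<and> j < j'"
  using pos_less_comp[OF assms] pos_less_comp[OF assms(2,1)] assms by (auto simp: pos_eq not_less_iff_gr_or_eq)

lemma pos_inj: "x \<in> nodes L \<Longrightarrow> y \<in> nodes L \<Longrightarrow> pos L x = pos L y \<longleftrightarrow> x = y"
  using bij_pos[of L] by (auto simp: bij_betw_def inj_on_def)

lemma pos_range: "x \<in> nodes L \<Longrightarrow> pos L x \<in> {1..mp_size L}"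
  using bij_pos[of L] by (auto simp: bij_betw_def)

lemma pos_cases:
  assumes "a \<in> {1..mp_size L}"
  obtains c i j where "(c, i, j) \<in> nodes L" "a = pos L (c, i, j)"
proof -
  have "a \<in> pos L ` nodes L"
    using assms bij_pos[of L] by (simp add: bij_betw_def)
  then show ?thesis
    using that by auto
qed

text \<open>Two numberings of the same nodes differ by a unique permutation. The definite
  descriptions for tableaux, block exchanges and transposition are all justified by this.\<close>

lemma ex1_permutes:
  assumes "bij_betw P N S" "bij_betw Q N S"
  shows "\<exists>!w. w permutes S \<and> (\<forall>x\<in>N. w (P x) = Q x)"
proof (rule ex_ex1I)
  let ?w = "\<lambda>a. if a \<in> S then Q (inv_into N P a) else a"
  have "bij_betw (Q \<circ> inv_into N P) S S"
    using assms bij_betw_inv_into bij_betw_trans by blast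
  then have "bij_betw ?w S S"
    by (rule bij_betw_cong[THEN iffD1, rotated]) simp
  then have "?w permutes S"
    by (rule bij_imp_permutes) simp
  moreover have "?w (P x) = Q x" if "x \<in> N" for x
    using that assms(1) by (auto simp: bij_betw_def)
  ultimately show "\<exists>w. w permutes S \<and> (\<forall>x\<in>N. w (P x) = Q x)"
    by blast
next
  fix w w' assume w: "w permutes S \<and> (\<forall>x\<in>N. w (P x) = Q x)" "w' permutes S \<and> (\<forall>x\<in>N. w' (P x) = Q x)"
  show "w = w'"
  proof
    fix a
    show "w a = w' a"
    proof (cases "a \<in> S")
      case True
      then obtain x where "x \<in> N" "a = P x"
        using assms(1) by (auto simp: bij_betw_def)
      then show ?thesis
        using w by simp
    qed (use w in \<open>auto simp: permutes_def\<close>)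
  qed
qed

lemma permutes_eqI:
  assumes "w permutes {1..mp_size L}" "w' permutes {1..mp_size L}" "\<And>x. x \<in> nodes L \<Longrightarrow> w (pos L x) = w' (pos L x)"
  shows "w = w'"
proof
  fix a
  show "w a = w' a"
  proof (cases "a \<in> {1..mp_size L}")
    case True
    then obtain c i j where "(c, i, j) \<in> nodes L" "a = pos L (c, i, j)"
      by (rule pos_cases)
    then show ?thesis
      using assms(3) by simp
  qed (use assms(1,2) permutes_not_in in metis)
qed

section \<open>Tableaux as permutations, and row stabilizers\<close>

lemma act_eq_iff:
  assumes "map (map length) t = L"
  shows "t = act (initial_tableau L) w \<longleftrightarrow> (\<forall>x\<in>nodes L. w (pos L x) = entry t x)"
proof -
  have len: "length t = length L" "c < length L \<Longrightarrow> length (t ! c) = length (L ! c)"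
    "c < length L \<Longrightarrow> i < length (L ! c) \<Longrightarrow> length (t ! c ! i) = L ! c ! i" for c i
    using assms by auto
  have leni: "c < length L \<Longrightarrow> length (initial_tableau L ! c) = length (L ! c)"
    "c < length L \<Longrightarrow> i < length (L ! c) \<Longrightarrow> length (initial_tableau L ! c ! i) = L ! c ! i" for c i
    using shape_initial[of L] by (metis length_initial length_map nth_map)+
  show ?thesis
    unfolding act_def list_eq_iff_nth_eq
    by (auto simp: len leni nodes_def entry_def)
qed

lemma tableau_perm_props:
  assumes "is_multitableau L t"
  shows "tableau_perm L t permutes {1..mp_size L}"
    and "x \<in> nodes L \<Longrightarrow> tableau_perm L t (pos L x) = entry t x"
proof -
  have sh: "map (map length) t = L"
    using assms by (simp add: is_multitableau_def)
  have "tableau_perm L t permutes {1..mp_size L} \<and> (\<forall>x\<in>nodes L. tableau_perm L t (pos L x) = entry t x)"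
    unfolding tableau_perm_def act_eq_iff[OF sh] by (rule theI'[OF ex1_permutes[OF bij_pos bij_entry[OF assms]]])
  then show "tableau_perm L t permutes {1..mp_size L}"
    "x \<in> nodes L \<Longrightarrow> tableau_perm L t (pos L x) = entry t x"
    by auto
qed

lemma set_row_initial:
  assumes "c < length L" "i < length (L ! c)"
  shows "set (initial_tableau L ! c ! i) = {pos L (c, i, j) |j. (c, i, j) \<in> nodes L}"
proof -
  have "length (initial_tableau L ! c ! i) = L ! c ! i"
    using assms shape_initial[of L] by (metis length_initial length_map nth_map)
  then show ?thesis
    using assms unfolding set_conv_nth by (auto simp: nodes_def entry_def)
qed

text \<open>A permutation that maps a finite row into itself maps it onto itself, so membership can
  be tested node by node.\<close>

lemma row_stabilizer_iff:
  "w \<in> row_stabilizer L \<longleftrightarrow> w permutes {1..mp_size L} \<and>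
    (\<forall>c i j. (c, i, j) \<in> nodes L \<longrightarrow> (\<exists>j'. (c, i, j') \<in> nodes L \<and> w (pos L (c, i, j)) = pos L (c, i, j')))"
proof -
  define row where "row c i = {pos L (c, i, j) |j. (c, i, j) \<in> nodes L}" for c i
  have len: "length (initial_tableau L ! c) = length (L ! c)" if "c < length L" for c
    using that shape_initial[of L] by (metis length_initial length_map nth_map)
  have "(\<forall>c\<in>set (initial_tableau L). \<forall>r\<in>set c. w ` set r = set r) \<longleftrightarrow>
      (\<forall>c<length L. \<forall>i<length (L ! c). w ` row c i = row c i)"
    by (auto simp: all_set_conv_all_nth len set_row_initial row_def[symmetric])
  also have "\<dots> \<longleftrightarrow> (\<forall>c<length L. \<forall>i<length (L ! c). w ` row c i \<subseteq> row c i)" if "w permutes {1..mp_size L}"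
  proof -
    have "w ` row c i = row c i" if "w ` row c i \<subseteq> row c i" for c i
    proof (rule endo_inj_surj[OF _ that])
      show "finite (row c i)"
        by (rule finite_subset[of _ "pos L ` nodes L"]) (auto simp: row_def)
      show "inj_on w (row c i)"
        using permutes_inj[OF \<open>w permutes {1..mp_size L}\<close>] by (rule inj_on_subset) simp
    qed
    then show ?thesis
      by (metis order_refl)
  qed
  also have "(\<forall>c<length L. \<forall>i<length (L ! c). w ` row c i \<subseteq> row c i) \<longleftrightarrow>
    (\<forall>c i j. (c, i, j) \<in> nodes L \<longrightarrow> (\<exists>j'. (c, i, j') \<in> nodes L \<and> w (pos L (c, i, j)) = pos L (c, i, j')))"
    by (fastforce simp: nodes_def row_def)
  finally show ?thesis
    unfolding row_stabilizer_def by auto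
qed

lemma row_stabilizerD:
  assumes "w \<in> row_stabilizer L"
  shows "w permutes {1..mp_size L}"
    and "(c, i, j) \<in> nodes L \<Longrightarrow> \<exists>j'. (c, i, j') \<in> nodes L \<and> w (pos L (c, i, j)) = pos L (c, i, j')"
  using assms by (auto simp: row_stabilizer_iff)

lemma finite_row_stabilizer [simp]: "finite (row_stabilizer L)"
  by (rule finite_subset[of _ "{w. w permutes {1..mp_size L}}"]) (auto simp: row_stabilizer_def finite_permutations)

lemma row_stabilizer_id: "id \<in> row_stabilizer L"
  by (auto simp: row_stabilizer_def permutes_id)

lemma row_stabilizer_comp: "w \<in> row_stabilizer L \<Longrightarrow> w' \<in> row_stabilizer L \<Longrightarrow> w' \<circ> w \<in> row_stabilizer L"
  unfolding row_stabilizer_def mem_Collect_eq image_comp[symmetric] by (simp add: permutes_compose)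

lemma row_stabilizer_inv:
  assumes "w \<in> row_stabilizer L"
  shows "inv w \<in> row_stabilizer L"
proof -
  have w: "w permutes {1..mp_size L}"
    using assms by (simp add: row_stabilizer_def)
  have "inv w ` A = A" if "w ` A = A" for A
    using that permutes_inj[OF w] by (metis image_inv_f_f)
  then show ?thesis
    using assms permutes_inv[OF w] by (auto simp: row_stabilizer_def)
qed

subsection \<open>Rows\<close>

definition same_row :: "multipartition \<Rightarrow> nat \<Rightarrow> nat \<Rightarrow> bool" where
  "same_row L a b \<longleftrightarrow> (\<exists>c i j j'. (c, i, j) \<in> nodes L \<and> (c, i, j') \<in> nodes L \<and> a = pos L (c, i, j) \<and> b = pos L (c, i, j'))"

text \<open>The distinguished representatives of the cosets \<open>{w \<circ> h}\<close> with
  \<open>h\<close> in the row stabilizer; they are the permutations of row standard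
  tableaux.\<close>

definition row_increasing :: "multipartition \<Rightarrow> (nat \<Rightarrow> nat) \<Rightarrow> bool" where
  "row_increasing L w \<longleftrightarrow> (\<forall>a b. same_row L a b \<and> a < b \<longrightarrow> w a < w b)"

lemma same_row_pos:
  "(c, i, j) \<in> nodes L \<Longrightarrow> (c', i', j') \<in> nodes L \<Longrightarrow> same_row L (pos L (c, i, j)) (pos L (c', i', j')) \<longleftrightarrow> c = c' \<and> i = i'"
  unfolding same_row_def using pos_inj[of _ L] by blast

lemma same_row_stab:
  assumes "w \<in> row_stabilizer L" "a \<in> {1..mp_size L}"
  shows "same_row L a (w a)"
proof -
  obtain c i j where "(c, i, j) \<in> nodes L" "a = pos L (c, i, j)"
    using assms(2) by (rule pos_cases)
  then show ?thesis
    using row_stabilizerD(2)[OF assms(1)] same_row_pos by metis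
qed

lemma same_row_range: "same_row L a b \<Longrightarrow> a \<in> {1..mp_size L} \<and> b \<in> {1..mp_size L}"
  unfolding same_row_def using pos_range by blast

lemma same_row_sym: "same_row L a b \<Longrightarrow> same_row L b a"
  unfolding same_row_def by blast

lemma same_row_trans: "same_row L a b \<Longrightarrow> same_row L b d \<Longrightarrow> same_row L a d"
  unfolding same_row_def using pos_inj[of _ L] by (metis Pair_inject)

lemma same_row_refl: "a \<in> {1..mp_size L} \<Longrightarrow> same_row L a a"
  unfolding same_row_def by (metis pos_cases)

lemma row_stabilizerI:
  assumes "w permutes {1..mp_size L}" "\<And>a. a \<in> {1..mp_size L} \<Longrightarrow> same_row L a (w a)"
  shows "w \<in> row_stabilizer L"
  unfolding row_stabilizer_iff
proof (intro conjI allI impI assms(1))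
  fix c i j assume x: "(c, i, j) \<in> nodes L"
  then have "same_row L (pos L (c, i, j)) (w (pos L (c, i, j)))"
    using assms(2) pos_range by blast
  then show "\<exists>j'. (c, i, j') \<in> nodes L \<and> w (pos L (c, i, j)) = pos L (c, i, j')"
    unfolding same_row_def using x pos_inj[of _ L] by (metis Pair_inject)
qed

lemma row_standard_increasing:
  assumes t: "is_multitableau L t" and rs: "row_standard t"
  shows "row_increasing L (tableau_perm L t)"
  unfolding row_increasing_def
proof (intro allI impI, elim conjE)
  fix a b assume ab: "same_row L a b" "a < b"
  then obtain c i j j' where x: "(c, i, j) \<in> nodes L" "(c, i, j') \<in> nodes L" "a = pos L (c, i, j)" "b = pos L (c, i, j')"
    unfolding same_row_def by blast
  then have "j < j'"
    using ab(2) by (simp add: pos_eq)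
  have len: "c < length t" "i < length (t ! c)" "j' < length (t ! c ! i)"
    using x(2) t by (auto simp: nodes_def is_multitableau_def)
  have "sorted_wrt (<) (t ! c ! i)"
    by (rule rs[unfolded row_standard_def, rule_format, OF nth_mem[OF len(1)] nth_mem[OF len(2)]])
  then have "t ! c ! i ! j < t ! c ! i ! j'"
    using \<open>j < j'\<close> len by (simp add: sorted_wrt_nth_less)
  then show "tableau_perm L t a < tableau_perm L t b"
    using tableau_perm_props(2)[OF t x(1)] tableau_perm_props(2)[OF t x(2)] x by (simp add: entry_def)
qed

lemma increasing_row_standard:
  assumes w: "w permutes {1..mp_size L}" and inc: "row_increasing L w"
  shows "is_multitableau L (act (initial_tableau L) w)"
    and "row_standard (act (initial_tableau L) w)"
    and "tableau_perm L (act (initial_tableau L) w) = w"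
proof -
  let ?t = "act (initial_tableau L) w"
  have sh: "map (map length) ?t = L"
    using shape_initial[of L] by (simp add: act_def comp_def)
  have e: "entry ?t x = w (pos L x)" if "x \<in> nodes L" for x
    using that act_eq_iff[OF sh] by metis
  have "entry ?t ` nodes L = w ` pos L ` nodes L"
    using e by (auto simp: image_iff)
  also have "\<dots> = {1..mp_size L}"
    using bij_pos[of L] permutes_image[OF w] by (simp add: bij_betw_def)
  finally show m: "is_multitableau L ?t"
    by (simp add: is_multitableau_iff sh)
  show "tableau_perm L ?t = w"
    by (rule permutes_eqI[OF tableau_perm_props(1)[OF m] w]) (simp add: tableau_perm_props(2)[OF m] e)
  show "row_standard ?t"
    unfolding row_standard_def
  proof (intro ballI)
    fix T r assume "T \<in> set ?t" "r \<in> set T"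
    then obtain c i where ci: "c < length ?t" "i < length (?t ! c)" "r = ?t ! c ! i"
      by (metis in_set_conv_nth)
    have "r ! j < r ! j'" if "j < j'" "j' < length r" for j j'
    proof -
      have "length ?t = length L" "length (?t ! c) = length (L ! c)" "length (?t ! c ! i) = L ! c ! i"
        using ci sh by (metis length_map nth_map)+
      then have x: "(c, i, j) \<in> nodes L" "(c, i, j') \<in> nodes L"
        using ci that by (auto simp: nodes_def)
      then have "w (pos L (c, i, j)) < w (pos L (c, i, j'))"
        using inc that(1) pos_less_row[OF x] unfolding row_increasing_def same_row_def by blast
      then show ?thesis
        using e[OF x(1)] e[OF x(2)] ci(3) by (simp add: entry_def)
    qed
    then show "sorted_wrt (<) r"
      by (simp add: sorted_wrt_iff_nth_less)
  qed
qed

text \<open>Every row is sorted by the key \<open>w\<close>, and the result is read as a tableau.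
  Only injectivity of the key is assumed, because the minimal entries of components serve as a key
  later.\<close>

lemma ex_sort_rows:
  assumes w: "inj_on w {1..mp_size L}"
  shows "\<exists>h\<in>row_stabilizer L. row_increasing L (w \<circ> h)"
proof -
  define t where "t = map (map (sort_key w)) (initial_tableau L)"
  have sh: "map (map length) t = L"
    using shape_initial[of L] by (simp add: t_def comp_def)
  have "set (concat (concat t)) = set (concat (concat (initial_tableau L)))"
    by (simp add: t_def)
  then have m: "is_multitableau L t"
    using is_multitableau_initial[of L] sh entry_image[of t] entry_image[of "initial_tableau L"] shape_initial[of L]
    by (simp add: is_multitableau_iff)
  define h where "h = tableau_perm L t"
  note h = tableau_perm_props[OF m, folded h_def]
  have row: "set (t ! c ! i) = set (initial_tableau L ! c ! i)" "sorted (map w (t ! c ! i))"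
    "length (t ! c ! i) = L ! c ! i"
    if "c < length L" "i < length (L ! c)" for c i
  proof -
    have "i < length (initial_tableau L ! c)"
      using that shape_initial[of L] by (metis length_initial length_map nth_map)
    then show "set (t ! c ! i) = set (initial_tableau L ! c ! i)" "sorted (map w (t ! c ! i))"
      using that by (simp_all add: t_def)
    show "length (t ! c ! i) = L ! c ! i"
      using that sh by auto
  qed
  have "h \<in> row_stabilizer L"
    unfolding row_stabilizer_iff
  proof (intro conjI allI impI h(1))
    fix c i j assume x: "(c, i, j) \<in> nodes L"
    then have ci: "c < length L" "i < length (L ! c)" "j < length (t ! c ! i)"
      using row(3) by (auto simp: nodes_def)
    have "h (pos L (c, i, j)) \<in> set (t ! c ! i)"
      using h(2)[OF x] nth_mem[OF ci(3)] by (simp add: entry_def)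
    then show "\<exists>j'. (c, i, j') \<in> nodes L \<and> h (pos L (c, i, j)) = pos L (c, i, j')"
      using row(1)[OF ci(1,2)] set_row_initial[OF ci(1,2)] by auto
  qed
  moreover have "row_increasing L (w \<circ> h)"
    unfolding row_increasing_def
  proof (intro allI impI, elim conjE)
    fix a b assume ab: "same_row L a b" "a < b"
    then obtain c i j j' where x: "(c, i, j) \<in> nodes L" "(c, i, j') \<in> nodes L" "a = pos L (c, i, j)" "b = pos L (c, i, j')"
      unfolding same_row_def by blast
    then have "j < j'"
      using ab(2) by (simp add: pos_eq)
    have ci: "c < length L" "i < length (L ! c)" "j' < length (t ! c ! i)"
      using x(2) row(3) by (auto simp: nodes_def)
    have "h a = t ! c ! i ! j" "h b = t ! c ! i ! j'"
      using h(2)[OF x(1)] h(2)[OF x(2)] x(3,4) by (simp_all add: entry_def)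
    then have "w (h a) \<le> w (h b)"
      using sorted_nth_mono[OF row(2)[OF ci(1,2)], of j j'] \<open>j < j'\<close> ci by simp
    moreover have "h a \<noteq> h b"
      using ab(2) permutes_inj[OF h(1)] by (metis injD less_irrefl)
    moreover have "h a \<in> {1..mp_size L}" "h b \<in> {1..mp_size L}"
      using same_row_range[OF ab(1)] permutes_in_image[OF h(1)] by auto
    ultimately show "(w \<circ> h) a < (w \<circ> h) b"
      using w unfolding inj_on_def by (metis comp_apply le_neq_implies_less)
  qed
  ultimately show ?thesis
    by blast
qed

text \<open>Inside a class \<open>h\<close> cannot invert a pair, as \<open>f\<close> would have to
  increase and to decrease on its image; so it is an order preserving permutation of the class. The
  classes are rows in one application and runs of equal components in the other.\<close>

lemma increasing_on_classes_id:
  fixes h :: "nat \<Rightarrow> nat"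
  assumes h: "h permutes {1..m}" and cls: "\<And>a. a \<in> {1..m} \<Longrightarrow> \<kappa> (h a) = \<kappa> a"
    and f: "\<And>a b. a \<in> {1..m} \<Longrightarrow> b \<in> {1..m} \<Longrightarrow> \<kappa> a = \<kappa> b \<Longrightarrow> a < b \<Longrightarrow> f a < (f b :: nat)"
    and fh: "\<And>a b. a \<in> {1..m} \<Longrightarrow> b \<in> {1..m} \<Longrightarrow> \<kappa> a = \<kappa> b \<Longrightarrow> a < b \<Longrightarrow> f (h a) < f (h b)"
  shows "h = id"
proof
  fix a
  show "h a = id a"
  proof (cases "a \<in> {1..m}")
    case True
    let ?C = "{b \<in> {1..m}. \<kappa> b = \<kappa> a}"
    have hm: "h b \<in> {1..m}" if "b \<in> {1..m}" for b
      using that permutes_in_image[OF h] by blast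
    have "h ` ?C \<subseteq> ?C"
      using cls hm by auto
    then have "h ` ?C = ?C"
      using permutes_inj[OF h] by (intro endo_inj_surj) (auto intro: inj_on_subset)
    then have "bij_betw h ?C ?C"
      using permutes_inj[OF h] by (auto simp: bij_betw_def intro: inj_on_subset)
    moreover have "h b < h d" if bd: "b \<in> ?C" "d \<in> ?C" "b < d" for b d
    proof (rule ccontr)
      assume "\<not> h b < h d"
      moreover have "h b \<noteq> h d"
        using bd(3) permutes_inj[OF h] by (metis injD less_irrefl)
      ultimately have "f (h d) < f (h b)"
        using bd hm cls by (intro f) auto
      moreover have "f (h b) < f (h d)"
        using bd by (intro fh) auto
      ultimately show False
        by simp
    qed
    ultimately show ?thesis
      using strict_mono_permutes_id[of h ?C a] True by auto
  qed (use h in \<open>auto simp: permutes_def\<close>)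
qed

lemma row_increasing_stab_id:
  assumes h: "h \<in> row_stabilizer L" and inc: "row_increasing L w" "row_increasing L (w \<circ> h)"
  shows "h = id"
proof (rule increasing_on_classes_id[where m = "mp_size L" and f = w and \<kappa> = "\<lambda>a. {b. same_row L a b}"])
  show "h permutes {1..mp_size L}"
    using h by (rule row_stabilizerD)
  show "{b. same_row L (h a) b} = {b. same_row L a b}" if "a \<in> {1..mp_size L}" for a
    using same_row_stab[OF h that] same_row_sym same_row_trans by blast
  have s: "same_row L a b" if "b \<in> {1..mp_size L}" "{d. same_row L a d} = {d. same_row L b d}" for a b
    using that same_row_refl by blast
  show "w a < w b" if "a \<in> {1..mp_size L}" "b \<in> {1..mp_size L}" "{d. same_row L a d} = {d. same_row L b d}" "a < b" for a b
    using inc(1) s[OF that(2,3)] that(4) unfolding row_increasing_def by blast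
  show "w (h a) < w (h b)" if "a \<in> {1..mp_size L}" "b \<in> {1..mp_size L}" "{d. same_row L a d} = {d. same_row L b d}" "a < b" for a b
    using inc(2) s[OF that(2,3)] that(4) unfolding row_increasing_def by auto
qed

section \<open>Transposition\<close>

text \<open>The parts exceeding \<open>j\<close> form an initial segment of a partition, so their
  number tells which rows reach column \<open>j\<close>.\<close>

lemma conj_partition_nth:
  assumes "is_partition \<rho>" "j < length (conj_partition \<rho>)"
  shows "i < conj_partition \<rho> ! j \<longleftrightarrow> i < length \<rho> \<and> j < \<rho> ! i"
proof -
  have "i < length (filter (\<lambda>p. j < p) \<rho>) \<longleftrightarrow> i < length \<rho> \<and> j < \<rho> ! i" if "sorted_wrt (\<ge>) \<rho>"
    using that
  proof (induction \<rho> arbitrary: i)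
    case (Cons p \<rho>)
    show ?case
    proof (cases "j < p")
      case True
      then show ?thesis
        using Cons by (cases i) auto
    next
      case False
      then have "filter (\<lambda>p. j < p) \<rho> = []"
        using Cons.prems by (auto simp: filter_empty_conv)
      moreover have "\<not> (i < length (p # \<rho>) \<and> j < (p # \<rho>) ! i)"
        using False Cons.prems by (cases i) (fastforce dest: nth_mem)+
      ultimately show ?thesis
        using False by auto
    qed
  qed simp
  then show ?thesis
    using assms by (simp add: conj_partition_def is_partition_def)
qed

lemma hd_partition: "is_partition \<rho> \<Longrightarrow> i < length \<rho> \<Longrightarrow> \<rho> ! i \<le> hd \<rho>"
  by (cases \<rho>; cases i) (auto simp: is_partition_def)

lemma length_conj_partition: "length (conj_partition \<rho>) = (if \<rho> = [] then 0 else hd \<rho>)"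
  by (simp add: conj_partition_def)

abbreviation conj_mp :: "multipartition \<Rightarrow> multipartition" where
  "conj_mp L \<equiv> map conj_partition L"

lemma nodes_conj:
  assumes "\<forall>\<rho>\<in>set L. is_partition \<rho>"
  shows "(c, j, i) \<in> nodes (conj_mp L) \<longleftrightarrow> (c, i, j) \<in> nodes L"
proof (cases "c < length L")
  case True
  then have p: "is_partition (L ! c)"
    using assms by simp
  show ?thesis
  proof
    assume "(c, j, i) \<in> nodes (conj_mp L)"
    then show "(c, i, j) \<in> nodes L"
      using True conj_partition_nth[OF p] by (auto simp: nodes_def)
  next
    assume x: "(c, i, j) \<in> nodes L"
    then have "j < length (conj_partition (L ! c))"
      using hd_partition[OF p, of i] by (auto simp: nodes_def length_conj_partition)
    then show "(c, j, i) \<in> nodes (conj_mp L)"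
      using x True conj_partition_nth[OF p] by (auto simp: nodes_def)
  qed
qed (auto simp: nodes_def)

lemma bij_swap_nodes:
  assumes "\<forall>\<rho>\<in>set L. is_partition \<rho>"
  shows "bij_betw (\<lambda>(c, i, j). (c, j, i)) (nodes L) (nodes (conj_mp L))"
  by (rule bij_betw_byWitness[where f' = "\<lambda>(c, i, j). (c, j, i)"]) (use nodes_conj[OF assms] in auto)

lemma mp_size_conj: "\<forall>\<rho>\<in>set L. is_partition \<rho> \<Longrightarrow> mp_size (conj_mp L) = mp_size L"
  using bij_betw_same_card[OF bij_swap_nodes[of L]] by (simp add: card_nodes)

lemma sum_list_conj: "is_partition \<rho> \<Longrightarrow> sum_list (conj_partition \<rho>) = sum_list \<rho>"
  using mp_size_conj[of "[\<rho>]"] by (simp add: mp_size_def)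

text \<open>The permutation usually written w_\<lambda>, from the numbering along rows to the
  numbering along columns; the latter is the row numbering of the transposed shape.\<close>

definition conj_perm :: "multipartition \<Rightarrow> nat \<Rightarrow> nat" where
  "conj_perm L = (THE w. w permutes {1..mp_size L} \<and> (\<forall>(c, i, j)\<in>nodes L. w (pos L (c, i, j)) = pos (conj_mp L) (c, j, i)))"

lemma conj_perm:
  assumes "\<forall>\<rho>\<in>set L. is_partition \<rho>"
  shows "conj_perm L permutes {1..mp_size L}"
    and "(c, i, j) \<in> nodes L \<Longrightarrow> conj_perm L (pos L (c, i, j)) = pos (conj_mp L) (c, j, i)"
proof -
  let ?Q = "\<lambda>(c, i, j). pos (conj_mp L) (c, j, i)"
  have "bij_betw (pos (conj_mp L) \<circ> (\<lambda>(c, i, j). (c, j, i))) (nodes L) {1..mp_size L}"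
    using bij_betw_trans[OF bij_swap_nodes[OF assms] bij_pos] by (simp add: mp_size_conj[OF assms])
  then have "bij_betw ?Q (nodes L) {1..mp_size L}"
    by (simp add: comp_def case_prod_unfold)
  from theI'[OF ex1_permutes[OF bij_pos this]]
  have "conj_perm L permutes {1..mp_size L} \<and> (\<forall>(c, i, j)\<in>nodes L. conj_perm L (pos L (c, i, j)) = pos (conj_mp L) (c, j, i))"
    unfolding conj_perm_def by (simp add: case_prod_unfold)
  then show "conj_perm L permutes {1..mp_size L}"
    "(c, i, j) \<in> nodes L \<Longrightarrow> conj_perm L (pos L (c, i, j)) = pos (conj_mp L) (c, j, i)"
    by auto
qed

text \<open>Rows and columns of a diagram meet in at most one node.\<close>

lemma row_column_trivial:
  assumes L: "\<forall>\<rho>\<in>set L. is_partition \<rho>"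
    and p: "p \<in> row_stabilizer L" and r: "r \<in> row_stabilizer (conj_mp L)"
    and eq: "r \<circ> conj_perm L \<circ> p = conj_perm L"
  shows "p = id" "r = id"
proof -
  note w = conj_perm[OF L]
  have "p (pos L x) = pos L x" if x_in: "x \<in> nodes L" for x
  proof -
    obtain c i j where x: "x = (c, i, j)" "(c, i, j) \<in> nodes L"
      using x_in prod_cases3[of x] by metis
    then obtain j' where j': "(c, i, j') \<in> nodes L" "p (pos L x) = pos L (c, i, j')"
      using row_stabilizerD(2)[OF p] by blast
    have "(c, j', i) \<in> nodes (conj_mp L)"
      using j' nodes_conj[OF L] by blast
    then obtain i' where i': "(c, j', i') \<in> nodes (conj_mp L)"
      "r (pos (conj_mp L) (c, j', i)) = pos (conj_mp L) (c, j', i')"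
      using row_stabilizerD(2)[OF r] by blast
    have "pos (conj_mp L) (c, j', i') = pos (conj_mp L) (c, j, i)"
      using fun_cong[OF eq, of "pos L x"] x j' i' w(2) by simp
    moreover have "(c, j, i) \<in> nodes (conj_mp L)"
      using x(2) nodes_conj[OF L] by blast
    ultimately have "j' = j"
      using i'(1) pos_inj[of _ "conj_mp L"] by blast
    then show ?thesis
      using j' x by simp
  qed
  then show "p = id"
    using permutes_eqI[OF row_stabilizerD(1)[OF p] permutes_id] by simp
  then have "r \<circ> conj_perm L = conj_perm L"
    using eq by simp
  then show "r = id"
    using permutes_surj[OF w(1)] by (metis comp_apply eq_id_iff surjD)
qed

text \<open>The rows of a partition do not get longer, so all nodes of the column between the two
  exist and the comparisons of neighbouring rows can be chained.\<close>

lemma col_standard_less: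
  assumes L: "\<forall>\<rho>\<in>set L. is_partition \<rho>" and t: "is_multitableau L t" "col_standard t"
    and x: "(c, i, j) \<in> nodes L" "(c, i', j) \<in> nodes L" "i < i'"
  shows "entry t (c, i, j) < entry t (c, i', j)"
  using x(3,2)
proof (induction i')
  case (Suc i')
  have len: "length t = length L" "length (t ! c) = length (L ! c)" "k < length (L ! c) \<Longrightarrow> length (t ! c ! k) = L ! c ! k" for k
    using t(1) Suc.prems by (auto simp: is_multitableau_def nodes_def)
  have c: "c < length L" "Suc i' < length (L ! c)" "j < L ! c ! Suc i'"
    using Suc.prems by (auto simp: nodes_def)
  have step: "entry t (c, i', j) < entry t (c, Suc i', j)"
    using t(2) c len nth_mem[of c t] unfolding col_standard_def entry_def by auto
  have "sorted_wrt (\<ge>) (L ! c)"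
    using L c(1) by (simp add: is_partition_def)
  then have "L ! c ! Suc i' \<le> L ! c ! i'"
    using c(2) by (metis lessI sorted_wrt_nth_less)
  then have "(c, i', j) \<in> nodes L"
    using c by (auto simp: nodes_def)
  then show ?case
    using Suc step by (cases "i = i'") auto
qed simp

lemma transpose_shape:
  assumes "is_partition (map length T)"
  shows "map length (List.transpose T) = conj_partition (map length T)"
    and "i < length T \<Longrightarrow> j < length (T ! i) \<Longrightarrow> List.transpose T ! j ! i = T ! i ! j"
proof -
  have s: "sorted (rev (map length T))"
    using assms by (simp add: is_partition_def sorted_wrt_rev)
  have len: "length (List.transpose T) = (if T = [] then 0 else length (T ! 0))"
    by (rule length_transpose_sorted[OF s])
  show "map length (List.transpose T) = conj_partition (map length T)"
    by (rule nth_equalityI)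
      (auto simp: len nth_transpose conj_partition_def filter_map comp_def hd_map hd_conv_nth)
  assume ij: "i < length T" "j < length (T ! i)"
  have "length (T ! i) \<le> hd (map length T)"
    using hd_partition[OF assms, of i] ij by simp
  then have "j < length (List.transpose T)"
    using ij len by (cases T) auto
  moreover have "i < length (filter (\<lambda>ys. j < length ys) T)"
    using conj_partition_nth[OF assms, of j i] ij \<open>length (T ! i) \<le> hd (map length T)\<close>
    by (cases T) (auto simp: conj_partition_def filter_map comp_def)
  ultimately show "List.transpose T ! j ! i = T ! i ! j"
    by (rule nth_nth_transpose_sorted[OF s])
qed

lemma conj_multitableau:
  assumes L: "\<forall>\<rho>\<in>set L. is_partition \<rho>" and t: "is_multitableau L t"
  shows "is_multitableau (conj_mp L) (map List.transpose t)"
    and "(c, i, j) \<in> nodes L \<Longrightarrow> entry (map List.transpose t) (c, j, i) = entry t (c, i, j)"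
proof -
  have sh: "map (map length) t = L"
    using t by (simp add: is_multitableau_def)
  have p: "is_partition (map length (t ! c))" if "c < length t" for c
    using that L sh by auto
  have sh': "map (map length) (map List.transpose t) = conj_mp L"
    unfolding sh[symmetric] by (rule nth_equalityI) (auto simp: transpose_shape[OF p])
  have e: "entry (map List.transpose t) (c, j, i) = entry t (c, i, j)" if "(c, i, j) \<in> nodes L" for c i j
    using that sh transpose_shape(2)[OF p, of c i j] by (auto simp: entry_def nodes_def)
  then show "(c, i, j) \<in> nodes L \<Longrightarrow> entry (map List.transpose t) (c, j, i) = entry t (c, i, j)" .
  have "entry (map List.transpose t) ` nodes (conj_mp L) = entry t ` nodes L"
  proof -
    have "nodes (conj_mp L) = (\<lambda>(c, i, j). (c, j, i)) ` nodes L"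
      using bij_swap_nodes[OF L] by (simp add: bij_betw_def)
    then show ?thesis
      by (simp only: image_image) (rule image_cong[OF refl], auto simp: e)
  qed
  then show "is_multitableau (conj_mp L) (map List.transpose t)"
    using t by (simp only: is_multitableau_iff sh' mp_size_conj[OF L])
qed

text \<open>A node and its transpose hold the same entry. Hence d(t) followed by the inverse of
  d(t') is w_\<lambda> for every \<open>t\<close>, which is where the dependence on the tableau
  disappears.\<close>

lemma conj_tableau_perm:
  assumes L: "\<forall>\<rho>\<in>set L. is_partition \<rho>" and t: "is_multitableau L t"
  shows "tableau_perm (conj_mp L) (map List.transpose t) permutes {1..mp_size L}"
    and "inv (tableau_perm (conj_mp L) (map List.transpose t)) \<circ> tableau_perm L t = conj_perm L"
proof -
  let ?d = "tableau_perm L t" and ?d' = "tableau_perm (conj_mp L) (map List.transpose t)"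
  note t' = conj_multitableau[OF L t]
  show d': "?d' permutes {1..mp_size L}"
    using tableau_perm_props(1)[OF t'(1)] by (simp add: mp_size_conj[OF L])
  show "inv ?d' \<circ> ?d = conj_perm L"
  proof (rule permutes_eqI)
    show "inv ?d' \<circ> ?d permutes {1..mp_size L}"
      by (rule permutes_compose[OF tableau_perm_props(1)[OF t] permutes_inv[OF d']])
    show "conj_perm L permutes {1..mp_size L}"
      by (rule conj_perm(1)[OF L])
    fix x assume "x \<in> nodes L"
    then obtain c i j where x: "x = (c, i, j)" "(c, i, j) \<in> nodes L"
      using prod_cases3 by metis
    have "?d' (pos (conj_mp L) (c, j, i)) = ?d (pos L x)"
      using x nodes_conj[OF L] t'(2) tableau_perm_props(2)[OF t'(1)] tableau_perm_props(2)[OF t] by simp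
    then show "(inv ?d' \<circ> ?d) (pos L x) = conj_perm L (pos L x)"
      using x conj_perm(2)[OF L] permutes_inverses[OF d'] by (metis comp_apply)
  qed
qed

section \<open>Components\<close>

text \<open>The colouring used for the action; components are counted from 0, like list
  positions.\<close>

definition comp_of :: "multipartition \<Rightarrow> nat \<Rightarrow> nat" where
  "comp_of L a = fst (inv_into (nodes L) (pos L) a)"

lemma comp_of_pos: "(c, i, j) \<in> nodes L \<Longrightarrow> comp_of L (pos L (c, i, j)) = c"
  using bij_betw_inv_into_left[OF bij_pos] by (simp add: comp_of_def)

definition comp_positions :: "multipartition \<Rightarrow> nat \<Rightarrow> nat set" where
  "comp_positions L c = {pos L (c, i, j) |i j. (c, i, j) \<in> nodes L}"

lemma comp_positions_iff: "a \<in> comp_positions L c \<longleftrightarrow> a \<in> {1..mp_size L} \<and> comp_of L a = c"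
proof
  assume "a \<in> {1..mp_size L} \<and> comp_of L a = c"
  then show "a \<in> comp_positions L c"
    using comp_of_pos unfolding comp_positions_def by (metis (mono_tags, lifting) mem_Collect_eq pos_cases)
qed (auto simp: comp_positions_def comp_of_pos dest: pos_range simp del: atLeastAtMost_iff)

lemma entries_eq:
  assumes "map (map length) t = L" "c < length L"
  shows "entries (t ! c) = {entry t (c, i, j) |i j. (c, i, j) \<in> nodes L}"
proof -
  have len: "length (t ! c) = length (L ! c)" "i < length (L ! c) \<Longrightarrow> length (t ! c ! i) = L ! c ! i" for i
    using assms by auto
  show ?thesis
  proof (intro equalityI subsetI)
    fix a assume "a \<in> entries (t ! c)"
    then obtain i j where "i < length (t ! c)" "j < length (t ! c ! i)" "a = t ! c ! i ! j"
      unfolding entries_def by (auto simp: in_set_conv_nth)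
    then show "a \<in> {entry t (c, i, j) |i j. (c, i, j) \<in> nodes L}"
      using assms(2) len by (auto simp: nodes_def entry_def)
  next
    fix a assume "a \<in> {entry t (c, i, j) |i j. (c, i, j) \<in> nodes L}"
    then obtain i j where "i < length (t ! c)" "j < length (t ! c ! i)" "a = t ! c ! i ! j"
      using len by (auto simp: nodes_def entry_def)
    then show "a \<in> entries (t ! c)"
      unfolding entries_def by (metis UN_I nth_mem set_concat)
  qed
qed

lemma entries_initial: "c < length L \<Longrightarrow> entries (initial_tableau L ! c) = comp_positions L c"
  unfolding comp_positions_def by (rule entries_eq[OF shape_initial])

lemma entries_image:
  assumes "is_multitableau L t" "c < length L"
  shows "entries (t ! c) = tableau_perm L t ` comp_positions L c"
proof -
  have "{entry t (c, i, j) |i j. (c, i, j) \<in> nodes L} = {tableau_perm L t (pos L (c, i, j)) |i j. (c, i, j) \<in> nodes L}"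
    using tableau_perm_props(2)[OF assms(1)] by (intro Collect_cong) metis
  moreover have "map (map length) t = L"
    using assms(1) by (simp add: is_multitableau_def)
  ultimately show ?thesis
    using entries_eq[of t L c] assms(2) by (auto simp: comp_positions_def)
qed

lemma comp_positions_interval:
  assumes "c < length L"
  shows "comp_positions L c = {comp_start L c..<comp_start L c + sum_list (L ! c)}"
proof -
  have "entries (initial_tableau L ! c) = {comp_start L c..<comp_start L c + sum_list (L ! c)}"
    by (simp add: entries_def initial_tableau_nth[OF assms] fill_rows_props(3) del: set_concat)
  then show ?thesis
    using entries_initial[OF assms] by simp
qed

lemma comp_of_less: "a \<in> {1..mp_size L} \<Longrightarrow> comp_of L a < length L"
  by (elim pos_cases) (auto simp: comp_of_pos nodes_def)

lemma partition_on_blocks: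
  "partition_on {1..mp_size L} (block_partition L)"
  and same_block_blocks: "same_block (block_partition L) a b \<longleftrightarrow>
    a \<in> {1..mp_size L} \<and> b \<in> {1..mp_size L} \<and> comp_of L a = comp_of L b"
proof -
  have B: "block_partition L = comp_positions L ` {..<length L} - {{}}"
    unfolding block_partition_def
    by (auto simp: set_conv_nth entries_initial image_iff) (metis entries_initial length_initial nth_mem)+
  show sb: "same_block (block_partition L) a b \<longleftrightarrow>
    a \<in> {1..mp_size L} \<and> b \<in> {1..mp_size L} \<and> comp_of L a = comp_of L b" for a b
  proof
    assume "a \<in> {1..mp_size L} \<and> b \<in> {1..mp_size L} \<and> comp_of L a = comp_of L b"
    then have "a \<in> comp_positions L (comp_of L a)" "b \<in> comp_positions L (comp_of L a)" "comp_of L a < length L"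
      using comp_of_less by (simp_all add: comp_positions_iff)
    then show "same_block (block_partition L) a b"
      unfolding same_block_def B by blast
  qed (auto simp: same_block_def B comp_positions_iff)
  show "partition_on {1..mp_size L} (block_partition L)"
  proof (rule partition_onI)
    have "a \<in> \<Union>(block_partition L) \<longleftrightarrow> a \<in> {1..mp_size L}" for a
      using sb[of a a] by (auto simp: same_block_def)
    then show "\<Union>(block_partition L) = {1..mp_size L}"
      by blast
    show "disjnt X Y" if "X \<in> block_partition L" "Y \<in> block_partition L" "X \<noteq> Y" for X Y
      using that unfolding B disjnt_def by (auto simp: comp_positions_iff)
  qed (simp add: B)
qed

text \<open>Transposition preserves the size of every component and therefore the interval of
  positions it occupies, so both shapes have the same colours and the same idempotent.\<close>

lemma conj_components:
  assumes L: "\<forall>\<rho>\<in>set L. is_partition \<rho>"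
  shows "c < length L \<Longrightarrow> comp_positions (conj_mp L) c = comp_positions L c"
    and "a \<in> {1..mp_size L} \<Longrightarrow> comp_of (conj_mp L) a = comp_of L a"
    and "block_partition (conj_mp L) = block_partition L"
proof -
  have *: "comp_positions (conj_mp L) c = comp_positions L c" if "c < length L" for c
  proof -
    have "map (sum_list \<circ> conj_partition) (take c L) = map sum_list (take c L)"
      using L by (auto dest: in_set_takeD simp: sum_list_conj)
    then have "comp_start (conj_mp L) c = comp_start L c"
      by (simp only: comp_start_def take_map map_map)
    then show ?thesis
      using that L by (simp add: comp_positions_interval sum_list_conj)
  qed
  then show "c < length L \<Longrightarrow> comp_positions (conj_mp L) c = comp_positions L c" .
  show "comp_of (conj_mp L) a = comp_of L a" if "a \<in> {1..mp_size L}"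
    using *[of "comp_of L a"] comp_of_less[OF that] that comp_positions_iff by metis
  have "block_partition L = comp_positions L ` {..<length L} - {{}}" for L
    unfolding block_partition_def
    by (auto simp: set_conv_nth entries_initial image_iff) (metis entries_initial length_initial nth_mem)+
  then show "block_partition (conj_mp L) = block_partition L"
    using * by simp
qed

lemma conj_perm_comp:
  assumes L: "\<forall>\<rho>\<in>set L. is_partition \<rho>" and a: "a \<in> {1..mp_size L}"
  shows "comp_of L (conj_perm L a) = comp_of L a"
proof -
  obtain c i j where x: "(c, i, j) \<in> nodes L" "a = pos L (c, i, j)"
    using a by (rule pos_cases)
  then have "(c, j, i) \<in> nodes (conj_mp L)"
    using nodes_conj[OF L] by blast
  moreover from this have "pos (conj_mp L) (c, j, i) \<in> {1..mp_size L}"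
    using pos_range mp_size_conj[OF L] by metis
  ultimately show ?thesis
    using x conj_perm(2)[OF L x(1)] conj_components(2)[OF L] comp_of_pos by metis
qed

lemma row_stabilizer_comp_of:
  assumes "w \<in> row_stabilizer L" "a \<in> {1..mp_size L}"
  shows "comp_of L (w a) = comp_of L a"
proof -
  obtain c i j where x: "(c, i, j) \<in> nodes L" "a = pos L (c, i, j)"
    using assms(2) by (rule pos_cases)
  then show ?thesis
    using row_stabilizerD(2)[OF assms(1) x(1)] comp_of_pos by metis
qed

section \<open>Runs of equal components\<close>

text \<open>The hypothesis says that equal entries are contiguous, so the list is the concatenation
  of its runs.\<close>

lemma concat_replicate_remdups_adj:
  "distinct (remdups_adj xs) \<Longrightarrow> concat (map (\<lambda>y. replicate (count_list xs y) y) (remdups_adj xs)) = xs"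
proof (induction xs rule: remdups_adj.induct)
  case (3 x y xs)
  have cong: "map (\<lambda>z. replicate (count_list (x # y # xs) z) z) zs = map (\<lambda>z. replicate (count_list (y # xs) z) z) zs"
    if "x \<notin> set zs" for zs
    using that by (intro map_cong) auto
  show ?case
  proof (cases "x = y")
    case True
    obtain zs where zs: "remdups_adj (y # xs) = y # zs"
      by (metis hd_Cons_tl hd_remdups_adj list.distinct(1) list.sel(1) remdups_adj_Nil_iff)
    have d: "distinct (remdups_adj (y # xs))"
      using 3(3) True by simp
    then have y: "y \<notin> set zs"
      unfolding zs by simp
    have "replicate (count_list (y # xs) y) y @ concat (map (\<lambda>z. replicate (count_list (y # xs) z) z) zs) = y # xs"
      using 3(1)[OF True] d True unfolding True zs list.map concat.simps by blast
    then have "replicate (Suc (count_list (y # xs) y)) y @ concat (map (\<lambda>z. replicate (count_list (x # y # xs) z) z) zs) = y # y # xs"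
    proof -
      have "map (\<lambda>z. replicate (count_list (x # y # xs) z) z) zs = map (\<lambda>z. replicate (count_list (y # xs) z) z) zs"
        by (rule cong) (use y True in simp)
      then show ?thesis
        using \<open>replicate (count_list (y # xs) y) y @ _ = _\<close> by (simp only: replicate_Suc append_Cons)
    qed
    moreover have "remdups_adj (x # y # xs) = y # zs" "count_list (x # y # xs) y = Suc (count_list (y # xs) y)"
      using True zs by simp_all
    ultimately show ?thesis
      using True by (simp only: list.map concat.simps)
  next
    case False
    then have "x \<notin> set (y # xs)" "distinct (remdups_adj (y # xs))"
      using 3(3) by auto
    then have x: "x \<notin> set (y # xs)" and IH: "concat (map (\<lambda>z. replicate (count_list (y # xs) z) z) (remdups_adj (y # xs))) = y # xs"
      by (simp, intro 3(2)[OF False]) simp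
    have c1: "count_list (x # y # xs) x = 1"
      using x by (auto simp: count_list_0_iff)
    have c: "map (\<lambda>z. replicate (count_list (x # y # xs) z) z) (remdups_adj (y # xs)) =
        map (\<lambda>z. replicate (count_list (y # xs) z) z) (remdups_adj (y # xs))"
      using x by (intro cong) simp
    have "remdups_adj (x # y # xs) = x # remdups_adj (y # xs)"
      using False by simp
    then show ?thesis
      by (simp only: list.map concat.simps c IH c1) simp
  qed
qed simp_all

lemma nth_concat_replicate:
  "k < length ys \<Longrightarrow> x < m (ys ! k) \<Longrightarrow>
    concat (map (\<lambda>y. replicate (m y) y) ys) ! (sum_list (take k (map m ys)) + x) = ys ! k"
proof (induction ys arbitrary: k)
  case (Cons y ys)
  then show ?case
    by (cases k) (auto simp: nth_append)
qed simp

text \<open>Positions in the initial tableau of \<open>M\<close> number the components of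
  \<open>L\<close>, and the components of \<open>M\<close> are the runs of equal ones. Positions
  count from 1 and list indices from 0, hence \<open>a - 1\<close>.\<close>

lemma run_component:
  assumes dist: "distinct (remdups_adj L)" and M: "map sum_list M = multiplicities L"
    and a: "a \<in> {1..mp_size M}"
  shows "comp_of M a < length (remdups_adj L)" "L ! (a - 1) = remdups_adj L ! comp_of M a"
proof -
  let ?D = "remdups_adj L" and ?m = "count_list L"
  have mult: "map sum_list M = map ?m ?D"
    using M by (simp add: multiplicities_def)
  then have len: "length M = length ?D"
    by (metis length_map)
  show k: "comp_of M a < length ?D"
    using comp_of_less[OF a] len by simp
  let ?k = "comp_of M a"
  have "a \<in> comp_positions M ?k"
    using a by (simp add: comp_positions_iff)
  then have "comp_start M ?k \<le> a" "a < comp_start M ?k + sum_list (M ! ?k)"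
    using comp_positions_interval[of ?k M] k len by auto
  then obtain x where x: "a = comp_start M ?k + x" "x < sum_list (M ! ?k)"
    by (metis le_add_diff_inverse nat_add_left_cancel_less)
  have "sum_list (M ! ?k) = ?m (?D ! ?k)"
    using mult k len by (metis nth_map)
  then have "x < ?m (?D ! ?k)"
    using x(2) by simp
  note nth = nth_concat_replicate[OF k, of x ?m, OF this, unfolded concat_replicate_remdups_adj[OF dist]]
  have "comp_start M ?k = 1 + sum_list (take ?k (map ?m ?D))"
    by (simp add: comp_start_def take_map[symmetric] mult)
  then have "a - 1 = sum_list (take ?k (map ?m ?D)) + x"
    using x(1) by linarith
  then show "L ! (a - 1) = ?D ! ?k"
    by (simp only: nth)
qed

lemma mp_size_runs:
  assumes "distinct (remdups_adj L)" "map sum_list M = multiplicities L"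
  shows "mp_size M = length L"
proof -
  have "length L = length (concat (map (\<lambda>y. replicate (count_list L y) y) (remdups_adj L)))"
    using concat_replicate_remdups_adj[OF assms(1)] by simp
  then show ?thesis
    using assms(2) by (simp add: mp_size_def multiplicities_def length_concat comp_def)
qed

text \<open>Only the component sizes of \<open>M\<close> enter, so this serves both the given shape
  and an auxiliary shape with one row for each run.\<close>

lemma same_run_iff:
  assumes dist: "distinct (remdups_adj L)" and M: "map sum_list M = multiplicities L"
    and ab: "a \<in> {1..length L}" "b \<in> {1..length L}"
  shows "L ! (a - 1) = L ! (b - 1) \<longleftrightarrow> comp_of M a = comp_of M b"
  using run_component[OF dist M, of a] run_component[OF dist M, of b] ab mp_size_runs[OF dist M] dist
  by (metis nth_eq_iff_index_eq)

lemma distinct_remdups_adj_sorted: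
  assumes "sorted_wrt (\<lambda>x y. (x, y) \<in> R) xs" "antisym R"
  shows "distinct (remdups_adj xs)"
  using assms(1)
proof (induction xs rule: remdups_adj.induct)
  case (3 x y xs)
  show ?case
  proof (cases "x = y")
    case False
    have "x \<notin> set (y # xs)"
      using 3(3) False assms(2) by (auto dest: antisymD)
    then show ?thesis
      using 3(2)[OF False] 3(3) False by simp
  qed (use 3 in auto)
qed simp_all

section \<open>Permutations of equal components\<close>

text \<open>The group of permutations of the indices of equal components, described by
  \<open>L\<close> alone. The shifts by one translate indices counted from 1 into list
  positions.\<close>

definition comp_stabilizer :: "multipartition \<Rightarrow> (nat \<Rightarrow> nat) set" where
  "comp_stabilizer L = {p. p permutes {1..length L} \<and> (\<forall>j\<in>{1..length L}. L ! (p j - 1) = L ! (j - 1))}"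

lemma comp_stabilizer_id: "id \<in> comp_stabilizer L"
  by (simp add: comp_stabilizer_def permutes_id)

lemma comp_stabilizer_comp:
  assumes "p \<in> comp_stabilizer L" "p' \<in> comp_stabilizer L"
  shows "p' \<circ> p \<in> comp_stabilizer L"
proof -
  have "p j \<in> {1..length L}" if "j \<in> {1..length L}" for j
    using that assms(1) permutes_in_image by (fastforce simp: comp_stabilizer_def)
  then show ?thesis
    using assms by (auto simp: comp_stabilizer_def intro: permutes_compose)
qed

lemma comp_stabilizer_inv:
  assumes "p \<in> comp_stabilizer L"
  shows "inv p \<in> comp_stabilizer L"
proof -
  have p: "p permutes {1..length L}" "\<And>j. j \<in> {1..length L} \<Longrightarrow> L ! (p j - 1) = L ! (j - 1)"
    using assms by (auto simp: comp_stabilizer_def)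
  have "inv p j \<in> {1..length L}" if "j \<in> {1..length L}" for j
    using that permutes_in_image[OF permutes_inv[OF p(1)]] by blast
  then have "L ! (inv p j - 1) = L ! (j - 1)" if "j \<in> {1..length L}" for j
    using p(2)[of "inv p j"] that permutes_inverses[OF p(1)] by simp
  then show ?thesis
    using permutes_inv[OF p(1)] by (simp add: comp_stabilizer_def)
qed

lemma comp_stabilizer_node:
  assumes "p \<in> comp_stabilizer L" "(c, i, j) \<in> nodes L"
  shows "(p (Suc c) - 1, i, j) \<in> nodes L" "p (Suc c) \<in> {1..length L}"
proof -
  have c: "Suc c \<in> {1..length L}"
    using assms(2) by (auto simp: nodes_def)
  then show r: "p (Suc c) \<in> {1..length L}"
    using assms(1) permutes_in_image by (fastforce simp: comp_stabilizer_def)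
  have "L ! (p (Suc c) - 1) = L ! c"
    using assms(1) c by (auto simp: comp_stabilizer_def)
  then show "(p (Suc c) - 1, i, j) \<in> nodes L"
    using assms(2) r by (auto simp: nodes_def)
qed

lemma bij_comp_nodes:
  assumes p: "p \<in> comp_stabilizer L"
  shows "bij_betw (\<lambda>(c, i, j). (p (Suc c) - 1, i, j)) (nodes L) (nodes L)"
proof -
  let ?f = "\<lambda>(c, i, j). (p (Suc c) - 1, i, j)"
  have "inj_on ?f (nodes L)"
  proof (rule inj_onI)
    fix x y assume xy: "x \<in> nodes L" "y \<in> nodes L" "?f x = ?f y"
    obtain c i j d k l where e: "x = (c, i, j)" "y = (d, k, l)"
      using prod_cases3 by metis
    have "p (Suc c) \<in> {1..length L}" "p (Suc d) \<in> {1..length L}"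
      using comp_stabilizer_node(2)[OF p] xy e by blast+
    moreover have "p (Suc c) - 1 = p (Suc d) - 1"
      using xy(3) e by simp
    ultimately have "p (Suc c) = p (Suc d)"
      by auto
    then have "c = d"
      using p permutes_inj by (fastforce simp: comp_stabilizer_def dest: injD)
    then show "x = y"
      using xy(3) e by simp
  qed
  moreover have "?f ` nodes L \<subseteq> nodes L"
    using comp_stabilizer_node(1)[OF p] by auto
  ultimately show ?thesis
    by (simp add: bij_betw_def endo_inj_surj)
qed

lemma block_eq: "j \<in> {1..length L} \<Longrightarrow> block L j = comp_positions L (j - 1)"
  unfolding block_def by (rule entries_initial) auto

text \<open>The \<open>k\<close>-th element of a block is the \<open>k\<close>-th node of its
  component in reading order, and components of equal shape have the same nodes. Exchanging blocks
  therefore moves components node by node.\<close>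

lemma block_perm:
  assumes p: "p \<in> comp_stabilizer L"
  shows "block_perm L p permutes {1..mp_size L}"
    and "(c, i, j) \<in> nodes L \<Longrightarrow> block_perm L p (pos L (c, i, j)) = pos L (p (Suc c) - 1, i, j)"
proof -
  let ?Q = "\<lambda>(c, i, j). pos L (p (Suc c) - 1, i, j)"
  have bij: "bij_betw ?Q (nodes L) {1..mp_size L}"
    using bij_betw_trans[OF bij_comp_nodes[OF p] bij_pos] by (simp add: comp_def case_prod_unfold)
  have pj: "p k \<in> {1..length L}" "L ! (p k - 1) = L ! (k - 1)" if "k \<in> {1..length L}" for k
    using p that permutes_in_image by (fastforce simp: comp_stabilizer_def)+
  have sorted: "x < sum_list (L ! (k - 1)) \<Longrightarrow> sorted_list_of_set (block L k) ! x = comp_start L (k - 1) + x"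
    and card: "card (block L k) = sum_list (L ! (k - 1))"
    if "k \<in> {1..length L}" for k x
  proof -
    have "k - 1 < length L"
      using that by auto
    then have "block L k = {comp_start L (k - 1)..<comp_start L (k - 1) + sum_list (L ! (k - 1))}"
      using comp_positions_interval block_eq[OF that] by simp
    then show "x < sum_list (L ! (k - 1)) \<Longrightarrow> sorted_list_of_set (block L k) ! x = comp_start L (k - 1) + x"
      "card (block L k) = sum_list (L ! (k - 1))"
      by simp_all
  qed
  have sumlt: "sum_list (take i (L ! c)) + j < sum_list (L ! c)" if "(c, i, j) \<in> nodes L" for c i j
  proof -
    have "sum_list (take i (L ! c)) + j < sum_list (take (Suc i) (L ! c))"
      using that by (auto simp: nodes_def sum_list_take_Suc)
    also have "\<dots> \<le> sum_list (take (length (L ! c)) (L ! c))"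
      using that by (intro sum_list_take_mono) (auto simp: nodes_def)
    finally show ?thesis by simp
  qed
  have iff: "(\<forall>k\<in>{1..length L}. \<forall>x<card (block L k).
        b (sorted_list_of_set (block L k) ! x) = sorted_list_of_set (block L (p k)) ! x) \<longleftrightarrow>
      (\<forall>x\<in>nodes L. b (pos L x) = ?Q x)" for b :: "nat \<Rightarrow> nat"
  proof
    assume b: "\<forall>k\<in>{1..length L}. \<forall>x<card (block L k).
        b (sorted_list_of_set (block L k) ! x) = sorted_list_of_set (block L (p k)) ! x"
    show "\<forall>x\<in>nodes L. b (pos L x) = ?Q x"
    proof
      fix y assume "y \<in> nodes L"
      then obtain c i j where y: "y = (c, i, j)" "(c, i, j) \<in> nodes L"
        using prod_cases3 by metis
      have c: "Suc c \<in> {1..length L}"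
        using y by (auto simp: nodes_def)
      let ?x = "sum_list (take i (L ! c)) + j"
      have "b (comp_start L c + ?x) = comp_start L (p (Suc c) - 1) + ?x"
        using b[rule_format, OF c, of ?x] sumlt[OF y(2)] sorted[OF c, of ?x] sorted[OF pj(1)[OF c], of ?x] card[OF c] pj(2)[OF c]
        by simp
      then show "b (pos L y) = ?Q y"
        using y pos_eq[OF y(2)] pos_eq[OF comp_stabilizer_node(1)[OF p y(2)]] pj(2)[OF c] by (simp add: add.assoc)
    qed
  next
    assume b: "\<forall>x\<in>nodes L. b (pos L x) = ?Q x"
    show "\<forall>k\<in>{1..length L}. \<forall>x<card (block L k).
        b (sorted_list_of_set (block L k) ! x) = sorted_list_of_set (block L (p k)) ! x"
    proof (intro ballI allI impI)
      fix k x assume k: "k \<in> {1..length L}" and x: "x < card (block L k)"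
      have xs: "x < sum_list (L ! (k - 1))"
        using x card[OF k] by simp
      have "comp_start L (k - 1) + x \<in> comp_positions L (k - 1)"
        using xs k comp_positions_interval[of "k - 1" L] by auto
      then obtain i j where y: "(k - 1, i, j) \<in> nodes L" "comp_start L (k - 1) + x = pos L (k - 1, i, j)"
        unfolding comp_positions_def by blast
      have "b (comp_start L (k - 1) + x) = pos L (p k - 1, i, j)"
        using b y k by (auto dest!: bspec[OF _ y(1)])
      moreover have "(p k - 1, i, j) \<in> nodes L"
        using comp_stabilizer_node(1)[OF p y(1)] k by simp
      ultimately have "b (comp_start L (k - 1) + x) = comp_start L (p k - 1) + x"
        using y(2) pos_eq[OF y(1)] pj(2)[OF k] by (simp add: pos_eq add.assoc)
      then show "b (sorted_list_of_set (block L k) ! x) = sorted_list_of_set (block L (p k)) ! x"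
        using sorted[OF k xs] sorted[OF pj(1)[OF k], of x] xs pj(2)[OF k] by simp
    qed
  qed
  have "block_perm L p permutes {1..mp_size L} \<and> (\<forall>x\<in>nodes L. block_perm L p (pos L x) = ?Q x)"
    unfolding block_perm_def iff by (rule theI'[OF ex1_permutes[OF bij_pos bij]])
  then show "block_perm L p permutes {1..mp_size L}"
    "(c, i, j) \<in> nodes L \<Longrightarrow> block_perm L p (pos L (c, i, j)) = pos L (p (Suc c) - 1, i, j)"
    by auto
qed

lemma block_perm_compose:
  assumes p: "p \<in> comp_stabilizer L" and p': "p' \<in> comp_stabilizer L"
  shows "block_perm L (p' \<circ> p) = block_perm L p' \<circ> block_perm L p"
proof (rule permutes_eqI)
  note pp = comp_stabilizer_comp[OF p p']
  show "block_perm L (p' \<circ> p) permutes {1..mp_size L}" "block_perm L p' \<circ> block_perm L p permutes {1..mp_size L}"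
    by (rule block_perm(1)[OF pp] permutes_compose[OF block_perm(1)[OF p] block_perm(1)[OF p']])+
  fix x assume "x \<in> nodes L"
  then obtain c i j where x: "x = (c, i, j)" "(c, i, j) \<in> nodes L"
    using prod_cases3 by metis
  show "block_perm L (p' \<circ> p) (pos L x) = (block_perm L p' \<circ> block_perm L p) (pos L x)"
    using x block_perm(2)[OF pp] block_perm(2)[OF p] block_perm(2)[OF p'] comp_stabilizer_node[OF p x(2)] by simp
qed

lemma block_perm_id: "block_perm L id = id"
proof (rule permutes_eqI)
  show "block_perm L id permutes {1..mp_size L}" "id permutes {1..mp_size L}"
    by (rule block_perm(1)[OF comp_stabilizer_id] permutes_id)+
  fix x assume "x \<in> nodes L"
  then show "block_perm L id (pos L x) = id (pos L x)"
    using block_perm(2)[OF comp_stabilizer_id, of _ _ _ L] by (cases x) simp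
qed

lemma block_perm_inv:
  assumes p: "p \<in> comp_stabilizer L"
  shows "block_perm L (inv p) = inv (block_perm L p)"
proof -
  have "p permutes {1..length L}"
    using p by (simp add: comp_stabilizer_def)
  then have "block_perm L (inv p) \<circ> block_perm L p = id"
    using block_perm_compose[OF p comp_stabilizer_inv[OF p]] by (simp add: permutes_inv_o block_perm_id)
  then show ?thesis
    using permutes_surj[OF block_perm(1)[OF p]] by (metis inv_unique_comp permutes_inv_o(1) block_perm(1) p comp_assoc comp_id id_comp)
qed

lemma block_perm_comp_of:
  assumes p: "p \<in> comp_stabilizer L" and a: "a \<in> {1..mp_size L}"
  shows "comp_of L (block_perm L p a) = p (Suc (comp_of L a)) - 1"
proof -
  obtain c i j where x: "(c, i, j) \<in> nodes L" "a = pos L (c, i, j)"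
    using a by (rule pos_cases)
  then show ?thesis
    using block_perm(2)[OF p x(1)] comp_stabilizer_node(1)[OF p x(1)] by (simp add: comp_of_pos)
qed

text \<open>Positions of one component compare by row and column, which a block exchange leaves
  alone. For this reason block exchanges never collide.\<close>

lemma block_perm_less:
  assumes p: "p \<in> comp_stabilizer L" and ab: "a \<in> {1..mp_size L}" "b \<in> {1..mp_size L}" "comp_of L a = comp_of L b" "a < b"
  shows "block_perm L p a < block_perm L p b"
proof -
  obtain c i j where x: "(c, i, j) \<in> nodes L" "a = pos L (c, i, j)"
    using ab(1) by (rule pos_cases)
  obtain d k l where y: "(d, k, l) \<in> nodes L" "b = pos L (d, k, l)"
    using ab(2) by (rule pos_cases)
  have "d = c"
    using ab(3) x y by (simp add: comp_of_pos)
  then show ?thesis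
    using x y ab(4) block_perm(2)[OF p] comp_stabilizer_node(1)[OF p] pos_less_iff by simp
qed

lemma block_perm_same_row:
  assumes p: "p \<in> comp_stabilizer L" and ab: "same_row L a b"
  shows "same_row L (block_perm L p a) (block_perm L p b)"
proof -
  obtain c i j j' where "(c, i, j) \<in> nodes L" "(c, i, j') \<in> nodes L" "a = pos L (c, i, j)" "b = pos L (c, i, j')"
    using ab unfolding same_row_def by blast
  then show ?thesis
    using block_perm(2)[OF p] comp_stabilizer_node(1)[OF p] unfolding same_row_def by metis
qed

lemma block_perm_conj:
  assumes L: "\<forall>\<rho>\<in>set L. is_partition \<rho>" and p: "p \<in> comp_stabilizer L"
  shows "block_perm (conj_mp L) p = block_perm L p" and "p \<in> comp_stabilizer (conj_mp L)"
proof -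
  have pj: "p j \<in> {1..length L}" if "j \<in> {1..length L}" for j
    using p that permutes_in_image by (fastforce simp: comp_stabilizer_def)
  have b: "block (conj_mp L) j = block L j" if "j \<in> {1..length L}" for j
    using that conj_components(1)[OF L, of "j - 1"] by (subst (1 2) block_eq) auto
  show "block_perm (conj_mp L) p = block_perm L p"
  proof -
    have "(\<forall>j\<in>{1..length L}. \<forall>k<card (block (conj_mp L) j). f (sorted_list_of_set (block (conj_mp L) j) ! k) =
          sorted_list_of_set (block (conj_mp L) (p j)) ! k) \<longleftrightarrow>
        (\<forall>j\<in>{1..length L}. \<forall>k<card (block L j). f (sorted_list_of_set (block L j) ! k) =
          sorted_list_of_set (block L (p j)) ! k)" for f :: "nat \<Rightarrow> nat"
      by (rule ball_cong[OF refl]) (simp only: b pj)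
    then show ?thesis
      unfolding block_perm_def mp_size_conj[OF L] length_map by simp
  qed
  show "p \<in> comp_stabilizer (conj_mp L)"
    using p pj by (force simp: comp_stabilizer_def)
qed

text \<open>Transposition acts on a component in a way that depends on its shape only, and block
  exchanges permute components of equal shape.\<close>

lemma conj_perm_block_perm:
  assumes L: "\<forall>\<rho>\<in>set L. is_partition \<rho>" and p: "p \<in> comp_stabilizer L"
  shows "conj_perm L \<circ> block_perm L p = block_perm L p \<circ> conj_perm L"
proof (rule permutes_eqI)
  show "conj_perm L \<circ> block_perm L p permutes {1..mp_size L}" "block_perm L p \<circ> conj_perm L permutes {1..mp_size L}"
    by (rule permutes_compose block_perm(1)[OF p] conj_perm(1)[OF L])+
  fix x assume "x \<in> nodes L"
  then obtain c i j where x: "x = (c, i, j)" "(c, i, j) \<in> nodes L"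
    using prod_cases3 by metis
  have x': "(c, j, i) \<in> nodes (conj_mp L)"
    using x nodes_conj[OF L] by blast
  have "conj_perm L (block_perm L p (pos L x)) = pos (conj_mp L) (p (Suc c) - 1, j, i)"
    using x block_perm(2)[OF p x(2)] conj_perm(2)[OF L comp_stabilizer_node(1)[OF p x(2)]] by simp
  also have "\<dots> = block_perm L p (pos (conj_mp L) (c, j, i))"
    using block_perm(2)[OF block_perm_conj(2)[OF L p] x'] block_perm_conj(1)[OF L p] by simp
  also have "\<dots> = block_perm L p (conj_perm L (pos L x))"
    using x conj_perm(2)[OF L x(2)] by simp
  finally show "(conj_perm L \<circ> block_perm L p) (pos L x) = (block_perm L p \<circ> conj_perm L) (pos L x)"
    by simp
qed

text \<open>Block exchanges carry rows to rows, so they normalize the row stabilizer.\<close>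

lemma block_perm_conj_row_stabilizer:
  assumes p: "p \<in> comp_stabilizer L" and h: "h \<in> row_stabilizer L"
  shows "block_perm L p \<circ> h \<circ> inv (block_perm L p) \<in> row_stabilizer L"
proof (rule row_stabilizerI)
  note B = block_perm(1)[OF p]
  show "block_perm L p \<circ> h \<circ> inv (block_perm L p) permutes {1..mp_size L}"
    by (intro permutes_compose permutes_inv B row_stabilizerD(1)[OF h])
  fix a assume a: "a \<in> {1..mp_size L}"
  then have "inv (block_perm L p) a \<in> {1..mp_size L}"
    using permutes_in_image[OF permutes_inv[OF B]] by blast
  from block_perm_same_row[OF p same_row_stab[OF h this]]
  show "same_row L a ((block_perm L p \<circ> h \<circ> inv (block_perm L p)) a)"
    using permutes_inverses[OF B] by simp
qed

section \<open>The index set\<close>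

text \<open>Of the chosen total order only the contiguity of equal components is recorded; it makes
  the components of \<open>M\<close> match the runs of \<open>L\<close>.\<close>

locale index_data =
  fixes L M :: multipartition
  assumes L_part: "\<forall>\<rho>\<in>set L. is_partition \<rho>" and L_nonempty: "[] \<notin> set L"
    and M_part: "\<forall>\<mu>\<in>set M. is_partition \<mu>" and M_mult: "map sum_list M = multiplicities L"
    and contiguous: "distinct (remdups_adj L)"
begin

lemma size_M: "mp_size M = length L"
  by (rule mp_size_runs[OF contiguous M_mult])

lemma comp_stabilizer_iff:
  "p \<in> comp_stabilizer L \<longleftrightarrow> p permutes {1..length L} \<and> (\<forall>j\<in>{1..length L}. comp_of M (p j) = comp_of M j)"
proof -
  have "L ! (p j - 1) = L ! (j - 1) \<longleftrightarrow> comp_of M (p j) = comp_of M j"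
    if "p permutes {1..length L}" "j \<in> {1..length L}" for j
    using that permutes_in_image[OF that(1)] by (intro same_run_iff[OF contiguous M_mult]) blast+
  then show ?thesis
    by (auto simp: comp_stabilizer_def)
qed

lemma stab_M: "p \<in> row_stabilizer M \<Longrightarrow> p \<in> comp_stabilizer L"
  unfolding comp_stabilizer_iff
  using row_stabilizerD(1)[of p M] row_stabilizer_comp_of[of p M] by (simp only: size_M) blast

lemma conj_perm_M: "conj_perm M \<in> comp_stabilizer L"
  unfolding comp_stabilizer_iff
  using conj_perm(1)[OF M_part] conj_perm_comp[OF M_part] by (simp only: size_M) blast

lemma stab_conj_M: "p \<in> row_stabilizer (conj_mp M) \<Longrightarrow> p \<in> comp_stabilizer L"
proof -
  assume p: "p \<in> row_stabilizer (conj_mp M)"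
  have pp: "p permutes {1..length L}"
    using row_stabilizerD(1)[OF p] by (simp only: mp_size_conj[OF M_part] size_M)
  have "comp_of M (p j) = comp_of M j" if j: "j \<in> {1..length L}" for j
  proof -
    have j': "j \<in> {1..mp_size M}" "p j \<in> {1..mp_size M}"
      using j permutes_in_image[OF pp] by (simp_all only: size_M)
    then show ?thesis
      using row_stabilizer_comp_of[OF p, of j] conj_components(2)[OF M_part] mp_size_conj[OF M_part] by metis
  qed
  then show "p \<in> comp_stabilizer L"
    unfolding comp_stabilizer_iff using pp by blast
qed

text \<open>Being of the initial kind says that the permutation maps every component of
  \<open>M\<close> to itself, and these components are the runs of equal components of
  \<open>L\<close>.\<close>

lemma tableau_M:
  assumes "is_multitableau M v" "initial_kind M v"
  shows "tableau_perm M v \<in> comp_stabilizer L"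
  unfolding comp_stabilizer_iff
proof (intro conjI ballI)
  note d = tableau_perm_props[OF assms(1)]
  show "tableau_perm M v permutes {1..length L}"
    using d(1) by (simp only: size_M)
  fix j assume "j \<in> {1..length L}"
  then have j: "j \<in> {1..mp_size M}"
    by (simp only: size_M)
  let ?c = "comp_of M j"
  have c: "?c < length M" "j \<in> comp_positions M ?c"
    using comp_of_less[OF j] j by (simp_all add: comp_positions_iff)
  have "length v = length M"
    using assms(1) by (auto simp: is_multitableau_def)
  then have "entries (v ! ?c) = comp_positions M ?c"
    using assms(2) c(1) entries_initial[OF c(1)] unfolding initial_kind_def by (metis length_initial nth_map)
  moreover have "tableau_perm M v j \<in> entries (v ! ?c)"
    unfolding entries_image[OF assms(1) c(1)] using c(2) by blast
  ultimately show "comp_of M (tableau_perm M v j) = ?c"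
    using comp_positions_iff by blast
qed

lemma initial_kindI:
  assumes "is_multitableau M v" "tableau_perm M v \<in> comp_stabilizer L"
  shows "initial_kind M v"
  unfolding initial_kind_def
proof (rule nth_equalityI)
  note d = tableau_perm_props[OF assms(1)]
  have "length v = length M"
    using assms(1) by (auto simp: is_multitableau_def)
  then show "length (map entries v) = length (map entries (initial_tableau M))"
    by simp
  fix c assume "c < length (map entries v)"
  then have c: "c < length M" "c < length v"
    using \<open>length v = length M\<close> by simp_all
  have "tableau_perm M v ` comp_positions M c \<subseteq> comp_positions M c"
    using assms(2) permutes_in_image[OF d(1)] unfolding comp_stabilizer_iff by (auto simp: comp_positions_iff size_M)
  then have "tableau_perm M v ` comp_positions M c = comp_positions M c"
    using c(1) permutes_inj[OF d(1)] by (intro endo_inj_surj) (auto simp: comp_positions_interval intro: inj_on_subset)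
  then show "map entries v ! c = map entries (initial_tableau M) ! c"
    using c entries_image[OF assms(1) c(1)] entries_initial[OF c(1)] by simp
qed

lemma conj_tableau_M:
  assumes "is_multitableau M v" "initial_kind M v"
  shows "tableau_perm (conj_mp M) (map List.transpose v) \<in> comp_stabilizer L"
    and "inv (tableau_perm (conj_mp M) (map List.transpose v)) \<circ> tableau_perm M v = conj_perm M"
proof -
  let ?d = "tableau_perm M v" and ?d' = "tableau_perm (conj_mp M) (map List.transpose v)"
  have d': "?d' permutes {1..mp_size M}" and eq: "inv ?d' \<circ> ?d = conj_perm M"
    by (rule conj_tableau_perm[OF M_part assms(1)])+
  show "inv ?d' \<circ> ?d = conj_perm M"
    by (rule eq)
  have "?d' \<circ> conj_perm M = ?d"
    unfolding eq[symmetric] comp_assoc[symmetric] permutes_inv_o(1)[OF d'] by simp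
  then have "?d' = ?d \<circ> inv (conj_perm M)"
    using permutes_inv_o(1)[OF conj_perm(1)[OF M_part]] by (metis comp_assoc comp_id)
  then show "?d' \<in> comp_stabilizer L"
    using comp_stabilizer_comp[OF comp_stabilizer_inv[OF conj_perm_M] tableau_M[OF assms]] by simp
qed

text \<open>The leading permutation of \<open>m\<close>: the block exchange of \<open>v\<close>
  followed by the permutation of \<open>t\<close>. Its inverse is the word of the index
  tableau.\<close>

definition std_perm :: "index_tableau \<Rightarrow> nat \<Rightarrow> nat" where
  "std_perm = (\<lambda>(t, v). tableau_perm L t \<circ> block_perm L (tableau_perm M v))"

lemma RStdD:
  assumes "(t, v) \<in> RStd (L, M)"
  shows "is_multitableau L t" "row_standard t" "increasing_tableau L t" "is_multitableau M v" "row_standard v"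
    "initial_kind M v" "tableau_perm M v \<in> comp_stabilizer L"
  using assms tableau_M by (auto simp: RStd_def)

lemma std_perm_permutes: "(t, v) \<in> RStd (L, M) \<Longrightarrow> std_perm (t, v) permutes {1..mp_size L}"
  unfolding std_perm_def split_conv
  by (intro permutes_compose block_perm(1) tableau_perm_props(1)) (auto dest: RStdD)

section \<open>Coset decomposition of permutations by index tableaux\<close>

lemma comp_positions_finite [simp]: "finite (comp_positions L c)"
  by (rule finite_subset[of _ "{1..mp_size L}"]) (auto simp: comp_positions_iff)

lemma comp_positions_nonempty: "c < length L \<Longrightarrow> comp_positions L c \<noteq> {}"
proof -
  assume c: "c < length L"
  then have "is_partition (L ! c)" "L ! c \<noteq> []"
    using L_part L_nonempty nth_mem by metis+
  then have "0 < L ! c ! 0" "0 < length (L ! c)"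
    unfolding is_partition_def by (metis length_greater_0_conv neq0_conv nth_mem)+
  then have "(c, 0, 0) \<in> nodes L"
    using c by (simp add: nodes_def)
  then show ?thesis
    unfolding comp_positions_def by blast
qed

lemma block_perm_image:
  assumes p: "p \<in> comp_stabilizer L" and j: "j \<in> {1..length L}"
  shows "block_perm L p ` comp_positions L (j - 1) = comp_positions L (p j - 1)"
proof (intro equalityI subsetI)
  note B = block_perm(1)[OF p]
  fix a assume "a \<in> block_perm L p ` comp_positions L (j - 1)"
  then obtain b where b: "b \<in> {1..mp_size L}" "comp_of L b = j - 1" "a = block_perm L p b"
    by (auto simp: comp_positions_iff)
  then have "comp_of L a = p j - 1" "a \<in> {1..mp_size L}"
    using block_perm_comp_of[OF p b(1)] permutes_in_image[OF B, of b] j by simp_all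
  then show "a \<in> comp_positions L (p j - 1)"
    by (simp only: comp_positions_iff simp_thms)
next
  note B = block_perm(1)[OF p]
  have pp: "p permutes {1..length L}"
    using p by (simp add: comp_stabilizer_def)
  fix a assume a: "a \<in> comp_positions L (p j - 1)"
  then have ar: "a \<in> {1..mp_size L}" "comp_of L a = p j - 1"
    by (simp_all add: comp_positions_iff)
  let ?b = "inv (block_perm L p) a"
  have b: "?b \<in> {1..mp_size L}" "block_perm L p ?b = a"
    using permutes_in_image[OF permutes_inv[OF B]] ar(1) permutes_inverses[OF B] by blast+
  have sb: "Suc (comp_of L ?b) \<in> {1..length L}"
    using comp_of_less[OF b(1)] by simp
  have "p (Suc (comp_of L ?b)) - 1 = p j - 1"
    using block_perm_comp_of[OF p b(1)] b(2) ar(2) by simp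
  moreover have "p (Suc (comp_of L ?b)) \<in> {1..length L}" "p j \<in> {1..length L}"
    using permutes_in_image[OF pp] sb j by blast+
  ultimately have "p (Suc (comp_of L ?b)) = p j"
    by auto
  then have "comp_of L ?b = j - 1"
    using permutes_inj[OF pp] by (metis diff_Suc_1 injD)
  then show "a \<in> block_perm L p ` comp_positions L (j - 1)"
    using b by (metis comp_positions_iff imageI)
qed

text \<open>Sorting at three levels: \<open>h\<close> sorts the entries within rows,
  \<open>\<sigma>\<close> sorts equal components by their minimal entries, which makes
  \<open>t\<close> increasing, and the block exchange undoing \<open>\<sigma>\<close> is sorted
  along the rows of \<open>M\<close>, which gives \<open>v\<close> and \<open>p\<close>.\<close>

theorem ex_decomposition:
  assumes w: "w permutes {1..mp_size L}"
  shows "\<exists>u\<in>RStd (L, M). \<exists>p\<in>row_stabilizer M. \<exists>h\<in>row_stabilizer L. w = std_perm u \<circ> block_perm L p \<circ> h"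
proof -
  obtain h where h: "h \<in> row_stabilizer L" "row_increasing L (w \<circ> h)"
    using ex_sort_rows[of w L] permutes_inj[OF w] by (meson inj_on_subset subset_UNIV)
  define w1 where "w1 = w \<circ> h"
  have w1: "w1 permutes {1..mp_size L}"
    unfolding w1_def by (rule permutes_compose[OF row_stabilizerD(1)[OF h(1)] w])
  define key where "key j = Min (w1 ` comp_positions L (j - 1))" for j
  \<comment> \<open>One row for each run: the row stabilizer of this shape contains all permutations
    of equal components, so that sorting its rows sorts every run completely.\<close>
  define K where "K = map (\<lambda>m. [m]) (multiplicities L)"
  have K: "map sum_list K = multiplicities L"
    by (simp add: K_def comp_def)
  have szK: "mp_size K = length L"
    by (rule mp_size_runs[OF contiguous K])
  have key_in: "key j \<in> w1 ` comp_positions L (j - 1)" if "j \<in> {1..length L}" for j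
    unfolding key_def using that by (intro Min_in) (auto simp: comp_positions_nonempty)
  have "inj_on key {1..mp_size K}"
  proof (rule inj_onI)
    fix i j assume ij: "i \<in> {1..mp_size K}" "j \<in> {1..mp_size K}" "key i = key j"
    then obtain a b where "a \<in> comp_positions L (i - 1)" "b \<in> comp_positions L (j - 1)" "w1 a = w1 b"
      using key_in[of i] key_in[of j] by (auto simp: szK)
    then have "i - 1 = j - 1"
      using permutes_inj[OF w1] by (metis comp_positions_iff injD)
    then show "i = j"
      using ij by auto
  qed
  then obtain \<sigma> where \<sigma>: "\<sigma> \<in> row_stabilizer K" "row_increasing K (key \<circ> \<sigma>)"
    using ex_sort_rows by blast
  have \<sigma>p: "\<sigma> permutes {1..length L}"
    using row_stabilizerD(1)[OF \<sigma>(1)] by (simp only: szK)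
  have "L ! (\<sigma> j - 1) = L ! (j - 1)" if "j \<in> {1..length L}" for j
  proof -
    have "\<sigma> j \<in> {1..length L}"
      using that permutes_in_image[OF \<sigma>p] by blast
    then show ?thesis
      using same_run_iff[OF contiguous K _ that] row_stabilizer_comp_of[OF \<sigma>(1)] that szK by metis
  qed
  then have \<sigma>s: "\<sigma> \<in> comp_stabilizer L"
    using \<sigma>p by (simp add: comp_stabilizer_def)
  note B = block_perm(1)[OF \<sigma>s]
  define w2 where "w2 = w1 \<circ> block_perm L \<sigma>"
  have w2: "w2 permutes {1..mp_size L}"
    unfolding w2_def by (rule permutes_compose[OF B w1])
  have "row_increasing L w2"
    unfolding row_increasing_def w2_def comp_def
  proof (intro allI impI, elim conjE)
    fix a b assume ab: "same_row L a b" "a < b"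
    have "comp_of L a = comp_of L b"
      using ab(1) unfolding same_row_def using comp_of_pos by metis
    then have "block_perm L \<sigma> a < block_perm L \<sigma> b"
      using same_row_range[OF ab(1)] ab(2) by (intro block_perm_less[OF \<sigma>s]) auto
    then show "w1 (block_perm L \<sigma> a) < w1 (block_perm L \<sigma> b)"
      using h(2) block_perm_same_row[OF \<sigma>s ab(1)] unfolding row_increasing_def w1_def by blast
  qed
  note t = increasing_row_standard[OF w2 this]
  define t where "t = act (initial_tableau L) w2"
  note t = t[folded t_def]
  have "increasing_tableau L t"
    unfolding increasing_tableau_def
  proof (intro allI impI, elim conjE)
    fix i j assume ij: "i < j" "j < length L" "L ! i = L ! j"
    have e: "Min (entries (t ! c)) = key (\<sigma> (Suc c))" if "c < length L" for c
    proof -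
      have "entries (t ! c) = w1 ` block_perm L \<sigma> ` comp_positions L c"
        using entries_image[OF t(1) that] t(3) by (simp add: w2_def image_comp)
      then show ?thesis
        using block_perm_image[OF \<sigma>s, of "Suc c"] that by (simp add: key_def)
    qed
    have r: "Suc i \<in> {1..mp_size K}" "Suc j \<in> {1..mp_size K}"
      using ij szK by auto
    have "comp_of K (Suc i) = comp_of K (Suc j)"
      using same_run_iff[OF contiguous K, of "Suc i" "Suc j"] ij by auto
    then have "Suc i \<in> comp_positions K (comp_of K (Suc i))" "Suc j \<in> comp_positions K (comp_of K (Suc i))"
      using r by (simp_all only: comp_positions_iff)
    then obtain c a b a' b' where x: "(c, a, b) \<in> nodes K" "(c, a', b') \<in> nodes K"
      "Suc i = pos K (c, a, b)" "Suc j = pos K (c, a', b')"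
      unfolding comp_positions_def by blast
    moreover have "a = 0" "a' = 0"
      using x by (auto simp: nodes_def K_def)
    ultimately have "same_row K (Suc i) (Suc j)"
      unfolding same_row_def by blast
    then show "Min (entries (t ! i)) < Min (entries (t ! j))"
      using \<sigma>(2) ij e[of i] e[of j] unfolding row_increasing_def by auto
  qed
  note \<sigma>i = comp_stabilizer_inv[OF \<sigma>s]
  have "inj_on (inv \<sigma>) {1..mp_size M}"
    using permutes_inj[OF permutes_inv[OF \<sigma>p]] by (rule inj_on_subset) simp
  then obtain p where p: "p \<in> row_stabilizer M" "row_increasing M (inv \<sigma> \<circ> p)"
    using ex_sort_rows by blast
  have \<tau>: "inv \<sigma> \<circ> p \<in> comp_stabilizer L"
    by (rule comp_stabilizer_comp[OF stab_M[OF p(1)] \<sigma>i])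
  then have "inv \<sigma> \<circ> p permutes {1..mp_size M}"
    by (simp add: comp_stabilizer_def size_M)
  note v = increasing_row_standard[OF this p(2)]
  define v where "v = act (initial_tableau M) (inv \<sigma> \<circ> p)"
  note v = v[folded v_def]
  have "initial_kind M v"
    using v(3) \<tau> by (intro initial_kindI[OF v(1)]) simp
  then have u: "(t, v) \<in> RStd (L, M)"
    using t v \<open>increasing_tableau L t\<close> by (simp add: RStd_def)
  have "std_perm (t, v) \<circ> block_perm L (inv p) \<circ> inv h = w2 \<circ> (block_perm L (inv \<sigma> \<circ> p) \<circ> block_perm L (inv p)) \<circ> inv h"
    by (simp add: std_perm_def t(3) v(3) comp_assoc)
  also have "block_perm L (inv \<sigma> \<circ> p) \<circ> block_perm L (inv p) = block_perm L (inv \<sigma> \<circ> p \<circ> inv p)"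
    by (rule block_perm_compose[OF comp_stabilizer_inv[OF stab_M[OF p(1)]] \<tau>, symmetric])
  also have "inv \<sigma> \<circ> p \<circ> inv p = inv \<sigma>"
    using permutes_inv_o(1)[OF row_stabilizerD(1)[OF p(1)]] by (simp add: comp_assoc)
  also have "w2 \<circ> block_perm L (inv \<sigma>) = w1"
    unfolding w2_def block_perm_inv[OF \<sigma>s] comp_assoc permutes_inv_o(1)[OF B] by simp
  also have "w1 \<circ> inv h = w"
    unfolding w1_def comp_assoc permutes_inv_o(1)[OF row_stabilizerD(1)[OF h(1)]] by simp
  finally show ?thesis
    using u row_stabilizer_inv[OF p(1)] row_stabilizer_inv[OF h(1)] by metis
qed

text \<open>The component permutations are collected in \<open>\<sigma>\<close>, and
  \<open>h\<close> is carried past the block exchange and becomes \<open>k\<close>. Minimal entries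
  of components are not affected by \<open>k\<close>, and both tableaux are increasing, so
  \<open>\<sigma>\<close> is trivial; then \<open>k\<close> and \<open>p\<close> are trivial because
  a coset has only one representative with sorted rows.\<close>

theorem decomposition_unique:
  assumes u: "(t, v) \<in> RStd (L, M)" "(t', v') \<in> RStd (L, M)"
    and p: "p \<in> row_stabilizer M" and h: "h \<in> row_stabilizer L"
    and eq: "std_perm (t, v) = std_perm (t', v') \<circ> block_perm L p \<circ> h"
  shows "(t, v) = (t', v')" "p = id" "h = id"
proof -
  note R = RStdD[OF u(1)] and R' = RStdD[OF u(2)]
  let ?d = "tableau_perm L t" and ?d' = "tableau_perm L t'" and ?e = "tableau_perm M v" and ?e' = "tableau_perm M v'"
  let ?B = "block_perm L ?e"
  note B = block_perm(1)[OF R(7)]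
  define \<sigma> where "\<sigma> = ?e' \<circ> p \<circ> inv ?e"
  define k where "k = ?B \<circ> h \<circ> inv ?B"
  have \<sigma>s: "\<sigma> \<in> comp_stabilizer L"
    unfolding \<sigma>_def by (intro comp_stabilizer_comp comp_stabilizer_inv R(7) R'(7) stab_M[OF p])
  have k: "k \<in> row_stabilizer L"
    unfolding k_def by (rule block_perm_conj_row_stabilizer[OF R(7) h])
  have e: "?e permutes {1..length L}"
    using R(7) by (simp add: comp_stabilizer_def)
  have "\<sigma> \<circ> ?e = ?e' \<circ> p"
    unfolding \<sigma>_def comp_assoc permutes_inv_o(2)[OF e] by simp
  then have "block_perm L \<sigma> \<circ> ?B = block_perm L ?e' \<circ> block_perm L p"
    using block_perm_compose[OF R(7) \<sigma>s] block_perm_compose[OF stab_M[OF p] R'(7)] by metis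
  moreover have "?B \<circ> h = k \<circ> ?B"
    unfolding k_def comp_assoc permutes_inv_o(2)[OF B] by simp
  ultimately have "?d \<circ> ?B = ?d' \<circ> block_perm L \<sigma> \<circ> k \<circ> ?B"
    using eq unfolding std_perm_def split_conv by (metis comp_assoc)
  then have "?d \<circ> (?B \<circ> inv ?B) = ?d' \<circ> block_perm L \<sigma> \<circ> k \<circ> (?B \<circ> inv ?B)"
    by (metis comp_assoc)
  then have d: "?d = ?d' \<circ> block_perm L \<sigma> \<circ> k"
    unfolding permutes_inv_o(1)[OF B] by simp
  have \<sigma>p: "\<sigma> permutes {1..length L}"
    using \<sigma>s by (simp add: comp_stabilizer_def)
  have k_image: "k ` comp_positions L c = comp_positions L c" for c
  proof (rule endo_inj_surj)
    show "k ` comp_positions L c \<subseteq> comp_positions L c"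
      using row_stabilizer_comp_of[OF k] permutes_in_image[OF row_stabilizerD(1)[OF k]] by (auto simp: comp_positions_iff)
    show "inj_on k (comp_positions L c)"
      using permutes_inj[OF row_stabilizerD(1)[OF k]] by (rule inj_on_subset) simp
  qed simp
  have min: "Min (entries (t ! (j - 1))) = Min (entries (t' ! (\<sigma> j - 1)))" if j: "j \<in> {1..length L}" for j
  proof -
    have "\<sigma> j \<in> {1..length L}"
      using permutes_in_image[OF \<sigma>p] j by blast
    then have "entries (t' ! (\<sigma> j - 1)) = ?d' ` block_perm L \<sigma> ` k ` comp_positions L (j - 1)"
      using entries_image[OF R'(1)] block_perm_image[OF \<sigma>s j] k_image by auto
    moreover have "entries (t ! (j - 1)) = ?d ` comp_positions L (j - 1)"
      using entries_image[OF R(1)] j by auto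
    ultimately show ?thesis
      by (simp add: d image_comp comp_assoc)
  qed
  have "\<sigma> = id"
  proof (rule increasing_on_classes_id[OF \<sigma>p, where \<kappa> = "\<lambda>j. L ! (j - 1)" and f = "\<lambda>j. Min (entries (t' ! (j - 1)))"])
    show "L ! (\<sigma> j - 1) = L ! (j - 1)" if "j \<in> {1..length L}" for j
      using \<sigma>s that by (simp add: comp_stabilizer_def)
    fix i j assume ij: "i \<in> {1..length L}" "j \<in> {1..length L}" "L ! (i - 1) = L ! (j - 1)" "i < j"
    then have *: "i - 1 < j - 1" "j - 1 < length L"
      by auto
    show "Min (entries (t' ! (i - 1))) < Min (entries (t' ! (j - 1)))"
      using R'(3) * ij(3) unfolding increasing_tableau_def by blast
    show "Min (entries (t' ! (\<sigma> i - 1))) < Min (entries (t' ! (\<sigma> j - 1)))"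
      unfolding min[OF ij(1), symmetric] min[OF ij(2), symmetric]
      using R(3) * ij(3) unfolding increasing_tableau_def by blast
  qed
  then have e_eq: "?e = ?e' \<circ> p" and d_eq: "?d = ?d' \<circ> k"
    using \<open>\<sigma> \<circ> ?e = ?e' \<circ> p\<close> d by (simp_all add: block_perm_id)
  show "p = id"
    using row_increasing_stab_id[OF p, of ?e'] row_standard_increasing[OF R(4,5)] row_standard_increasing[OF R'(4,5)] e_eq by simp
  have "k = id"
    using row_increasing_stab_id[OF k, of ?d'] row_standard_increasing[OF R(1,2)] row_standard_increasing[OF R'(1,2)] d_eq by simp
  have act: "s = act (initial_tableau N) (tableau_perm N s)" if "is_multitableau N s" for N s
    using act_eq_iff[of s N] tableau_perm_props(2)[OF that] that unfolding is_multitableau_def by blast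
  show "(t, v) = (t', v')"
    using act[OF R(1)] act[OF R'(1)] act[OF R(4)] act[OF R'(4)] e_eq d_eq \<open>p = id\<close> \<open>k = id\<close> by simp
  have "?B \<circ> h = ?B"
    using \<open>?B \<circ> h = k \<circ> ?B\<close> \<open>k = id\<close> by simp
  then show "h = id"
    using permutes_inv_o(2)[OF B] by (metis comp_assoc id_comp)
qed

end

section \<open>The action on the elements of the permutation module\<close>

lemma pos_less_of_comp:
  assumes "(c, i, j) \<in> nodes L" "(d, k, l) \<in> nodes L" "c < d"
  shows "pos L (c, i, j) < pos L (d, k, l)"
proof -
  have c: "c < length L" "d < length L"
    using assms by (auto simp: nodes_def)
  have "pos L (c, i, j) \<in> comp_positions L c" "pos L (d, k, l) \<in> comp_positions L d"
    using assms unfolding comp_positions_def by blast+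
  then have 1: "pos L (c, i, j) < comp_start L c + sum_list (L ! c)" "comp_start L d \<le> pos L (d, k, l)"
    using comp_positions_interval c by auto
  have "comp_start L c + sum_list (L ! c) = 1 + sum_list (take (Suc c) (map sum_list L))"
    using c by (simp add: comp_start_def take_map[symmetric] sum_list_take_Suc)
  also have "\<dots> \<le> 1 + sum_list (take d (map sum_list L))"
    using assms(3) by (intro add_left_mono sum_list_take_mono) simp
  finally show ?thesis
    using 1 by (simp add: comp_start_def take_map)
qed

text \<open>Rows occupy consecutive intervals of positions, so positions in different rows compare
  like the rows.\<close>

lemma same_row_less:
  assumes "a < b" "\<not> same_row L a b" "same_row L a a'" "same_row L b b'"
  shows "a' < b'"
proof -
  obtain c i j j' where x: "(c, i, j) \<in> nodes L" "(c, i, j') \<in> nodes L" "a = pos L (c, i, j)" "a' = pos L (c, i, j')"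
    using assms(3) unfolding same_row_def by blast
  obtain d k l l' where y: "(d, k, l) \<in> nodes L" "(d, k, l') \<in> nodes L" "b = pos L (d, k, l)" "b' = pos L (d, k, l')"
    using assms(4) unfolding same_row_def by blast
  have ne: "\<not> (c = d \<and> i = k)"
    using assms(2) x y same_row_pos by metis
  consider "c < d" | "d < c" | "c = d" "i < k" | "c = d" "k < i"
    using ne by (metis linorder_neqE_nat)
  then show ?thesis
  proof cases
    case 1
    then show ?thesis
      using pos_less_of_comp x y by metis
  next
    case 2
    then show ?thesis
      using pos_less_of_comp[OF y(1) x(1)] x y assms(1) by simp
  next
    case 3
    then show ?thesis
      using pos_less_comp x y by metis
  next
    case 4
    then have "b < a"
      using pos_less_comp[of d k l L i j] x y by simp
    then show ?thesis
      using assms(1) by simp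
  qed
qed

text \<open>The length of the row permutation \<open>h\<close> in \<open>w = f \<circ> h\<close>,
  with \<open>f\<close> increasing along rows, expressed without a choice of decomposition. It is
  the exponent of \<open>q\<close> at \<open>w\<close>.\<close>

definition row_inv :: "multipartition \<Rightarrow> (nat \<Rightarrow> nat) \<Rightarrow> nat" where
  "row_inv L w = card {(a, b). same_row L a b \<and> a < b \<and> w b < w a}"

lemma row_inv_stabilizer:
  assumes h: "h \<in> row_stabilizer L" and f: "row_increasing L f"
  shows "row_inv L (f \<circ> h) = inv_count (mp_size L) h"
proof -
  have "{(a, b). same_row L a b \<and> a < b \<and> (f \<circ> h) b < (f \<circ> h) a} = inversions (mp_size L) h"
  proof (rule Set.set_eqI, rule iffI; clarify)
    fix a b assume ab: "same_row L a b" "a < b" "(f \<circ> h) b < (f \<circ> h) a"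
    have "same_row L (h a) (h b)"
      using same_row_stab[OF h] same_row_range[OF ab(1)] ab(1) same_row_sym same_row_trans by meson
    then have "\<not> h a < h b"
      using f ab(3) unfolding row_increasing_def by force
    moreover have "h a \<noteq> h b"
      using ab(3) by auto
    ultimately show "(a, b) \<in> inversions (mp_size L) h"
      using ab same_row_range[OF ab(1)] by (auto simp: inversions_def)
  next
    fix a b assume "(a, b) \<in> inversions (mp_size L) h"
    then have ab: "a \<in> {1..mp_size L}" "b \<in> {1..mp_size L}" "a < b" "h b < h a"
      by (auto simp: inversions_def)
    have r: "same_row L a (h a)" "same_row L b (h b)"
      using same_row_stab[OF h] ab by auto
    then have s: "same_row L a b"
      using same_row_less[of a b L "h a" "h b"] ab by fastforce
    then have "same_row L (h b) (h a)"
      using r same_row_sym same_row_trans by meson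
    then show "same_row L a b \<and> a < b \<and> (f \<circ> h) b < (f \<circ> h) a"
      using s ab f unfolding row_increasing_def by auto
  qed
  then show ?thesis
    by (simp add: row_inv_def inv_count_def)
qed

definition lin_comb :: "'k set \<Rightarrow> ('k \<Rightarrow> 'a::comm_ring_1) \<Rightarrow> ('k \<Rightarrow> nat \<Rightarrow> nat) \<Rightarrow> (nat \<Rightarrow> nat) \<Rightarrow> 'a" where
  "lin_comb K c f = (\<lambda>x. \<Sum>k\<in>K. c k * basis_vec (f k) x)"

lemma bt_act_lin_comb:
  assumes "\<And>k. k \<in> K \<Longrightarrow> bt_act n q col X (basis_vec (f k)) = basis_vec (f' k)"
  shows "bt_act n q col X (lin_comb K c f) = lin_comb K c f'"
  unfolding lin_comb_def bt_act_sum using assms by (intro ext sum.cong) auto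

lemma bt_act_lin_comb_expand:
  assumes "\<And>k. k \<in> K \<Longrightarrow> bt_act n q col X (basis_vec (f k)) = lin_comb S d (f' k)"
  shows "bt_act n q col X (lin_comb K c f) = lin_comb (K \<times> S) (\<lambda>(k, l). c k * d l) (\<lambda>(k, l). f' k l)"
proof
  fix x
  have "bt_act n q col X (lin_comb K c f) x = (\<Sum>k\<in>K. c k * (\<Sum>l\<in>S. d l * basis_vec (f' k l) x))"
    unfolding lin_comb_def[of K] bt_act_sum using assms by (intro sum.cong) (auto simp: lin_comb_def)
  then show "bt_act n q col X (lin_comb K c f) x = lin_comb (K \<times> S) (\<lambda>(k, l). c k * d l) (\<lambda>(k, l). f' k l) x"
    by (simp add: lin_comb_def sum_distrib_left sum.cartesian_product case_prod_unfold mult.assoc)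
qed

lemma bt_act_finsum_basis:
  assumes "finite S" "\<And>k. k \<in> S \<Longrightarrow> Y k \<in> carrier (bt n q)"
    and "\<And>k. k \<in> S \<Longrightarrow> bt_act n q col (Y k) (basis_vec w) = basis_vec (f k)"
  shows "bt_act n q col (\<Oplus>\<^bsub>bt n q\<^esub>k\<in>S. bt_smult n q (c k) (Y k)) (basis_vec w) = lin_comb S c f"
  using assms
  by (auto simp: fun_eq_iff lin_comb_def bt_act_finsum[OF assms(1)] bt_smult_closed bt_act_smult intro!: sum.cong)

lemma bt_smult_one: "X \<in> carrier (bt n q) \<Longrightarrow> bt_smult n q 1 X = X"
  using ring.ring_simprules(12)[OF ring_bt, of X n q]
  by (simp add: bt_smult_def free_scalar_def bt_class_one)

lemma bt_finsum_closed:
  assumes "\<And>k. k \<in> S \<Longrightarrow> Y k \<in> carrier (bt n q)"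
  shows "(\<Oplus>\<^bsub>bt n q\<^esub>k\<in>S. Y k) \<in> carrier (bt n q)"
proof -
  interpret ring "bt n q" by (rule ring_bt)
  show ?thesis
    using assms by (intro finsum_closed) auto
qed

text \<open>Components are mapped to components, possibly permuted. On the basis vectors of such
  permutations the idempotent of \<open>L\<close> acts as the identity, so the property is
  maintained as long as idempotents remain to be applied.\<close>

definition comp_preserving :: "multipartition \<Rightarrow> (nat \<Rightarrow> nat) \<Rightarrow> bool" where
  "comp_preserving L w \<longleftrightarrow> w permutes {1..mp_size L} \<and>
    (\<forall>a\<in>{1..mp_size L}. \<forall>b\<in>{1..mp_size L}. comp_of L (w a) = comp_of L (w b) \<longleftrightarrow> comp_of L a = comp_of L b)"

lemma comp_preserving_id: "comp_preserving L id"
  by (simp add: comp_preserving_def permutes_id)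

lemma comp_preserving_comp:
  assumes "comp_preserving L w" "comp_preserving L u"
  shows "comp_preserving L (u \<circ> w)"
proof -
  have w: "w permutes {1..mp_size L}" and u: "u permutes {1..mp_size L}"
    using assms by (auto simp: comp_preserving_def)
  have "comp_of L (u (w a)) = comp_of L (u (w b)) \<longleftrightarrow> comp_of L a = comp_of L b"
    if ab: "a \<in> {1..mp_size L}" "b \<in> {1..mp_size L}" for a b
  proof -
    have "w a \<in> {1..mp_size L}" "w b \<in> {1..mp_size L}"
      using ab permutes_in_image[OF w] by blast+
    then have "comp_of L (u (w a)) = comp_of L (u (w b)) \<longleftrightarrow> comp_of L (w a) = comp_of L (w b)"
      using assms(2) unfolding comp_preserving_def by blast
    also have "\<dots> \<longleftrightarrow> comp_of L a = comp_of L b"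
      using assms(1) ab unfolding comp_preserving_def by blast
    finally show ?thesis .
  qed
  then show ?thesis
    using permutes_compose[OF w u] by (simp add: comp_preserving_def)
qed

lemma comp_preservingI:
  assumes "w permutes {1..mp_size L}" "\<And>a. a \<in> {1..mp_size L} \<Longrightarrow> comp_of L (w a) = comp_of L a"
  shows "comp_preserving L w"
  using assms by (auto simp: comp_preserving_def)

lemma comp_preserving_row_stabilizer: "h \<in> row_stabilizer L \<Longrightarrow> comp_preserving L h"
  by (rule comp_preservingI[OF row_stabilizerD(1) row_stabilizer_comp_of])

lemma comp_preserving_block_perm:
  assumes p: "p \<in> comp_stabilizer L"
  shows "comp_preserving L (block_perm L p)"
proof -
  have pp: "p permutes {1..length L}"
    using p by (simp add: comp_stabilizer_def)
  have "p (Suc c) - 1 = p (Suc d) - 1 \<longleftrightarrow> c = d" if "c < length L" "d < length L" for c d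
  proof -
    have "p (Suc c) \<in> {1..length L}" "p (Suc d) \<in> {1..length L}"
      using that permutes_in_image[OF pp] by auto
    then have "p (Suc c) - 1 = p (Suc d) - 1 \<longleftrightarrow> p (Suc c) = p (Suc d)"
      by auto
    then show ?thesis
      using permutes_inj[OF pp] by (auto simp: inj_eq)
  qed
  then show ?thesis
    using block_perm(1)[OF p] block_perm_comp_of[OF p] comp_of_less by (simp add: comp_preserving_def)
qed

text \<open>The inverse of \<open>q\<close> is a parameter, which covers the Laurent variable and
  nonzero elements of a field alike.\<close>

locale index_rep = index_data L M for L M +
  fixes q q' :: "'a::comm_ring_1"
  assumes unit: "q * q' = 1"
begin

abbreviation n where "n \<equiv> mp_size L"
abbreviation act where "act \<equiv> bt_act n q (comp_of L)"
abbreviation E where "E \<equiv> bt_EEm n q L"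
abbreviation BP where "BP \<equiv> block_perm L"
abbreviation z where "z \<equiv> q - unit_inv q"

lemma unit_inv_q: "unit_inv q = q'"
  by (rule unit_inv_eqI[OF unit])

section \<open>The elements \<open>m\<close> as vectors\<close>

lemma E_closed: "E \<in> carrier (bt n q)"
  unfolding bt_EEm_def by (rule bt_EE_closed)

text \<open>In the word of a component preserving permutation, positions have letters of equal
  colour exactly if they lie in one component. Hence only the idempotent of that partition
  survives.\<close>

lemma act_EE_basis:
  assumes A: "partition_on {1..n} A" and w: "comp_preserving L w"
  shows "act (bt_EE n q A) (basis_vec w) = (if A = block_partition L then basis_vec w else (\<lambda>x. 0))"
proof
  fix x
  have wp: "w permutes {1..n}"
    using w by (simp add: comp_preserving_def)
  have wi: "comp_of L (inv w i) = comp_of L (inv w j) \<longleftrightarrow> comp_of L i = comp_of L j" if "i \<in> {1..n}" "j \<in> {1..n}" for i j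
  proof -
    have "inv w i \<in> {1..n}" "inv w j \<in> {1..n}"
      using that permutes_in_image[OF permutes_inv[OF wp]] by blast+
    then show ?thesis
      using w permutes_inverses[OF wp] unfolding comp_preserving_def by metis
  qed
  have iff: "(\<forall>i\<in>{1..n}. \<forall>j\<in>{1..n}. same_block A i j \<longleftrightarrow> comp_of L (inv w i) = comp_of L (inv w j)) \<longleftrightarrow> A = block_partition L"
  proof
    assume *: "\<forall>i\<in>{1..n}. \<forall>j\<in>{1..n}. same_block A i j \<longleftrightarrow> comp_of L (inv w i) = comp_of L (inv w j)"
    have "same_block A i j \<Longrightarrow> i \<in> {1..n} \<and> j \<in> {1..n}" for i j
      using A by (auto simp: same_block_def partition_on_def)
    then have "same_block A i j \<longleftrightarrow> same_block (block_partition L) i j" for i j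
      using * wi unfolding same_block_blocks by metis
    then show "A = block_partition L"
      using refines_iff_same_block[OF A partition_on_blocks] refines_iff_same_block[OF partition_on_blocks A]
      by (intro refines_asym) auto
  qed (use wi in \<open>auto simp: same_block_blocks\<close>)
  show "act (bt_EE n q A) (basis_vec w) x = (if A = block_partition L then basis_vec w else (\<lambda>x. 0)) x"
  proof (cases "x = inv w")
    case True
    show ?thesis
      unfolding True bt_act_EE[OF A permutes_inj[OF permutes_inv[OF wp]]] iff by simp
  next
    case False
    then show ?thesis
      by (cases "inj x") (simp_all add: bt_act_EE[OF A] bt_act_not_inj basis_vec_def)
  qed
qed

lemma act_E: "comp_preserving L w \<Longrightarrow> act E (basis_vec w) = basis_vec w"
  unfolding bt_EEm_def by (simp add: act_EE_basis[OF partition_on_blocks])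

lemma act_one_basis: "w permutes {1..n} \<Longrightarrow> act \<one>\<^bsub>bt n q\<^esub> (basis_vec w) = basis_vec w"
proof
  fix x assume "w permutes {1..n}"
  then have "inj (inv w)"
    using permutes_inj permutes_inv by blast
  then show "act \<one>\<^bsub>bt n q\<^esub> (basis_vec w) x = basis_vec w x"
    by (cases "x = inv w") (simp_all add: bt_act_one basis_vec_def)
qed

lemma BB_closed: "p \<in> comp_stabilizer L \<Longrightarrow> bt_BB n q L p \<in> carrier (bt n q)"
  unfolding bt_BB_def by (intro bt_mult_closed E_closed bt_gw_closed block_perm(1))

lemma act_BB:
  assumes p: "p \<in> comp_stabilizer L" and w: "comp_preserving L w" "collision_free n (comp_of L) w (BP p)"
  shows "act (bt_BB n q L p) (basis_vec w) = basis_vec (BP p \<circ> w)"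
  using w unfolding bt_BB_def
  by (simp add: bt_act_mult[OF E_closed bt_gw_closed[OF block_perm(1)[OF p]]] act_E
      bt_act_gw[OF _ block_perm(1)[OF p]] comp_preserving_def[of L w])

lemma collision_free_id: "collision_free n (comp_of L) id u"
  by (auto simp: collision_free_def)

lemma x_closed: "bt_x n q L \<in> carrier (bt n q)"
  unfolding bt_x_def by (intro bt_finsum_closed bt_smult_closed bt_gw_closed row_stabilizerD(1))

lemma act_x: "act (bt_x n q L) (basis_vec id) = lin_comb (row_stabilizer L) (\<lambda>h. q ^ inv_count n h) (\<lambda>h. h)"
proof -
  have "act (bt_x n q L) (basis_vec id) = lin_comb (row_stabilizer L) (\<lambda>h. q ^ perm_length n h) (\<lambda>h. h)"
    unfolding bt_x_def
    using row_stabilizerD(1)[of _ L] bt_act_gw[OF permutes_id, where n = n and col = "comp_of L" and q = q] collision_free_id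
    by (intro bt_act_finsum_basis) (auto intro: bt_gw_closed)
  then show ?thesis
    using perm_length_eq[OF row_stabilizerD(1)[of _ L]] by (simp add: lin_comb_def)
qed

lemma b_closed: "bt_b n q (L, M) \<in> carrier (bt n q)"
  unfolding bt_b_def split_conv by (intro bt_finsum_closed BB_closed stab_M)

lemma collision_free_BP:
  assumes p: "p \<in> comp_stabilizer L" and w: "comp_preserving L w"
  shows "collision_free n (comp_of L) w (BP p)"
  unfolding collision_free_def
proof (intro ballI impI, elim conjE)
  fix a b assume ab: "a \<in> {1..n}" "b \<in> {1..n}" "comp_of L a = comp_of L b" "w b < w a"
  have "w permutes {1..n}"
    using w by (simp add: comp_preserving_def)
  then have wr: "w a \<in> {1..n}" "w b \<in> {1..n}"
    using permutes_in_image ab by metis+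
  have "comp_of L (w b) = comp_of L (w a)"
    using w ab(1-3) unfolding comp_preserving_def by metis
  then show "BP p (w b) < BP p (w a)"
    by (rule block_perm_less[OF p wr(2,1) _ ab(4)])
qed

lemma act_b:
  assumes w: "comp_preserving L w"
  shows "act (bt_b n q (L, M)) (basis_vec w) = lin_comb (row_stabilizer M) (\<lambda>_. 1) (\<lambda>p. BP p \<circ> w)"
proof -
  interpret ring "bt n q" by (rule ring_bt)
  have "bt_b n q (L, M) = (\<Oplus>\<^bsub>bt n q\<^esub>p\<in>row_stabilizer M. bt_smult n q 1 (bt_BB n q L p))"
    unfolding bt_b_def split_conv
    by (intro finsum_cong') (auto simp: bt_smult_one BB_closed stab_M)
  then show ?thesis
    using act_BB[OF stab_M w collision_free_BP[OF stab_M w]] BB_closed stab_M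
    by (simp add: bt_act_finsum_basis)
qed

lemma act_xb:
  "act (bt_b n q (L, M)) (act (bt_x n q L) (basis_vec id)) =
    lin_comb (row_stabilizer L \<times> row_stabilizer M) (\<lambda>(h, p). q ^ inv_count n h) (\<lambda>(h, p). BP p \<circ> h)"
  unfolding act_x by (subst bt_act_lin_comb_expand[OF act_b[OF comp_preserving_row_stabilizer]]) (simp_all add: case_prod_unfold)

text \<open>Block exchanges keep the order inside components, so an inversion there comes from
  \<open>h\<close> and lies in one row, where the permutation of a row standard tableau
  increases.\<close>

lemma collision_free_tableau:
  assumes u: "(t, v) \<in> RStd (L, M)" and h: "h \<in> row_stabilizer L" and p: "p \<in> comp_stabilizer L"
  shows "collision_free n (comp_of L) (BP p \<circ> h) (tableau_perm L t)"
  unfolding collision_free_def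
proof (intro ballI impI, elim conjE)
  fix a b assume ab: "a \<in> {1..n}" "b \<in> {1..n}" "a < b" "comp_of L a = comp_of L b" "(BP p \<circ> h) b < (BP p \<circ> h) a"
  have h_in: "h a \<in> {1..n}" "h b \<in> {1..n}" "comp_of L (h a) = comp_of L (h b)"
    using ab row_stabilizer_comp_of[OF h] permutes_in_image[OF row_stabilizerD(1)[OF h]] by auto
  have hab: "h b < h a"
    using block_perm_less[OF p h_in] ab(5) permutes_inj[OF row_stabilizerD(1)[OF h]] ab(3)
    by (metis comp_apply injD less_asym linorder_neqE_nat)
  have r: "same_row L a (h a)" "same_row L b (h b)"
    using same_row_stab[OF h] ab by auto
  then have "same_row L a b"
    using same_row_less[of a b L "h a" "h b"] ab(3) hab by fastforce
  then have "same_row L (h b) (h a)"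
    using r same_row_sym same_row_trans by meson
  then have "same_row L (BP p (h b)) (BP p (h a))"
    by (rule block_perm_same_row[OF p])
  then show "tableau_perm L t ((BP p \<circ> h) b) < tableau_perm L t ((BP p \<circ> h) a)"
    using row_standard_increasing[OF RStdD(1,2)[OF u]] ab(5) unfolding row_increasing_def by simp
qed

lemma m_closed:
  assumes "(t, v) \<in> RStd (L, M)"
  shows "bt_m n q (L, M) (t, v) \<in> carrier (bt n q)"
  unfolding bt_m_def split_conv
  using E_closed x_closed b_closed BB_closed[OF RStdD(7)[OF assms]] bt_gw_closed[OF tableau_perm_props(1)[OF RStdD(1)[OF assms]]]
  by (intro bt_prod_closed) simp

lemma coset_permutes:
  assumes "u \<in> RStd (L, M)" "p \<in> row_stabilizer M" "h \<in> row_stabilizer L"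
  shows "std_perm u \<circ> BP p \<circ> h permutes {1..n}"
proof -
  have "std_perm u permutes {1..n}"
    using std_perm_permutes[of "fst u" "snd u"] assms(1) by simp
  then show ?thesis
    using permutes_compose[OF row_stabilizerD(1)[OF assms(3)] permutes_compose[OF block_perm(1)[OF stab_M[OF assms(2)]]]] by simp
qed

text \<open>No factor collides, so each summand is a single basis vector and the powers of
  \<open>q\<close> come from \<open>x\<close> alone.\<close>

lemma act_m:
  assumes u: "(t, v) \<in> RStd (L, M)"
  shows "act (bt_m n q (L, M) (t, v)) (basis_vec id) =
    lin_comb (row_stabilizer L \<times> row_stabilizer M) (\<lambda>(h, p). q ^ inv_count n h) (\<lambda>(h, p). std_perm (t, v) \<circ> BP p \<circ> h)"
proof -
  let ?S = "row_stabilizer L \<times> row_stabilizer M" and ?d = "tableau_perm M v"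
  note d = RStdD(7)[OF u] and t = tableau_perm_props(1)[OF RStdD(1)[OF u]]
  have cp: "comp_preserving L (BP p \<circ> h)" if "h \<in> row_stabilizer L" "p \<in> row_stabilizer M" for h p
    using that by (intro comp_preserving_comp comp_preserving_row_stabilizer comp_preserving_block_perm stab_M)
  have 1: "act (bt_BB n q L ?d) (lin_comb ?S (\<lambda>(h, p). q ^ inv_count n h) (\<lambda>(h, p). BP p \<circ> h)) =
      lin_comb ?S (\<lambda>(h, p). q ^ inv_count n h) (\<lambda>(h, p). BP (?d \<circ> p) \<circ> h)"
    by (rule bt_act_lin_comb)
      (auto simp: act_BB[OF d cp collision_free_BP[OF d cp]] block_perm_compose[OF stab_M d] comp_assoc)
  have 2: "act (bt_gw n q (tableau_perm L t)) (lin_comb ?S (\<lambda>(h, p). q ^ inv_count n h) (\<lambda>(h, p). BP (?d \<circ> p) \<circ> h)) =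
      lin_comb ?S (\<lambda>(h, p). q ^ inv_count n h) (\<lambda>(h, p). std_perm (t, v) \<circ> BP p \<circ> h)"
  proof (rule bt_act_lin_comb, clarify)
    fix h p assume hp: "h \<in> row_stabilizer L" "p \<in> row_stabilizer M"
    have dp: "?d \<circ> p \<in> comp_stabilizer L"
      by (rule comp_stabilizer_comp[OF stab_M[OF hp(2)] d])
    have "act (bt_gw n q (tableau_perm L t)) (basis_vec (BP (?d \<circ> p) \<circ> h)) = basis_vec (tableau_perm L t \<circ> (BP (?d \<circ> p) \<circ> h))"
      by (rule bt_act_gw[OF permutes_compose[OF row_stabilizerD(1)[OF hp(1)] block_perm(1)[OF dp]] t collision_free_tableau[OF u hp(1) dp]])
    also have "tableau_perm L t \<circ> (BP (?d \<circ> p) \<circ> h) = std_perm (t, v) \<circ> BP p \<circ> h"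
      by (simp only: std_perm_def split_conv block_perm_compose[OF stab_M[OF hp(2)] d] comp_assoc)
    finally show "act (bt_gw n q (tableau_perm L t)) (basis_vec (BP (?d \<circ> p) \<circ> h)) = basis_vec (std_perm (t, v) \<circ> BP p \<circ> h)" .
  qed
  have 3: "act \<one>\<^bsub>bt n q\<^esub> (lin_comb ?S (\<lambda>(h, p). q ^ inv_count n h) (\<lambda>(h, p). std_perm (t, v) \<circ> BP p \<circ> h)) =
      lin_comb ?S (\<lambda>(h, p). q ^ inv_count n h) (\<lambda>(h, p). std_perm (t, v) \<circ> BP p \<circ> h)"
    using coset_permutes[OF u] by (intro bt_act_lin_comb) (auto intro!: act_one_basis)
  have c: "bt_BB n q L ?d \<in> carrier (bt n q)" "bt_gw n q (tableau_perm L t) \<in> carrier (bt n q)" "\<one>\<^bsub>bt n q\<^esub> \<in> carrier (bt n q)"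
    by (rule BB_closed[OF d] bt_gw_closed[OF t] ring.ring_simprules(6)[OF ring_bt])+
  show ?thesis
    unfolding bt_m_def split_conv bt_prod_Cons bt_prod_Nil
    by (simp only: bt_act_mult bt_mult_closed E_closed x_closed b_closed c act_E[OF comp_preserving_id] act_xb 1 2 3)
qed

text \<open>Moving \<open>p\<close> and \<open>h\<close> to the other side gives a decomposition of
  \<open>std_perm u\<close>, to which uniqueness applies; \<open>k\<close> is the resulting row
  permutation after its passage through the block exchange.\<close>

lemma decomposition_full_unique:
  assumes u: "u \<in> RStd (L, M)" "u' \<in> RStd (L, M)"
    and p: "p \<in> row_stabilizer M" "p' \<in> row_stabilizer M" and h: "h \<in> row_stabilizer L" "h' \<in> row_stabilizer L"
    and eq: "std_perm u \<circ> BP p \<circ> h = std_perm u' \<circ> BP p' \<circ> h'"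
  shows "u = u'" "p = p'" "h = h'"
proof -
  note B = block_perm(1)[OF stab_M[OF p(1)]] and H = row_stabilizerD(1)[OF h(1)]
  define k where "k = BP p \<circ> (h' \<circ> inv h) \<circ> inv (BP p)"
  have k: "k \<in> row_stabilizer L"
    unfolding k_def by (intro block_perm_conj_row_stabilizer[OF stab_M[OF p(1)]] row_stabilizer_comp row_stabilizer_inv h)
  have pp: "p' \<circ> inv p \<in> row_stabilizer M"
    by (intro row_stabilizer_comp row_stabilizer_inv p)
  have "BP (p' \<circ> inv p) = BP p' \<circ> inv (BP p)"
    using block_perm_compose[OF comp_stabilizer_inv[OF stab_M[OF p(1)]] stab_M[OF p(2)]] block_perm_inv[OF stab_M[OF p(1)]] by simp
  then have "std_perm u' \<circ> BP (p' \<circ> inv p) \<circ> k = std_perm u' \<circ> BP p' \<circ> (inv (BP p) \<circ> BP p) \<circ> h' \<circ> inv h \<circ> inv (BP p)"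
    unfolding k_def by (simp only: comp_assoc)
  also have "\<dots> = std_perm u' \<circ> BP p' \<circ> h' \<circ> inv h \<circ> inv (BP p)"
    unfolding permutes_inv_o(2)[OF B] by simp
  also have "\<dots> = std_perm u \<circ> (BP p \<circ> (h \<circ> inv h) \<circ> inv (BP p))"
    unfolding eq[symmetric] by (simp only: comp_assoc)
  also have "\<dots> = std_perm u"
    unfolding permutes_inv_o(1)[OF H] using permutes_inv_o(1)[OF B] by simp
  finally have e: "std_perm u = std_perm u' \<circ> BP (p' \<circ> inv p) \<circ> k" ..
  obtain t v t' v' where tv: "u = (t, v)" "u' = (t', v')"
    by (cases u; cases u')
  note U = decomposition_unique[OF u[unfolded tv] pp k e[unfolded tv]]
  show "u = u'"
    using U(1) tv by simp
  have "p' \<circ> (inv p \<circ> p) = p"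
    using U(2) by (simp only: comp_assoc[symmetric] id_comp)
  then show pe: "p = p'"
    unfolding permutes_inv_o(2)[OF row_stabilizerD(1)[OF p(1)]] by simp
  have su: "std_perm u permutes {1..n}"
    using std_perm_permutes u tv by simp
  have "inj (std_perm u \<circ> BP p)"
    using permutes_inj[OF permutes_compose[OF B su]] .
  then show "h = h'"
    using eq \<open>u = u'\<close> pe by (metis fun.inj_map_strong inj_eq fun_eq_iff comp_apply)
qed

lemma lin_comb_coset:
  assumes u: "u \<in> RStd (L, M)" and w: "w permutes {1..n}" "w = std_perm u \<circ> BP p \<circ> h"
    and p: "p \<in> row_stabilizer M" and h: "h \<in> row_stabilizer L" and u': "u' \<in> RStd (L, M)"
  shows "lin_comb (row_stabilizer L \<times> row_stabilizer M) (\<lambda>(h, p). q ^ inv_count n h) (\<lambda>(h, p). std_perm u' \<circ> BP p \<circ> h) (inv w)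
    = (if u' = u then q ^ inv_count n h else 0)"
proof -
  have iff: "inv w = inv (std_perm u' \<circ> BP p' \<circ> h') \<longleftrightarrow> u' = u \<and> p' = p \<and> h' = h"
    if "p' \<in> row_stabilizer M" "h' \<in> row_stabilizer L" for p' h'
  proof -
    have "std_perm u' \<circ> BP p' \<circ> h' permutes {1..n}"
      using u' that by (rule coset_permutes)
    then have "inv w = inv (std_perm u' \<circ> BP p' \<circ> h') \<longleftrightarrow> std_perm u' \<circ> BP p' \<circ> h' = w"
      using w(1) inv_inv_eq[OF permutes_bij] by metis
    then show ?thesis
      unfolding w(2) using decomposition_full_unique[OF u' u that(1) p that(2) h] by blast
  qed
  have "lin_comb (row_stabilizer L \<times> row_stabilizer M) (\<lambda>(h, p). q ^ inv_count n h) (\<lambda>(h, p). std_perm u' \<circ> BP p \<circ> h) (inv w)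
      = (\<Sum>k\<in>row_stabilizer L \<times> row_stabilizer M. if k = (h, p) then (if u' = u then q ^ inv_count n h else 0) else 0)"
    unfolding lin_comb_def
  proof (intro sum.cong refl)
    fix k assume "k \<in> row_stabilizer L \<times> row_stabilizer M"
    then obtain h' p' where k: "k = (h', p')" "p' \<in> row_stabilizer M" "h' \<in> row_stabilizer L"
      by auto
    show "(case k of (h, p) \<Rightarrow> q ^ inv_count n h) * basis_vec (case k of (h, p) \<Rightarrow> std_perm u' \<circ> BP p \<circ> h) (inv w) =
        (if k = (h, p) then if u' = u then q ^ inv_count n h else 0 else 0)"
      unfolding k(1) split_conv basis_vec_def iff[OF k(2,3)] by auto
  qed
  also have "\<dots> = (if u' = u then q ^ inv_count n h else 0)"
    using p h by (simp only: sum.delta finite_cartesian_product finite_row_stabilizer mem_Times_iff fst_conv snd_conv simp_thms if_True)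
  finally show ?thesis .
qed

lemma finite_RStd: "finite (RStd (L, M))"
proof (rule finite_imageD)
  show "finite (std_perm ` RStd (L, M))"
  proof (rule finite_subset)
    show "std_perm ` RStd (L, M) \<subseteq> {w. w permutes {1..n}}"
    proof (rule image_subsetI)
      fix u assume "u \<in> RStd (L, M)"
      from coset_permutes[OF this row_stabilizer_id row_stabilizer_id]
      show "std_perm u \<in> {w. w permutes {1..n}}"
        by (simp add: block_perm_id)
    qed
  qed (simp add: finite_permutations)
  show "inj_on std_perm (RStd (L, M))"
  proof (rule inj_onI)
    fix u u' assume u: "u \<in> RStd (L, M)" "u' \<in> RStd (L, M)" "std_perm u = std_perm u'"
    show "u = u'"
      by (rule decomposition_full_unique(1)[OF u(1,2) row_stabilizer_id row_stabilizer_id row_stabilizer_id row_stabilizer_id])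
        (simp only: u(3))
  qed
qed

section \<open>Tabloid vectors\<close>

text \<open>Model of the permutation module inside the space of vectors: the elements \<open>m\<close> are sent to
  the tabloid vectors of the coset indicators.\<close>

definition tabloid_coeff :: "((nat \<Rightarrow> nat) \<Rightarrow> 'a) \<Rightarrow> bool" where
  "tabloid_coeff c \<longleftrightarrow> (\<forall>w. w permutes {1..n} \<longrightarrow>
    (\<forall>h\<in>row_stabilizer L. c (w \<circ> h) = c w) \<and> (\<forall>p\<in>row_stabilizer M. c (w \<circ> BP p) = c w))"

text \<open>A coset function spread over its cosets with the weights that \<open>x\<close> gives to
  row permutations. Only words that permute \<open>{1..n}\<close> carry a value.\<close>

definition tabloid_vec :: "((nat \<Rightarrow> nat) \<Rightarrow> 'a) \<Rightarrow> (nat \<Rightarrow> nat) \<Rightarrow> 'a" where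
  "tabloid_vec c x = (if x permutes {1..n} then q ^ row_inv L (inv x) * c (inv x) else 0)"

definition tabloids :: "((nat \<Rightarrow> nat) \<Rightarrow> 'a) set" where
  "tabloids = {tabloid_vec c |c. tabloid_coeff c}"

lemma transpose_row_stabilizer:
  assumes "same_row L a b" "a \<noteq> b"
  shows "Transposition.transpose a b \<in> row_stabilizer L"
proof (rule row_stabilizerI)
  show "Transposition.transpose a b permutes {1..n}"
    using same_row_range[OF assms(1)] by (intro permutes_swap_id) auto
  fix d assume "d \<in> {1..n}"
  then show "same_row L d (Transposition.transpose a b d)"
    using assms(1) same_row_sym same_row_refl by (auto simp: Transposition.transpose_def)
qed

lemma row_inv_adj_swap_other:
  assumes w: "w permutes {1..n}" and i: "i \<in> {1..<n}" and ns: "\<not> same_row L (inv w i) (inv w (Suc i))"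
  shows "row_inv L (adj_swap i \<circ> w) = row_inv L w"
proof -
  have "(adj_swap i \<circ> w) b < (adj_swap i \<circ> w) a \<longleftrightarrow> w b < w a" if "same_row L a b" "a < b" for a b
  proof -
    have "\<not> (w a = i \<and> w b = Suc i)" "\<not> (w b = i \<and> w a = Suc i)"
      using ns that(1) same_row_sym permutes_inverses(2)[OF w] by metis+
    moreover have "w a \<noteq> w b"
      using that(2) permutes_inj[OF w] by (metis injD less_irrefl)
    ultimately show ?thesis
      by (auto simp: adj_swap_eq)
  qed
  then show ?thesis
    unfolding row_inv_def by (intro arg_cong[of _ _ card]) auto
qed

lemma row_inv_adj_swap_up:
  assumes w: "w permutes {1..n}" and i: "i \<in> {1..<n}" and s: "same_row L (inv w i) (inv w (Suc i))" "inv w i < inv w (Suc i)"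
  shows "row_inv L (adj_swap i \<circ> w) = Suc (row_inv L w)"
proof -
  let ?a = "inv w i" and ?b = "inv w (Suc i)"
  let ?R = "\<lambda>w. {(a, b). same_row L a b \<and> a < b \<and> w b < w a}"
  have "?R (adj_swap i \<circ> w) = insert (?a, ?b) (?R w)"
  proof (rule Set.set_eqI, clarify)
    fix a b
    have "(adj_swap i \<circ> w) b < (adj_swap i \<circ> w) a \<longleftrightarrow> w b < w a \<or> (a = ?a \<and> b = ?b)" if "same_row L a b" "a < b"
    proof -
      have "a = ?a \<longleftrightarrow> w a = i" "b = ?b \<longleftrightarrow> w b = Suc i" "\<not> (w a = Suc i \<and> w b = i)"
        using permutes_inverses[OF w] that(2) s(2) by (metis, metis, metis less_asym)
      moreover have "w a \<noteq> w b"
        using that(2) permutes_inj[OF w] by (metis injD less_irrefl)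
      moreover have "adj_swap i y < adj_swap i x \<longleftrightarrow> y < x \<or> (x = i \<and> y = Suc i)"
        if "x \<noteq> y" "\<not> (x = Suc i \<and> y = i)" for x y
        using that by (auto simp: adj_swap_eq)
      ultimately show ?thesis
        by (metis comp_apply)
    qed
    then show "(a, b) \<in> ?R (adj_swap i \<circ> w) \<longleftrightarrow> (a, b) \<in> insert (?a, ?b) (?R w)"
      using s by auto
  qed
  moreover have "(?a, ?b) \<notin> ?R w"
    using permutes_inverses[OF w] by simp
  moreover have "finite (?R w)"
    by (rule finite_subset[of _ "{1..n} \<times> {1..n}"]) (use same_row_range in blast)+
  ultimately show ?thesis
    by (simp add: row_inv_def)
qed

lemma tabloid_letter_e:
  assumes c: "tabloid_coeff c" and i: "i \<in> {1..<n}"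
  shows "act_letter (comp_of L) z (Gen_e i) (tabloid_vec c) \<in> tabloids"
proof -
  define c' where "c' w = (if comp_of L (inv w i) = comp_of L (inv w (Suc i)) then c w else 0)" for w
  have inv: "comp_of L (inv (w \<circ> u) i) = comp_of L (inv (w \<circ> u) (Suc i)) \<longleftrightarrow> comp_of L (inv w i) = comp_of L (inv w (Suc i))"
    if w: "w permutes {1..n}" and u: "comp_preserving L u" for w u
  proof -
    have up: "u permutes {1..n}"
      using u by (simp add: comp_preserving_def)
    have iv: "inv (w \<circ> u) = inv u \<circ> inv w"
      by (rule o_inv_distrib[OF permutes_bij[OF w] permutes_bij[OF up]])
    have r: "(inv u \<circ> inv w) j \<in> {1..n}" if "j \<in> {1..n}" for j
      using that permutes_in_image[OF permutes_compose[OF permutes_inv[OF w] permutes_inv[OF up]]] by blast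
    have "i \<in> {1..n}" "Suc i \<in> {1..n}"
      using i by auto
    then show ?thesis
      using u r permutes_inverses(1)[OF up] unfolding iv comp_preserving_def by (metis comp_apply)
  qed
  have "tabloid_coeff c'"
    using c inv comp_preserving_row_stabilizer comp_preserving_block_perm stab_M
    unfolding tabloid_coeff_def c'_def by simp
  moreover have "act_letter (comp_of L) z (Gen_e i) (tabloid_vec c) = tabloid_vec c'"
  proof
    fix x
    show "act_letter (comp_of L) z (Gen_e i) (tabloid_vec c) x = tabloid_vec c' x"
      by (auto simp: tabloid_vec_def c'_def inv_inv_eq permutes_bij)
  qed
  ultimately show ?thesis
    by (auto simp: tabloids_def)
qed

text \<open>If the letters at \<open>i\<close> and \<open>i + 1\<close> belong to one row, the
  exchange stays in the coset and the generator acts as the scalar \<open>q\<close>, by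
  \<open>q * q = 1 + z * q\<close>. Otherwise the row weight is unchanged and the coefficients
  follow the rule for single words.\<close>

lemma tabloid_letter_g:
  assumes c: "tabloid_coeff c" and i: "i \<in> {1..<n}"
  shows "act_letter (comp_of L) z (Gen_g i) (tabloid_vec c) \<in> tabloids"
proof -
  let ?a = "\<lambda>w. inv w i" and ?b = "\<lambda>w. inv w (Suc i)"
  define c' where "c' w = (if same_row L (?a w) (?b w) then q * c w
    else c (adj_swap i \<circ> w) + (if comp_of L (?a w) = comp_of L (?b w) \<and> ?b w < ?a w then z * c w else 0))" for w
  have qq: "q * q = 1 + z * q"
    using unit by (simp add: unit_inv_q algebra_simps)
  \<comment> \<open>The properties shared by row permutations and by block exchanges are isolated
    here, so that both kinds of invariance come from one computation.\<close>
  have invariant: "c' (w \<circ> u) = c' w"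
    if w: "w permutes {1..n}" and u: "u permutes {1..n}"
      and cu: "\<And>w. w permutes {1..n} \<Longrightarrow> c (w \<circ> u) = c w"
      and row: "\<And>a b. a \<in> {1..n} \<Longrightarrow> b \<in> {1..n} \<Longrightarrow> same_row L (u a) (u b) \<longleftrightarrow> same_row L a b"
      and comp: "\<And>a b. a \<in> {1..n} \<Longrightarrow> b \<in> {1..n} \<Longrightarrow> comp_of L (u a) = comp_of L (u b) \<longleftrightarrow> comp_of L a = comp_of L b"
      and less: "\<And>a b. a \<in> {1..n} \<Longrightarrow> b \<in> {1..n} \<Longrightarrow> \<not> same_row L a b \<Longrightarrow> comp_of L a = comp_of L b \<Longrightarrow> a < b \<Longrightarrow> u a < u b"
    for w u
  proof -
    have iv: "inv (w \<circ> u) = inv u \<circ> inv w"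
      by (rule o_inv_distrib[OF permutes_bij[OF w] permutes_bij[OF u]])
    define a b where "a = inv (w \<circ> u) i" and "b = inv (w \<circ> u) (Suc i)"
    have "i \<in> {1..n}" "Suc i \<in> {1..n}"
      using i by auto
    then have ab: "a \<in> {1..n}" "b \<in> {1..n}"
      unfolding a_def b_def using permutes_in_image[OF permutes_inv[OF permutes_compose[OF u w]]] by blast+
    have ua: "inv w i = u a" "inv w (Suc i) = u b"
      unfolding a_def b_def iv using permutes_inverses[OF u] by simp_all
    have neq: "a \<noteq> b"
      using permutes_inj[OF permutes_inv[OF w]] ua by (metis injD n_not_Suc_n)
    have lt: "u b < u a \<longleftrightarrow> b < a" if "\<not> same_row L a b" "comp_of L a = comp_of L b"
      using less[OF ab(1,2)] less[OF ab(2,1)] that neq same_row_sym by (metis less_asym linorder_neqE_nat)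
    have "c (adj_swap i \<circ> (w \<circ> u)) = c (adj_swap i \<circ> w)"
      using cu[OF permutes_comp_adj_swap(2)[OF w i]] by (simp only: comp_assoc)
    then show ?thesis
      unfolding c'_def a_def[symmetric] b_def[symmetric] ua
      using row[OF ab] comp[OF ab] cu[OF w] lt by auto
  qed
  have "tabloid_coeff c'"
    unfolding tabloid_coeff_def
  proof (intro allI impI conjI ballI)
    fix w h assume w: "w permutes {1..n}" and h: "h \<in> row_stabilizer L"
    have hr: "same_row L a (h a)" "comp_of L (h a) = comp_of L a" if "a \<in> {1..n}" for a
      using that same_row_stab[OF h] row_stabilizer_comp_of[OF h] by auto
    show "c' (w \<circ> h) = c' w"
    proof (rule invariant[OF w row_stabilizerD(1)[OF h]])
      show "c (w \<circ> h) = c w" if "w permutes {1..n}" for w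
        using c h that unfolding tabloid_coeff_def by blast
      show "same_row L (h a) (h b) \<longleftrightarrow> same_row L a b" if "a \<in> {1..n}" "b \<in> {1..n}" for a b
        using hr(1)[OF that(1)] hr(1)[OF that(2)] same_row_sym same_row_trans by meson
      show "h a < h b" if "a \<in> {1..n}" "b \<in> {1..n}" "\<not> same_row L a b" "a < b" for a b
        using same_row_less[OF that(4,3) hr(1)[OF that(1)] hr(1)[OF that(2)]] .
    qed (use hr in auto)
  next
    fix w p assume w: "w permutes {1..n}" and p: "p \<in> row_stabilizer M"
    note ps = stab_M[OF p]
    show "c' (w \<circ> BP p) = c' w"
    proof (rule invariant[OF w block_perm(1)[OF ps]])
      show "c (w \<circ> BP p) = c w" if "w permutes {1..n}" for w
        using c p that unfolding tabloid_coeff_def by blast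
      show "same_row L (BP p a) (BP p b) \<longleftrightarrow> same_row L a b" if "a \<in> {1..n}" "b \<in> {1..n}" for a b
        using block_perm_same_row[OF ps, of a b] block_perm_same_row[OF comp_stabilizer_inv[OF ps], of "BP p a" "BP p b"]
        by (auto simp: block_perm_inv[OF ps] permutes_inverses[OF block_perm(1)[OF ps]])
      show "comp_of L (BP p a) = comp_of L (BP p b) \<longleftrightarrow> comp_of L a = comp_of L b" if "a \<in> {1..n}" "b \<in> {1..n}" for a b
        using comp_preserving_block_perm[OF ps] that unfolding comp_preserving_def by blast
      show "BP p a < BP p b" if "a \<in> {1..n}" "b \<in> {1..n}" "comp_of L a = comp_of L b" "a < b" for a b
        by (rule block_perm_less[OF ps that])
    qed
  qed
  moreover have "act_letter (comp_of L) z (Gen_g i) (tabloid_vec c) = tabloid_vec c'"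
  proof
    fix x
    show "act_letter (comp_of L) z (Gen_g i) (tabloid_vec c) x = tabloid_vec c' x"
    proof (cases "x permutes {1..n}")
      case False
      have "x = (x \<circ> adj_swap i) \<circ> adj_swap i"
        by (simp only: swap_twice)
      then have "\<not> x \<circ> adj_swap i permutes {1..n}"
        using False permutes_comp_adj_swap(1)[OF _ i] by metis
      then show ?thesis
        using False by (simp add: tabloid_vec_def)
    next
      case x: True
      define w where "w = inv x"
      have w: "w permutes {1..n}" and xw: "x = inv w"
        unfolding w_def using permutes_inv[OF x] inv_inv_eq[OF permutes_bij[OF x]] by auto
      have s: "x \<circ> adj_swap i permutes {1..n}"
        by (rule permutes_comp_adj_swap(1)[OF x i])
      have ix: "inv (x \<circ> adj_swap i) = adj_swap i \<circ> w"
        unfolding w_def using o_inv_distrib[OF permutes_bij[OF x] permutes_bij[OF permutes_adj_swap[OF i]]]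
        by (simp only: inv_adj_swap)
      note sw = permutes_comp_adj_swap(2)[OF w i]
      have ne: "?a w \<noteq> ?b w"
        using permutes_inj[OF permutes_inv[OF w]] by (metis injD n_not_Suc_n)
      have L: "act_letter (comp_of L) z (Gen_g i) (tabloid_vec c) x = q ^ row_inv L (adj_swap i \<circ> w) * c (adj_swap i \<circ> w) +
          (if comp_of L (?a w) = comp_of L (?b w) \<and> ?b w < ?a w then z * (q ^ row_inv L w * c w) else 0)"
        using s x ix xw inv_inv_eq[OF permutes_bij[OF w]] by (simp add: tabloid_vec_def w_def[symmetric] del: adj_swap_simps)
      have R: "tabloid_vec c' x = q ^ row_inv L w * c' w"
        using x by (simp add: tabloid_vec_def w_def)
      show ?thesis
      proof (cases "same_row L (?a w) (?b w)")
        case False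
        then show ?thesis
          unfolding L R c'_def row_inv_adj_swap_other[OF w i False] by (simp add: algebra_simps)
      next
        case same: True
        have inv_s: "inv (adj_swap i \<circ> w) = inv w \<circ> adj_swap i"
          using o_inv_distrib[OF permutes_bij[OF permutes_adj_swap[OF i]] permutes_bij[OF w]] by (simp only: inv_adj_swap)
        \<comment> \<open>Exchanging the values \<open>i\<close> and \<open>i + 1\<close> amounts to
          exchanging the two places of the row that hold them, which is a row permutation.\<close>
        have "adj_swap i \<circ> w = w \<circ> Transposition.transpose (?a w) (?b w)"
        proof
          fix d
          show "(adj_swap i \<circ> w) d = (w \<circ> Transposition.transpose (?a w) (?b w)) d"
          proof -
            have "w d = i \<longleftrightarrow> d = ?a w" "w d = Suc i \<longleftrightarrow> d = ?b w"
              using permutes_inverses[OF w] by metis+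
            then show ?thesis
              using permutes_inverses(1)[OF w] ne by (auto simp: adj_swap_eq Transposition.transpose_def)
          qed
        qed
        then have cs: "c (adj_swap i \<circ> w) = c w"
          using c w transpose_row_stabilizer[OF same ne] unfolding tabloid_coeff_def by metis
        have cc: "comp_of L (?a w) = comp_of L (?b w)"
          using same unfolding same_row_def by (metis comp_of_pos)
        show ?thesis
        proof (cases "?a w < ?b w")
          case True
          then show ?thesis
            unfolding L R c'_def cs row_inv_adj_swap_up[OF w i same True] using same by (simp add: algebra_simps)
        next
          case False
          then have ba: "?b w < ?a w"
            using ne by simp
          have "row_inv L (adj_swap i \<circ> (adj_swap i \<circ> w)) = Suc (row_inv L (adj_swap i \<circ> w))"
            using ba same_row_sym[OF same] by (intro row_inv_adj_swap_up[OF sw i]) (simp_all add: inv_s)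
          moreover have "adj_swap i \<circ> (adj_swap i \<circ> w) = w"
            by (simp add: comp_assoc[symmetric])
          ultimately have r: "row_inv L w = Suc (row_inv L (adj_swap i \<circ> w))"
            by simp
          have "q ^ row_inv L (adj_swap i \<circ> w) * c w + z * (q ^ row_inv L w * c w) =
              q ^ row_inv L (adj_swap i \<circ> w) * c w * (1 + z * q)"
            unfolding r by (simp add: algebra_simps)
          also have "\<dots> = q ^ row_inv L w * (q * c w)"
            unfolding qq[symmetric] r by (simp add: algebra_simps)
          finally show ?thesis
            unfolding L R c'_def cs using same cc ba by simp
        qed
      qed
    qed
  qed
  ultimately show ?thesis
    by (auto simp: tabloids_def)
qed

lemma tabloids_sum:
  assumes "finite K" "\<And>k. k \<in> K \<Longrightarrow> v k \<in> tabloids"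
  shows "(\<lambda>x. \<Sum>k\<in>K. d k * v k x) \<in> tabloids"
proof -
  have "\<forall>k\<in>K. \<exists>c. tabloid_coeff c \<and> v k = tabloid_vec c"
    using assms(2) by (auto simp: tabloids_def)
  then obtain c where c: "\<forall>k\<in>K. tabloid_coeff (c k) \<and> v k = tabloid_vec (c k)"
    by metis
  have "tabloid_coeff (\<lambda>w. \<Sum>k\<in>K. d k * c k w)"
    unfolding tabloid_coeff_def
  proof (intro allI impI conjI ballI sum.cong refl arg_cong2[of _ _ _ _ "(*)"])
    fix w h k assume "w permutes {1..n}" "h \<in> row_stabilizer L" "k \<in> K"
    then show "c k (w \<circ> h) = c k w"
      using c unfolding tabloid_coeff_def by blast
  next
    fix w p k assume "w permutes {1..n}" "p \<in> row_stabilizer M" "k \<in> K"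
    then show "c k (w \<circ> BP p) = c k w"
      using c unfolding tabloid_coeff_def by blast
  qed
  moreover have "(\<lambda>x. \<Sum>k\<in>K. d k * v k x) = tabloid_vec (\<lambda>w. \<Sum>k\<in>K. d k * c k w)"
    using c by (auto simp: fun_eq_iff tabloid_vec_def sum_distrib_left mult.left_commute intro!: sum.cong)
  ultimately show ?thesis
    by (auto simp: tabloids_def)
qed

lemma act_word_tabloids:
  "set u \<subseteq> Gen_g ` {1..<n} \<union> Gen_e ` {1..<n} \<Longrightarrow> v \<in> tabloids \<Longrightarrow> act_word (comp_of L) z u v \<in> tabloids"
proof (induction u arbitrary: v)
  case (Cons l u)
  then obtain c where c: "tabloid_coeff c" "v = tabloid_vec c"
    by (auto simp: tabloids_def)
  have "act_letter (comp_of L) z l v \<in> tabloids"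
    using Cons.prems(1) tabloid_letter_g[OF c(1)] tabloid_letter_e[OF c(1)] c(2) by auto
  then show ?case
    using Cons by (simp add: act_word_Cons)
qed simp

text \<open>Words in the generators preserve tabloid vectors, and so do linear combinations. The
  mask changes nothing, as tabloid vectors vanish off the permutations.\<close>

lemma act_tabloids:
  assumes X: "X \<in> carrier (bt n q)" and v: "v \<in> tabloids"
  shows "act X v \<in> tabloids"
proof -
  obtain p where p: "p \<in> carrier (free_alg n)" "X = bt_class n q p"
    using X by (rule bt_carrierE)
  let ?v = "\<lambda>x. \<Sum>u\<in>Poly_Mapping.keys p. Poly_Mapping.lookup p u * act_word (comp_of L) z (letters u) v x"
  have t: "?v \<in> tabloids"
  proof (rule tabloids_sum)
    fix u assume "u \<in> Poly_Mapping.keys p"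
    then have "set (letters u) \<subseteq> Gen_g ` {1..<n} \<union> Gen_e ` {1..<n}"
      using p(1) unfolding free_alg_def words_below_def by auto
    then show "act_word (comp_of L) z (letters u) v \<in> tabloids"
      by (rule act_word_tabloids[OF _ v])
  qed simp
  then obtain c where c: "?v = tabloid_vec c"
    by (auto simp: tabloids_def)
  have "?v x = 0" if "\<not> inj x" for x
  proof -
    have "\<not> x permutes {1..n}"
      using that permutes_inj by blast
    then show ?thesis
      using fun_cong[OF c, of x] by (simp add: tabloid_vec_def)
  qed
  then have "act X v = ?v"
    unfolding p(2) bt_act_class act_free_def by auto
  then show ?thesis
    using t by simp
qed

lemma row_increasing_std_perm:
  assumes u: "u \<in> RStd (L, M)" and p: "p \<in> row_stabilizer M"
  shows "row_increasing L (std_perm u \<circ> BP p)"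
proof -
  obtain t v where tv: "u = (t, v)"
    by (cases u)
  note R = RStdD[OF u[unfolded tv]]
  have s: "tableau_perm M v \<circ> p \<in> comp_stabilizer L"
    by (rule comp_stabilizer_comp[OF stab_M[OF p] R(7)])
  have "std_perm u \<circ> BP p = tableau_perm L t \<circ> BP (tableau_perm M v \<circ> p)"
    by (simp only: tv std_perm_def split_conv block_perm_compose[OF stab_M[OF p] R(7)] comp_assoc)
  moreover have "row_increasing L (tableau_perm L t \<circ> BP (tableau_perm M v \<circ> p))"
    unfolding row_increasing_def
  proof (intro allI impI, elim conjE)
    fix a b assume ab: "same_row L a b" "a < b"
    have "comp_of L a = comp_of L b"
      using ab(1) unfolding same_row_def by (metis comp_of_pos)
    then have "BP (tableau_perm M v \<circ> p) a < BP (tableau_perm M v \<circ> p) b"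
      using same_row_range[OF ab(1)] ab(2) by (intro block_perm_less[OF s]) auto
    then show "(tableau_perm L t \<circ> BP (tableau_perm M v \<circ> p)) a < (tableau_perm L t \<circ> BP (tableau_perm M v \<circ> p)) b"
      using row_standard_increasing[OF R(1,2)] block_perm_same_row[OF s ab(1)] unfolding row_increasing_def by simp
  qed
  ultimately show ?thesis
    by simp
qed

text \<open>A coset function is determined by its values at the representatives
  \<open>std_perm u\<close>. Their rows are sorted, so the weight there is 1 and the values of the
  vector are the coordinates.\<close>

lemma tabloid_expansion:
  assumes v: "v \<in> tabloids"
  shows "v = (\<lambda>x. \<Sum>u\<in>RStd (L, M). v (inv (std_perm u)) * act (bt_m n q (L, M) u) (basis_vec id) x)"
proof
  fix x
  obtain c where c: "tabloid_coeff c" "v = tabloid_vec c"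
    using v by (auto simp: tabloids_def)
  have m: "act (bt_m n q (L, M) u) (basis_vec id) =
      lin_comb (row_stabilizer L \<times> row_stabilizer M) (\<lambda>(h, p). q ^ inv_count n h) (\<lambda>(h, p). std_perm u \<circ> BP p \<circ> h)"
    if "u \<in> RStd (L, M)" for u
    using act_m[of "fst u" "snd u"] that by simp
  show "v x = (\<Sum>u\<in>RStd (L, M). v (inv (std_perm u)) * act (bt_m n q (L, M) u) (basis_vec id) x)"
  proof (cases "x permutes {1..n}")
    case False
    have "act (bt_m n q (L, M) u) (basis_vec id) x = 0" if u: "u \<in> RStd (L, M)" for u
      unfolding m[OF u] lin_comb_def
    proof (rule sum.neutral, clarify)
      fix h p assume hp: "h \<in> row_stabilizer L" "p \<in> row_stabilizer M"
      then have "x \<noteq> inv (std_perm u \<circ> BP p \<circ> h)"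
        using coset_permutes[OF u hp(2,1)] permutes_inv False by metis
      then show "q ^ inv_count n h * basis_vec (std_perm u \<circ> BP p \<circ> h) x = 0"
        by (simp add: basis_vec_def)
    qed
    then show ?thesis
      using False c(2) by (simp add: tabloid_vec_def)
  next
    case x: True
    define w where "w = inv x"
    have w: "w permutes {1..n}" and xw: "x = inv w"
      unfolding w_def using permutes_inv[OF x] inv_inv_eq[OF permutes_bij[OF x]] by auto
    obtain u p h where d: "u \<in> RStd (L, M)" "p \<in> row_stabilizer M" "h \<in> row_stabilizer L" "w = std_perm u \<circ> BP p \<circ> h"
      using ex_decomposition[OF w] by blast
    have su: "std_perm u permutes {1..n}" and sup: "std_perm u \<circ> BP p permutes {1..n}"
      using coset_permutes[OF d(1) row_stabilizer_id row_stabilizer_id] coset_permutes[OF d(1,2) row_stabilizer_id]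
      by (simp_all add: block_perm_id)
    have "row_inv L (std_perm u) = 0"
      using row_inv_stabilizer[OF row_stabilizer_id row_increasing_std_perm[OF d(1) row_stabilizer_id]] by (simp add: block_perm_id)
    then have vu: "v (inv (std_perm u)) = c (std_perm u)"
      using su by (simp add: c(2) tabloid_vec_def permutes_inv inv_inv_eq permutes_bij)
    have "c w = c (std_perm u)"
      using c(1) su sup d(2,3) unfolding d(4) tabloid_coeff_def by simp
    then have vx: "v x = q ^ inv_count n h * c (std_perm u)"
      using x row_inv_stabilizer[OF d(3) row_increasing_std_perm[OF d(1,2)]]
      by (simp add: c(2) tabloid_vec_def w_def[symmetric] d(4))
    have "(\<Sum>u'\<in>RStd (L, M). v (inv (std_perm u')) * act (bt_m n q (L, M) u') (basis_vec id) x) =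
        (\<Sum>u'\<in>RStd (L, M). if u' = u then v (inv (std_perm u)) * q ^ inv_count n h else 0)"
      by (intro sum.cong refl) (simp add: m xw lin_comb_coset[OF d(1) w d(4,2,3)])
    also have "\<dots> = v (inv (std_perm u)) * q ^ inv_count n h"
      using d(1) finite_RStd by simp
    finally show ?thesis
      using vx vu by (simp add: mult.commute)
  qed
qed

text \<open>The coset function is the indicator of the coset \<open>C\<close> of
  \<open>std_perm u\<close>. It is stable under both stabilizers because block exchanges normalize
  the row stabilizer.\<close>

lemma m_tabloid: "u \<in> RStd (L, M) \<Longrightarrow> act (bt_m n q (L, M) u) (basis_vec id) \<in> tabloids"
proof -
  assume u: "u \<in> RStd (L, M)"
  have m: "act (bt_m n q (L, M) u) (basis_vec id) =
      lin_comb (row_stabilizer L \<times> row_stabilizer M) (\<lambda>(h, p). q ^ inv_count n h) (\<lambda>(h, p). std_perm u \<circ> BP p \<circ> h)"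
    using act_m[of "fst u" "snd u"] u by simp
  define C where "C = {std_perm u \<circ> BP p \<circ> h |p h. p \<in> row_stabilizer M \<and> h \<in> row_stabilizer L}"
  define c where "c w = (if w \<in> C then 1 else 0 :: 'a)" for w
  have Ch: "w \<circ> h \<in> C" if "w \<in> C" "h \<in> row_stabilizer L" for w h
    using that row_stabilizer_comp[OF that(2)] unfolding C_def by (auto simp: comp_assoc) (metis comp_assoc)
  have Cp: "w \<circ> BP p \<in> C" if wC: "w \<in> C" and pM: "p \<in> row_stabilizer M" for w p
  proof -
    obtain p' h where d: "w = std_perm u \<circ> BP p' \<circ> h" "p' \<in> row_stabilizer M" "h \<in> row_stabilizer L"
      using wC unfolding C_def by blast
    note ps = stab_M[OF pM]
    note B = block_perm(1)[OF ps]
    have k: "inv (BP p) \<circ> h \<circ> BP p \<in> row_stabilizer L"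
      using block_perm_conj_row_stabilizer[OF comp_stabilizer_inv[OF ps] d(3)]
      by (simp add: block_perm_inv[OF ps] inv_inv_eq[OF permutes_bij[OF B]])
    have "std_perm u \<circ> BP (p' \<circ> p) \<circ> (inv (BP p) \<circ> h \<circ> BP p) = std_perm u \<circ> BP p' \<circ> (BP p \<circ> inv (BP p)) \<circ> h \<circ> BP p"
      by (simp only: block_perm_compose[OF ps stab_M[OF d(2)]] comp_assoc)
    also have "\<dots> = w \<circ> BP p"
      unfolding permutes_inv_o(1)[OF B] d(1) by simp
    finally show ?thesis
      unfolding C_def using row_stabilizer_comp[OF pM d(2)] k by (intro CollectI exI conjI) (rule sym)
  qed
  have "tabloid_coeff c"
    unfolding tabloid_coeff_def
  proof (intro allI impI conjI ballI)
    fix w h :: "nat \<Rightarrow> nat" assume h: "h \<in> row_stabilizer L"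
    have "w \<circ> h \<circ> inv h = w"
      unfolding comp_assoc permutes_inv_o(1)[OF row_stabilizerD(1)[OF h]] by simp
    then show "c (w \<circ> h) = c w"
      unfolding c_def using Ch h row_stabilizer_inv[OF h] by metis
  next
    fix w p :: "nat \<Rightarrow> nat" assume p: "p \<in> row_stabilizer M"
    note ps = stab_M[OF p]
    have "w \<circ> BP p \<circ> BP (inv p) = w"
      unfolding comp_assoc block_perm_inv[OF ps] permutes_inv_o(1)[OF block_perm(1)[OF ps]] by simp
    then show "c (w \<circ> BP p) = c w"
      unfolding c_def using Cp p row_stabilizer_inv[OF p] by metis
  qed
  moreover have "act (bt_m n q (L, M) u) (basis_vec id) = tabloid_vec c"
  proof
    fix x
    show "act (bt_m n q (L, M) u) (basis_vec id) x = tabloid_vec c x"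
    proof (cases "x permutes {1..n} \<and> inv x \<in> C")
      case True
      then obtain p h where d: "p \<in> row_stabilizer M" "h \<in> row_stabilizer L" "inv x = std_perm u \<circ> BP p \<circ> h"
        unfolding C_def by blast
      have x: "x = inv (inv x)"
        using True inv_inv_eq[OF permutes_bij] by metis
      have "act (bt_m n q (L, M) u) (basis_vec id) (inv (inv x)) = q ^ inv_count n h"
        unfolding m using lin_comb_coset[OF u _ d(3,1,2) u] True permutes_inv by metis
      moreover have "row_inv L (inv x) = inv_count n h"
        unfolding d(3) by (rule row_inv_stabilizer[OF d(2) row_increasing_std_perm[OF u d(1)]])
      ultimately show ?thesis
        using True x by (simp add: tabloid_vec_def c_def)
    next
      case False
      have "basis_vec (std_perm u \<circ> BP p \<circ> h) x = (0 :: 'a)" if "h \<in> row_stabilizer L" "p \<in> row_stabilizer M" for h p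
      proof -
        let ?g = "std_perm u \<circ> BP p \<circ> h"
        have g: "?g permutes {1..n}" "?g \<in> C"
          using coset_permutes[OF u that(2,1)] that unfolding C_def by blast+
        have "x \<noteq> inv ?g"
        proof
          assume x: "x = inv ?g"
          then have "inv x = ?g"
            using inv_inv_eq[OF permutes_bij[OF g(1)]] by simp
          then show False
            using False g permutes_inv[OF g(1)] x by simp
        qed
        then show ?thesis
          by (simp add: basis_vec_def)
      qed
      then have "act (bt_m n q (L, M) u) (basis_vec id) x = 0"
        unfolding m lin_comb_def by (intro sum.neutral) auto
      then show ?thesis
        using False by (auto simp: tabloid_vec_def c_def)
    qed
  qed
  ultimately show ?thesis
    by (auto simp: tabloids_def)
qed

end

context index_rep
begin

section \<open>The coefficient of the product\<close>

text \<open>Exchanging neighbouring letters within \<open>{1..n}\<close> never turns a word outside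
  the permutations into a permutation.\<close>

lemma bt_act_support:
  assumes X: "X \<in> carrier (bt n q)" and v: "\<And>x. \<not> x permutes {1..n} \<Longrightarrow> v x = 0" and x: "\<not> x permutes {1..n}"
  shows "act X v x = 0"
proof -
  have letter: "act_letter (comp_of L) z l v x = 0"
    if v: "\<And>x. \<not> x permutes {1..n} \<Longrightarrow> v x = 0" and x: "\<not> x permutes {1..n}" and l: "l \<in> Gen_g ` {1..<n} \<union> Gen_e ` {1..<n}"
    for l v x
  proof -
    have "\<not> x \<circ> adj_swap i permutes {1..n}" if "i \<in> {1..<n}" for i
      using permutes_comp_adj_swap(1)[OF _ that, of "x \<circ> adj_swap i"] x by (metis swap_twice)
    then show ?thesis
      using v x l by auto
  qed
  have word: "act_word (comp_of L) z u v x = 0"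
    if "\<And>x. \<not> x permutes {1..n} \<Longrightarrow> v x = 0" "\<not> x permutes {1..n}" "set u \<subseteq> Gen_g ` {1..<n} \<union> Gen_e ` {1..<n}"
    for u v x
    using that
  proof (induction u arbitrary: v x)
    case (Cons l u)
    show ?case
      unfolding act_word_Cons by (rule Cons.IH) (use Cons.prems letter[of v _ l] in auto)
  qed simp
  obtain p where p: "p \<in> carrier (free_alg n)" "X = bt_class n q p"
    using X by (rule bt_carrierE)
  have "set (letters u) \<subseteq> Gen_g ` {1..<n} \<union> Gen_e ` {1..<n}" if "u \<in> Poly_Mapping.keys p" for u
    using p(1) that unfolding free_alg_def words_below_def by auto
  then show ?thesis
    unfolding p(2) bt_act_class act_free_def using word[OF v x] by (simp add: sum.neutral)
qed

lemma bt_star_invol: "X \<in> carrier (bt n q) \<Longrightarrow> bt_star (bt_star X) = X"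
  by (auto elim!: bt_carrierE simp: bt_star_class)

lemma sum_basis:
  assumes "w permutes {1..n}"
  shows "(\<Sum>x | x permutes {1..n}. v x * basis_vec w x) = v (inv w)"
  using assms by (simp add: basis_vec_def if_distrib[of "\<lambda>y. _ * y"] finite_permutations permutes_inv cong: if_cong)

text \<open>Adjointness takes the place of the identity E* = E: on basis vectors \<open>E\<close> is
  diagonal, so its adjoint has the same entries.\<close>

lemma act_star_E:
  assumes w: "comp_preserving L w"
  shows "act (bt_star E) (basis_vec w) = basis_vec w"
proof
  fix x
  have wp: "w permutes {1..n}"
    using w by (simp add: comp_preserving_def)
  show "act (bt_star E) (basis_vec w) x = basis_vec w x"
  proof (cases "x permutes {1..n}")
    case False
    then have "act (bt_star E) (basis_vec w) x = 0"
      by (intro bt_act_support bt_star_closed E_closed)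
        (use permutes_inv[OF wp] in \<open>auto simp: basis_vec_def\<close>)
    then show ?thesis
      using False permutes_inv[OF wp] by (auto simp: basis_vec_def)
  next
    case True
    let ?P = "{x. x permutes {1..n}}"
    have x: "inv (inv x) = x" "inv x permutes {1..n}"
      using inv_inv_eq[OF permutes_bij[OF True]] permutes_inv[OF True] by auto
    have "act (bt_star E) (basis_vec w) x = (\<Sum>y\<in>?P. act (bt_star E) (basis_vec w) y * basis_vec (inv x) y)"
      by (simp only: sum_basis[OF x(2)] x(1))
    also have "\<dots> = (\<Sum>y\<in>?P. basis_vec w y * act E (basis_vec (inv x)) y)"
      by (subst bt_act_adjoint[OF bt_star_closed[OF E_closed]]) (simp add: bt_star_invol[OF E_closed])
    also have "\<dots> = act E (basis_vec (inv x)) (inv w)"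
      using sum_basis[OF wp, of "act E (basis_vec (inv x))"] by (simp add: mult.commute)
    also have "\<dots> = basis_vec w x"
    proof (cases "x = inv w")
      case True
      then show ?thesis
        using act_E[OF w] inv_inv_eq[OF permutes_bij[OF wp]] by (simp add: basis_vec_def)
    next
      case False
      have "act E (basis_vec (inv x)) (inv w) = (0 :: 'a)"
        unfolding bt_EEm_def using False x(1)
        by (subst bt_act_EE[OF partition_on_blocks permutes_inj[OF permutes_inv[OF wp]]]) (simp add: basis_vec_def)
      then show ?thesis
        using False by (simp add: basis_vec_def)
    qed
    finally show ?thesis .
  qed
qed

section \<open>Columns of standard tableaux\<close>

abbreviation L' where "L' \<equiv> conj_mp L"
abbreviation M' where "M' \<equiv> conj_mp M"
abbreviation wL where "wL \<equiv> conj_perm L"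

lemma comp_preserving_wL: "comp_preserving L wL"
  by (rule comp_preservingI[OF conj_perm(1)[OF L_part] conj_perm_comp[OF L_part]])

lemma row_stabilizer_L': "k \<in> row_stabilizer L' \<Longrightarrow> k permutes {1..n}"
  using row_stabilizerD(1)[of k L'] by (simp add: mp_size_conj[OF L_part])

lemma comp_preserving_L':
  assumes k: "k \<in> row_stabilizer L'"
  shows "comp_preserving L k"
proof (rule comp_preservingI[OF row_stabilizer_L'[OF k]])
  fix a assume a: "a \<in> {1..n}"
  then have "k a \<in> {1..n}"
    using permutes_in_image[OF row_stabilizer_L'[OF k]] by blast
  then show "comp_of L (k a) = comp_of L a"
    using row_stabilizer_comp_of[OF k, of a] conj_components(2)[OF L_part] a mp_size_conj[OF L_part] by metis
qed

text \<open>For a standard tableau, a node above another one has the smaller entry unless it is strictly to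
  its right, in which case the column reading order agrees with the order of the entries.\<close>

lemma collision_free_conj:
  assumes u: "(t, v) \<in> RStd (L, M)" "col_standard t" and h: "h \<in> row_stabilizer L" and p: "p \<in> comp_stabilizer L"
  shows "collision_free n (comp_of L) (tableau_perm L t \<circ> (BP p \<circ> h)) (inv (tableau_perm L' (map List.transpose t)))"
  unfolding collision_free_def
proof (intro ballI impI, elim conjE)
  let ?d = "tableau_perm L t" and ?d' = "tableau_perm L' (map List.transpose t)"
  note R = RStdD[OF u(1)]
  fix a b assume ab: "a \<in> {1..n}" "b \<in> {1..n}" "a < b" "comp_of L a = comp_of L b" "(?d \<circ> (BP p \<circ> h)) b < (?d \<circ> (BP p \<circ> h)) a"
  have conj: "inv ?d' (?d y) = wL y" for y
    using fun_cong[OF conj_tableau_perm(2)[OF L_part R(1)], of y] by simp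
  let ?a = "BP p (h a)" and ?b = "BP p (h b)"
  have cp: "comp_preserving L (BP p \<circ> h)"
    by (intro comp_preserving_comp comp_preserving_row_stabilizer h comp_preserving_block_perm p)
  then have Wp: "BP p \<circ> h permutes {1..n}"
    by (simp add: comp_preserving_def)
  have rng: "?a \<in> {1..n}" "?b \<in> {1..n}"
    using permutes_in_image[OF Wp, of a] permutes_in_image[OF Wp, of b] ab by simp_all
  have "comp_of L ?a = comp_of L ?b"
    using cp ab(1,2,4) unfolding comp_preserving_def by simp
  then obtain c i j k l where x: "(c, i, j) \<in> nodes L" "?a = pos L (c, i, j)" and y: "(c, k, l) \<in> nodes L" "?b = pos L (c, k, l)"
    using rng comp_of_pos pos_cases by metis
  have hr: "same_row L a (h a)" "same_row L b (h b)"
    using same_row_stab[OF h] ab by auto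
  have "i \<le> k"
  proof (cases "same_row L a b")
    case True
    then have "same_row L (h a) (h b)"
      using hr same_row_sym same_row_trans by meson
    then have "same_row L ?a ?b"
      by (rule block_perm_same_row[OF p])
    then show ?thesis
      using x y same_row_pos[OF x(1) y(1)] by simp
  next
    case False
    then have "h a < h b"
      by (rule same_row_less[OF ab(3) _ hr])
    moreover have "h a \<in> {1..n}" "h b \<in> {1..n}" "comp_of L (h a) = comp_of L (h b)"
      using ab row_stabilizer_comp_of[OF h] permutes_in_image[OF row_stabilizerD(1)[OF h]] by auto
    ultimately have "?a < ?b"
      by (intro block_perm_less[OF p])
    then show ?thesis
      using x y pos_less_iff[OF x(1) y(1)] by auto
  qed
  have "l < j"
  proof (rule ccontr)
    assume "\<not> l < j"
    then have jl: "j \<le> l" by simp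
    \<comment> \<open>The node of row \<open>i\<close> in the column of \<open>(c, k, l)\<close>.
      Entries are compared along row \<open>i\<close> up to this node and then down the
      column.\<close>
    have il: "(c, i, l) \<in> nodes L"
    proof -
      have "(c, l, k) \<in> nodes L'"
        using y(1) nodes_conj[OF L_part] by blast
      then have "(c, l, i) \<in> nodes L'"
        using \<open>i \<le> k\<close> by (auto simp: nodes_def)
      then show ?thesis
        using nodes_conj[OF L_part] by blast
    qed
    have e: "?d (pos L y) = entry t y" if "y \<in> nodes L" for y
      by (rule tableau_perm_props(2)[OF R(1) that])
    have "?d (pos L (c, i, j)) \<le> ?d (pos L (c, i, l))"
    proof (cases "j = l")
      case False
      then have "pos L (c, i, j) < pos L (c, i, l)" "same_row L (pos L (c, i, j)) (pos L (c, i, l))"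
        using jl pos_less_row[OF x(1) il] same_row_pos[OF x(1) il] by auto
      then show ?thesis
        using row_standard_increasing[OF R(1,2)] unfolding row_increasing_def by (metis less_imp_le)
    qed simp
    also have "\<dots> \<le> ?d (pos L (c, k, l))"
      using col_standard_less[OF L_part R(1) u(2) il y(1)] \<open>i \<le> k\<close> e[OF il] e[OF y(1)] by (cases "i = k") auto
    finally show False
      using ab(5) x y by simp
  qed
  have x': "(c, j, i) \<in> nodes L'" and y': "(c, l, k) \<in> nodes L'"
    using x(1) y(1) nodes_conj[OF L_part] by blast+
  have "wL ?b < wL ?a"
    using pos_less_comp[OF y' x' \<open>l < j\<close>] conj_perm(2)[OF L_part x(1)] conj_perm(2)[OF L_part y(1)] x(2) y(2) by simp
  then show "inv ?d' ((?d \<circ> (BP p \<circ> h)) b) < inv ?d' ((?d \<circ> (BP p \<circ> h)) a)"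
    by (simp add: conj)
qed

text \<open>An inverted pair cannot lie in one column: there the order is that of the rows, which
  \<open>h\<close> and the block exchange do not invert. For different columns every column
  permutation keeps the order.\<close>

lemma collision_free_columns:
  assumes h: "h \<in> row_stabilizer L" and p: "p \<in> comp_stabilizer L" and k: "k \<in> row_stabilizer L'"
  shows "collision_free n (comp_of L) (wL \<circ> (BP p \<circ> h)) k"
  unfolding collision_free_def
proof (intro ballI impI, elim conjE)
  fix a b assume ab: "a \<in> {1..n}" "b \<in> {1..n}" "a < b" "comp_of L a = comp_of L b" "(wL \<circ> (BP p \<circ> h)) b < (wL \<circ> (BP p \<circ> h)) a"
  let ?a = "BP p (h a)" and ?b = "BP p (h b)"
  have cp: "comp_preserving L (BP p \<circ> h)"
    by (intro comp_preserving_comp comp_preserving_row_stabilizer h comp_preserving_block_perm p)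
  then have Wp: "BP p \<circ> h permutes {1..n}"
    by (simp add: comp_preserving_def)
  have rng: "?a \<in> {1..n}" "?b \<in> {1..n}"
    using permutes_in_image[OF Wp, of a] permutes_in_image[OF Wp, of b] ab by simp_all
  then have wrng: "wL ?a \<in> {1..mp_size L'}" "wL ?b \<in> {1..mp_size L'}"
    using permutes_in_image[OF conj_perm(1)[OF L_part]] mp_size_conj[OF L_part] by metis+
  have "comp_of L ?a = comp_of L ?b"
    using cp ab(1,2,4) unfolding comp_preserving_def by simp
  then obtain c i j k' l where x: "(c, i, j) \<in> nodes L" "?a = pos L (c, i, j)" and y: "(c, k', l) \<in> nodes L" "?b = pos L (c, k', l)"
    using rng comp_of_pos pos_cases by metis
  have x': "(c, j, i) \<in> nodes L'" and y': "(c, l, k') \<in> nodes L'"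
    using x(1) y(1) nodes_conj[OF L_part] by blast+
  have w: "wL ?a = pos L' (c, j, i)" "wL ?b = pos L' (c, l, k')"
    using conj_perm(2)[OF L_part x(1)] conj_perm(2)[OF L_part y(1)] x(2) y(2) by simp_all
  have "\<not> same_row L' (wL ?b) (wL ?a)"
  proof
    assume "same_row L' (wL ?b) (wL ?a)"
    then have jl: "l = j"
      unfolding w using same_row_pos[OF y' x'] by simp
    then have ki: "k' < i"
      using ab(5) w pos_less_iff[OF y' x'] by simp
    have hr: "same_row L a (h a)" "same_row L b (h b)"
      using same_row_stab[OF h] ab by auto
    show False
    proof (cases "same_row L a b")
      case True
      then have "same_row L (h a) (h b)"
        using hr same_row_sym same_row_trans by meson
      then have "same_row L ?a ?b"
        by (rule block_perm_same_row[OF p])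
      then show ?thesis
        using x y same_row_pos[OF x(1) y(1)] ki by simp
    next
      case False
      then have "h a < h b"
        by (rule same_row_less[OF ab(3) _ hr])
      moreover have "h a \<in> {1..n}" "h b \<in> {1..n}" "comp_of L (h a) = comp_of L (h b)"
        using ab row_stabilizer_comp_of[OF h] permutes_in_image[OF row_stabilizerD(1)[OF h]] by auto
      ultimately have "?a < ?b"
        by (intro block_perm_less[OF p])
      then show ?thesis
        using x y pos_less_iff[OF x(1) y(1)] ki by auto
    qed
  qed
  then show "k ((wL \<circ> (BP p \<circ> h)) b) < k ((wL \<circ> (BP p \<circ> h)) a)"
    using same_row_less[of "wL ?b" "wL ?a" L'] ab(5) same_row_stab[OF k wrng(1)] same_row_stab[OF k wrng(2)] by simp
qed

lemma E_conj: "bt_EEm n q L' = E"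
  by (simp add: bt_EEm_def conj_components(3)[OF L_part])

lemma BB_conj: "p \<in> comp_stabilizer L \<Longrightarrow> bt_BB n q L' p = bt_BB n q L p"
  by (simp add: bt_BB_def E_conj block_perm_conj(1)[OF L_part])

lemma act_star_BB:
  assumes p: "p \<in> comp_stabilizer L" and w: "comp_preserving L w"
  shows "act (bt_star (bt_BB n q L p)) (basis_vec w) = basis_vec (BP (inv p) \<circ> w)"
proof -
  note B = block_perm(1)[OF p] and ip = comp_stabilizer_inv[OF p]
  have wp: "w permutes {1..n}"
    using w by (simp add: comp_preserving_def)
  have g: "bt_gw n q (BP p) \<in> carrier (bt n q)"
    by (rule bt_gw_closed[OF B])
  have "act (bt_star (bt_gw n q (BP p))) (basis_vec w) = basis_vec (BP (inv p) \<circ> w)"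
    using bt_act_star_gw[OF wp B] collision_free_BP[OF ip w] by (simp add: block_perm_inv[OF p])
  moreover have "comp_preserving L (BP (inv p) \<circ> w)"
    by (rule comp_preserving_comp[OF w comp_preserving_block_perm[OF ip]])
  ultimately show ?thesis
    unfolding bt_BB_def bt_star_mult[OF E_closed g]
    by (simp add: bt_act_mult[OF bt_star_closed[OF g] bt_star_closed[OF E_closed]] act_star_E)
qed

abbreviation y_coeff where "y_coeff k \<equiv> unit_inv (- q) ^ perm_length n k"
abbreviation c_coeff where "c_coeff r \<equiv> (- 1 :: 'a) ^ perm_length (mp_size M') r"

lemma y_closed: "bt_y n q L' \<in> carrier (bt n q)"
  unfolding bt_y_def by (intro bt_finsum_closed bt_smult_closed bt_gw_closed row_stabilizer_L')

lemma c_closed: "bt_c n q (L', M') \<in> carrier (bt n q)"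
  unfolding bt_c_def split_conv
  by (intro bt_finsum_closed bt_smult_closed) (simp add: BB_conj BB_closed stab_conj_M)

lemma act_y:
  assumes h: "h \<in> row_stabilizer L" and p: "p \<in> comp_stabilizer L"
  shows "act (bt_y n q L') (basis_vec (wL \<circ> (BP p \<circ> h))) =
    lin_comb (row_stabilizer L') y_coeff (\<lambda>k. k \<circ> (wL \<circ> (BP p \<circ> h)))"
proof -
  have w: "wL \<circ> (BP p \<circ> h) permutes {1..n}"
    by (intro permutes_compose row_stabilizerD(1)[OF h] block_perm(1)[OF p] conj_perm(1)[OF L_part])
  show ?thesis
    unfolding bt_y_def
  proof (rule bt_act_finsum_basis)
    show "finite (row_stabilizer L')"
      by simp
    fix k assume k: "k \<in> row_stabilizer L'"
    show "bt_gw n q k \<in> carrier (bt n q)"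
      by (rule bt_gw_closed[OF row_stabilizer_L'[OF k]])
    show "act (bt_gw n q k) (basis_vec (wL \<circ> (BP p \<circ> h))) = basis_vec (k \<circ> (wL \<circ> (BP p \<circ> h)))"
      by (rule bt_act_gw[OF w row_stabilizer_L'[OF k] collision_free_columns[OF h p k]])
  qed
qed

lemma act_c:
  assumes w: "comp_preserving L w"
  shows "act (bt_c n q (L', M')) (basis_vec w) = lin_comb (row_stabilizer M') c_coeff (\<lambda>r. BP r \<circ> w)"
  unfolding bt_c_def split_conv
  by (rule bt_act_finsum_basis)
    (simp_all add: BB_conj BB_closed stab_conj_M act_BB[OF stab_conj_M w collision_free_BP[OF stab_conj_M w]])

lemma bt_prod_append:
  assumes "set xs \<subseteq> carrier (bt n q)" "set ys \<subseteq> carrier (bt n q)"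
  shows "bt_prod n q (xs @ ys) = bt_prod n q xs \<otimes>\<^bsub>bt n q\<^esub> bt_prod n q ys"
  using assms
proof (induction xs)
  case Nil
  then show ?case
    using ring.ring_simprules(12)[OF ring_bt bt_prod_closed[OF assms(2)]] by (simp add: bt_prod_Nil)
next
  case (Cons x xs)
  then show ?case
    using bt_mult_assoc[OF _ bt_prod_closed bt_prod_closed, of x n q xs ys] by (simp add: bt_prod_Cons)
qed

section \<open>The vector of the product\<close>

lemma StdD:
  assumes "(t, v) \<in> Std (L, M)"
  shows "(t, v) \<in> RStd (L, M)" "col_standard t"
  using assms by (auto simp: Std_def)

lemma conj_closed:
  assumes "(t, v) \<in> RStd (L, M)"
  shows "tableau_perm M' (map List.transpose v) \<in> comp_stabilizer L"
    and "tableau_perm L' (map List.transpose t) permutes {1..n}"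
    and "bt_gw n q (tableau_perm L' (map List.transpose t)) \<in> carrier (bt n q)"
  using conj_tableau_M(1)[OF RStdD(4,6)[OF assms]] conj_tableau_perm(1)[OF L_part RStdD(1)[OF assms]] bt_gw_closed
  by blast+

text \<open>Here d(t) meets the inverse of d(t') and the two combine to w_\<lambda>, so that
  \<open>t\<close> no longer occurs.\<close>

lemma act_star_tableau:
  assumes u: "(t, v) \<in> Std (L, M)" and h: "h \<in> row_stabilizer L" and p: "p \<in> comp_stabilizer L"
  shows "act (bt_star (bt_gw n q (tableau_perm L' (map List.transpose t)))) (basis_vec (std_perm (t, v) \<circ> BP p \<circ> h)) =
    basis_vec (wL \<circ> (BP (tableau_perm M v \<circ> p) \<circ> h))"
proof -
  note R = RStdD[OF StdD(1)[OF u]] and C = conj_closed[OF StdD(1)[OF u]]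
  let ?dp = "tableau_perm M v \<circ> p"
  have dp: "?dp \<in> comp_stabilizer L"
    by (rule comp_stabilizer_comp[OF p R(7)])
  have e: "std_perm (t, v) \<circ> BP p \<circ> h = tableau_perm L t \<circ> (BP ?dp \<circ> h)"
    by (simp only: std_perm_def split_conv block_perm_compose[OF p R(7)] comp_assoc)
  have w: "tableau_perm L t \<circ> (BP ?dp \<circ> h) permutes {1..n}"
    by (intro permutes_compose row_stabilizerD(1)[OF h] block_perm(1)[OF dp] tableau_perm_props(1)[OF R(1)])
  show ?thesis
    unfolding e bt_act_star_gw[OF w C(2) collision_free_conj[OF StdD[OF u] h dp]]
    by (simp only: comp_assoc[symmetric] conj_tableau_perm(2)[OF L_part R(1)])
qed

text \<open>The product without its last two factors: a sum over row permutations \<open>h\<close>,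
  \<open>p\<close> of \<open>L\<close>, \<open>M\<close> and column permutations \<open>k\<close>,
  \<open>r\<close> of the same diagrams. The arguments \<open>d\<close> and \<open>d'\<close> are
  the permutations of \<open>v\<close> and of its transpose.\<close>

definition product_vec where
  "product_vec d d' = lin_comb (((row_stabilizer L \<times> row_stabilizer M) \<times> row_stabilizer L') \<times> row_stabilizer M')
    (\<lambda>(((h, p), k), r). q ^ inv_count n h * y_coeff k * c_coeff r)
    (\<lambda>(((h, p), k), r). BP r \<circ> (BP (inv d') \<circ> (k \<circ> (wL \<circ> (BP (d \<circ> p) \<circ> h)))))"

lemma act_product:
  assumes u: "(t, v) \<in> Std (L, M)"
  defines "d' \<equiv> tableau_perm M' (map List.transpose v)"
  shows "act (bt_prod n q [bt_m n q (L, M) (t, v), bt_star (bt_gw n q (tableau_perm L' (map List.transpose t))), E,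
      bt_y n q L', bt_star (bt_BB n q L d'), bt_c n q (L', M')]) (basis_vec id) = product_vec (tableau_perm M v) d'"
proof -
  note R = RStdD[OF StdD(1)[OF u]] and C = conj_closed[OF StdD(1)[OF u]]
  let ?d = "tableau_perm M v" and ?S = "row_stabilizer L \<times> row_stabilizer M" and ?q = "\<lambda>(h, p). q ^ inv_count n h"
  have d': "d' \<in> comp_stabilizer L"
    unfolding d'_def by (rule C(1))
  have dp: "?d \<circ> p \<in> comp_stabilizer L" if "p \<in> row_stabilizer M" for p
    by (rule comp_stabilizer_comp[OF stab_M[OF that] R(7)])
  have cp: "comp_preserving L (wL \<circ> (BP (?d \<circ> p) \<circ> h))" if "h \<in> row_stabilizer L" "p \<in> row_stabilizer M" for h p
    using that dp by (intro comp_preserving_comp comp_preserving_row_stabilizer comp_preserving_block_perm comp_preserving_wL)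
  have cpk: "comp_preserving L (k \<circ> (wL \<circ> (BP (?d \<circ> p) \<circ> h)))"
    if "h \<in> row_stabilizer L" "p \<in> row_stabilizer M" "k \<in> row_stabilizer L'" for h p k
    by (rule comp_preserving_comp[OF cp[OF that(1,2)] comp_preserving_L'[OF that(3)]])
  have cpb: "comp_preserving L (BP (inv d') \<circ> (k \<circ> (wL \<circ> (BP (?d \<circ> p) \<circ> h))))"
    if "h \<in> row_stabilizer L" "p \<in> row_stabilizer M" "k \<in> row_stabilizer L'" for h p k
    by (rule comp_preserving_comp[OF cpk[OF that] comp_preserving_block_perm[OF comp_stabilizer_inv[OF d']]])
  have 1: "act (bt_star (bt_gw n q (tableau_perm L' (map List.transpose t)))) (act (bt_m n q (L, M) (t, v)) (basis_vec id)) =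
      lin_comb ?S ?q (\<lambda>(h, p). wL \<circ> (BP (?d \<circ> p) \<circ> h))"
    unfolding act_m[OF StdD(1)[OF u]] by (rule bt_act_lin_comb) (auto simp: act_star_tableau[OF u] stab_M)
  have 2: "act E (lin_comb ?S ?q (\<lambda>(h, p). wL \<circ> (BP (?d \<circ> p) \<circ> h))) = lin_comb ?S ?q (\<lambda>(h, p). wL \<circ> (BP (?d \<circ> p) \<circ> h))"
    by (rule bt_act_lin_comb) (auto simp: act_E cp)
  have 3: "act (bt_y n q L') (lin_comb ?S ?q (\<lambda>(h, p). wL \<circ> (BP (?d \<circ> p) \<circ> h))) =
      lin_comb (?S \<times> row_stabilizer L') (\<lambda>((h, p), k). q ^ inv_count n h * y_coeff k) (\<lambda>((h, p), k). k \<circ> (wL \<circ> (BP (?d \<circ> p) \<circ> h)))"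
    by (subst bt_act_lin_comb_expand[where f' = "\<lambda>(h, p) k. k \<circ> (wL \<circ> (BP (?d \<circ> p) \<circ> h))"])
      (auto simp: act_y dp case_prod_unfold)
  have 4: "act (bt_star (bt_BB n q L d')) (lin_comb (?S \<times> row_stabilizer L') (\<lambda>((h, p), k). q ^ inv_count n h * y_coeff k) (\<lambda>((h, p), k). k \<circ> (wL \<circ> (BP (?d \<circ> p) \<circ> h)))) =
      lin_comb (?S \<times> row_stabilizer L') (\<lambda>((h, p), k). q ^ inv_count n h * y_coeff k) (\<lambda>((h, p), k). BP (inv d') \<circ> (k \<circ> (wL \<circ> (BP (?d \<circ> p) \<circ> h))))"
    by (rule bt_act_lin_comb) (auto simp: act_star_BB[OF d'] cpk)
  have 5: "act (bt_c n q (L', M')) (lin_comb (?S \<times> row_stabilizer L') (\<lambda>((h, p), k). q ^ inv_count n h * y_coeff k) (\<lambda>((h, p), k). BP (inv d') \<circ> (k \<circ> (wL \<circ> (BP (?d \<circ> p) \<circ> h))))) =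
      product_vec ?d d'"
    unfolding product_vec_def
    by (subst bt_act_lin_comb_expand[where f' = "\<lambda>((h, p), k) r. BP r \<circ> (BP (inv d') \<circ> (k \<circ> (wL \<circ> (BP (?d \<circ> p) \<circ> h))))"])
      (auto simp: act_c cpb case_prod_unfold)
  have 6: "act \<one>\<^bsub>bt n q\<^esub> (product_vec ?d d') = product_vec ?d d'"
    unfolding product_vec_def
  proof (rule bt_act_lin_comb, clarify)
    fix h p k r assume hp: "h \<in> row_stabilizer L" "p \<in> row_stabilizer M" "k \<in> row_stabilizer L'" "r \<in> row_stabilizer M'"
    have "comp_preserving L (BP r \<circ> (BP (inv d') \<circ> (k \<circ> (wL \<circ> (BP (?d \<circ> p) \<circ> h)))))"
      by (rule comp_preserving_comp[OF cpb[OF hp(1-3)] comp_preserving_block_perm[OF stab_conj_M[OF hp(4)]]])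
    then show "act \<one>\<^bsub>bt n q\<^esub> (basis_vec (BP r \<circ> (BP (inv d') \<circ> (k \<circ> (wL \<circ> (BP (?d \<circ> p) \<circ> h)))))) =
        basis_vec (BP r \<circ> (BP (inv d') \<circ> (k \<circ> (wL \<circ> (BP (?d \<circ> p) \<circ> h)))))"
      by (intro act_one_basis) (simp add: comp_preserving_def)
  qed
  have c: "\<one>\<^bsub>bt n q\<^esub> \<in> carrier (bt n q)"
    by (rule ring.ring_simprules(6)[OF ring_bt])
  show ?thesis
    unfolding bt_prod_Cons bt_prod_Nil
    by (simp only: bt_act_mult bt_mult_closed m_closed[OF StdD(1)[OF u]] bt_star_closed C(3) E_closed y_closed
        BB_closed[OF d'] c_closed c 1 2 3 4 5 6)
qed

text \<open>A summand of the product contributes to the coefficient of the standard tableau only if its row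
  and column permutations are trivial: first on the level of components, where the row stabilizer of
  \<open>M\<close> meets a conjugate of the row stabilizer of \<open>M'\<close> trivially, and then inside the components.\<close>

lemma product_perm_eq_iff:
  assumes h: "h \<in> row_stabilizer L" and p: "p \<in> row_stabilizer M" and k: "k \<in> row_stabilizer L'" and r: "r \<in> row_stabilizer M'"
    and d: "d \<in> comp_stabilizer L" "d' \<in> comp_stabilizer L" "inv d' \<circ> d = conj_perm M"
    and e: "e \<in> comp_stabilizer L" "e' \<in> comp_stabilizer L" "inv e' \<circ> e = conj_perm M"
  shows "BP r \<circ> (BP (inv d') \<circ> (k \<circ> (wL \<circ> (BP (d \<circ> p) \<circ> h)))) = BP (inv e') \<circ> (wL \<circ> BP e) \<longleftrightarrow>
    h = id \<and> p = id \<and> k = id \<and> r = id"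
proof -
  note ps = stab_M[OF p] and rs = stab_conj_M[OF r] and id' = comp_stabilizer_inv[OF d(2)] and ie' = comp_stabilizer_inv[OF e(2)]
  \<comment> \<open>\<open>wL\<close> commutes with block exchanges, and what is left on the side of
    \<open>M\<close> is \<open>conj_perm M\<close> for every choice, so the target permutation does
    not depend on the tableaux.\<close>
  have collapse: "BP (inv f') \<circ> (wL \<circ> BP f) = wL \<circ> BP (conj_perm M)"
    if "f \<in> comp_stabilizer L" "f' \<in> comp_stabilizer L" "inv f' \<circ> f = conj_perm M" for f f'
    using conj_perm_block_perm[OF L_part comp_stabilizer_inv[OF that(2)]] block_perm_compose[OF that(1) comp_stabilizer_inv[OF that(2)]] that(3)
    by (metis comp_assoc)
  show ?thesis
  proof
    assume eq: "BP r \<circ> (BP (inv d') \<circ> (k \<circ> (wL \<circ> (BP (d \<circ> p) \<circ> h)))) = BP (inv e') \<circ> (wL \<circ> BP e)"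
    have cs: "comp_of L (f a) = comp_of L a \<and> f a \<in> {1..n}" if "a \<in> {1..n}" "f = h \<or> f = k \<or> f = wL" for f a
    proof -
      have "h permutes {1..n}" "k permutes {1..n}" "wL permutes {1..n}"
        using row_stabilizerD(1)[OF h] row_stabilizer_L'[OF k] conj_perm(1)[OF L_part] by auto
      then have r: "f a \<in> {1..n}"
        using that permutes_in_image by metis
      have "comp_of L (k a) = comp_of L a"
        using row_stabilizer_comp_of[OF k, of a] conj_components(2)[OF L_part] that(1) mp_size_conj[OF L_part]
          permutes_in_image[OF row_stabilizer_L'[OF k], of a] by metis
      then show ?thesis
        using r that row_stabilizer_comp_of[OF h that(1)] conj_perm_comp[OF L_part that(1)] by auto
    qed
    have cB: "comp_of L (BP f a) = f (Suc (comp_of L a)) - 1 \<and> BP f a \<in> {1..n} \<and> Suc (comp_of L (BP f a)) = f (Suc (comp_of L a))"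
      if "f \<in> comp_stabilizer L" "a \<in> {1..n}" for f a
    proof -
      have fp: "f permutes {1..length L}"
        using that(1) by (simp add: comp_stabilizer_def)
      have "f (Suc (comp_of L a)) \<in> {1..length L}"
        using permutes_in_image[OF fp, of "Suc (comp_of L a)"] comp_of_less[OF that(2)] by simp
      then show ?thesis
        using block_perm_comp_of[OF that] permutes_in_image[OF block_perm(1)[OF that(1)], of a] that(2) by auto
    qed
    have dps: "d \<circ> p \<in> comp_stabilizer L"
      by (rule comp_stabilizer_comp[OF ps d(1)])
    \<comment> \<open>Only the component of a position is followed: \<open>h\<close>,
      \<open>k\<close> and \<open>wL\<close> keep it, and each block exchange changes it by its own
      index permutation.\<close>
    have "(r \<circ> conj_perm M \<circ> p) j = conj_perm M j" if j: "j \<in> {1..length L}" for j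
    proof -
      obtain a where a: "a \<in> {1..n}" "comp_of L a = j - 1"
      proof -
        have "j - 1 < length L"
          using j by auto
        then obtain a where "a \<in> comp_positions L (j - 1)"
          using comp_positions_nonempty by blast
        then show thesis
          by (intro that[of a]) (simp_all only: comp_positions_iff)
      qed
      then have ja: "Suc (comp_of L a) = j"
        using j by auto
      define a1 where "a1 = BP (d \<circ> p) (h a)"
      have a1: "a1 \<in> {1..n}" "Suc (comp_of L a1) = (d \<circ> p) j"
        unfolding a1_def using cs[OF a(1), of h] cB[OF dps, of "h a"] ja by auto
      define a2 where "a2 = k (wL a1)"
      have a2: "a2 \<in> {1..n}" "Suc (comp_of L a2) = (d \<circ> p) j"
        unfolding a2_def using cs[OF a1(1), of wL] cs[of "wL a1" k] a1(2) by auto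
      have "Suc (comp_of L (BP r (BP (inv d') a2))) = r (inv d' ((d \<circ> p) j))"
        using cB[OF id' a2(1)] cB[OF rs, of "BP (inv d') a2"] a2(2) by auto
      moreover have "Suc (comp_of L (BP (inv e') (wL (BP e a)))) = inv e' (e j)"
        using cB[OF e(1) a(1)] cs[of "BP e a" wL] cB[OF ie', of "wL (BP e a)"] ja by auto
      moreover have "BP r (BP (inv d') a2) = BP (inv e') (wL (BP e a))"
        using fun_cong[OF eq, of a] by (simp add: a1_def a2_def)
      ultimately have "r (inv d' ((d \<circ> p) j)) = inv e' (e j)"
        by simp
      then show ?thesis
        using fun_cong[OF d(3), of "p j"] fun_cong[OF e(3), of j] by simp
    qed
    moreover have "(r \<circ> conj_perm M \<circ> p) j = conj_perm M j" if "j \<notin> {1..length L}" for j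
    proof -
      have "p j = j" "r j = j" "conj_perm M j = j"
        using ps rs conj_perm_M permutes_not_in[OF _ that] unfolding comp_stabilizer_def by auto
      then show ?thesis
        by simp
    qed
    ultimately have "r \<circ> conj_perm M \<circ> p = conj_perm M"
      by blast
    then have pr: "p = id" "r = id"
      using row_column_trivial[OF M_part p r] by auto
    note B = block_perm(1)[OF d(1)] and B' = block_perm(1)[OF id']
    have "BP (inv d') \<circ> (k \<circ> (wL \<circ> (BP d \<circ> h))) = BP (inv d') \<circ> (wL \<circ> BP d)"
      using eq collapse[OF d] collapse[OF e] by (simp add: pr block_perm_id)
    then have "inv (BP (inv d')) \<circ> BP (inv d') \<circ> (k \<circ> (wL \<circ> (BP d \<circ> h))) = inv (BP (inv d')) \<circ> BP (inv d') \<circ> (wL \<circ> BP d)"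
      by (simp only: comp_assoc)
    then have kw: "k \<circ> (wL \<circ> (BP d \<circ> h)) = wL \<circ> BP d"
      unfolding permutes_inv_o(2)[OF B'] by simp
    then have "k \<circ> wL \<circ> (BP d \<circ> h \<circ> inv (BP d)) = wL \<circ> (BP d \<circ> inv (BP d))"
      by (metis comp_assoc)
    then have "k \<circ> wL \<circ> (BP d \<circ> h \<circ> inv (BP d)) = wL"
      unfolding permutes_inv_o(1)[OF B] by simp
    from row_column_trivial[OF L_part block_perm_conj_row_stabilizer[OF d(1) h] k this]
    have kid: "k = id" and hid: "BP d \<circ> h \<circ> inv (BP d) = id"
      by auto
    have "h = inv (BP d) \<circ> (BP d \<circ> h \<circ> inv (BP d)) \<circ> BP d"
      unfolding comp_assoc permutes_inv_o(2)[OF B] unfolding comp_assoc[symmetric] permutes_inv_o(2)[OF B] by simp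
    then have "h = id"
      unfolding hid using permutes_inv_o(2)[OF B] by simp
    then show "h = id \<and> p = id \<and> k = id \<and> r = id"
      using pr kid by simp
  next
    assume "h = id \<and> p = id \<and> k = id \<and> r = id"
    then show "BP r \<circ> (BP (inv d') \<circ> (k \<circ> (wL \<circ> (BP (d \<circ> p) \<circ> h)))) = BP (inv e') \<circ> (wL \<circ> BP e)"
      using collapse[OF d] collapse[OF e] by (simp add: block_perm_id)
  qed
qed

text \<open>Only the summand of four identities meets this word, and its coefficient is a product of
  zeroth powers.\<close>

lemma product_vec_coeff:
  assumes d: "d \<in> comp_stabilizer L" "d' \<in> comp_stabilizer L" "inv d' \<circ> d = conj_perm M"
    and e: "e \<in> comp_stabilizer L" "e' \<in> comp_stabilizer L" "inv e' \<circ> e = conj_perm M"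
  shows "product_vec d d' (inv (BP (inv e') \<circ> (wL \<circ> BP e))) = 1"
proof -
  let ?g = "BP (inv e') \<circ> (wL \<circ> BP e)"
  let ?K = "((row_stabilizer L \<times> row_stabilizer M) \<times> row_stabilizer L') \<times> row_stabilizer M'"
  let ?i = "(((id, id), id), id) :: (((nat \<Rightarrow> nat) \<times> (nat \<Rightarrow> nat)) \<times> (nat \<Rightarrow> nat)) \<times> (nat \<Rightarrow> nat)"
  have gp: "?g permutes {1..n}"
    by (intro permutes_compose block_perm(1) e(1) comp_stabilizer_inv e(2) conj_perm(1)[OF L_part])
  have "product_vec d d' (inv ?g) = (\<Sum>x\<in>?K. if x = ?i then 1 else 0)"
    unfolding product_vec_def lin_comb_def
  proof (rule sum.cong[OF refl])
    fix x assume "x \<in> ?K"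
    then obtain h p k r where x: "x = (((h, p), k), r)" "h \<in> row_stabilizer L" "p \<in> row_stabilizer M" "k \<in> row_stabilizer L'" "r \<in> row_stabilizer M'"
      by auto
    let ?f = "BP r \<circ> (BP (inv d') \<circ> (k \<circ> (wL \<circ> (BP (d \<circ> p) \<circ> h))))"
    have fp: "?f permutes {1..n}"
      by (intro permutes_compose block_perm(1) comp_stabilizer_comp stab_M stab_conj_M comp_stabilizer_inv d(1,2)
          conj_perm(1)[OF L_part] row_stabilizerD(1)[OF x(2)] row_stabilizer_L' x)
    have "inv ?g = inv ?f \<longleftrightarrow> ?f = ?g"
      using inv_inv_eq[OF permutes_bij[OF gp]] inv_inv_eq[OF permutes_bij[OF fp]] by metis
    also have "\<dots> \<longleftrightarrow> x = ?i"
      unfolding product_perm_eq_iff[OF x(2-5) d e] x(1) by simp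
    finally have b: "basis_vec ?f (inv ?g) = (if x = ?i then 1 else 0 :: 'a)"
      by (simp add: basis_vec_def)
    have len: "perm_length m id = 0" for m
      using perm_length_eq[OF permutes_id] by simp
    show "(\<lambda>(((h, p), k), r). q ^ inv_count n h * y_coeff k * c_coeff r) x *
        (basis_vec ((\<lambda>(((h, p), k), r). BP r \<circ> (BP (inv d') \<circ> (k \<circ> (wL \<circ> (BP (d \<circ> p) \<circ> h))))) x) (inv ?g) :: 'a) =
        (if x = ?i then 1 else 0)"
      unfolding x(1) split_conv b[unfolded x(1)] by (auto simp: len)
  qed
  also have "\<dots> = 1"
    by (simp add: row_stabilizer_id)
  finally show ?thesis .
qed

lemma n_closed:
  assumes "(s, u) \<in> RStd (L, M)" "(t, v) \<in> RStd (L, M)"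
  shows "bt_n n q (L', M') (map List.transpose t, map List.transpose v) (map List.transpose s, map List.transpose u) \<in> carrier (bt n q)"
  unfolding bt_n_def split_conv E_conj
  using conj_closed[OF assms(1)] conj_closed[OF assms(2)] E_closed y_closed c_closed
  by (intro bt_prod_closed) (simp add: BB_conj bt_star_closed BB_closed)

text \<open>By adjunction the last two factors act on the basis vector of \<open>(s, u)\<close>
  instead. They turn it into the basis vector of a permutation of the form occurring in the product
  vector, where the coefficient is known.\<close>

theorem product_coeff:
  assumes s: "(s, u) \<in> Std (L, M)" and t: "(t, v) \<in> Std (L, M)"
  shows "act (bt_m n q (L, M) (t, v) \<otimes>\<^bsub>bt n q\<^esub>
      bt_n n q (L', M') (map List.transpose t, map List.transpose v) (map List.transpose s, map List.transpose u))
    (basis_vec id) (inv (std_perm (s, u))) = 1"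
proof -
  note S = StdD(1)[OF s] and T = StdD(1)[OF t]
  note RS = RStdD[OF S] and RT = RStdD[OF T] and CS = conj_closed[OF S] and CT = conj_closed[OF T]
  let ?d = "tableau_perm M v" and ?d' = "tableau_perm M' (map List.transpose v)"
  let ?e = "tableau_perm M u" and ?e' = "tableau_perm M' (map List.transpose u)"
  let ?gs = "bt_gw n q (tableau_perm L' (map List.transpose s))"
  let ?X = "[bt_m n q (L, M) (t, v), bt_star (bt_gw n q (tableau_perm L' (map List.transpose t))), E,
      bt_y n q L', bt_star (bt_BB n q L ?d'), bt_c n q (L', M')]"
  let ?Y = "bt_BB n q L ?e' \<otimes>\<^bsub>bt n q\<^esub> ?gs"
  have B: "bt_BB n q L ?e' \<in> carrier (bt n q)" "bt_BB n q L ?d' \<in> carrier (bt n q)"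
    by (rule BB_closed[OF CS(1)] BB_closed[OF CT(1)])+
  have X: "set ?X \<subseteq> carrier (bt n q)"
    using m_closed[OF T] CT(3) E_closed y_closed B(2) c_closed by (simp add: bt_star_closed)
  have Y: "?Y \<in> carrier (bt n q)"
    by (intro bt_mult_closed B(1) CS(3))
  have prod2: "bt_prod n q [bt_BB n q L ?e', ?gs] = ?Y"
    using monoid.r_one[OF ring.is_monoid[OF ring_bt] CS(3)] by (simp add: bt_prod_Cons bt_prod_Nil)
  have "bt_m n q (L, M) (t, v) \<otimes>\<^bsub>bt n q\<^esub>
      bt_n n q (L', M') (map List.transpose t, map List.transpose v) (map List.transpose s, map List.transpose u)
    = bt_prod n q (?X @ [bt_BB n q L ?e', ?gs])"
    unfolding bt_n_def split_conv E_conj BB_conj[OF CS(1)] BB_conj[OF CT(1)] append_Cons append_Nil bt_prod_Cons[of n q "bt_m n q (L, M) (t, v)"] ..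
  also have "\<dots> = bt_prod n q ?X \<otimes>\<^bsub>bt n q\<^esub> ?Y"
    using bt_prod_append[OF X, of "[bt_BB n q L ?e', ?gs]"] B(1) CS(3) by (simp add: prod2)
  finally have P: "bt_m n q (L, M) (t, v) \<otimes>\<^bsub>bt n q\<^esub>
      bt_n n q (L', M') (map List.transpose t, map List.transpose v) (map List.transpose s, map List.transpose u)
    = bt_prod n q ?X \<otimes>\<^bsub>bt n q\<^esub> ?Y" .
  let ?w = "std_perm (s, u)" and ?g = "BP (inv ?e') \<circ> (wL \<circ> BP ?e)"
  have wp: "?w permutes {1..n}"
    by (rule std_perm_permutes[OF S])
  have gp: "?g permutes {1..n}"
    by (intro permutes_compose block_perm(1) RS(7) comp_stabilizer_inv CS(1) conj_perm(1)[OF L_part])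
  have "act (bt_star ?gs) (basis_vec ?w) = basis_vec (wL \<circ> BP ?e)"
    using act_star_tableau[OF s row_stabilizer_id comp_stabilizer_id] by (simp add: block_perm_id)
  moreover have "comp_preserving L (wL \<circ> BP ?e)"
    by (intro comp_preserving_comp comp_preserving_wL comp_preserving_block_perm RS(7))
  ultimately have star: "act (bt_star ?Y) (basis_vec ?w) = basis_vec ?g"
    unfolding bt_star_mult[OF B(1) CS(3)] bt_act_mult[OF bt_star_closed[OF CS(3)] bt_star_closed[OF B(1)]]
    by (simp add: act_star_BB[OF CS(1)])
  have "act (bt_prod n q ?X \<otimes>\<^bsub>bt n q\<^esub> ?Y) (basis_vec id) (inv ?w) =
      (\<Sum>x | x permutes {1..n}. act ?Y (act (bt_prod n q ?X) (basis_vec id)) x * basis_vec ?w x)"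
    by (simp only: sum_basis[OF wp] bt_act_mult[OF bt_prod_closed[OF X] Y])
  also have "\<dots> = (\<Sum>x | x permutes {1..n}. act (bt_prod n q ?X) (basis_vec id) x * basis_vec ?g x)"
    unfolding bt_act_adjoint[OF Y] star ..
  also have "\<dots> = act (bt_prod n q ?X) (basis_vec id) (inv ?g)"
    by (rule sum_basis[OF gp])
  also have "\<dots> = 1"
    unfolding act_product[OF t]
    by (rule product_vec_coeff[OF RT(7) CT(1) conj_tableau_M(2)[OF RT(4,6)] RS(7) CS(1) conj_tableau_M(2)[OF RS(4,6)]])
  finally show ?thesis
    unfolding P .
qed

end

text \<open>Additivity is assumed on the subset \<open>V\<close> alone, because the form is
  specified only on the permutation module.\<close>

lemma finsum_linear:
  fixes F :: "'a::comm_ring_1 free_elem set \<Rightarrow> 'b::comm_ring_1" and r :: "'a \<Rightarrow> 'b"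
  assumes V: "V \<subseteq> carrier (bt n q)" "\<zero>\<^bsub>bt n q\<^esub> \<in> V" "\<And>x y. x \<in> V \<Longrightarrow> y \<in> V \<Longrightarrow> x \<oplus>\<^bsub>bt n q\<^esub> y \<in> V"
    and F: "\<And>x y. x \<in> V \<Longrightarrow> y \<in> V \<Longrightarrow> F (x \<oplus>\<^bsub>bt n q\<^esub> y) = F x + F y"
    and K: "finite K" "\<And>k. k \<in> K \<Longrightarrow> f k \<in> V"
  shows "(\<Oplus>\<^bsub>bt n q\<^esub>k\<in>K. f k) \<in> V \<and> F (\<Oplus>\<^bsub>bt n q\<^esub>k\<in>K. f k) = (\<Sum>k\<in>K. F (f k))"
proof -
  interpret ring "bt n q" by (rule ring_bt)
  have "F \<zero>\<^bsub>bt n q\<^esub> = F \<zero>\<^bsub>bt n q\<^esub> + F \<zero>\<^bsub>bt n q\<^esub>"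
    using F[OF V(2) V(2)] by simp
  then have 0: "F \<zero>\<^bsub>bt n q\<^esub> = 0"
    by simp
  show ?thesis
    using K
  proof (induction K)
    case empty
    then show ?case
      using V(2) 0 by simp
  next
    case (insert k K)
    then have "f \<in> K \<rightarrow> carrier (bt n q)" "f k \<in> carrier (bt n q)"
      using V(1) by auto
    then have "(\<Oplus>\<^bsub>bt n q\<^esub>k\<in>insert k K. f k) = f k \<oplus>\<^bsub>bt n q\<^esub> (\<Oplus>\<^bsub>bt n q\<^esub>k\<in>K. f k)"
      using insert.hyps by simp
    then show ?case
      using insert V(3) F by simp
  qed
qed

context index_rep
begin

section \<open>The permutation module and its form\<close>

lemma basis_vec_id: "basis_vec id = (\<lambda>x. if x = id then 1 else 0)"
  by (simp add: basis_vec_def fun_eq_iff)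

lemma E_faithful:
  assumes "X \<in> carrier (bt n q)" "Y \<in> carrier (bt n q)" "act X (basis_vec id) = act Y (basis_vec id)"
  shows "E \<otimes>\<^bsub>bt n q\<^esub> X = E \<otimes>\<^bsub>bt n q\<^esub> Y"
  unfolding bt_EEm_def
  by (rule bt_EE_faithful[OF partition_on_blocks _ assms(1,2) assms(3)[unfolded basis_vec_id]])
    (simp only: same_block_blocks simp_thms)

text \<open>\<open>E\<close> and the unit have the same effect on the vector of the identity, so
  faithfulness applies to them.\<close>

lemma E_idem: "E \<otimes>\<^bsub>bt n q\<^esub> E = E"
proof -
  interpret ring "bt n q" by (rule ring_bt)
  have "E \<otimes>\<^bsub>bt n q\<^esub> E = E \<otimes>\<^bsub>bt n q\<^esub> \<one>\<^bsub>bt n q\<^esub>"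
    by (rule E_faithful[OF E_closed one_closed]) (simp add: act_E[OF comp_preserving_id] act_one_basis permutes_id)
  then show ?thesis
    using E_closed by simp
qed

definition xb where "xb = E \<otimes>\<^bsub>bt n q\<^esub> (bt_x n q L \<otimes>\<^bsub>bt n q\<^esub> bt_b n q (L, M))"

lemma xb_closed: "xb \<in> carrier (bt n q)"
  unfolding xb_def by (intro bt_mult_closed E_closed x_closed b_closed)

lemma E_xb:
  assumes "h \<in> carrier (bt n q)"
  shows "E \<otimes>\<^bsub>bt n q\<^esub> (xb \<otimes>\<^bsub>bt n q\<^esub> h) = xb \<otimes>\<^bsub>bt n q\<^esub> h"
proof -
  have "E \<otimes>\<^bsub>bt n q\<^esub> xb = xb"
    unfolding xb_def using bt_mult_assoc[OF E_closed E_closed bt_mult_closed[OF x_closed b_closed]] by (simp add: E_idem)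
  then show ?thesis
    using bt_mult_assoc[OF E_closed xb_closed assms] by simp
qed

lemma act_xb_id: "act xb (basis_vec id) =
    lin_comb (row_stabilizer L \<times> row_stabilizer M) (\<lambda>(h, p). q ^ inv_count n h) (\<lambda>(h, p). BP p \<circ> h)"
  unfolding xb_def
  by (simp only: bt_act_mult E_closed x_closed b_closed bt_mult_closed act_E[OF comp_preserving_id] act_xb)

lemma bt_EE_type_closed: "bt_EE_type n q \<alpha> \<in> carrier (bt n q)"
  unfolding bt_EE_type_def by (intro bt_finsum_closed bt_EE_closed)

lemma act_EE_type:
  assumes \<alpha>: "has_type (block_partition L) \<alpha>" and w: "comp_preserving L w"
  shows "act (bt_EE_type n q \<alpha>) (basis_vec w) = basis_vec w"
proof
  fix x
  let ?K = "{A \<in> set_partitions n. has_type A \<alpha>}"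
  have K: "finite ?K"
    using finitely_many_partition_on[of "{1..n}"] by (simp add: set_partitions_def)
  have bp: "block_partition L \<in> ?K"
    using \<alpha> partition_on_blocks by (simp add: set_partitions_def)
  have "act (bt_EE_type n q \<alpha>) (basis_vec w) x = (\<Sum>A\<in>?K. act (bt_EE n q A) (basis_vec w) x)"
    unfolding bt_EE_type_def by (rule bt_act_finsum[OF K bt_EE_closed])
  also have "\<dots> = (\<Sum>A\<in>?K. if A = block_partition L then basis_vec w x else 0)"
    using act_EE_basis[OF _ w] by (intro sum.cong refl) (simp add: set_partitions_def)
  also have "\<dots> = basis_vec w x"
    using K bp by (simp only: sum.delta if_True)
  finally show "act (bt_EE_type n q \<alpha>) (basis_vec w) x = basis_vec w x" .
qed

text \<open>All permutations in the vector of \<open>xb\<close> preserve components, so of the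
  idempotents in the sum only that of \<open>L\<close> acts, as the identity. The permutation module
  thus becomes the right ideal that \<open>xb\<close> generates in the whole algebra.\<close>

lemma xb_EE_type:
  assumes \<alpha>: "has_type (block_partition L) \<alpha>"
  shows "xb \<otimes>\<^bsub>bt n q\<^esub> bt_EE_type n q \<alpha> = xb"
proof -
  interpret ring "bt n q" by (rule ring_bt)
  note T = bt_EE_type_closed[of \<alpha>]
  have "act (bt_EE_type n q \<alpha>) (act xb (basis_vec id)) = act xb (basis_vec id)"
    unfolding act_xb_id
  proof (rule bt_act_lin_comb, clarify)
    fix h p assume "h \<in> row_stabilizer L" "p \<in> row_stabilizer M"
    then show "act (bt_EE_type n q \<alpha>) (basis_vec (BP p \<circ> h)) = basis_vec (BP p \<circ> h)"
      by (intro act_EE_type[OF \<alpha>] comp_preserving_comp[OF comp_preserving_row_stabilizer comp_preserving_block_perm[OF stab_M]])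
  qed
  then have "E \<otimes>\<^bsub>bt n q\<^esub> (xb \<otimes>\<^bsub>bt n q\<^esub> bt_EE_type n q \<alpha>) = E \<otimes>\<^bsub>bt n q\<^esub> (xb \<otimes>\<^bsub>bt n q\<^esub> \<one>\<^bsub>bt n q\<^esub>)"
    using xb_closed by (intro E_faithful bt_mult_closed T one_closed) (simp_all add: bt_act_mult[OF xb_closed T])
  then show ?thesis
    unfolding E_xb[OF T] E_xb[OF one_closed] using xb_closed by simp
qed

lemma perm_module_eq:
  assumes \<alpha>: "has_type (block_partition L) \<alpha>"
  shows "perm_module n q \<alpha> (L, M) = (\<lambda>h. xb \<otimes>\<^bsub>bt n q\<^esub> h) ` carrier (bt n q)"
proof -
  interpret ring "bt n q" by (rule ring_bt)
  note T = bt_EE_type_closed[of \<alpha>] and c = E_closed x_closed b_closed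
  have "bt_prod n q [E, bt_x n q L, bt_b n q (L, M), bt_EE_type n q \<alpha> \<otimes>\<^bsub>bt n q\<^esub> h] = xb \<otimes>\<^bsub>bt n q\<^esub> h" if h: "h \<in> carrier (bt n q)" for h
  proof -
    have "bt_prod n q [E, bt_x n q L, bt_b n q (L, M), bt_EE_type n q \<alpha> \<otimes>\<^bsub>bt n q\<^esub> h] = xb \<otimes>\<^bsub>bt n q\<^esub> (bt_EE_type n q \<alpha> \<otimes>\<^bsub>bt n q\<^esub> h)"
      unfolding xb_def using c T h by (simp add: bt_prod_Cons bt_prod_Nil m_assoc)
    also have "\<dots> = xb \<otimes>\<^bsub>bt n q\<^esub> h"
      using m_assoc[OF xb_closed T h] by (simp add: xb_EE_type[OF \<alpha>])
    finally show ?thesis .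
  qed
  then show ?thesis
    unfolding perm_module_def bt_summand_def image_image by (simp cong: image_cong)
qed

lemma m_eq_xb:
  assumes "(t, v) \<in> RStd (L, M)"
  shows "bt_m n q (L, M) (t, v) = xb \<otimes>\<^bsub>bt n q\<^esub> (bt_BB n q L (tableau_perm M v) \<otimes>\<^bsub>bt n q\<^esub> bt_gw n q (tableau_perm L t))"
proof -
  interpret ring "bt n q" by (rule ring_bt)
  show ?thesis
    unfolding bt_m_def xb_def split_conv
    using E_closed x_closed b_closed BB_closed[OF RStdD(7)[OF assms]] bt_gw_closed[OF tableau_perm_props(1)[OF RStdD(1)[OF assms]], of q]
    by (simp add: bt_prod_Cons bt_prod_Nil m_assoc)
qed

abbreviation m where "m u \<equiv> bt_m n q (L, M) u"

text \<open>Defined on the whole algebra; on the permutation module it is the coordinate at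
  \<open>m u\<close>.\<close>

definition coord where "coord u X = act X (basis_vec id) (inv (std_perm u))"

lemma coord_add: "X \<in> carrier (bt n q) \<Longrightarrow> Y \<in> carrier (bt n q) \<Longrightarrow> coord u (X \<oplus>\<^bsub>bt n q\<^esub> Y) = coord u X + coord u Y"
  by (simp add: coord_def bt_act_add)

lemma coord_smult: "X \<in> carrier (bt n q) \<Longrightarrow> coord u (bt_smult n q a X) = a * coord u X"
  by (simp add: coord_def bt_act_smult)

lemma coord_m:
  assumes u: "u \<in> RStd (L, M)" and u': "u' \<in> RStd (L, M)"
  shows "coord u (m u') = (if u' = u then 1 else 0)"
proof -
  have s: "std_perm u permutes {1..n}" "std_perm u = std_perm u \<circ> BP id \<circ> id"
    using coset_permutes[OF u row_stabilizer_id row_stabilizer_id] by (simp_all add: block_perm_id)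
  have "inversions n id = {}"
    by (auto simp: inversions_def)
  then have "inv_count n id = 0"
    by (simp add: inv_count_def)
  then show ?thesis
    using lin_comb_coset[OF u s row_stabilizer_id row_stabilizer_id u'] act_m[of "fst u'" "snd u'"] u'
    by (simp add: coord_def)
qed

lemma m_carrier: "u \<in> RStd (L, M) \<Longrightarrow> m u \<in> carrier (bt n q)"
  using m_closed[of "fst u" "snd u"] by simp

text \<open>The form is a choice and needs a witness: the sum of products of coordinates is bilinear
  and has the prescribed values.\<close>

lemma form_spec:
  assumes \<alpha>: "has_type (block_partition L) \<alpha>"
  shows "bilinear_on n q (perm_module n q \<alpha> (L, M)) (bt_form n q \<alpha> (L, M))" (is ?bilinear)
    and "s \<in> RStd (L, M) \<Longrightarrow> t \<in> RStd (L, M) \<Longrightarrow> bt_form n q \<alpha> (L, M) (m s) (m t) = (if s = t then 1 else 0)"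
proof -
  let ?f = "\<lambda>x y. \<Sum>u\<in>RStd (L, M). coord u x * coord u y"
  let ?P = "\<lambda>f. bilinear_on n q (perm_module n q \<alpha> (L, M)) f \<and>
    (\<forall>s\<in>RStd (L, M). \<forall>t\<in>RStd (L, M). f (m s) (m t) = (if s = t then 1 else 0))"
  have V: "x \<in> carrier (bt n q)" if "x \<in> perm_module n q \<alpha> (L, M)" for x
    using that bt_mult_closed[OF xb_closed] unfolding perm_module_eq[OF \<alpha>] by blast
  have "bilinear_on n q (perm_module n q \<alpha> (L, M)) ?f"
    unfolding bilinear_on_def
    by (auto dest!: V simp: coord_add coord_smult sum.distrib[symmetric] sum_distrib_left algebra_simps)
  moreover have "?f (m s) (m t) = (if s = t then 1 else 0)" if st: "s \<in> RStd (L, M)" "t \<in> RStd (L, M)" for s t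
  proof -
    have "?f (m s) (m t) = (\<Sum>u\<in>RStd (L, M). if u = s then (if s = t then 1 else 0) else 0)"
      using st by (intro sum.cong) (auto simp: coord_m)
    then show ?thesis
      using st(1) finite_RStd by simp
  qed
  ultimately have "?P ?f"
    by blast
  from someI[of ?P, OF this] show ?bilinear
    "s \<in> RStd (L, M) \<Longrightarrow> t \<in> RStd (L, M) \<Longrightarrow> bt_form n q \<alpha> (L, M) (m s) (m t) = (if s = t then 1 else 0)"
    unfolding bt_form_def by blast+
qed

text \<open>The chosen form is known only through bilinearity and its values on the elements
  \<open>m\<close>, so \<open>X\<close> has to be expanded in these. Its vector is a tabloid vector
  with the coordinates as coefficients, and faithfulness lifts this expansion to the
  algebra.\<close>

lemma form_coord:
  assumes \<alpha>: "has_type (block_partition L) \<alpha>" and u: "u \<in> RStd (L, M)" and s: "s \<in> RStd (L, M)" and Y: "Y \<in> carrier (bt n q)"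
  defines "X \<equiv> m u \<otimes>\<^bsub>bt n q\<^esub> Y"
  shows "bt_form n q \<alpha> (L, M) X (m s) = coord s X" "bt_form n q \<alpha> (L, M) (m s) X = coord s X"
proof -
  interpret ring "bt n q" by (rule ring_bt)
  let ?V = "perm_module n q \<alpha> (L, M)" and ?form = "bt_form n q \<alpha> (L, M)"
  note V = perm_module_eq[OF \<alpha>]
  have VI: "xb \<otimes>\<^bsub>bt n q\<^esub> h \<in> ?V" if "h \<in> carrier (bt n q)" for h
    unfolding V using that by (rule imageI)
  have V1: "?V \<subseteq> carrier (bt n q)"
    unfolding V using xb_closed by auto
  have V2: "\<zero>\<^bsub>bt n q\<^esub> \<in> ?V"
    using VI[OF zero_closed] xb_closed by simp
  have V3: "x \<oplus>\<^bsub>bt n q\<^esub> y \<in> ?V" if xy: "x \<in> ?V" "y \<in> ?V" for x y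
  proof -
    obtain h h' where h: "h \<in> carrier (bt n q)" "h' \<in> carrier (bt n q)" "x = xb \<otimes>\<^bsub>bt n q\<^esub> h" "y = xb \<otimes>\<^bsub>bt n q\<^esub> h'"
      using xy unfolding V by blast
    show ?thesis
      using VI[OF a_closed[OF h(1,2)]] r_distr[OF h(1,2) xb_closed] h(3,4) by simp
  qed
  have V4: "bt_smult n q a x \<in> ?V" if x: "x \<in> ?V" for a x
  proof -
    obtain h where h: "h \<in> carrier (bt n q)" "x = xb \<otimes>\<^bsub>bt n q\<^esub> h"
      using x unfolding V by blast
    show ?thesis
      using VI[OF bt_smult_closed[OF h(1)]] bt_smult_mult[OF xb_closed h(1)] h(2) by simp
  qed
  have mV: "\<exists>h\<in>carrier (bt n q). m u' = xb \<otimes>\<^bsub>bt n q\<^esub> h" if u': "u' \<in> RStd (L, M)" for u'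
  proof -
    obtain t v where tv: "u' = (t, v)"
      by (cases u')
    note R = RStdD[OF u'[unfolded tv]]
    have "bt_BB n q L (tableau_perm M v) \<otimes>\<^bsub>bt n q\<^esub> bt_gw n q (tableau_perm L t) \<in> carrier (bt n q)"
      by (intro bt_mult_closed BB_closed R(7) bt_gw_closed tableau_perm_props(1)[OF R(1)])
    then show ?thesis
      using m_eq_xb[OF u'[unfolded tv]] unfolding tv by blast
  qed
  have m_V: "m u' \<in> ?V" if "u' \<in> RStd (L, M)" for u'
    using mV[OF that] VI by auto
  have XV: "X \<in> ?V"
  proof -
    obtain h where h: "h \<in> carrier (bt n q)" "m u = xb \<otimes>\<^bsub>bt n q\<^esub> h"
      using mV[OF u] by blast
    then show ?thesis
      using VI[OF m_closed[OF h(1) Y]] m_assoc[OF xb_closed h(1) Y] unfolding X_def by simp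
  qed
  have EV: "E \<otimes>\<^bsub>bt n q\<^esub> x = x" if "x \<in> ?V" for x
    using that E_xb unfolding V by auto
  let ?Z = "\<Oplus>\<^bsub>bt n q\<^esub>u'\<in>RStd (L, M). bt_smult n q (coord u' X) (m u')"
  have ZV: "?Z \<in> ?V"
    using finsum_linear[OF V1 V2 V3, of "\<lambda>_. 0 :: 'a" "RStd (L, M)" "\<lambda>u'. bt_smult n q (coord u' X) (m u')"]
      finite_RStd V4 m_V by auto
  have "act X (basis_vec id) = act ?Z (basis_vec id)"
  proof
    fix x
    have "act X (basis_vec id) \<in> tabloids"
      unfolding X_def bt_act_mult[OF m_carrier[OF u] Y] by (rule act_tabloids[OF Y m_tabloid[OF u]])
    from fun_cong[OF tabloid_expansion[OF this], of x]
    show "act X (basis_vec id) x = act ?Z (basis_vec id) x"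
      by (simp add: bt_act_finsum[OF finite_RStd] bt_smult_closed bt_act_smult m_carrier coord_def cong: sum.cong)
  qed
  then have X: "X = ?Z"
    using E_faithful[OF subsetD[OF V1 XV] subsetD[OF V1 ZV]] EV[OF XV] EV[OF ZV] by simp
  note B = form_spec(1)[OF \<alpha>, unfolded bilinear_on_def]
  have "?form ?Z (m s) = (\<Sum>u'\<in>RStd (L, M). ?form (bt_smult n q (coord u' X) (m u')) (m s))"
    using finsum_linear[OF V1 V2 V3, of "\<lambda>x. ?form x (m s)" "RStd (L, M)" "\<lambda>u'. bt_smult n q (coord u' X) (m u')"]
      finite_RStd V4 m_V s B by blast
  also have "\<dots> = (\<Sum>u'\<in>RStd (L, M). if u' = s then coord s X else 0)"
    using B m_V s by (intro sum.cong refl) (simp add: form_spec(2)[OF \<alpha>])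
  also have "\<dots> = coord s X"
    using finite_RStd s by simp
  finally show "?form X (m s) = coord s X"
    using X by simp
  have "?form (m s) ?Z = (\<Sum>u'\<in>RStd (L, M). ?form (m s) (bt_smult n q (coord u' X) (m u')))"
    using finsum_linear[OF V1 V2 V3, of "\<lambda>x. ?form (m s) x" "RStd (L, M)" "\<lambda>u'. bt_smult n q (coord u' X) (m u')"]
      finite_RStd V4 m_V s B by blast
  also have "\<dots> = (\<Sum>u'\<in>RStd (L, M). if u' = s then coord s X else 0)"
    using B m_V s by (intro sum.cong refl) (simp add: form_spec(2)[OF \<alpha>])
  also have "\<dots> = coord s X"
    using finite_RStd s by simp
  finally show "?form (m s) X = coord s X"
    using X by simp
qed

text \<open>The value is 1 for either order of the arguments; the second order, with
  \<open>s\<close> and \<open>t\<close> exchanged, is the equivalent version of the claim.\<close>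

theorem form_product:
  assumes \<alpha>: "has_type (block_partition L) \<alpha>" and s: "s \<in> Std (L, M)" and t: "t \<in> Std (L, M)"
  defines "X \<equiv> m t \<otimes>\<^bsub>bt n q\<^esub> bt_n n q (conj_index (L, M)) (conj_tableau t) (conj_tableau s)"
  shows "bt_form n q \<alpha> (L, M) X (m s) = 1" "bt_form n q \<alpha> (L, M) (m s) X = 1" "X \<noteq> \<zero>\<^bsub>bt n q\<^esub>"
proof -
  obtain s' u t' v where st: "s = (s', u)" "t = (t', v)"
    by (cases s; cases t)
  note R = StdD(1)[OF s[unfolded st]] StdD(1)[OF t[unfolded st]]
  have X: "X = m (t', v) \<otimes>\<^bsub>bt n q\<^esub>
      bt_n n q (L', M') (map List.transpose t', map List.transpose v) (map List.transpose s', map List.transpose u)"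
    unfolding X_def st by (simp add: conj_index_def conj_tableau_def)
  have c: "coord s X = 1"
    unfolding X coord_def unfolding st by (rule product_coeff[OF s[unfolded st] t[unfolded st]])
  show "bt_form n q \<alpha> (L, M) X (m s) = 1" "bt_form n q \<alpha> (L, M) (m s) X = 1"
    using form_coord[OF \<alpha> R(2,1) n_closed[OF R(1,2)]] c unfolding X st by simp_all
  show "X \<noteq> \<zero>\<^bsub>bt n q\<^esub>"
    using c by (auto simp: coord_def bt_act_zero)
qed

end

text \<open>Antisymmetry of the order prevents a component from reappearing after a different one,
  which gives contiguity.\<close>

lemma index_repI:
  assumes R: "admissible_order R" and I: "(L, M) \<in> index_set R n \<alpha>" and q: "q * q' = (1 :: 'a::comm_ring_1)"
  shows "index_rep L M q q'"
proof -
  have "antisym R"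
    using R by (simp add: admissible_order_def linear_order_on_def partial_order_on_def)
  then show ?thesis
    using I q distinct_remdups_adj_sorted[of R L] by unfold_locales (auto simp: index_set_def)
qed

lemma form_product_nonzero:
  assumes R: "admissible_order R" and I: "I \<in> index_set R n \<alpha>" and q: "q * q' = (1 :: 'a::comm_ring_1)"
    and st: "s \<in> Std I" "t \<in> Std I"
  shows "bt_form n q \<alpha> I (bt_m n q I t \<otimes>\<^bsub>bt n q\<^esub> bt_n n q (conj_index I) (conj_tableau t) (conj_tableau s)) (bt_m n q I s) \<noteq> 0 \<and>
    bt_form n q \<alpha> I (bt_m n q I t) (bt_m n q I s \<otimes>\<^bsub>bt n q\<^esub> bt_n n q (conj_index I) (conj_tableau s) (conj_tableau t)) \<noteq> 0 \<and>
    bt_m n q I t \<otimes>\<^bsub>bt n q\<^esub> bt_n n q (conj_index I) (conj_tableau t) (conj_tableau s) \<noteq> \<zero>\<^bsub>bt n q\<^esub> \<and>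
    bt_m n q I s \<otimes>\<^bsub>bt n q\<^esub> bt_n n q (conj_index I) (conj_tableau s) (conj_tableau t) \<noteq> \<zero>\<^bsub>bt n q\<^esub>"
proof -
  obtain L M where LM: "I = (L, M)"
    by (cases I)
  interpret index_rep L M q q'
    using R I[unfolded LM] q by (rule index_repI)
  have n: "n = mp_size L" and \<alpha>: "has_type (block_partition L) \<alpha>"
    using I unfolding LM index_set_def by auto
  show ?thesis
    using form_product[OF \<alpha> st[unfolded LM]] form_product[OF \<alpha> st(2,1)[unfolded LM]] unfolding LM n by simp
qed

theorem lemma14:
  fixes n :: nat and \<alpha> :: "nat list" and R :: "(nat list \<times> nat list) set"
    and I :: index and s t :: index_tableau and q :: "'k::field"
  assumes "is_partition \<alpha>" and "sum_list \<alpha> = n"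
    and "admissible_order R"
    and "I \<in> index_set R n \<alpha>"
    and "s \<in> Std I" and "t \<in> Std I"
  shows
    "(let q = laurent_q in
        bt_form n q \<alpha> I (bt_m n q I t \<otimes>\<^bsub>bt n q\<^esub> bt_n n q (conj_index I) (conj_tableau t) (conj_tableau s)) (bt_m n q I s) \<noteq> 0 \<and>
        bt_form n q \<alpha> I (bt_m n q I t) (bt_m n q I s \<otimes>\<^bsub>bt n q\<^esub> bt_n n q (conj_index I) (conj_tableau s) (conj_tableau t)) \<noteq> 0 \<and>
        bt_m n q I t \<otimes>\<^bsub>bt n q\<^esub> bt_n n q (conj_index I) (conj_tableau t) (conj_tableau s) \<noteq> \<zero>\<^bsub>bt n q\<^esub> \<and>
        bt_m n q I s \<otimes>\<^bsub>bt n q\<^esub> bt_n n q (conj_index I) (conj_tableau s) (conj_tableau t) \<noteq> \<zero>\<^bsub>bt n q\<^esub>) \<and>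
     (q \<noteq> 0 \<longrightarrow>
        bt_form n q \<alpha> I (bt_m n q I t \<otimes>\<^bsub>bt n q\<^esub> bt_n n q (conj_index I) (conj_tableau t) (conj_tableau s)) (bt_m n q I s) \<noteq> 0 \<and>
        bt_form n q \<alpha> I (bt_m n q I t) (bt_m n q I s \<otimes>\<^bsub>bt n q\<^esub> bt_n n q (conj_index I) (conj_tableau s) (conj_tableau t)) \<noteq> 0 \<and>
        bt_m n q I t \<otimes>\<^bsub>bt n q\<^esub> bt_n n q (conj_index I) (conj_tableau t) (conj_tableau s) \<noteq> \<zero>\<^bsub>bt n q\<^esub> \<and>
        bt_m n q I s \<otimes>\<^bsub>bt n q\<^esub> bt_n n q (conj_index I) (conj_tableau s) (conj_tableau t) \<noteq> \<zero>\<^bsub>bt n q\<^esub>)"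
proof -
  have 1: "laurent_q * Poly_Mapping.single (-1) 1 = 1"
    by (simp add: laurent_q_def mult_single)
  show ?thesis
    using form_product_nonzero[OF assms(3,4) 1 assms(5,6)]
      form_product_nonzero[OF assms(3,4) right_inverse[of q] assms(5,6)]
    unfolding Let_def by blast
qed

end
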